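(* Let $G$ be a finite Abelian group acting on a compact almost complex manifold $X$ (preserving the almost complex structure), let $I$ be a finite set and $\sigma,\tau\in\Sigma_I$. Let $\mathfrak g\in G^{o(\sigma)}$, $\mathfrak h\in G^{o(\tau)}$, $\mathfrak w\in G^{o(\sigma\tau)}$ and $f\in G^I$ be such that $\epsilon_{\mathfrak g}\sigma\cdot f^{-1}\epsilon_{\mathfrak h}\tau f\in\mathcal O_{\mathfrak w}\sigma\tau$. For $d\in o(\sigma,\tau)$ let $Z_d:=X^{\mathfrak g_d,\mathfrak h_d,\mathfrak w_d}$. Choose $\mathfrak f_{(d)}\in G^{2gd(d)}$ for each $d\in o(\sigma,\tau)$ and $\overline f\in\prod_{a\in o(\sigma)}\Delta^a_G$ such that $$\prod_{a\in o(\sigma)}\Delta^a_{X^{\mathfrak g_a}}\cap\rho(f)\prod_{b\in o(\tau)}\Delta^b_{X^{\mathfrak h_b}}=\prod_{d\in o(\sigma,\tau)}\rho(\overline f_d)^{-1}\Delta^d_{X^{\mathfrak g_d,\mathfrak h_d,\mathfrak w_d,\mathfrak f_{(d)}}}.$$ Then, in $K$-theory, $$\mathscr R(\epsilon_{\mathfrak g}\sigma,f^{-1}\epsilon_{\mathfrak h}\tau f)=\prod_{d\in o(\sigma,\tau)}\rho(\overline f_d)^*\Delta^d_*\Big(TZ_d^{\mathfrak f_{(d)}}\oplus(gd(d)-1)\,TX|_{Z_d^{\mathfrak f_{(d)}}}\oplus\mathscr S_{\mathfrak g_d}|_{Z_d^{\mathfrak f_{(d)}}}\oplus\mathscr S_{\mathfrak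 h_d}|_{Z_d^{\mathfrak f_{(d)}}}\oplus\mathscr S_{\mathfrak w_d^{-1}}|_{Z_d^{\mathfrak f_{(d)}}}\Big),$$ where $\Delta^d:Z_d^{\mathfrak f_{(d)}}\to\Delta^d_{Z_d^{\mathfrak f_{(d)}}}$ is the isomorphism induced by the diagonal embedding $X\hookrightarrow X^d$. Moreover, for any $g,h\in G^I$, $$\mathscr R(g\sigma,h\tau)=\rho(\nu^\sigma(g))^*\,\mathscr R(\epsilon_{\mathfrak g}\sigma,f^{-1}\epsilon_{\mathfrak h}\tau f),\qquad \mathfrak g:=\psi^\sigma(g),\ \mathfrak h:=\psi^\tau(h),\ f:=\nu^\tau(h)^{-1}\nu^\sigma(g).$$
   Context: Actions are right actions (denoted $\rho$); $K$-theory has $\mathbb Q$ coefficients. Obstruction bundle. For a finite group $\Gamma$ acting on a compact almost complex manifold $M$, $M^{\alpha_1,\dots,\alpha_r}$ denotes the fixed locus of $\langle\alpha_1,\dots,\alpha_r\rangle$. For $\alpha\in\Gamma$ of order $r$, $\mathscr S_\alpha=\bigoplus_{k=0}^{r-1}\frac krW_{\alpha,k}\in K(M^\alpha)$, where $W_{\alpha,k}\subset TM|_{M^\alpha}$ is the eigenbundle on which $\alpha$ acts by $\exp(-2\pi ik/r)$. $\mathscr R(\alpha,\beta)$ is the (Fantechi–Göttsche) obstruction bundle on $M^{\alpha,\beta}$, with class in $K(M^{\alpha,\beta})$ equal to $TM^{\alpha,\beta}\ominus TM|_{M^{\alpha,\beta}}\oplus\mathscr S_\alpha|\oplus\mathscr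 S_\beta|\oplus\mathscr S_{(\alpha\beta)^{-1}}|$ (restrictions to $M^{\alpha,\beta}$). In the claim, $\mathscr R$ is taken for $M=X^I$, $\Gamma=G^I\rtimes\Sigma_I$, while the classes $\mathscr S$ are those for $M=X$, $\Gamma=G$. For a tuple $\mathfrak k\in G^J$, $X^{\mathfrak k}$ is the fixed locus of the subgroup generated by all components of $\mathfrak k$ (similarly for several tuples, and $Z^{\mathfrak f}$ is the fixed locus in $Z$ of the components of $\mathfrak f$), and $\mathscr S_{\mathfrak k}=\bigoplus_{j\in J}\mathscr S_{\mathfrak k_j}|_{X^{\mathfrak k}}$. Wreath product. $G^I=\mathrm{Map}(I,G)$, $(g^\sigma)_i=g_{\sigma(i)}$, $g\sigma\cdot h\tau=gh^{\sigma^{-1}}\sigma\tau$ in $G^I\rtimes\Sigma_I$; it acts on $X^I$ by $(\rho(g\sigma)x)_i=\rho(g_{\sigma(i)})x_{\sigma(i)}$. $o(\sigma)$, $o(\sigma,\tau)$ are the sets of orbits in $I$ of $\langle\sigma\rangle$, $\langle\sigma,\tau\rangle$. For $J\subset I$, $\Delta^J$ denotes the diagonal map into the $J$-fold product and $\Delta^J_S$ the diagonal copy of $S$ in $S^J$. Fix representatives $i_a\in a$ for all $a$ in $o(\sigma)$, $o(\tau)$, $o(\sigma\tau)$. For $\mathfrak g\in G^{o(\sigma)}$, $\epsilon_{\mathfrak g}\in G^I$ has $i_a$-component $\mathfrak g_a$ ($a\in o(\sigma)$) and all other components $1$. For $g\in G^I$: $\nu^\sigma(g)_{\sigma^m(i_a)}=g_{\sigma^m(i_a)}g_{\sigma^{m-1}(i_a)}\cdots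 g_{i_a}$ for $0\le m\le|a|-1$, and the cycle product $\psi^\sigma(g)\in G^{o(\sigma)}$ is $\psi^\sigma(g)_a=g_{\sigma^{|a|-1}(i_a)}\cdots g_{\sigma(i_a)}g_{i_a}$. $\mathcal O_{\mathfrak g}\sigma=\{g\sigma: \psi^\sigma(g)=\mathfrak g\}$ ($G$ Abelian); similarly for $\tau$, $\sigma\tau$. For $d\in o(\sigma,\tau)$: $\mathfrak g_d$, $\mathfrak h_d$, $\mathfrak w_d$ are the restrictions of the tuples to the orbits contained in $d$; $f_d$ is the restriction of $f\in G^I$ to $d$; and $gd(d)=\frac12(|d|+2-|d/\langle\sigma\rangle|-|d/\langle\tau\rangle|-|d/\langle\sigma\tau\rangle|)$, a non-negative integer. (Such $\mathfrak f_{(d)}$ and $\overline f$ always exist.) The product $\prod_d$ of $K$-theory classes is the external direct sum over the product of the spaces $\rho(\overline f_d)^{-1}\Delta^d_{Z_d^{\mathfrak f_{(d)}}}$. *)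

theory Defs
  imports
    "HOL-Analysis.Analysis"
    "HOL-Algebra.Multiplicative_Group"
    "HOL-Algebra.Generated_Groups"
    "HOL-Combinatorics.Permutations"
    "HOL-Library.Poly_Mapping"
begin

section \<open>Complex vector bundles\<close>

text \<open>
  The fibres over the points of \<open>bbase\<close> are carried by subsets of the type \<open>'v\<close>; the linear
  structure of each fibre is given explicitly, and \<open>btotal\<close> is the topology of the total space
  \<open>{(y, v). v \<in> fibre y}\<close>.
\<close>

record ('b, 'v) cbundle =
  bbase :: "'b topology"
  fibre :: "'b \<Rightarrow> 'v set"
  badd :: "'b \<Rightarrow> 'v \<Rightarrow> 'v \<Rightarrow> 'v"
  bscale :: "'b \<Rightarrow> complex \<Rightarrow> 'v \<Rightarrow> 'v"
  btotal :: "('b \<times> 'v) topology"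

definition bundle_iso :: "('b, 'v) cbundle \<Rightarrow> ('b, 'w) cbundle \<Rightarrow> bool" where
  "bundle_iso E F \<longleftrightarrow> bbase E = bbase F \<and>
     (\<exists>\<phi>. homeomorphic_map (btotal E) (btotal F) (\<lambda>(y, v). (y, \<phi> y v)) \<and>
        (\<forall>y\<in>topspace (bbase E). \<forall>v\<in>fibre E y.
           (\<forall>w\<in>fibre E y. \<phi> y (badd E y v w) = badd F y (\<phi> y v) (\<phi> y w)) \<and>
           (\<forall>z. \<phi> y (bscale E y z v) = bscale F y z (\<phi> y v))))"

definition pull_bundle :: "'c topology \<Rightarrow> ('c \<Rightarrow> 'b) \<Rightarrow> ('b, 'v) cbundle \<Rightarrow> ('c, 'v) cbundle" where
  "pull_bundle Z f E =
     \<lparr> bbase = Z,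
       fibre = (\<lambda>z. fibre E (f z)),
       badd = (\<lambda>z. badd E (f z)),
       bscale = (\<lambda>z. bscale E (f z)),
       btotal = pullback_topology (Sigma (topspace Z) (\<lambda>z. fibre E (f z)))
                  (\<lambda>(z, v). (z, (f z, v))) (prod_topology Z (btotal E)) \<rparr>"

definition trivial_bundle :: "'b topology \<Rightarrow> nat \<Rightarrow> ('b, nat \<Rightarrow> complex) cbundle" where
  "trivial_bundle Y n =
     \<lparr> bbase = Y,
       fibre = (\<lambda>y. {..<n} \<rightarrow>\<^sub>E UNIV),
       badd = (\<lambda>y v w. \<lambda>i\<in>{..<n}. v i + w i),
       bscale = (\<lambda>y z v. \<lambda>i\<in>{..<n}. z * v i),
       btotal = prod_topology Y (product_topology (\<lambda>_. euclidean) {..<n}) \<rparr>"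

text \<open>The rank is only locally constant. The linear structure of the fibres over the base satisfies
  the vector space axioms because it is closed and locally isomorphic to that of \<open>\<complex>\<^sup>n\<close>.\<close>

definition vector_bundle :: "('b, 'v) cbundle \<Rightarrow> bool" where
  "vector_bundle E \<longleftrightarrow>
     topspace (btotal E) = Sigma (topspace (bbase E)) (fibre E) \<and>
     continuous_map (btotal E) (bbase E) fst \<and>
     (\<forall>y\<in>topspace (bbase E). \<forall>v\<in>fibre E y.
        (\<forall>w\<in>fibre E y. badd E y v w \<in> fibre E y) \<and> (\<forall>z. bscale E y z v \<in> fibre E y)) \<and>
     (\<forall>y\<in>topspace (bbase E). \<exists>U n. openin (bbase E) U \<and> y \<in> U \<and>
        bundle_iso (pull_bundle (subtopology (bbase E) U) id E)
          (trivial_bundle (subtopology (bbase E) U) n))"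

definition direct_sum :: "('b, 'v) cbundle \<Rightarrow> ('b, 'w) cbundle \<Rightarrow> ('b, 'v \<times> 'w) cbundle" where
  "direct_sum E F =
     \<lparr> bbase = bbase E,
       fibre = (\<lambda>y. fibre E y \<times> fibre F y),
       badd = (\<lambda>y (v, w) (v', w'). (badd E y v v', badd F y w w')),
       bscale = (\<lambda>y z (v, w). (bscale E y z v, bscale F y z w)),
       btotal = pullback_topology (Sigma (topspace (bbase E)) (\<lambda>y. fibre E y \<times> fibre F y))
                  (\<lambda>(y, (v, w)). ((y, v), (y, w))) (prod_topology (btotal E) (btotal F)) \<rparr>"


section \<open>Rational K-theory\<close>

text \<open>
  \<open>K\<^sup>0(Y) \<otimes> \<rat>\<close> is the quotient of the free rational vector space on the vector bundles over \<open>Y\<close> by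
  the relations \<open>[E \<oplus> F] = [E] + [F]\<close>. As generators we take the bundles whose fibres are carried by
  subsets of \<open>nat \<Rightarrow> complex\<close>; by cardinality every complex vector bundle over \<open>Y\<close>, whatever the
  type of its fibres, is isomorphic to one of these (transport the structure along fibrewise
  bijections with \<open>\<complex>\<^sup>n\<close>).

  The operations below (scaling, pull-back, ...) act on formal rational combinations of bundles and
  respect the relations; \<open>K_class Y x\<close> is the element of \<open>K\<^sup>0(Y) \<otimes> \<rat>\<close> represented by \<open>x\<close>.
\<close>

type_synonym 'b virt = "('b, nat \<Rightarrow> complex) cbundle \<Rightarrow>\<^sub>0 rat"

definition q_scale :: "rat \<Rightarrow> 'b virt \<Rightarrow> 'b virt" where
  "q_scale q x = Poly_Mapping.map ((*) q) x"

text \<open>Isomorphic bundles are identified by these relations: for a zero bundle \<open>0\<close>, the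
  isomorphism \<open>0 \<cong> 0 \<oplus> 0\<close> kills \<open>[0]\<close>, and \<open>H \<cong> E\<close> gives \<open>H \<cong> E \<oplus> 0\<close>.\<close>

inductive_set K_rel :: "'b topology \<Rightarrow> 'b virt set" for Y :: "'b topology" where
  zero: "0 \<in> K_rel Y"
| sum: "\<lbrakk>vector_bundle E; vector_bundle F; vector_bundle H;
         bbase E = Y; bbase F = Y; bbase H = Y; bundle_iso H (direct_sum E F)\<rbrakk> \<Longrightarrow>
        Poly_Mapping.single H 1 - Poly_Mapping.single E 1 - Poly_Mapping.single F 1 \<in> K_rel Y"
| add: "\<lbrakk>x \<in> K_rel Y; y \<in> K_rel Y\<rbrakk> \<Longrightarrow> x + y \<in> K_rel Y"
| scale: "x \<in> K_rel Y \<Longrightarrow> q_scale q x \<in> K_rel Y"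

definition K_class :: "'b topology \<Rightarrow> 'b virt \<Rightarrow> 'b virt set" where
  "K_class Y x = {y. y - x \<in> K_rel Y}"

definition virt_of :: "('b, 'v) cbundle \<Rightarrow> 'b virt" where
  "virt_of E = Poly_Mapping.single (SOME F. vector_bundle F \<and> bundle_iso F E) 1"

definition K_pull :: "'c topology \<Rightarrow> ('c \<Rightarrow> 'b) \<Rightarrow> 'b virt \<Rightarrow> 'c virt" where
  "K_pull Z f x = (\<Sum>E\<in>Poly_Mapping.keys x.
     Poly_Mapping.single (pull_bundle Z f E) (Poly_Mapping.lookup x E))"

abbreviation K_restrict :: "'b topology \<Rightarrow> 'b set \<Rightarrow> 'b virt \<Rightarrow> 'b virt" where
  "K_restrict Y S \<equiv> K_pull (subtopology Y S) id"

text \<open>Push-forward along a homeomorphism \<open>f\<close> from \<open>Z\<close> onto \<open>Y\<close>.\<close>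

definition K_push :: "'c topology \<Rightarrow> 'b topology \<Rightarrow> ('c \<Rightarrow> 'b) \<Rightarrow> 'c virt \<Rightarrow> 'b virt" where
  "K_push Z Y f = K_pull Y (inv_into (topspace Z) f)"

text \<open>External direct sum of classes \<open>x d\<close>, for \<open>d \<in> D\<close>, over a product space \<open>N\<close> with
  projections \<open>pr d\<close>.\<close>

definition K_external_sum :: "'b topology \<Rightarrow> 'k set \<Rightarrow> ('k \<Rightarrow> 'b \<Rightarrow> 'c) \<Rightarrow> ('k \<Rightarrow> 'c virt) \<Rightarrow> 'b virt" where
  "K_external_sum N D pr x = (\<Sum>d\<in>D. K_pull N (pr d) (x d))"


section \<open>Almost complex manifolds\<close>

text \<open>\<open>Ck k V S f\<close>: \<open>f\<close> is of class \<open>C\<^sup>k\<close> on the relatively open subset \<open>S\<close> of the linear subspace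
  \<open>V\<close>. (Derivatives within \<open>S\<close> are only determined on \<open>V\<close>.)\<close>

primrec Ck :: "nat \<Rightarrow> 'a::euclidean_space set \<Rightarrow> 'a set \<Rightarrow> ('a \<Rightarrow> 'b::euclidean_space) \<Rightarrow> bool" where
  "Ck 0 V S f \<longleftrightarrow> continuous_on S f"
| "Ck (Suc k) V S f \<longleftrightarrow>
     (\<exists>f'. (\<forall>x\<in>S. (f has_derivative f' x) (at x within S)) \<and> (\<forall>v\<in>V. Ck k V S (\<lambda>x. f' x v)))"

definition smooth_on :: "'a::euclidean_space set \<Rightarrow> 'a set \<Rightarrow> ('a \<Rightarrow> 'b::euclidean_space) \<Rightarrow> bool" where
  "smooth_on V S f \<longleftrightarrow> (\<forall>k. Ck k V S f)"

type_synonym ('p, 'e) chart = "'p set \<times> ('p \<Rightarrow> 'e)"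

text \<open>
  The charts take values in a linear subspace \<open>model\<close> of a Euclidean space, so that all dimensions
  (including 0) are covered. A tangent vector at \<open>p\<close> is the family of its coordinate vectors with
  respect to the charts around \<open>p\<close>; it has the value 0 at all other arguments.
\<close>

type_synonym ('p, 'e) tvec = "('p, 'e) chart \<Rightarrow> 'e"

record ('p, 'e) acm =
  mtop :: "'p topology"
  model :: "'e set"
  atlas :: "('p, 'e) chart set"
  acs :: "'p \<Rightarrow> ('p, 'e) tvec \<Rightarrow> ('p, 'e) tvec"

abbreviation points :: "('p, 'e) acm \<Rightarrow> 'p set" where
  "points M \<equiv> topspace (mtop M)"

definition charts_at :: "('p, 'e) acm \<Rightarrow> 'p \<Rightarrow> ('p, 'e) chart set" where
  "charts_at M p = {c \<in> atlas M. p \<in> fst c}"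

definition tangent_space :: "('p, 'e::euclidean_space) acm \<Rightarrow> 'p \<Rightarrow> ('p, 'e) tvec set" where
  "tangent_space M p = {v.
     (\<forall>c. c \<notin> charts_at M p \<longrightarrow> v c = 0) \<and>
     (\<forall>c\<in>charts_at M p. v c \<in> model M) \<and>
     (\<forall>c\<in>charts_at M p. \<forall>c'\<in>charts_at M p. \<exists>D.
        ((snd c' \<circ> inv_into (fst c) (snd c)) has_derivative D)
          (at (snd c p) within snd c ` (fst c \<inter> fst c')) \<and>
        v c' = D (v c))}"

definition tvec_in_chart ::
    "('p, 'e::euclidean_space) acm \<Rightarrow> 'p \<Rightarrow> ('p, 'e) chart \<Rightarrow> 'e \<Rightarrow> ('p, 'e) tvec" where
  "tvec_in_chart M p c w = (THE v. v \<in> tangent_space M p \<and> v c = w)"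

definition smooth_atlas :: "('p, 'e::euclidean_space) acm \<Rightarrow> bool" where
  "smooth_atlas M \<longleftrightarrow> subspace (model M) \<and>
     (\<Union>c\<in>atlas M. fst c) = points M \<and>
     (\<forall>(U, \<phi>)\<in>atlas M. openin (mtop M) U \<and> openin (top_of_set (model M)) (\<phi> ` U) \<and>
        homeomorphic_map (subtopology (mtop M) U) (top_of_set (\<phi> ` U)) \<phi>) \<and>
     (\<forall>(U, \<phi>)\<in>atlas M. \<forall>(U', \<phi>')\<in>atlas M.
        smooth_on (model M) (\<phi> ` (U \<inter> U')) (\<phi>' \<circ> inv_into U \<phi>))"

definition almost_complex_structure :: "('p, 'e::euclidean_space) acm \<Rightarrow> bool" where
  "almost_complex_structure M \<longleftrightarrow>
     (\<forall>p\<in>points M. \<forall>v\<in>tangent_space M p.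
        acs M p v \<in> tangent_space M p \<and>
        (\<forall>w\<in>tangent_space M p. acs M p (\<lambda>c. v c + w c) = (\<lambda>c. acs M p v c + acs M p w c)) \<and>
        (\<forall>r. acs M p (\<lambda>c. r *\<^sub>R v c) = (\<lambda>c. r *\<^sub>R acs M p v c)) \<and>
        acs M p (acs M p v) = (\<lambda>c. - v c)) \<and>
     (\<forall>c\<in>atlas M. \<forall>w\<in>model M. smooth_on (model M) (snd c ` fst c)
        (\<lambda>x. let p = inv_into (fst c) (snd c) x in acs M p (tvec_in_chart M p c w) c))"

definition compact_acm :: "('p, 'e::euclidean_space) acm \<Rightarrow> bool" where
  "compact_acm M \<longleftrightarrow> compact_space (mtop M) \<and> Hausdorff_space (mtop M) \<and>
     smooth_atlas M \<and> almost_complex_structure M"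

definition smooth_map ::
    "('p, 'e::euclidean_space) acm \<Rightarrow> ('q, 'f::euclidean_space) acm \<Rightarrow> ('p \<Rightarrow> 'q) \<Rightarrow> bool" where
  "smooth_map M N F \<longleftrightarrow> continuous_map (mtop M) (mtop N) F \<and>
     (\<forall>(U, \<phi>)\<in>atlas M. \<forall>(U', \<phi>')\<in>atlas N.
        smooth_on (model M) (\<phi> ` (U \<inter> F -` U')) (\<phi>' \<circ> F \<circ> inv_into U \<phi>))"

definition tangent_map ::
    "('p, 'e::euclidean_space) acm \<Rightarrow> ('q, 'f::euclidean_space) acm \<Rightarrow> ('p \<Rightarrow> 'q) \<Rightarrow>
      'p \<Rightarrow> ('p, 'e) tvec \<Rightarrow> ('q, 'f) tvec" where
  "tangent_map M N F p v = (THE w. w \<in> tangent_space N (F p) \<and>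
     (\<forall>b\<in>charts_at M p. \<forall>c\<in>charts_at N (F p). \<exists>D.
        ((snd c \<circ> F \<circ> inv_into (fst b) (snd b)) has_derivative D)
          (at (snd b p) within snd b ` (fst b \<inter> F -` fst c)) \<and>
        w c = D (v b)))"

text \<open>Tangent spaces of an embedded submanifold \<open>Z\<close> of \<open>M\<close>, whose components may have different
  dimensions: the velocities at \<open>p\<close> of the curves in \<open>Z\<close> through \<open>p\<close>. (For embedded submanifolds
  it makes no difference whether the curves are smooth or only differentiable at \<open>p\<close>.)\<close>

definition tangent_subspace :: "('p, 'e::euclidean_space) acm \<Rightarrow> 'p set \<Rightarrow> 'p \<Rightarrow> ('p, 'e) tvec set" where
  "tangent_subspace M Z p = {v \<in> tangent_space M p.
     \<exists>\<gamma> :: real \<Rightarrow> 'p. continuous_map euclidean (subtopology (mtop M) Z) \<gamma> \<and> \<gamma> 0 = p \<and>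
       (\<forall>c\<in>charts_at M p. ((snd c \<circ> \<gamma>) has_vector_derivative v c) (at 0))}"

definition c_scale :: "('p, 'e::euclidean_space) acm \<Rightarrow> 'p \<Rightarrow> complex \<Rightarrow> ('p, 'e) tvec \<Rightarrow> ('p, 'e) tvec" where
  "c_scale M p z v = (\<lambda>c. Re z *\<^sub>R v c + Im z *\<^sub>R acs M p v c)"

definition tangent_topology :: "('p, 'e::euclidean_space) acm \<Rightarrow> ('p \<times> ('p, 'e) tvec) topology" where
  "tangent_topology M = topology_generated_by
     {{(p, v). p \<in> fst c \<and> v \<in> tangent_space M p \<and> (snd c p, v c) \<in> W} | c W. c \<in> atlas M \<and> open W}"

text \<open>The subbundle of \<open>TM|\<^sub>Z\<close> with fibres \<open>F p \<subseteq> T\<^sub>pM\<close>.\<close>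

definition tangent_subbundle ::
    "('p, 'e::euclidean_space) acm \<Rightarrow> 'p set \<Rightarrow> ('p \<Rightarrow> ('p, 'e) tvec set) \<Rightarrow>
      ('p, ('p, 'e) tvec) cbundle" where
  "tangent_subbundle M Z F =
     \<lparr> bbase = subtopology (mtop M) Z,
       fibre = F,
       badd = (\<lambda>p v w. \<lambda>c. v c + w c),
       bscale = c_scale M,
       btotal = subtopology (tangent_topology M) (Sigma Z F) \<rparr>"

definition TM_restricted :: "('p, 'e::euclidean_space) acm \<Rightarrow> 'p set \<Rightarrow> ('p, ('p, 'e) tvec) cbundle" where
  "TM_restricted M Z = tangent_subbundle M Z (tangent_space M)"

definition T_submanifold :: "('p, 'e::euclidean_space) acm \<Rightarrow> 'p set \<Rightarrow> ('p, ('p, 'e) tvec) cbundle" where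
  "T_submanifold M Z = tangent_subbundle M Z (tangent_subspace M Z)"

definition product_chart :: "'i set \<Rightarrow> ('i \<Rightarrow> ('x, 'e::euclidean_space) chart) \<Rightarrow>
    ('i \<Rightarrow> 'x, 'e ^ 'i::finite) chart" where
  "product_chart I c = (PiE I (\<lambda>i. fst (c i)), \<lambda>x. \<chi> i. if i \<in> I then snd (c i) (x i) else 0)"

definition power_manifold_with ::
    "(('i \<Rightarrow> 'x) \<Rightarrow> ('i \<Rightarrow> 'x, 'e ^ 'i) tvec \<Rightarrow> ('i \<Rightarrow> 'x, 'e ^ 'i) tvec) \<Rightarrow>
      'i::finite set \<Rightarrow> ('x, 'e::euclidean_space) acm \<Rightarrow> ('i \<Rightarrow> 'x, 'e ^ 'i) acm" where
  "power_manifold_with J I X =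
     \<lparr> mtop = product_topology (\<lambda>_. mtop X) I,
       model = {v. (\<forall>i\<in>I. v $ i \<in> model X) \<and> (\<forall>i. i \<notin> I \<longrightarrow> v $ i = 0)},
       atlas = {product_chart I c | c. \<forall>i\<in>I. c i \<in> atlas X},
       acs = J \<rparr>"

text \<open>Tangent spaces and tangent maps do not depend on the field \<open>acs\<close>; the almost complex structure
  of \<open>X\<^sup>I\<close> is the one for which all projections to \<open>X\<close> are complex linear on tangent vectors.\<close>

definition acm_power :: "'i::finite set \<Rightarrow> ('x, 'e::euclidean_space) acm \<Rightarrow> ('i \<Rightarrow> 'x, 'e ^ 'i) acm" where
  "acm_power I X =
     (let M = power_manifold_with (\<lambda>_ v. v) I X in
      power_manifold_with
        (\<lambda>x v. THE w. w \<in> tangent_space M x \<and>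
           (\<forall>i\<in>I. tangent_map M X (\<lambda>y. y i) x w = acs X (x i) (tangent_map M X (\<lambda>y. y i) x v)))
        I X)"


section \<open>Group actions and obstruction classes\<close>

text \<open>Right actions: \<open>\<rho> (a b) = \<rho> b \<circ> \<rho> a\<close>.\<close>

definition acm_action ::
    "('g, 'm) monoid_scheme \<Rightarrow> ('p, 'e::euclidean_space) acm \<Rightarrow> ('g \<Rightarrow> 'p \<Rightarrow> 'p) \<Rightarrow> bool" where
  "acm_action \<Gamma> M \<rho> \<longleftrightarrow>
     (\<forall>p\<in>points M. \<rho> \<one>\<^bsub>\<Gamma>\<^esub> p = p) \<and>
     (\<forall>a\<in>carrier \<Gamma>. \<forall>b\<in>carrier \<Gamma>. \<forall>p\<in>points M. \<rho> (a \<otimes>\<^bsub>\<Gamma>\<^esub> b) p = \<rho> b (\<rho> a p)) \<and>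
     (\<forall>a\<in>carrier \<Gamma>. smooth_map M M (\<rho> a) \<and>
        (\<forall>p\<in>points M. \<forall>v\<in>tangent_space M p.
           tangent_map M M (\<rho> a) p (acs M p v) = acs M (\<rho> a p) (tangent_map M M (\<rho> a) p v)))"

definition fixed_locus ::
    "('g, 'm) monoid_scheme \<Rightarrow> ('p, 'e) acm \<Rightarrow> ('g \<Rightarrow> 'p \<Rightarrow> 'p) \<Rightarrow> 'g set \<Rightarrow> 'p set" where
  "fixed_locus \<Gamma> M \<rho> A = {p \<in> points M. \<forall>\<gamma>\<in>generate \<Gamma> A. \<rho> \<gamma> p = p}"

definition eigenbundle ::
    "('g, 'm) monoid_scheme \<Rightarrow> ('p, 'e::euclidean_space) acm \<Rightarrow> ('g \<Rightarrow> 'p \<Rightarrow> 'p) \<Rightarrow> 'g \<Rightarrow> nat \<Rightarrow>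
      ('p, ('p, 'e) tvec) cbundle" where
  "eigenbundle \<Gamma> M \<rho> \<alpha> k = tangent_subbundle M (fixed_locus \<Gamma> M \<rho> {\<alpha>})
     (\<lambda>p. {v \<in> tangent_space M p. tangent_map M M (\<rho> \<alpha>) p v =
        c_scale M p (exp (- (2 * of_real pi * \<i> * of_nat k / of_nat (group.ord \<Gamma> \<alpha>)))) v})"

definition S_virt ::
    "('g, 'm) monoid_scheme \<Rightarrow> ('p, 'e::euclidean_space) acm \<Rightarrow> ('g \<Rightarrow> 'p \<Rightarrow> 'p) \<Rightarrow> 'g \<Rightarrow> 'p virt" where
  "S_virt \<Gamma> M \<rho> \<alpha> = (\<Sum>k<group.ord \<Gamma> \<alpha>.
     q_scale (of_nat k / of_nat (group.ord \<Gamma> \<alpha>)) (virt_of (eigenbundle \<Gamma> M \<rho> \<alpha> k)))"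

definition S_tuple_virt ::
    "('g, 'm) monoid_scheme \<Rightarrow> ('p, 'e::euclidean_space) acm \<Rightarrow> ('g \<Rightarrow> 'p \<Rightarrow> 'p) \<Rightarrow>
      'j set \<Rightarrow> ('j \<Rightarrow> 'g) \<Rightarrow> 'p virt" where
  "S_tuple_virt \<Gamma> M \<rho> J \<kappa> =
     (\<Sum>j\<in>J. K_restrict (mtop M) (fixed_locus \<Gamma> M \<rho> (\<kappa> ` J)) (S_virt \<Gamma> M \<rho> (\<kappa> j)))"

text \<open>The class in K-theory of the Fantechi-Goettsche obstruction bundle, over
  \<open>fixed_locus \<Gamma> M \<rho> {\<alpha>, \<beta>}\<close>, given by its expression in terms of tangent bundles and the
  classes \<open>S_virt\<close>; the bundle itself (not needed for identities in K-theory) is not constructed.\<close>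

definition obstruction_virt ::
    "('g, 'm) monoid_scheme \<Rightarrow> ('p, 'e::euclidean_space) acm \<Rightarrow> ('g \<Rightarrow> 'p \<Rightarrow> 'p) \<Rightarrow>
      'g \<Rightarrow> 'g \<Rightarrow> 'p virt" where
  "obstruction_virt \<Gamma> M \<rho> \<alpha> \<beta> =
     (let Z = fixed_locus \<Gamma> M \<rho> {\<alpha>, \<beta>} in
      virt_of (T_submanifold M Z) - virt_of (TM_restricted M Z)
      + K_restrict (mtop M) Z (S_virt \<Gamma> M \<rho> \<alpha>)
      + K_restrict (mtop M) Z (S_virt \<Gamma> M \<rho> \<beta>)
      + K_restrict (mtop M) Z (S_virt \<Gamma> M \<rho> (inv\<^bsub>\<Gamma>\<^esub> (\<alpha> \<otimes>\<^bsub>\<Gamma>\<^esub> \<beta>))))"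


section \<open>Wreath products\<close>

definition perm_group :: "'i set \<Rightarrow> ('i \<Rightarrow> 'i) monoid" where
  "perm_group I = \<lparr> carrier = {\<pi>. \<pi> permutes I}, mult = (\<circ>), one = id \<rparr>"

definition wreath :: "('g, 'm) monoid_scheme \<Rightarrow> 'i set \<Rightarrow> (('i \<Rightarrow> 'g) \<times> ('i \<Rightarrow> 'i)) monoid" where
  "wreath G I =
     \<lparr> carrier = (I \<rightarrow>\<^sub>E carrier G) \<times> {\<pi>. \<pi> permutes I},
       mult = (\<lambda>(g, \<sigma>) (h, \<tau>). (\<lambda>i\<in>I. g i \<otimes>\<^bsub>G\<^esub> h (inv_into UNIV \<sigma> i), \<sigma> \<circ> \<tau>)),
       one = (\<lambda>i\<in>I. \<one>\<^bsub>G\<^esub>, id) \<rparr>"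

definition wreath_act ::
    "('g \<Rightarrow> 'x \<Rightarrow> 'x) \<Rightarrow> 'i set \<Rightarrow> ('i \<Rightarrow> 'g) \<times> ('i \<Rightarrow> 'i) \<Rightarrow> ('i \<Rightarrow> 'x) \<Rightarrow> ('i \<Rightarrow> 'x)" where
  "wreath_act \<rho> I = (\<lambda>(g, \<sigma>) x. \<lambda>i\<in>I. \<rho> (g (\<sigma> i)) (x (\<sigma> i)))"

definition orbit_on :: "'i set \<Rightarrow> ('i \<Rightarrow> 'i) set \<Rightarrow> 'i \<Rightarrow> 'i set" where
  "orbit_on I P i = (\<lambda>\<pi>. \<pi> i) ` generate (perm_group I) P"

text \<open>\<open>orbits_on I {\<sigma>}\<close> and \<open>orbits_on I {\<sigma>, \<tau>}\<close> are the sets written \<open>o(\<sigma>)\<close> and \<open>o(\<sigma>, \<tau>)\<close>.\<close>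

definition orbits_on :: "'i set \<Rightarrow> ('i \<Rightarrow> 'i) set \<Rightarrow> 'i set set" where
  "orbits_on I P = orbit_on I P ` I"

definition orbits_in :: "'i set \<Rightarrow> ('i \<Rightarrow> 'i) \<Rightarrow> 'i set \<Rightarrow> 'i set set" where
  "orbits_in I \<sigma> d = {a \<in> orbits_on I {\<sigma>}. a \<subseteq> d}"

definition representatives :: "'i set \<Rightarrow> ('i \<Rightarrow> 'i) \<Rightarrow> ('i set \<Rightarrow> 'i) \<Rightarrow> bool" where
  "representatives I \<sigma> r \<longleftrightarrow> (\<forall>a\<in>orbits_on I {\<sigma>}. r a \<in> a)"

definition eps_tuple :: "('g, 'm) monoid_scheme \<Rightarrow> 'i set \<Rightarrow> ('i \<Rightarrow> 'i) \<Rightarrow> ('i set \<Rightarrow> 'i) \<Rightarrow>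
    ('i set \<Rightarrow> 'g) \<Rightarrow> ('i \<Rightarrow> 'g)" where
  "eps_tuple G I \<sigma> r \<gg> = (\<lambda>i\<in>I. if i = r (orbit_on I {\<sigma>} i) then \<gg> (orbit_on I {\<sigma>} i) else \<one>\<^bsub>G\<^esub>)"

primrec partial_cycle_product ::
    "('g, 'm) monoid_scheme \<Rightarrow> ('i \<Rightarrow> 'i) \<Rightarrow> ('i \<Rightarrow> 'g) \<Rightarrow> 'i \<Rightarrow> nat \<Rightarrow> 'g" where
  "partial_cycle_product G \<sigma> g i 0 = g i"
| "partial_cycle_product G \<sigma> g i (Suc m) =
     g ((\<sigma> ^^ Suc m) i) \<otimes>\<^bsub>G\<^esub> partial_cycle_product G \<sigma> g i m"

definition nu :: "('g, 'm) monoid_scheme \<Rightarrow> 'i set \<Rightarrow> ('i \<Rightarrow> 'i) \<Rightarrow> ('i set \<Rightarrow> 'i) \<Rightarrow>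
    ('i \<Rightarrow> 'g) \<Rightarrow> ('i \<Rightarrow> 'g)" where
  "nu G I \<sigma> r g = (\<lambda>j\<in>I. let i = r (orbit_on I {\<sigma>} j) in
     partial_cycle_product G \<sigma> g i (LEAST m. (\<sigma> ^^ m) i = j))"

definition cycle_product :: "('g, 'm) monoid_scheme \<Rightarrow> 'i set \<Rightarrow> ('i \<Rightarrow> 'i) \<Rightarrow> ('i set \<Rightarrow> 'i) \<Rightarrow>
    ('i \<Rightarrow> 'g) \<Rightarrow> ('i set \<Rightarrow> 'g)" where
  "cycle_product G I \<sigma> r g =
     (\<lambda>a\<in>orbits_on I {\<sigma>}. partial_cycle_product G \<sigma> g (r a) (card a - 1))"

definition O_class :: "('g, 'm) monoid_scheme \<Rightarrow> 'i set \<Rightarrow> ('i \<Rightarrow> 'i) \<Rightarrow> ('i set \<Rightarrow> 'i) \<Rightarrow>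
    ('i set \<Rightarrow> 'g) \<Rightarrow> (('i \<Rightarrow> 'g) \<times> ('i \<Rightarrow> 'i)) set" where
  "O_class G I \<sigma> r \<gg> = {(g, \<sigma>) | g. g \<in> I \<rightarrow>\<^sub>E carrier G \<and> cycle_product G I \<sigma> r g = \<gg>}"

text \<open>\<open>f\<^sup>-\<^sup>1 x f\<close> for \<open>f \<in> G\<^sup>I\<close> and \<open>x\<close> in the wreath product.\<close>

definition conj_by :: "('g, 'm) monoid_scheme \<Rightarrow> 'i set \<Rightarrow> ('i \<Rightarrow> 'g) \<Rightarrow>
    ('i \<Rightarrow> 'g) \<times> ('i \<Rightarrow> 'i) \<Rightarrow> ('i \<Rightarrow> 'g) \<times> ('i \<Rightarrow> 'i)" where
  "conj_by G I f x = inv\<^bsub>wreath G I\<^esub> (f, id) \<otimes>\<^bsub>wreath G I\<^esub> x \<otimes>\<^bsub>wreath G I\<^esub> (f, id)"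

text \<open>The genus is kept as a rational number, so that the formula involves no truncation; it is a
  natural number for all orbits \<open>d\<close> of \<open>\<langle>\<sigma>, \<tau>\<rangle>\<close>.\<close>

definition gd :: "'i set \<Rightarrow> ('i \<Rightarrow> 'i) \<Rightarrow> ('i \<Rightarrow> 'i) \<Rightarrow> 'i set \<Rightarrow> rat" where
  "gd I \<sigma> \<tau> d = (of_nat (card d) + 2 - of_nat (card (orbits_in I \<sigma> d))
     - of_nat (card (orbits_in I \<tau> d)) - of_nat (card (orbits_in I (\<sigma> \<circ> \<tau>) d))) / 2"


section \<open>Diagonals and the local classes\<close>

definition diag_map :: "'i set \<Rightarrow> 's \<Rightarrow> ('i \<Rightarrow> 's)" where
  "diag_map J s = (\<lambda>i\<in>J. s)"

definition diag :: "'i set \<Rightarrow> 's set \<Rightarrow> ('i \<Rightarrow> 's) set" where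
  "diag J S = diag_map J ` S"

text \<open>For a partition \<open>D\<close> of \<open>I\<close>, the product over \<open>d \<in> D\<close> of subsets \<open>A d\<close> of \<open>S\<^sup>d\<close>, inside
  \<open>S\<^sup>I\<close>.\<close>

definition block_product :: "'i set \<Rightarrow> 'i set set \<Rightarrow> ('i set \<Rightarrow> ('i \<Rightarrow> 's) set) \<Rightarrow> ('i \<Rightarrow> 's) set" where
  "block_product I D A = {x \<in> extensional I. \<forall>d\<in>D. restrict x d \<in> A d}"

text \<open>\<open>\<rho>(f\<^sub>d)\<^sup>-\<^sup>1 \<Delta>\<^sup>d\<^sub>Z \<subseteq> X\<^sup>d\<close>.\<close>

definition twisted_diag :: "('x, 'e) acm \<Rightarrow> ('g \<Rightarrow> 'x \<Rightarrow> 'x) \<Rightarrow> ('i \<Rightarrow> 'g) \<Rightarrow> 'i set \<Rightarrow> 'x set \<Rightarrow>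
    ('i \<Rightarrow> 'x) set" where
  "twisted_diag X \<rho> f d Z =
     {x \<in> d \<rightarrow>\<^sub>E points X. wreath_act \<rho> d (restrict f d, id) x \<in> diag d Z}"

text \<open>\<open>\<rho>(f\<^sub>d)\<^sup>* \<Delta>\<^sup>d\<^sub>* y\<close>, over \<open>\<rho>(f\<^sub>d)\<^sup>-\<^sup>1 \<Delta>\<^sup>d\<^sub>Z\<close>, for a class \<open>y\<close> over \<open>Z\<close>.\<close>

definition transfer :: "('x, 'e) acm \<Rightarrow> ('g \<Rightarrow> 'x \<Rightarrow> 'x) \<Rightarrow> ('i \<Rightarrow> 'g) \<Rightarrow> 'i set \<Rightarrow> 'x set \<Rightarrow>
    'x virt \<Rightarrow> ('i \<Rightarrow> 'x) virt" where
  "transfer X \<rho> f d Z y =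
     (let Xd = product_topology (\<lambda>_. mtop X) d in
      K_pull (subtopology Xd (twisted_diag X \<rho> f d Z)) (wreath_act \<rho> d (restrict f d, id))
        (K_push (subtopology (mtop X) Z) (subtopology Xd (diag d Z)) (diag_map d) y))"

text \<open>The fixed locus in \<open>Z\<^sub>d\<close> of the components of \<open>fs\<close>, where \<open>Z\<^sub>d\<close> is the fixed locus of the
  components of \<open>\<gg>\<close>, \<open>\<hh>\<close> and \<open>\<ww>\<close> at the orbits contained in \<open>d\<close>.\<close>

definition Z_sector :: "('g, 'm) monoid_scheme \<Rightarrow> ('x, 'e) acm \<Rightarrow> ('g \<Rightarrow> 'x \<Rightarrow> 'x) \<Rightarrow> 'i set \<Rightarrow>
    ('i \<Rightarrow> 'i) \<Rightarrow> ('i \<Rightarrow> 'i) \<Rightarrow> ('i set \<Rightarrow> 'g) \<Rightarrow> ('i set \<Rightarrow> 'g) \<Rightarrow> ('i set \<Rightarrow> 'g) \<Rightarrow>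
    'g list \<Rightarrow> 'i set \<Rightarrow> 'x set" where
  "Z_sector G X \<rho> I \<sigma> \<tau> \<gg> \<hh> \<ww> fs d = fixed_locus G X \<rho>
     (\<gg> ` orbits_in I \<sigma> d \<union> \<hh> ` orbits_in I \<tau> d \<union> \<ww> ` orbits_in I (\<sigma> \<circ> \<tau>) d \<union> set fs)"

definition local_virt :: "('g, 'm) monoid_scheme \<Rightarrow> ('x, 'e::euclidean_space) acm \<Rightarrow>
    ('g \<Rightarrow> 'x \<Rightarrow> 'x) \<Rightarrow> 'i set \<Rightarrow> ('i \<Rightarrow> 'i) \<Rightarrow> ('i \<Rightarrow> 'i) \<Rightarrow>
    ('i set \<Rightarrow> 'g) \<Rightarrow> ('i set \<Rightarrow> 'g) \<Rightarrow> ('i set \<Rightarrow> 'g) \<Rightarrow> 'g list \<Rightarrow> 'i set \<Rightarrow> 'x virt" where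
  "local_virt G X \<rho> I \<sigma> \<tau> \<gg> \<hh> \<ww> fs d =
     (let Z = Z_sector G X \<rho> I \<sigma> \<tau> \<gg> \<hh> \<ww> fs d in
      virt_of (T_submanifold X Z)
      + q_scale (gd I \<sigma> \<tau> d - 1) (virt_of (TM_restricted X Z))
      + K_restrict (mtop X) Z (S_tuple_virt G X \<rho> (orbits_in I \<sigma> d) \<gg>)
      + K_restrict (mtop X) Z (S_tuple_virt G X \<rho> (orbits_in I \<tau> d) \<hh>)
      + K_restrict (mtop X) Z
          (S_tuple_virt G X \<rho> (orbits_in I (\<sigma> \<circ> \<tau>) d) (\<lambda>c. inv\<^bsub>G\<^esub> (\<ww> c))))"

end

theory Submission
 imports Defs "HOL-Combinatorics.Cycles"
begin

text \<open>
Let \<open>\<kappa> = g\<pi>\<close> act on \<open>X\<^sup>I\<close>. Over its fixed locus, a tangent vector in the eigenspace of \<open>\<kappa>\<close> for \<open>\<mu>\<close> is determined by its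
components at the representatives of the cycles \<open>a\<close> of \<open>\<pi>\<close>, and the component at \<open>i\<^sub>a\<close> can be any eigenvector of the
cycle product \<open>\<psi>(g)\<^sub>a\<close> for \<open>\<mu>\<^sup>n\<close>, \<open>n = |a|\<close>. Summing over the \<open>R\<close>-th roots of unity, for a common multiple \<open>R\<close> of all orders,
shows that \<open>\<S>\<^sub>\<kappa>\<close> is the sum over \<open>a\<close> of the pull-backs of the \<open>\<S>\<close> of \<open>\<psi>(g)\<^sub>a\<close> plus \<open>(|a| - 1)/2\<close> times \<open>TX\<close>. On the fixed locus \<open>N\<close>
of the sector, the components of a point in an orbit \<open>d\<close> are translates of one point of \<open>Z\<^sub>d\<close>, so \<open>TN\<close> is the sum of the
\<open>TZ\<^sub>d\<close> and \<open>TX\<^sup>I\<close> that of the \<open>|d| TX\<close>; the multiplicities of \<open>TX\<close> add up to \<open>gd(d) - 1\<close>. The last formula holds because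
the obstruction class is natural under conjugation and \<open>\<nu>(g)\<close> conjugates \<open>(g\<sigma>, h\<tau>)\<close> to the normal form.
\<close>

text \<open>The fixed loci come as bare sets, and a bundle has a class only once it is locally
  trivial. Local triviality of tangent bundles and eigenbundles is obtained by writing the fibres as
  images of averages over group elements: these are continuous fibrewise projections of the ambient
  tangent bundle. Tangent vectors of a fixed locus are velocities of curves of fixed points; that
  every invariant vector is one rests on the inverse function theorem for an equivariant chart. The
  term (|a| - 1)/2 has this origin: an eigenvalue exp(-2 pi i j/s) of a cycle product has n = |a|
  roots of order n, with the weights (l s + j)/(n s) for l < n, and these add up to j/s + (n - 1)/2.
  Over the cycles in d of \<sigma>, \<tau> and the inverse of \<sigma>\<tau> this gives half of 3|d|
  minus the number of cycles; subtracting |d| leaves gd(d) - 1. Commutativity of G makes the class S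
  of an element invariant under translations, so that classes met at different components of a block
  can all be pulled back along one map to Z_d.\<close>

notation continuous_map ("cmap") and tangent_space ("\<T>") and tangent_topology ("\<TT>")

lemmas into_sub = continuous_map_in_subtopology
lemmas from_sub = continuous_map_from_subtopology

abbreviation top_on :: "('p, 'e::euclidean_space) acm \<Rightarrow> 'p set \<Rightarrow> 'p topology" where
 "top_on M \<equiv> subtopology (mtop M)"

section \<open>Bundles and their isomorphisms\<close>

lemma continuous_map_mem: "\<lbrakk>cmap X Y f; x \<in> topspace X\<rbrakk> \<Longrightarrow> f x \<in> topspace Y"
 using continuous_map_funspace by fastforce

text \<open>\<open>vector_bundle\<close> without local triviality: enough to handle isomorphisms,
  pull-backs and sums before any of them is known to be locally trivial.\<close>

definition prebundle :: "('b, 'v) cbundle \<Rightarrow> bool" where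
 "prebundle E \<longleftrightarrow>
   topspace (btotal E) = Sigma (topspace (bbase E)) (fibre E) \<and>
   cmap (btotal E) (bbase E) fst \<and>
   (\<forall>y\<in>topspace (bbase E). \<forall>v\<in>fibre E y.
    (\<forall>w\<in>fibre E y. badd E y v w \<in> fibre E y) \<and> (\<forall>z. bscale E y z v \<in> fibre E y))"

lemma prebundleD:
 assumes "prebundle E"
 shows "topspace (btotal E) = Sigma (topspace (bbase E)) (fibre E)"
  and "cmap (btotal E) (bbase E) fst"
  and "\<lbrakk>y \<in> topspace (bbase E); v \<in> fibre E y; w \<in> fibre E y\<rbrakk> \<Longrightarrow> badd E y v w \<in> fibre E y"
  and "\<lbrakk>y \<in> topspace (bbase E); v \<in> fibre E y\<rbrakk> \<Longrightarrow> bscale E y z v \<in> fibre E y"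
 using assms by (auto simp: prebundle_def)

definition fibre_linear :: "('b, 'v) cbundle \<Rightarrow> ('b, 'w) cbundle \<Rightarrow> ('b \<Rightarrow> 'v \<Rightarrow> 'w) \<Rightarrow> bool" where
 "fibre_linear E F \<phi> \<longleftrightarrow> (\<forall>y\<in>topspace (bbase E). \<forall>v\<in>fibre E y.
   (\<forall>w\<in>fibre E y. \<phi> y (badd E y v w) = badd F y (\<phi> y v) (\<phi> y w)) \<and>
   (\<forall>z. \<phi> y (bscale E y z v) = bscale F y z (\<phi> y v)))"

lemma fibre_linearD:
 assumes "fibre_linear E F \<phi>" "y \<in> topspace (bbase E)" "v \<in> fibre E y"
 shows "w \<in> fibre E y \<Longrightarrow> \<phi> y (badd E y v w) = badd F y (\<phi> y v) (\<phi> y w)"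
  and "\<phi> y (bscale E y z v) = bscale F y z (\<phi> y v)" using assms by (auto simp: fibre_linear_def)

text \<open>Keeps the inverse as data. A homeomorphism over the identity of the base amounts to two
  mutually inverse fibrewise maps, each continuous on total spaces, so that continuity of the
  inverse becomes a condition that can be checked directly.\<close>

definition bundle_iso_by ::
  "('b, 'v) cbundle \<Rightarrow> ('b, 'w) cbundle \<Rightarrow> ('b \<Rightarrow> 'v \<Rightarrow> 'w) \<Rightarrow> ('b \<Rightarrow> 'w \<Rightarrow> 'v) \<Rightarrow> bool" where
 "bundle_iso_by E F \<phi> \<psi> \<longleftrightarrow> bbase E = bbase F \<and>
   cmap (btotal E) (btotal F) (\<lambda>p. (fst p, \<phi> (fst p) (snd p))) \<and>
   cmap (btotal F) (btotal E) (\<lambda>p. (fst p, \<psi> (fst p) (snd p))) \<and>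
   (\<forall>y\<in>topspace (bbase E). \<forall>v\<in>fibre E y. \<phi> y v \<in> fibre F y \<and> \<psi> y (\<phi> y v) = v) \<and>
   (\<forall>y\<in>topspace (bbase E). \<forall>w\<in>fibre F y. \<psi> y w \<in> fibre E y \<and> \<phi> y (\<psi> y w) = w) \<and>
   fibre_linear E F \<phi>"

lemma bundle_iso_byD:
 assumes "bundle_iso_by E F \<phi> \<psi>"
 shows "bbase E = bbase F"
  and "cmap (btotal E) (btotal F) (\<lambda>p. (fst p, \<phi> (fst p) (snd p)))"
  and "cmap (btotal F) (btotal E) (\<lambda>p. (fst p, \<psi> (fst p) (snd p)))"
  and "\<lbrakk>y \<in> topspace (bbase E); v \<in> fibre E y\<rbrakk> \<Longrightarrow> \<phi> y v \<in> fibre F y"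
  and "\<lbrakk>y \<in> topspace (bbase E); v \<in> fibre E y\<rbrakk> \<Longrightarrow> \<psi> y (\<phi> y v) = v"
  and "\<lbrakk>y \<in> topspace (bbase E); w \<in> fibre F y\<rbrakk> \<Longrightarrow> \<psi> y w \<in> fibre E y"
  and "\<lbrakk>y \<in> topspace (bbase E); w \<in> fibre F y\<rbrakk> \<Longrightarrow> \<phi> y (\<psi> y w) = w"
  and "fibre_linear E F \<phi>" using assms by (auto simp: bundle_iso_by_def)

lemma bundle_iso_iff:
 assumes E: "prebundle E" and F: "prebundle F"
 shows "bundle_iso E F \<longleftrightarrow> (\<exists>\<phi> \<psi>. bundle_iso_by E F \<phi> \<psi>)"
proof
 assume "bundle_iso E F"
 then obtain \<phi> where base: "bbase E = bbase F"
  and hom: "homeomorphic_map (btotal E) (btotal F) (\<lambda>(y, v). (y, \<phi> y v))"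
  and lin: "fibre_linear E F \<phi>" unfolding bundle_iso_def fibre_linear_def by blast
 let ?f = "\<lambda>(y, v). (y, \<phi> y v)"
 obtain g where g: "homeomorphic_maps (btotal E) (btotal F) ?f g" using hom homeomorphic_map_maps by blast
 \<comment> \<open>The inverse homeomorphism preserves base points because \<open>?f\<close> does;
   hence it is determined by its second component, which becomes \<open>\<psi>\<close>.\<close>
 have gfst: "fst (g p) = fst p" if "p \<in> topspace (btotal F)" for p
 proof -
  have "?f (g p) = p" using g that by (auto simp: homeomorphic_maps_def)
  then show ?thesis by (metis (no_types, lifting) case_prod_unfold fst_conv)
 qed
 define \<psi> where "\<psi> = (\<lambda>y w. snd (g (y, w)))"
 have geq: "g p = (fst p, \<psi> (fst p) (snd p))" if "p \<in> topspace (btotal F)" for p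
  using gfst[OF that] by (auto simp: \<psi>_def prod_eq_iff)
 have c1: "cmap (btotal E) (btotal F) (\<lambda>p. (fst p, \<phi> (fst p) (snd p)))"
  using g by (simp add: homeomorphic_maps_def case_prod_unfold)
 have c2: "cmap (btotal F) (btotal E) (\<lambda>p. (fst p, \<psi> (fst p) (snd p)))"
  using g geq by (auto simp: homeomorphic_maps_def intro: continuous_map_eq)
 have "\<phi> y v \<in> fibre F y \<and> \<psi> y (\<phi> y v) = v" if "y \<in> topspace (bbase E)" "v \<in> fibre E y" for y v
 proof -
  have in1: "(y, v) \<in> topspace (btotal E)" using that prebundleD(1)[OF E] by auto
  then have in2: "(y, \<phi> y v) \<in> topspace (btotal F)" using continuous_map_mem[OF c1 in1] by simp
  have "g (y, \<phi> y v) = (y, v)" using g in1 by (auto simp: homeomorphic_maps_def)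
  then show ?thesis using in2 prebundleD(1)[OF F] by (auto simp: \<psi>_def)
 qed
 moreover have "\<psi> y w \<in> fibre E y \<and> \<phi> y (\<psi> y w) = w"
  if "y \<in> topspace (bbase E)" "w \<in> fibre F y" for y w
 proof -
  have in1: "(y, w) \<in> topspace (btotal F)" using that prebundleD(1)[OF F] base by auto
  then have in2: "(y, \<psi> y w) \<in> topspace (btotal E)" using continuous_map_mem[OF c2 in1] by simp
  have "?f (g (y, w)) = (y, w)" using g in1 by (auto simp: homeomorphic_maps_def)
  then show ?thesis using in2 prebundleD(1)[OF E] geq[OF in1] by auto
 qed
 ultimately show "\<exists>\<phi> \<psi>. bundle_iso_by E F \<phi> \<psi>" unfolding bundle_iso_by_def using base c1 c2 lin by blast
next
 assume "\<exists>\<phi> \<psi>. bundle_iso_by E F \<phi> \<psi>"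
 then obtain \<phi> \<psi> where iso: "bundle_iso_by E F \<phi> \<psi>" by blast
 note D = bundle_iso_byD[OF iso]
 have "homeomorphic_maps (btotal E) (btotal F) (\<lambda>(y, v). (y, \<phi> y v)) (\<lambda>(y, v). (y, \<psi> y v))"
  unfolding homeomorphic_maps_def using D prebundleD(1)[OF E] prebundleD(1)[OF F] by (auto simp: case_prod_unfold)
 then have "homeomorphic_map (btotal E) (btotal F) (\<lambda>(y, v). (y, \<phi> y v))" using homeomorphic_maps_imp_map by blast
 with D(1,8) show "bundle_iso E F" unfolding bundle_iso_def fibre_linear_def by blast
qed

text \<open>Linearity of the inverse uses that the fibres of \<open>E\<close> are closed: the sum in
  \<open>E\<close> of two preimages has to lie in the fibre before \<open>\<psi>\<close> after
  \<open>\<phi>\<close> cancels on it.\<close>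

lemma bundle_iso_by_sym:
 assumes E: "prebundle E" and iso: "bundle_iso_by E F \<phi> \<psi>"
 shows "bundle_iso_by F E \<psi> \<phi>"
proof -
 note D = bundle_iso_byD[OF iso]
 have "fibre_linear F E \<psi>" unfolding fibre_linear_def
 proof (intro ballI conjI allI)
  fix y v w z assume y: "y \<in> topspace (bbase F)" and v: "v \<in> fibre F y"
  have y': "y \<in> topspace (bbase E)" using y D(1) by simp
  note inE = D(6)[OF y'] and inv = D(7)[OF y']
  show "\<psi> y (bscale F y z v) = bscale E y z (\<psi> y v)" using fibre_linearD(2)[OF D(8) y' inE[OF v], of z] inv[OF v]
    D(5)[OF y' prebundleD(4)[OF E y' inE[OF v]], of z] by simp
  assume w: "w \<in> fibre F y"
  show "\<psi> y (badd F y v w) = badd E y (\<psi> y v) (\<psi> y w)"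
   using fibre_linearD(1)[OF D(8) y' inE[OF v] inE[OF w]] inv[OF v] inv[OF w]
    D(5)[OF y' prebundleD(3)[OF E y' inE[OF v] inE[OF w]]] by simp
 qed
 then show ?thesis using D by (auto simp: bundle_iso_by_def)
qed

lemma bundle_iso_by_trans:
 assumes "bundle_iso_by E F \<phi> \<psi>" "bundle_iso_by F H \<phi>' \<psi>'"
 shows "bundle_iso_by E H (\<lambda>y v. \<phi>' y (\<phi> y v)) (\<lambda>y w. \<psi> y (\<psi>' y w))"
proof -
 note D = bundle_iso_byD[OF assms(1)] and D' = bundle_iso_byD[OF assms(2)]
 have 1: "cmap (btotal E) (btotal H) (\<lambda>p. (fst p, \<phi>' (fst p) (\<phi> (fst p) (snd p))))"
  using continuous_map_compose[OF D(2) D'(2)] by (simp add: o_def)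
 have 2: "cmap (btotal H) (btotal E) (\<lambda>p. (fst p, \<psi> (fst p) (\<psi>' (fst p) (snd p))))"
  using continuous_map_compose[OF D'(3) D(3)] by (simp add: o_def)
 have 3: "fibre_linear E H (\<lambda>y v. \<phi>' y (\<phi> y v))" using D(1,4,8) D'(8) by (auto simp: fibre_linear_def)
 show ?thesis unfolding bundle_iso_by_def using 1 2 3 D D' by auto
qed

text \<open>With the structural axioms built in, symmetry and transitivity hold without side
  conditions.\<close>

definition bundle_equiv :: "('b, 'v) cbundle \<Rightarrow> ('b, 'w) cbundle \<Rightarrow> bool" where
 "bundle_equiv E F \<longleftrightarrow> prebundle E \<and> prebundle F \<and> bundle_iso E F"

lemma bundle_equivI: "\<lbrakk>prebundle E; prebundle F; bundle_iso_by E F \<phi> \<psi>\<rbrakk> \<Longrightarrow> bundle_equiv E F"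
 unfolding bundle_equiv_def using bundle_iso_iff by blast

lemma bundle_equivE:
 assumes "bundle_equiv E F"
 obtains \<phi> \<psi> where "bundle_iso_by E F \<phi> \<psi>" "prebundle E" "prebundle F" "bbase F = bbase E"
 using assms unfolding bundle_equiv_def bundle_iso_iff[of E F] by (metis bundle_iso_byD(1) bundle_iso_iff)

lemma bundle_equivD: "bundle_equiv E F \<Longrightarrow> prebundle E" "bundle_equiv E F \<Longrightarrow> prebundle F"
 "bundle_equiv E F \<Longrightarrow> bbase F = bbase E" by (auto simp: bundle_equiv_def bundle_iso_def)

lemma bundle_equiv_sym: "bundle_equiv E F \<Longrightarrow> bundle_equiv F E"
 by (erule bundle_equivE) (rule bundle_equivI[OF _ _ bundle_iso_by_sym])

lemma bundle_equiv_trans [trans]: "\<lbrakk>bundle_equiv E F; bundle_equiv F H\<rbrakk> \<Longrightarrow> bundle_equiv E H"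
 by (elim bundle_equivE) (rule bundle_equivI[OF _ _ bundle_iso_by_trans])

text \<open>Topologies are compared through the maps into them: applied to the identity, the last
  two hypotheses give continuity in both directions. The universal properties of the total spaces
  thus suffice, and open sets do not appear.\<close>

lemma bundle_equiv_id:
 assumes "prebundle E" "prebundle F" "bbase E = bbase F"
  and "\<And>y. y \<in> topspace (bbase E) \<Longrightarrow> fibre E y = fibre F y \<and> badd E y = badd F y \<and> bscale E y = bscale F y"
  and "\<And>g. cmap (btotal E) (btotal E) g \<Longrightarrow> cmap (btotal E) (btotal F) g"
  and "\<And>g. cmap (btotal F) (btotal F) g \<Longrightarrow> cmap (btotal F) (btotal E) g"
 shows "bundle_equiv E F"
 by (rule bundle_equivI[of _ _ "\<lambda>_ v. v" "\<lambda>_ v. v"]) (use assms in \<open>simp_all add: bundle_iso_by_def fibre_linear_def\<close>)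

section \<open>Constructions of bundles\<close>

lemma continuous_map_fst_subtopology:
 "cmap (prod_topology (subtopology X U) Y) X fst" by (rule continuous_map_into_fulltopology[OF continuous_map_fst])

lemma pull_bundle_simps [simp]:
 "bbase (pull_bundle Z f E) = Z"
 "fibre (pull_bundle Z f E) z = fibre E (f z)"
 "badd (pull_bundle Z f E) z = badd E (f z)"
 "bscale (pull_bundle Z f E) z = bscale E (f z)" by (auto simp: pull_bundle_def)

lemma direct_sum_simps [simp]:
 "bbase (direct_sum E F) = bbase E"
 "fibre (direct_sum E F) y = fibre E y \<times> fibre F y"
 "badd (direct_sum E F) y (v, w) (v', w') = (badd E y v v', badd F y w w')"
 "bscale (direct_sum E F) y z (v, w) = (bscale E y z v, bscale F y z w)" by (auto simp: direct_sum_def)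

lemma trivial_bundle_simps [simp]:
 "bbase (trivial_bundle Y n) = Y"
 "fibre (trivial_bundle Y n) y = {..<n} \<rightarrow>\<^sub>E UNIV"
 "badd (trivial_bundle Y n) y v w = (\<lambda>i\<in>{..<n}. v i + w i)"
 "bscale (trivial_bundle Y n) y z v = (\<lambda>i\<in>{..<n}. z * v i)"
 "btotal (trivial_bundle Y n) = prod_topology Y (product_topology (\<lambda>_. euclidean) {..<n})"
 by (auto simp: trivial_bundle_def)

text \<open>Indexing the fibre by \<open>J\<close> lets an isomorphism onto a finite sum be a family
  of maps. The factor \<open>Y\<close> in the topology keeps the topology of the base when
  \<open>J\<close> is empty, where the result is the zero bundle.\<close>

definition big_sum :: "'b topology \<Rightarrow> 'j set \<Rightarrow> ('j \<Rightarrow> ('b, 'v) cbundle) \<Rightarrow> ('b, 'j \<Rightarrow> 'v) cbundle" where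
 "big_sum Y J E =
   \<lparr> bbase = Y,
    fibre = (\<lambda>y. \<Pi>\<^sub>E j\<in>J. fibre (E j) y),
    badd = (\<lambda>y v w. \<lambda>j\<in>J. badd (E j) y (v j) (w j)),
    bscale = (\<lambda>y z v. \<lambda>j\<in>J. bscale (E j) y z (v j)),
    btotal = pullback_topology (Sigma (topspace Y) (\<lambda>y. \<Pi>\<^sub>E j\<in>J. fibre (E j) y))
         (\<lambda>p. (fst p, \<lambda>j\<in>J. (fst p, snd p j)))
         (prod_topology Y (product_topology (\<lambda>j. btotal (E j)) J)) \<rparr>"

lemma big_sum_simps [simp]:
 "bbase (big_sum Y J E) = Y"
 "fibre (big_sum Y J E) y = (\<Pi>\<^sub>E j\<in>J. fibre (E j) y)"
 "badd (big_sum Y J E) y v w = (\<lambda>j\<in>J. badd (E j) y (v j) (w j))"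
 "bscale (big_sum Y J E) y z v = (\<lambda>j\<in>J. bscale (E j) y z (v j))" by (auto simp: big_sum_def)

lemma topspace_pull_bundle:
 assumes "prebundle E" "cmap Z (bbase E) f"
 shows "topspace (btotal (pull_bundle Z f E)) = Sigma (topspace Z) (\<lambda>z. fibre E (f z))"
 using assms continuous_map_funspace[OF assms(2)] by (auto simp: pull_bundle_def topspace_pullback_topology prebundle_def)

text \<open>The universal property through which the total spaces of pull-backs and sums are
  handled.\<close>

lemma continuous_map_pullback_iff:
 "cmap T (pullback_topology A f T') g \<longleftrightarrow>
   cmap T T' (\<lambda>t. f (g t)) \<and> g \<in> topspace T \<rightarrow> A"
proof
 assume L: "cmap T (pullback_topology A f T') g"
 have "cmap (pullback_topology A f T') T' (id \<circ> f)" by (rule continuous_map_pullback) auto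
 from continuous_map_compose[OF L this]
 show "cmap T T' (\<lambda>t. f (g t)) \<and> g \<in> topspace T \<rightarrow> A"
  using continuous_map_funspace[OF L] by (auto simp: o_def topspace_pullback_topology)
next
 assume "cmap T T' (\<lambda>t. f (g t)) \<and> g \<in> topspace T \<rightarrow> A"
 then show "cmap T (pullback_topology A f T') g" by (intro continuous_map_pullback') (auto simp: o_def)
qed

lemma continuous_map_into_pull:
 assumes "prebundle E" "cmap Z (bbase E) f"
 shows "cmap T (btotal (pull_bundle Z f E)) g \<longleftrightarrow>
   cmap T Z (\<lambda>t. fst (g t)) \<and>
   cmap T (btotal E) (\<lambda>t. (f (fst (g t)), snd (g t)))"
  (is "?L \<longleftrightarrow> ?R1 \<and> ?R2")
proof
 assume ?L
 then show "?R1 \<and> ?R2" by (auto simp: pull_bundle_def continuous_map_pullback_iff continuous_map_pairwise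
    case_prod_unfold o_def)
next
 assume R: "?R1 \<and> ?R2"
 \<comment> \<open>Membership in the fibres comes with continuity: the second map takes values in
   the total space of \<open>E\<close>.\<close>
 have "g t \<in> Sigma (topspace Z) (\<lambda>z. fibre E (f z))" if "t \<in> topspace T" for t
 proof -
  have "fst (g t) \<in> topspace Z" "(f (fst (g t)), snd (g t)) \<in> topspace (btotal E)"
   using continuous_map_mem[OF conjunct1[OF R] that] continuous_map_mem[OF conjunct2[OF R] that] by simp_all
  then show ?thesis using prebundleD(1)[OF assms(1)] by (cases "g t") simp
 qed
 with R show ?L by (auto simp: pull_bundle_def continuous_map_pullback_iff continuous_map_pairwise
    case_prod_unfold o_def)
qed

lemma continuous_map_from_pull:
 assumes "prebundle E" "cmap Z (bbase E) f"
 shows "cmap (btotal (pull_bundle Z f E)) Z fst"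
  and "cmap (btotal (pull_bundle Z f E)) (btotal E) (\<lambda>p. (f (fst p), snd p))"
 using continuous_map_into_pull[OF assms, of "btotal (pull_bundle Z f E)" "\<lambda>p. p"] by auto

lemma prebundle_pull:
 assumes "prebundle E" "cmap Z (bbase E) f"
 shows "prebundle (pull_bundle Z f E)" unfolding prebundle_def
 using assms topspace_pull_bundle[OF assms] continuous_map_from_pull[OF assms] continuous_map_funspace[OF assms(2)]
 by (auto simp: prebundle_def Pi_iff)

lemma topspace_direct_sum:
 assumes "prebundle E" "prebundle F" "bbase E = bbase F"
 shows "topspace (btotal (direct_sum E F)) = Sigma (topspace (bbase E)) (\<lambda>y. fibre E y \<times> fibre F y)"
 using assms by (auto simp: direct_sum_def topspace_pullback_topology prebundle_def)

lemma continuous_map_into_direct_sum: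
 assumes "prebundle E" "prebundle F" "bbase E = bbase F"
 shows "cmap T (btotal (direct_sum E F)) g \<longleftrightarrow>
   cmap T (btotal E) (\<lambda>t. (fst (g t), fst (snd (g t)))) \<and>
   cmap T (btotal F) (\<lambda>t. (fst (g t), snd (snd (g t))))"
  (is "?L \<longleftrightarrow> ?R1 \<and> ?R2")
proof
 assume ?L
 then show "?R1 \<and> ?R2" by (auto simp: direct_sum_def continuous_map_pullback_iff continuous_map_pairwise
    case_prod_unfold o_def)
next
 assume R: "?R1 \<and> ?R2"
 have "g t \<in> Sigma (topspace (bbase E)) (\<lambda>y. fibre E y \<times> fibre F y)" if "t \<in> topspace T" for t
 proof -
  obtain y v w where g: "g t = (y, v, w)" by (metis prod.exhaust)
  have "(fst (g t), fst (snd (g t))) \<in> topspace (btotal E)" "(fst (g t), snd (snd (g t))) \<in> topspace (btotal F)"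
   using continuous_map_mem[OF conjunct1[OF R] that] continuous_map_mem[OF conjunct2[OF R] that] by simp_all
  then show ?thesis using prebundleD(1)[OF assms(1)] prebundleD(1)[OF assms(2)] g by simp
 qed
 with R show ?L by (auto simp: direct_sum_def continuous_map_pullback_iff continuous_map_pairwise
    case_prod_unfold o_def)
qed

lemma continuous_map_from_direct_sum:
 assumes "prebundle E" "prebundle F" "bbase E = bbase F"
 shows "cmap (btotal (direct_sum E F)) (btotal E) (\<lambda>p. (fst p, fst (snd p)))"
  and "cmap (btotal (direct_sum E F)) (btotal F) (\<lambda>p. (fst p, snd (snd p)))"
 using continuous_map_into_direct_sum[OF assms, of "btotal (direct_sum E F)" "\<lambda>p. p"] by auto

lemma prebundle_direct_sum:
 assumes "prebundle E" "prebundle F" "bbase E = bbase F"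
 shows "prebundle (direct_sum E F)"
proof -
 have "cmap (btotal (direct_sum E F)) (bbase E) fst"
  using continuous_map_compose[OF continuous_map_from_direct_sum(1)[OF assms] prebundleD(2)[OF assms(1)]] by (simp add: o_def)
 then show ?thesis unfolding prebundle_def using assms topspace_direct_sum[OF assms] by (auto simp: prebundle_def)
qed

lemma topspace_big_sum:
 assumes "\<forall>j\<in>J. prebundle (E j) \<and> bbase (E j) = Y"
 shows "topspace (btotal (big_sum Y J E)) = Sigma (topspace Y) (\<lambda>y. \<Pi>\<^sub>E j\<in>J. fibre (E j) y)"
 using assms by (auto simp: big_sum_def topspace_pullback_topology prebundle_def PiE_def Pi_iff)

lemma continuous_map_into_big_sum:
 assumes "\<forall>j\<in>J. prebundle (E j) \<and> bbase (E j) = Y"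
 shows "cmap T (btotal (big_sum Y J E)) g \<longleftrightarrow>
   cmap T Y (\<lambda>t. fst (g t)) \<and>
   (\<forall>t\<in>topspace T. snd (g t) \<in> extensional J) \<and>
   (\<forall>j\<in>J. cmap T (btotal (E j)) (\<lambda>t. (fst (g t), snd (g t) j)))"
  (is "?L \<longleftrightarrow> ?R1 \<and> ?R2 \<and> ?R3")
proof
 assume ?L
 then have "cmap T Y (\<lambda>t. fst (g t))"
   "cmap T (product_topology (\<lambda>j. btotal (E j)) J) (\<lambda>t. \<lambda>j\<in>J. (fst (g t), snd (g t) j))"
   and ext: "g \<in> topspace T \<rightarrow> Sigma (topspace Y) (\<lambda>y. \<Pi>\<^sub>E j\<in>J. fibre (E j) y)"
  by (auto simp: big_sum_def continuous_map_pullback_iff continuous_map_pairwise o_def)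
 moreover have "snd (g t) \<in> extensional J" if "t \<in> topspace T" for t
 proof -
  have "g t \<in> Sigma (topspace Y) (\<lambda>y. \<Pi>\<^sub>E j\<in>J. fibre (E j) y)" using ext that by blast
  then show ?thesis by (auto simp: PiE_def)
 qed
 ultimately show "?R1 \<and> ?R2 \<and> ?R3" by (simp add: continuous_map_componentwise)
next
 assume R: "?R1 \<and> ?R2 \<and> ?R3"
 have "g t \<in> Sigma (topspace Y) (\<lambda>y. \<Pi>\<^sub>E j\<in>J. fibre (E j) y)" if t: "t \<in> topspace T" for t
 proof -
  obtain a b where g: "g t = (a, b)" by fastforce
  have "a \<in> topspace Y" using continuous_map_mem[OF conjunct1[OF R] t] g by simp
  moreover have "b \<in> extensional J" using R t g by force
  moreover have "(a, b j) \<in> topspace (btotal (E j))" if "j \<in> J" for j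
  proof -
   have "cmap T (btotal (E j)) (\<lambda>t. (fst (g t), snd (g t) j))" using R that by blast
   from continuous_map_mem[OF this t] show ?thesis using g by simp
  qed
  then have "b j \<in> fibre (E j) a" if "j \<in> J" for j using prebundleD(1)[of "E j"] assms that by auto
  ultimately show ?thesis using g by (auto simp: PiE_def)
 qed
 then have "g \<in> topspace T \<rightarrow> Sigma (topspace Y) (\<lambda>y. \<Pi>\<^sub>E j\<in>J. fibre (E j) y)" by blast
 moreover have "cmap T (product_topology (\<lambda>j. btotal (E j)) J) (\<lambda>t. \<lambda>j\<in>J. (fst (g t), snd (g t) j))"
  using R by (auto simp: continuous_map_componentwise)
 ultimately show ?L using R by (simp add: big_sum_def continuous_map_pullback_iff continuous_map_pairwise o_def)
qed

lemma continuous_map_from_big_sum: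
 assumes "\<forall>j\<in>J. prebundle (E j) \<and> bbase (E j) = Y"
 shows "cmap (btotal (big_sum Y J E)) Y fst"
  and "j \<in> J \<Longrightarrow> cmap (btotal (big_sum Y J E)) (btotal (E j)) (\<lambda>p. (fst p, snd p j))"
 using continuous_map_into_big_sum[OF assms, of "btotal (big_sum Y J E)" "\<lambda>p. p"] by auto

lemma prebundle_big_sum:
 assumes "\<forall>j\<in>J. prebundle (E j) \<and> bbase (E j) = Y"
 shows "prebundle (big_sum Y J E)" unfolding prebundle_def
proof (intro conjI ballI allI)
 show "topspace (btotal (big_sum Y J E)) = Sigma (topspace (bbase (big_sum Y J E))) (fibre (big_sum Y J E))"
  by (auto simp: topspace_big_sum[OF assms])
 show "cmap (btotal (big_sum Y J E)) (bbase (big_sum Y J E)) fst" by (simp add: continuous_map_from_big_sum(1)[OF assms])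
 fix y v z assume "y \<in> topspace (bbase (big_sum Y J E))" and v: "v \<in> fibre (big_sum Y J E) y"
 then have y: "j \<in> J \<Longrightarrow> y \<in> topspace (bbase (E j))" for j using assms by simp
 show "bscale (big_sum Y J E) y z v \<in> fibre (big_sum Y J E) y"
  using v assms y by (auto simp: PiE_def Pi_iff intro!: prebundleD(4))
 fix w assume "w \<in> fibre (big_sum Y J E) y"
 then show "badd (big_sum Y J E) y v w \<in> fibre (big_sum Y J E) y"
  using v assms y by (auto simp: PiE_def Pi_iff intro!: prebundleD(3))
qed

lemma prebundle_trivial: "prebundle (trivial_bundle Y n)"
 unfolding prebundle_def trivial_bundle_simps by (simp add: continuous_map_fst)

section \<open>Pull-backs and sums of bundles\<close>

lemma bundle_equiv_pull:
 assumes EF: "bundle_equiv E F" and f: "cmap Z (bbase E) f"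
 shows "bundle_equiv (pull_bundle Z f E) (pull_bundle Z f F)"
proof -
 obtain \<phi> \<psi> where iso: "bundle_iso_by E F \<phi> \<psi>" and E: "prebundle E" and F: "prebundle F" and b: "bbase F = bbase E"
  using EF by (rule bundle_equivE)
 note I = bundle_iso_byD[OF iso]
 have f': "cmap Z (bbase F) f" using f b by simp
 note fz = continuous_map_mem[OF f]
 show ?thesis
 proof (rule bundle_equivI[OF prebundle_pull[OF E f] prebundle_pull[OF F f']], unfold bundle_iso_by_def, intro conjI ballI)
  show "cmap (btotal (pull_bundle Z f E)) (btotal (pull_bundle Z f F)) (\<lambda>p. (fst p, \<phi> (f (fst p)) (snd p)))"
   using continuous_map_from_pull(1)[OF E f] continuous_map_compose[OF continuous_map_from_pull(2)[OF E f] I(2)]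
   by (simp add: continuous_map_into_pull[OF F f'] o_def)
  show "cmap (btotal (pull_bundle Z f F)) (btotal (pull_bundle Z f E)) (\<lambda>p. (fst p, \<psi> (f (fst p)) (snd p)))"
   using continuous_map_from_pull(1)[OF F f'] continuous_map_compose[OF continuous_map_from_pull(2)[OF F f'] I(3)]
   by (simp add: continuous_map_into_pull[OF E f] o_def)
  show "fibre_linear (pull_bundle Z f E) (pull_bundle Z f F) (\<lambda>z. \<phi> (f z))"
   using I(8) fz by (simp add: fibre_linear_def)
 qed (use I(4-7) fz in simp_all)
qed

lemma bundle_equiv_pull_pull:
 assumes E: "prebundle E" and f: "cmap Y (bbase E) f" and g: "cmap Z Y g"
 shows "bundle_equiv (pull_bundle Z g (pull_bundle Y f E)) (pull_bundle Z (\<lambda>z. f (g z)) E)"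
proof -
 have fg: "cmap Z (bbase E) (\<lambda>z. f (g z))" using continuous_map_compose[OF g f] by (simp add: o_def)
 have g': "cmap Z (bbase (pull_bundle Y f E)) g" using g by simp
 show ?thesis by (intro bundle_equiv_id prebundle_pull E f g' fg)
   (auto simp: continuous_map_into_pull[OF prebundle_pull[OF E f] g'] continuous_map_into_pull[OF E f] continuous_map_into_pull[OF E fg]
    intro: continuous_map_compose[OF _ g, unfolded o_def])
qed

lemma bundle_equiv_pull_cong:
 fixes E :: "('b, 'v) cbundle" and f :: "'c \<Rightarrow> 'b"
 assumes E: "prebundle E" and f: "cmap Z (bbase E) f" and eq: "\<And>z. z \<in> topspace Z \<Longrightarrow> f z = f' z"
 shows "bundle_equiv (pull_bundle Z f E) (pull_bundle Z f' E)"
proof -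
 have f': "cmap Z (bbase E) f'" using f eq by (rule continuous_map_eq)
 have *: "cmap T (btotal E) (\<lambda>t. (f (fst (g t)), snd (g t))) \<longleftrightarrow> cmap T (btotal E) (\<lambda>t. (f' (fst (g t)), snd (g t)))"
  if "cmap T Z (\<lambda>t. fst (g t))" for T :: "('c \<times> 'v) topology" and g
  using continuous_map_mem[OF that] eq by (auto elim!: continuous_map_eq)
 show ?thesis by (intro bundle_equiv_id prebundle_pull E f f')
   (auto simp: continuous_map_into_pull[OF E f] continuous_map_into_pull[OF E f'] * eq)
qed

lemma bundle_equiv_pull_direct_sum:
 assumes E: "prebundle E" and F: "prebundle F" and base: "bbase E = bbase F" and f: "cmap Z (bbase E) f"
 shows "bundle_equiv (pull_bundle Z f (direct_sum E F)) (direct_sum (pull_bundle Z f E) (pull_bundle Z f F))"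
proof -
 have f': "cmap Z (bbase F) f" using f base by simp
 note S = prebundle_direct_sum[OF E F base]
 have fS: "cmap Z (bbase (direct_sum E F)) f" using f by simp
 note P = prebundle_pull[OF E f] prebundle_pull[OF F f']
 have b: "bbase (pull_bundle Z f E) = bbase (pull_bundle Z f F)" by simp
 show ?thesis by (intro bundle_equiv_id prebundle_pull[OF S fS] prebundle_direct_sum[OF P b])
   (auto simp: continuous_map_into_pull[OF S fS] continuous_map_into_direct_sum[OF P b] continuous_map_into_direct_sum[OF E F base]
    continuous_map_into_pull[OF E f] continuous_map_into_pull[OF F f'] fun_eq_iff)
qed

lemma bundle_equiv_pull_trivial:
 assumes f: "cmap Z Y f"
 shows "bundle_equiv (pull_bundle Z f (trivial_bundle Y n)) (trivial_bundle Z n)"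
proof -
 have f': "cmap Z (bbase (trivial_bundle Y n)) f" using f by simp
 show ?thesis by (intro bundle_equiv_id prebundle_pull f' prebundle_trivial)
   (auto simp: continuous_map_into_pull[OF prebundle_trivial f'] continuous_map_pairwise o_def fun_eq_iff
    intro: continuous_map_compose[OF _ f, unfolded o_def])
qed

lemma bundle_equiv_direct_sum:
 assumes "bundle_equiv E E'" "bundle_equiv F F'" and base: "bbase E = bbase F"
 shows "bundle_equiv (direct_sum E F) (direct_sum E' F')"
proof -
 obtain \<phi> \<psi> where 1: "bundle_iso_by E E' \<phi> \<psi>" "prebundle E" "prebundle E'" "bbase E' = bbase E"
  using assms(1) by (rule bundle_equivE)
 obtain \<phi>' \<psi>' where 2: "bundle_iso_by F F' \<phi>' \<psi>'" "prebundle F" "prebundle F'" "bbase F' = bbase F"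
  using assms(2) by (rule bundle_equivE)
 have base': "bbase E' = bbase F'" using base 1 2 by simp
 note I1 = bundle_iso_byD[OF 1(1)] and I2 = bundle_iso_byD[OF 2(1)]
 note cS = continuous_map_from_direct_sum[OF 1(2) 2(2) base] and cS' = continuous_map_from_direct_sum[OF 1(3) 2(3) base']
 have "bundle_iso_by (direct_sum E F) (direct_sum E' F')
   (\<lambda>y p. (\<phi> y (fst p), \<phi>' y (snd p))) (\<lambda>y p. (\<psi> y (fst p), \<psi>' y (snd p)))"
  unfolding bundle_iso_by_def
 proof (intro conjI ballI)
  show "cmap (btotal (direct_sum E F)) (btotal (direct_sum E' F'))
    (\<lambda>p. (fst p, \<phi> (fst p) (fst (snd p)), \<phi>' (fst p) (snd (snd p))))"
   using continuous_map_compose[OF cS(1) I1(2)] continuous_map_compose[OF cS(2) I2(2)]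
   by (simp add: continuous_map_into_direct_sum[OF 1(3) 2(3) base'] o_def)
  show "cmap (btotal (direct_sum E' F')) (btotal (direct_sum E F))
    (\<lambda>p. (fst p, \<psi> (fst p) (fst (snd p)), \<psi>' (fst p) (snd (snd p))))"
   using continuous_map_compose[OF cS'(1) I1(3)] continuous_map_compose[OF cS'(2) I2(3)]
   by (simp add: continuous_map_into_direct_sum[OF 1(2) 2(2) base] o_def)
  show "fibre_linear (direct_sum E F) (direct_sum E' F') (\<lambda>y p. (\<phi> y (fst p), \<phi>' y (snd p)))"
   using I1(8) I2(8) base by (auto simp: fibre_linear_def)
 qed (use I1(4-7) I2(4-7) 1(4) 2(4) base in auto)
 then show ?thesis by (rule bundle_equivI[OF prebundle_direct_sum[OF 1(2) 2(2) base] prebundle_direct_sum[OF 1(3) 2(3) base']])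
qed

lemma bundle_equiv_trivial_sum:
 "bundle_equiv (direct_sum (trivial_bundle Y n) (trivial_bundle Y m)) (trivial_bundle Y (n + m))"
proof -
 let ?S = "direct_sum (trivial_bundle Y n) (trivial_bundle Y m)" and ?T = "trivial_bundle Y (n + m)"
 let ?\<phi> = "\<lambda>p. \<lambda>i\<in>{..<n+m}. if i < n then fst p i else snd p (i - n)"
  and ?\<psi> = "\<lambda>u. (\<lambda>i\<in>{..<n}. u i, \<lambda>i\<in>{..<m}. u (n + i))"
 have b: "bbase (trivial_bundle Y n) = bbase (trivial_bundle Y m)" by simp
 note pS = prebundle_direct_sum[OF prebundle_trivial prebundle_trivial b]
 note cS = continuous_map_from_direct_sum[OF prebundle_trivial prebundle_trivial b]
 have c1: "cmap (btotal ?S) euclidean (\<lambda>p. fst (snd p) i)" if "i < n" for i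
  using cS(1) that by (simp add: continuous_map_pairwise o_def continuous_map_componentwise)
 have c2: "cmap (btotal ?S) euclidean (\<lambda>p. snd (snd p) i)" if "i < m" for i
  using cS(2) that by (simp add: continuous_map_pairwise o_def continuous_map_componentwise)
 have c3: "cmap (btotal ?T) euclidean (\<lambda>p. snd p i)" if "i < n + m" for i
  using continuous_map_compose[OF continuous_map_snd continuous_map_product_projection[of i "{..<n+m}"]] that by (simp add: o_def)
 have "cmap (btotal ?S) euclidean (\<lambda>p. ?\<phi> (snd p) i)" if "i \<in> {..<n+m}" for i
  using c1[of i] c2[of "i - n"] that by (cases "i < n") auto
 then have "cmap (btotal ?S) (btotal ?T) (\<lambda>p. (fst p, ?\<phi> (snd p)))"
  using prebundleD(2)[OF pS] by (auto simp: continuous_map_pairwise o_def continuous_map_componentwise)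
 moreover have "cmap (btotal ?T) (btotal ?S) (\<lambda>p. (fst p, ?\<psi> (snd p)))"
  using c3 by (auto simp: continuous_map_into_direct_sum[OF prebundle_trivial prebundle_trivial b] continuous_map_pairwise
    o_def continuous_map_componentwise continuous_map_fst)
 ultimately have "bundle_iso_by ?S ?T (\<lambda>_. ?\<phi>) (\<lambda>_. ?\<psi>)" unfolding bundle_iso_by_def fibre_linear_def
  by (auto simp: fun_eq_iff PiE_def extensional_def)
 then show ?thesis by (rule bundle_equivI[OF pS prebundle_trivial])
qed

text \<open>The induction step that reduces finite sums to binary ones, for which the relations of
  K-theory are formulated.\<close>

lemma big_sum_insert_iso:
 assumes fam: "\<forall>i\<in>insert j J. prebundle (E i) \<and> bbase (E i) = Y" and j: "j \<notin> J"
 shows "bundle_iso_by (big_sum Y (insert j J) E) (direct_sum (E j) (big_sum Y J E))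
   (\<lambda>y v. (v j, restrict v J)) (\<lambda>y p. (snd p)(j := fst p))"
proof -
 have fJ: "\<forall>i\<in>J. prebundle (E i) \<and> bbase (E i) = Y" using fam by blast
 have pj: "prebundle (E j)" "bbase (E j) = Y" using fam by blast+
 note pJ = prebundle_big_sum[OF fJ]
 let ?B = "big_sum Y (insert j J) E" and ?S = "direct_sum (E j) (big_sum Y J E)"
 have base: "bbase (E j) = bbase (big_sum Y J E)" using pj by simp
 note cS = continuous_map_from_direct_sum[OF pj(1) pJ base]
 have c1: "cmap (btotal ?B) (btotal ?S) (\<lambda>p. (fst p, snd p j, restrict (snd p) J))"
  using continuous_map_from_big_sum[OF fam]
  by (auto simp: continuous_map_into_direct_sum[OF pj(1) pJ base] continuous_map_into_big_sum[OF fJ])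
 have "cmap (btotal ?S) (btotal (E i)) (\<lambda>p. (fst p, (snd (snd p)) i))" if "i \<in> J" for i
  using continuous_map_compose[OF cS(2) continuous_map_from_big_sum(2)[OF fJ that]] by (simp add: o_def)
 then have "cmap (btotal ?S) (btotal (E i)) (\<lambda>p. (fst p, ((snd (snd p))(j := fst (snd p))) i))"
  if "i \<in> insert j J" for i using that cS(1) j by (cases "i = j") auto
 moreover have "cmap (btotal ?S) Y fst" using prebundleD(2)[OF prebundle_direct_sum[OF pj(1) pJ base]] pj by simp
 moreover have "(snd (snd p))(j := fst (snd p)) \<in> extensional (insert j J)" if "p \<in> topspace (btotal ?S)" for p
  using that by (auto simp: topspace_direct_sum[OF pj(1) pJ base] PiE_def extensional_def)
 ultimately have c2: "cmap (btotal ?S) (btotal ?B) (\<lambda>p. (fst p, (snd (snd p))(j := fst (snd p))))"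
  by (simp add: continuous_map_into_big_sum[OF fam])
 show ?thesis unfolding bundle_iso_by_def
 proof (intro conjI ballI)
  show "cmap (btotal ?B) (btotal ?S) (\<lambda>p. (fst p, snd p j, restrict (snd p) J))" by (rule c1)
  show "cmap (btotal ?S) (btotal ?B) (\<lambda>p. (fst p, (snd (snd p))(j := fst (snd p))))" by (rule c2)
  show "fibre_linear ?B ?S (\<lambda>y v. (v j, restrict v J))"
   unfolding fibre_linear_def using j by (auto simp: fun_eq_iff restrict_def)
 next
  fix y v assume "v \<in> fibre ?B y"
  then show "(v j, restrict v J) \<in> fibre ?S y" "(snd (v j, restrict v J))(j := fst (v j, restrict v J)) = v"
   using j by (auto simp: PiE_def Pi_iff extensional_def fun_eq_iff restrict_def)
 next
  fix y w assume "w \<in> fibre ?S y"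
  then show "(snd w)(j := fst w) \<in> fibre ?B y" "(((snd w)(j := fst w)) j, restrict ((snd w)(j := fst w)) J) = w"
   using j by (auto simp: PiE_def Pi_iff extensional_def fun_eq_iff restrict_def prod_eq_iff)
 qed (use pj in simp)
qed

section \<open>Vector bundles\<close>

abbreviation cvec :: "nat \<Rightarrow> (nat \<Rightarrow> complex) set" where
 "cvec n \<equiv> {..<n} \<rightarrow>\<^sub>E UNIV"

abbreviation cvec_top :: "nat \<Rightarrow> (nat \<Rightarrow> complex) topology" where
 "cvec_top n \<equiv> product_topology (\<lambda>_. euclidean) {..<n}"

definition trivial_on :: "('b, 'v) cbundle \<Rightarrow> 'b set \<Rightarrow> nat \<Rightarrow> bool" where
 "trivial_on E U n \<longleftrightarrow> openin (bbase E) U \<and>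
   bundle_equiv (pull_bundle (subtopology (bbase E) U) id E) (trivial_bundle (subtopology (bbase E) U) n)"

lemma vector_bundle_iff:
 "vector_bundle E \<longleftrightarrow> prebundle E \<and> (\<forall>y\<in>topspace (bbase E). \<exists>U n. y \<in> U \<and> trivial_on E U n)"
proof (cases "prebundle E")
 case True
 have "prebundle (pull_bundle (subtopology (bbase E) U) id E)" for U by (rule prebundle_pull[OF True]) simp
 then have *: "(openin (bbase E) U \<and> y \<in> U \<and> bundle_iso (pull_bundle (subtopology (bbase E) U) id E)
   (trivial_bundle (subtopology (bbase E) U) n)) \<longleftrightarrow> y \<in> U \<and> trivial_on E U n" for U n y
  by (auto simp: trivial_on_def bundle_equiv_def prebundle_trivial)
 show ?thesis using True unfolding vector_bundle_def * by (auto simp: prebundle_def)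
qed (auto simp: vector_bundle_def prebundle_def)

lemma vector_bundle_prebundle: "vector_bundle E \<Longrightarrow> prebundle E" by (simp add: vector_bundle_iff)

text \<open>The form in which trivialisations are found: coordinates \<open>\<phi>\<close> on the
  part of the total space over \<open>U\<close>, and a frame \<open>\<psi>\<close> inverse to them;
  linearity has to be checked for \<open>\<phi>\<close> alone.\<close>

lemma trivial_onI:
 assumes E: "prebundle E" and U: "openin (bbase E) U"
  and c1: "cmap (subtopology (btotal E) (Sigma U (fibre E))) (cvec_top n) (\<lambda>p. \<phi> (fst p) (snd p))"
  and c2: "cmap (prod_topology (subtopology (bbase E) U) (cvec_top n)) (btotal E)
    (\<lambda>p. (fst p, \<psi> (fst p) (snd p)))"
  and "\<And>y v. \<lbrakk>y \<in> U; v \<in> fibre E y\<rbrakk> \<Longrightarrow> \<phi> y v \<in> cvec n"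
  and "\<And>y v. \<lbrakk>y \<in> U; v \<in> fibre E y\<rbrakk> \<Longrightarrow> \<psi> y (\<phi> y v) = v"
  and "\<And>y v w. \<lbrakk>y \<in> U; v \<in> fibre E y; w \<in> fibre E y\<rbrakk> \<Longrightarrow>
      \<phi> y (badd E y v w) = (\<lambda>i\<in>{..<n}. \<phi> y v i + \<phi> y w i)"
  and "\<And>y v z. \<lbrakk>y \<in> U; v \<in> fibre E y\<rbrakk> \<Longrightarrow> \<phi> y (bscale E y z v) = (\<lambda>i\<in>{..<n}. z * \<phi> y v i)"
  and "\<And>y u. \<lbrakk>y \<in> U; u \<in> cvec n\<rbrakk> \<Longrightarrow> \<psi> y u \<in> fibre E y"
  and "\<And>y u. \<lbrakk>y \<in> U; u \<in> cvec n\<rbrakk> \<Longrightarrow> \<phi> y (\<psi> y u) = u"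
 shows "trivial_on E U n"
proof -
 let ?U = "subtopology (bbase E) U"
 have cid: "cmap ?U (bbase E) id" by simp
 have UY: "U \<subseteq> topspace (bbase E)" using U openin_subset by blast
 note pP = prebundle_pull[OF E cid]
 have "cmap (btotal (pull_bundle ?U id E)) (subtopology (btotal E) (Sigma U (fibre E))) (\<lambda>p. p)"
  using continuous_map_from_pull(2)[OF E cid] topspace_pull_bundle[OF E cid] UY by (auto simp: into_sub)
 from continuous_map_compose[OF this c1]
 have "bundle_iso_by (pull_bundle ?U id E) (trivial_bundle ?U n) \<phi> \<psi>"
  unfolding bundle_iso_by_def fibre_linear_def using continuous_map_from_pull(1)[OF E cid] c2 assms(5-)
  by (auto simp: continuous_map_into_pull[OF E cid] continuous_map_pairwise o_def continuous_map_fst)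
 then show ?thesis using U bundle_equivI[OF pP prebundle_trivial] by (simp add: trivial_on_def)
qed

lemma trivial_on_subset:
 assumes E: "prebundle E" and T: "trivial_on E U n" and V: "openin (bbase E) V" "V \<subseteq> U"
 shows "trivial_on E V n"
proof -
 let ?U = "subtopology (bbase E) U" and ?V = "subtopology (bbase E) V"
 have VU: "cmap ?V ?U id" using V(2) by (auto simp: into_sub)
 have "bundle_equiv (pull_bundle ?V id E) (pull_bundle ?V id (pull_bundle ?U id E))"
  using bundle_equiv_sym[OF bundle_equiv_pull_pull[OF E _ VU, of id]] by (simp add: id_def)
 also have "bundle_equiv \<dots> (pull_bundle ?V id (trivial_bundle ?U n))"
  by (rule bundle_equiv_pull) (use T VU in \<open>simp_all add: trivial_on_def\<close>)
 also have "bundle_equiv \<dots> (trivial_bundle ?V n)" by (rule bundle_equiv_pull_trivial[OF VU])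
 finally show ?thesis using V by (simp add: trivial_on_def)
qed

lemma vector_bundle_equiv:
 assumes FE: "bundle_equiv F E" and E: "vector_bundle E"
 shows "vector_bundle F"
proof -
 have "trivial_on F U n" if "trivial_on E U n" for U n
  using bundle_equiv_trans[OF bundle_equiv_pull[OF FE, of "subtopology (bbase F) U" id], of "trivial_bundle (subtopology (bbase F) U) n"]
   that bundle_equivD(3)[OF FE] by (simp add: trivial_on_def)
 then show ?thesis using E bundle_equivD[OF FE] unfolding vector_bundle_iff by metis
qed

lemma vector_bundle_iso:
 "\<lbrakk>prebundle F; bundle_iso_by F E \<phi> \<psi>; vector_bundle E\<rbrakk> \<Longrightarrow> vector_bundle F"
 by (rule vector_bundle_equiv[OF bundle_equivI[OF _ vector_bundle_prebundle]])

lemma vector_bundle_trivial: "vector_bundle (trivial_bundle Y n)"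
 unfolding vector_bundle_iff trivial_on_def using prebundle_trivial[of Y n] bundle_equiv_pull_trivial[of _ Y id n]
 by (auto intro!: exI[of _ "topspace Y"] exI[of _ n])

lemma vector_bundle_pull:
 assumes E: "vector_bundle E" and f: "cmap Z (bbase E) f"
 shows "vector_bundle (pull_bundle Z f E)" unfolding vector_bundle_iff
proof (intro conjI ballI)
 have pE: "prebundle E" using E vector_bundle_prebundle by blast
 show "prebundle (pull_bundle Z f E)" by (rule prebundle_pull[OF pE f])
 fix z assume "z \<in> topspace (bbase (pull_bundle Z f E))"
 then have z: "z \<in> topspace Z" by simp
 obtain U n where U: "f z \<in> U" and T: "trivial_on E U n" using E continuous_map_mem[OF f z] by (auto simp: vector_bundle_iff)
 define V where "V = {z \<in> topspace Z. f z \<in> U}"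
 have V: "openin Z V" unfolding V_def using f T by (auto simp: trivial_on_def openin_continuous_map_preimage)
 let ?U = "subtopology (bbase E) U" and ?V = "subtopology Z V"
 have fV: "cmap ?V ?U f" using f by (auto simp: into_sub from_sub V_def)
 have "bundle_equiv (pull_bundle ?V id (pull_bundle Z f E)) (pull_bundle ?V f E)"
  using bundle_equiv_pull_pull[OF pE f, of ?V id] by simp
 also have "bundle_equiv \<dots> (pull_bundle ?V f (pull_bundle ?U id E))"
  using bundle_equiv_sym[OF bundle_equiv_pull_pull[OF pE _ fV, of id]] by simp
 also have "bundle_equiv \<dots> (pull_bundle ?V f (trivial_bundle ?U n))"
  by (rule bundle_equiv_pull) (use T fV in \<open>simp_all add: trivial_on_def\<close>)
 also have "bundle_equiv \<dots> (trivial_bundle ?V n)" by (rule bundle_equiv_pull_trivial[OF fV])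
 finally have "trivial_on (pull_bundle Z f E) V n" using V by (simp add: trivial_on_def)
 moreover have "z \<in> V" using z U by (simp add: V_def)
 ultimately show "\<exists>V n. z \<in> V \<and> trivial_on (pull_bundle Z f E) V n" by blast
qed

lemma vector_bundle_direct_sum:
 assumes E: "vector_bundle E" and F: "vector_bundle F" and base: "bbase E = bbase F"
 shows "vector_bundle (direct_sum E F)" unfolding vector_bundle_iff
proof (intro conjI ballI)
 note pE = vector_bundle_prebundle[OF E] and pF = vector_bundle_prebundle[OF F]
 show "prebundle (direct_sum E F)" by (rule prebundle_direct_sum[OF pE pF base])
 fix y assume "y \<in> topspace (bbase (direct_sum E F))"
 then obtain U1 n U2 m where U: "y \<in> U1" "trivial_on E U1 n" "y \<in> U2" "trivial_on F U2 m"
  using E F base by (fastforce simp: vector_bundle_iff)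
 let ?U = "subtopology (bbase E) (U1 \<inter> U2)"
 have oU: "openin (bbase E) (U1 \<inter> U2)" using U base by (auto simp: trivial_on_def)
 have T: "trivial_on E (U1 \<inter> U2) n" "trivial_on F (U1 \<inter> U2) m"
  using trivial_on_subset[OF pE U(2) oU] trivial_on_subset[OF pF U(4)] oU base by auto
 have "bundle_equiv (pull_bundle ?U id (direct_sum E F)) (direct_sum (pull_bundle ?U id E) (pull_bundle ?U id F))"
  by (rule bundle_equiv_pull_direct_sum[OF pE pF base]) simp
 also have "bundle_equiv \<dots> (direct_sum (trivial_bundle ?U n) (trivial_bundle ?U m))"
  by (rule bundle_equiv_direct_sum) (use T base in \<open>simp_all add: trivial_on_def\<close>)
 also note bundle_equiv_trivial_sum
 finally have "trivial_on (direct_sum E F) (U1 \<inter> U2) (n + m)" using oU by (simp add: trivial_on_def)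
 then show "\<exists>U n. y \<in> U \<and> trivial_on (direct_sum E F) U n" using U by blast
qed

text \<open>Injections of the fibres into \<open>nat \<Rightarrow> complex\<close> come from local
  trivialisations, one for each point and without any continuity; topology and linear structure are
  transported along them afterwards.\<close>

lemma ex_bundle_representative:
 fixes E :: "('b, 'v) cbundle"
 assumes E: "vector_bundle E"
 shows "\<exists>F :: ('b, nat \<Rightarrow> complex) cbundle. vector_bundle F \<and> bundle_iso F E"
proof -
 have pE: "prebundle E" using E vector_bundle_prebundle by blast
 have "\<exists>g :: 'v \<Rightarrow> nat \<Rightarrow> complex. inj_on g (fibre E y)" if y: "y \<in> topspace (bbase E)" for y
 proof -
  obtain U n where U: "y \<in> U" "trivial_on E U n" using E y by (auto simp: vector_bundle_iff)
  then obtain a b where "bundle_iso_by (pull_bundle (subtopology (bbase E) U) id E) (trivial_bundle (subtopology (bbase E) U) n) a b"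
   unfolding trivial_on_def by (blast elim: bundle_equivE)
  from bundle_iso_byD(5)[OF this, of y] have "inj_on (a y) (fibre E y)" using U y by (intro inj_on_inverseI[of _ "b y"]) simp
  then show ?thesis by blast
 qed
 then obtain g :: "'b \<Rightarrow> 'v \<Rightarrow> nat \<Rightarrow> complex"
  where g: "\<And>y. y \<in> topspace (bbase E) \<Longrightarrow> inj_on (g y) (fibre E y)" by metis
 define h where "h = (\<lambda>y. inv_into (fibre E y) (g y))"
 have hg: "h y (g y v) = v" if "y \<in> topspace (bbase E)" "v \<in> fibre E y" for y v using g that by (simp add: h_def)
 \<comment> \<open>With the topology pulled back along \<open>h\<close>, the map \<open>h\<close> is
   continuous at once, and \<open>g\<close> is continuous because \<open>h\<close> after
   \<open>g\<close> is the identity.\<close>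
 define F :: "('b, nat \<Rightarrow> complex) cbundle" where
  "F = \<lparr> bbase = bbase E, fibre = (\<lambda>y. g y ` fibre E y),
    badd = (\<lambda>y u w. g y (badd E y (h y u) (h y w))),
    bscale = (\<lambda>y z u. g y (bscale E y z (h y u))),
    btotal = pullback_topology (Sigma (topspace (bbase E)) (\<lambda>y. g y ` fibre E y))
         (\<lambda>p. (fst p, h (fst p) (snd p))) (btotal E) \<rparr>"
 have Fs: "bbase F = bbase E" "\<And>y. fibre F y = g y ` fibre E y"
  "\<And>y u w. badd F y u w = g y (badd E y (h y u) (h y w))"
  "\<And>y u z. bscale F y z u = g y (bscale E y z (h y u))" by (simp_all add: F_def)
 have c1: "cmap (btotal F) (btotal E) (\<lambda>p. (fst p, h (fst p) (snd p)))"
  using continuous_map_pullback_iff[of "btotal F" "Sigma (topspace (bbase E)) (\<lambda>y. g y ` fibre E y)"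
    "\<lambda>p. (fst p, h (fst p) (snd p))" "btotal E" "\<lambda>p. p"] by (simp add: F_def)
 have tE: "topspace (btotal E) = Sigma (topspace (bbase E)) (fibre E)" by (rule prebundleD(1)[OF pE])
 have "cmap (btotal E) (btotal E) (\<lambda>p. (fst p, h (fst p) (g (fst p) (snd p))))"
  by (rule continuous_map_eq[OF continuous_map_id]) (use tE hg in auto)
 then have c2: "cmap (btotal E) (btotal F) (\<lambda>p. (fst p, g (fst p) (snd p)))"
  by (auto simp: F_def continuous_map_pullback_iff tE)
 have pF: "prebundle F" unfolding prebundle_def
 proof (intro conjI ballI allI)
  show "topspace (btotal F) = Sigma (topspace (bbase F)) (fibre F)" using hg by (auto simp: F_def topspace_pullback_topology tE)
  show "cmap (btotal F) (bbase F) fst" using continuous_map_compose[OF c1 prebundleD(2)[OF pE]] by (simp add: o_def Fs)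
 qed (use hg in \<open>auto simp: Fs intro!: imageI prebundleD(3,4)[OF pE]\<close>)
 have "bundle_iso_by F E h g" unfolding bundle_iso_by_def fibre_linear_def using c1 c2 hg prebundleD(3,4)[OF pE] by (auto simp: Fs)
 then show ?thesis using vector_bundle_iso[OF pF _ E] bundle_iso_iff[OF pF pE] by blast
qed

section \<open>Rational K-theory\<close>

lemma lookup_q_scale [simp]: "Poly_Mapping.lookup (q_scale q x) k = q * Poly_Mapping.lookup x k"
 by (simp add: q_scale_def map.rep_eq when_def)

lemma q_scale_simps:
 "q_scale q (x + y) = q_scale q x + q_scale q y"
 "q_scale q (x - y) = q_scale q x - q_scale q y"
 "q_scale (p + q) x = q_scale p x + q_scale q x"
 "q_scale p (q_scale q x) = q_scale (p * q) x"
 "q_scale 1 x = x"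
 "q_scale 0 x = 0"
 "q_scale q 0 = 0"
 "q_scale (- q) x = - q_scale q x"
 "q_scale q (Poly_Mapping.single k c) = Poly_Mapping.single k (q * c)"
 by (rule poly_mapping_eqI; simp add: lookup_add lookup_minus algebra_simps lookup_single when_def)+

lemma q_scale_sum: "q_scale q (\<Sum>i\<in>A. x i) = (\<Sum>i\<in>A. q_scale q (x i))"
 by (induction A rule: infinite_finite_induct) (auto simp: q_scale_simps)

lemma q_scale_sum_left: "q_scale (\<Sum>i\<in>A. q i) x = (\<Sum>i\<in>A. q_scale (q i) x)"
 by (induction A rule: infinite_finite_induct) (auto simp: q_scale_simps)

definition K_equiv :: "'b topology \<Rightarrow> 'b virt \<Rightarrow> 'b virt \<Rightarrow> bool" where
 "K_equiv Y x y \<longleftrightarrow> x - y \<in> K_rel Y"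

lemma K_rel_uminus: "x \<in> K_rel Y \<Longrightarrow> - x \<in> K_rel Y"
 using K_rel.scale[of x Y "- 1"] by (simp add: q_scale_simps)

lemma K_rel_diff: "\<lbrakk>x \<in> K_rel Y; y \<in> K_rel Y\<rbrakk> \<Longrightarrow> x - y \<in> K_rel Y"
 using K_rel.add[OF _ K_rel_uminus] by (metis diff_conv_add_uminus)

lemma K_equiv_refl [simp]: "K_equiv Y x x" by (simp add: K_equiv_def K_rel.zero)

lemma K_equiv_sym: "K_equiv Y x y \<Longrightarrow> K_equiv Y y x" using K_rel_uminus by (fastforce simp: K_equiv_def)

lemma K_equiv_trans [trans]: "\<lbrakk>K_equiv Y x y; K_equiv Y y z\<rbrakk> \<Longrightarrow> K_equiv Y x z"
 using K_rel.add by (fastforce simp: K_equiv_def)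

lemma K_equiv_add: "\<lbrakk>K_equiv Y x x'; K_equiv Y y y'\<rbrakk> \<Longrightarrow> K_equiv Y (x + y) (x' + y')"
 using K_rel.add[of "x - x'" Y "y - y'"] by (simp add: K_equiv_def algebra_simps)

lemma K_equiv_diff: "\<lbrakk>K_equiv Y x x'; K_equiv Y y y'\<rbrakk> \<Longrightarrow> K_equiv Y (x - y) (x' - y')"
 using K_rel_diff[of "x - x'" Y "y - y'"] by (simp add: K_equiv_def algebra_simps)

lemma K_equiv_scale: "K_equiv Y x x' \<Longrightarrow> K_equiv Y (q_scale q x) (q_scale q x')"
 using K_rel.scale[of "x - x'" Y q] by (simp add: K_equiv_def q_scale_simps)

lemma K_equiv_sum: "(\<And>i. i \<in> A \<Longrightarrow> K_equiv Y (x i) (y i)) \<Longrightarrow> K_equiv Y (\<Sum>i\<in>A. x i) (\<Sum>i\<in>A. y i)"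
 by (induction A rule: infinite_finite_induct) (auto intro: K_equiv_add)

lemma K_class_eq_iff: "K_class Y x = K_class Y y \<longleftrightarrow> K_equiv Y x y"
proof
 assume "K_class Y x = K_class Y y"
 moreover have "x \<in> K_class Y x" by (simp add: K_class_def K_rel.zero)
 ultimately show "K_equiv Y x y" by (simp add: K_class_def K_equiv_def)
next
 assume "K_equiv Y x y"
 then show "K_class Y x = K_class Y y" unfolding K_class_def using K_equiv_trans K_equiv_sym unfolding K_equiv_def by blast
qed

lemma bundle_equiv_add_zero:
 assumes E: "prebundle E"
 shows "bundle_equiv E (direct_sum E (trivial_bundle (bbase E) 0))"
proof -
 have base: "bbase E = bbase (trivial_bundle (bbase E) 0)" by simp
 have "bundle_iso_by E (direct_sum E (trivial_bundle (bbase E) 0)) (\<lambda>y v. (v, \<lambda>i. undefined)) (\<lambda>y. fst)"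
  unfolding bundle_iso_by_def fibre_linear_def
  using prebundleD(2)[OF E] continuous_map_from_direct_sum(1)[OF E prebundle_trivial base]
  by (auto simp: continuous_map_into_direct_sum[OF E prebundle_trivial base] continuous_map_pairwise o_def
    continuous_map_componentwise restrict_def)
 then show ?thesis by (rule bundle_equivI[OF E prebundle_direct_sum[OF E prebundle_trivial base]])
qed

lemma K_equiv_single_sum:
 assumes "vector_bundle E" "vector_bundle F" "bbase E = Y" "bbase F = Y" and H: "bundle_equiv H (direct_sum E F)"
 shows "K_equiv Y (Poly_Mapping.single H 1) (Poly_Mapping.single E 1 + Poly_Mapping.single F 1)"
 using K_rel.sum[of E F H Y] vector_bundle_equiv[OF H vector_bundle_direct_sum] bundle_equivD(3)[OF H] assms
 by (simp add: K_equiv_def bundle_equiv_def diff_diff_eq)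

lemma K_equiv_zero_bundle: "K_equiv Y (Poly_Mapping.single (trivial_bundle Y 0) 1) 0"
 using K_rel_uminus K_equiv_single_sum[of "trivial_bundle Y 0" "trivial_bundle Y 0" Y "trivial_bundle Y 0"]
  bundle_equiv_add_zero[of "trivial_bundle Y 0"] by (fastforce simp: K_equiv_def vector_bundle_trivial prebundle_trivial)

lemma K_equiv_single_equiv:
 assumes F: "vector_bundle F" and EF: "bundle_equiv E F" and Y: "bbase F = Y"
 shows "K_equiv Y (Poly_Mapping.single E 1) (Poly_Mapping.single F 1)"
proof -
 have "bundle_equiv E (direct_sum F (trivial_bundle Y 0))"
  using bundle_equiv_trans[OF EF bundle_equiv_add_zero[OF bundle_equivD(2)[OF EF]]] Y by simp
 then have "K_equiv Y (Poly_Mapping.single E 1) (Poly_Mapping.single F 1 + Poly_Mapping.single (trivial_bundle Y 0) 1)"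
  by (intro K_equiv_single_sum) (simp_all add: F Y vector_bundle_trivial)
 also have "K_equiv Y \<dots> (Poly_Mapping.single F 1 + 0)" by (intro K_equiv_add K_equiv_refl K_equiv_zero_bundle)
 finally show ?thesis by simp
qed

text \<open>An equality and not just an equivalence: isomorphic bundles have the same candidates in
  the choice made by \<open>virt_of\<close>, hence the same chosen one.\<close>

lemma virt_of_cong:
 assumes "prebundle E" "prebundle F" "bundle_iso_by E F \<phi> \<psi>"
 shows "virt_of E = virt_of F"
proof -
 note EF = bundle_equivI[OF assms]
 have "vector_bundle H \<and> bundle_iso H E \<longleftrightarrow> vector_bundle H \<and> bundle_iso H F" for H :: "('a, nat \<Rightarrow> complex) cbundle"
  using bundle_equiv_trans[OF _ EF, of H] bundle_equiv_trans[OF _ bundle_equiv_sym[OF EF], of H] assms(1,2)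
   vector_bundle_prebundle[of H] unfolding bundle_equiv_def by blast
 then show ?thesis by (simp add: virt_of_def)
qed

lemma virt_ofE:
 assumes "vector_bundle E"
 obtains F where "vector_bundle F" "bundle_equiv F E" "virt_of E = Poly_Mapping.single F 1" "bbase F = bbase E"
proof -
 define F where "F = (SOME F :: ('a, nat \<Rightarrow> complex) cbundle. vector_bundle F \<and> bundle_iso F E)"
 have F: "vector_bundle F \<and> bundle_iso F E" unfolding F_def by (rule someI_ex[OF ex_bundle_representative[OF assms]])
 show ?thesis
 proof (rule that)
  show "virt_of E = Poly_Mapping.single F 1" by (simp add: virt_of_def F_def)
 qed (use F assms in \<open>auto simp: bundle_equiv_def vector_bundle_prebundle bundle_iso_def\<close>)
qed

lemma virt_of_eq_single:
 assumes E: "vector_bundle E" and FE: "bundle_equiv F E"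
 shows "K_equiv (bbase E) (virt_of E) (Poly_Mapping.single F 1)"
proof -
 obtain H where H: "bundle_equiv H E" "virt_of E = Poly_Mapping.single H 1" using virt_ofE[OF E] by metis
 show ?thesis
  unfolding H(2) using bundle_equiv_trans[OF H(1) bundle_equiv_sym[OF FE]] vector_bundle_equiv[OF FE E] bundle_equivD(3)[OF FE]
  by (intro K_equiv_single_equiv) auto
qed

lemma virt_of_direct_sum:
 assumes E: "vector_bundle E" and F: "vector_bundle F" and Y: "bbase E = Y" "bbase F = Y"
 shows "K_equiv Y (virt_of (direct_sum E F)) (virt_of E + virt_of F)"
proof -
 have S: "vector_bundle (direct_sum E F)" using vector_bundle_direct_sum[OF E F] Y by simp
 obtain E' where E': "vector_bundle E'" "bundle_equiv E' E" "virt_of E = Poly_Mapping.single E' 1" "bbase E' = bbase E"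
  by (rule virt_ofE[OF E])
 obtain F' where F': "vector_bundle F'" "bundle_equiv F' F" "virt_of F = Poly_Mapping.single F' 1" "bbase F' = bbase F"
  by (rule virt_ofE[OF F])
 obtain H where H: "bundle_equiv H (direct_sum E F)" "virt_of (direct_sum E F) = Poly_Mapping.single H 1"
  using virt_ofE[OF S] by metis
 note H(1)
 also have "bundle_equiv (direct_sum E F) (direct_sum E' F')"
  by (rule bundle_equiv_direct_sum[OF bundle_equiv_sym[OF E'(2)] bundle_equiv_sym[OF F'(2)]]) (simp add: Y)
 finally show ?thesis unfolding H(2) E'(3) F'(3) using E' F' Y by (intro K_equiv_single_sum) simp_all
qed

text \<open>Serves the empty sum and the eigenspaces of numbers that are not eigenvalues.\<close>

lemma virt_of_zero:
 assumes E: "prebundle E" and Y: "bbase E = Y"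
  and z: "\<And>y. y \<in> topspace Y \<Longrightarrow> fibre E y = {z y}"
  and c: "cmap Y (btotal E) (\<lambda>y. (y, z y))"
 shows "vector_bundle E" "K_equiv Y (virt_of E) 0"
proof -
 let ?Z = "trivial_bundle Y 0"
 have iso: "bundle_iso_by E ?Z (\<lambda>y v. \<lambda>i. undefined) (\<lambda>y u. z y)" unfolding bundle_iso_by_def
 proof (intro conjI ballI)
  show "cmap (btotal E) (btotal ?Z) (\<lambda>p. (fst p, \<lambda>i. undefined))"
   using prebundleD(2)[OF E] Y by (simp add: continuous_map_pairwise o_def)
  show "cmap (btotal ?Z) (btotal E) (\<lambda>p. (fst p, z (fst p)))"
   using continuous_map_compose[OF continuous_map_fst c] by (simp add: o_def)
  show "fibre_linear E ?Z (\<lambda>y v i. undefined)" by (simp add: fibre_linear_def restrict_def)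
 qed (use z Y in auto)
 show vE: "vector_bundle E" by (rule vector_bundle_iso[OF E iso vector_bundle_trivial])
 have "K_equiv Y (virt_of E) (Poly_Mapping.single ?Z 1)"
  using virt_of_eq_single[OF vE bundle_equiv_sym[OF bundle_equivI[OF E prebundle_trivial iso]]] Y by simp
 then show "K_equiv Y (virt_of E) 0" using K_equiv_zero_bundle by (rule K_equiv_trans)
qed

lemma virt_of_big_sum:
 assumes "finite J" "\<forall>j\<in>J. vector_bundle (E j) \<and> bbase (E j) = Y"
 shows "vector_bundle (big_sum Y J E) \<and> K_equiv Y (virt_of (big_sum Y J E)) (\<Sum>j\<in>J. virt_of (E j))" using assms
proof (induction J rule: finite_induct)
 case empty
 have pre: "prebundle (big_sum Y {} E)" by (rule prebundle_big_sum) simp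
 have c: "cmap Y (btotal (big_sum Y {} E)) (\<lambda>y. (y, \<lambda>_. undefined))" by (subst continuous_map_into_big_sum) auto
 from virt_of_zero[OF pre _ _ c] show ?case by simp
next
 case (insert j J)
 have pre: "\<forall>i\<in>insert j J. prebundle (E i) \<and> bbase (E i) = Y" using insert.prems vector_bundle_prebundle by blast
 let ?S = "direct_sum (E j) (big_sum Y J E)"
 have IH: "vector_bundle (big_sum Y J E)" "K_equiv Y (virt_of (big_sum Y J E)) (\<Sum>j\<in>J. virt_of (E j))" using insert by auto
 have S: "vector_bundle ?S" by (rule vector_bundle_direct_sum) (use IH insert.prems in simp_all)
 note iso = big_sum_insert_iso[OF pre insert.hyps(2)]
 note pB = prebundle_big_sum[OF pre]
 have "virt_of (big_sum Y (insert j J) E) = virt_of ?S" by (rule virt_of_cong[OF pB vector_bundle_prebundle[OF S] iso])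
 also have "K_equiv Y \<dots> (virt_of (E j) + virt_of (big_sum Y J E))"
  by (rule virt_of_direct_sum) (use IH insert.prems in simp_all)
 also have "K_equiv Y \<dots> (virt_of (E j) + (\<Sum>j\<in>J. virt_of (E j)))" by (intro K_equiv_add IH K_equiv_refl)
 finally show ?case using insert.hyps vector_bundle_iso[OF pB iso S] by simp
qed

text \<open>Local triviality of \<open>E\<close> is a conclusion here: it is inherited from the
  summands.\<close>

lemma virt_of_decomposition:
 assumes J: "finite J" and F: "\<forall>j\<in>J. vector_bundle (F j) \<and> bbase (F j) = Y"
  and E: "prebundle E" and iso: "bundle_iso_by E (big_sum Y J F) \<phi> \<psi>"
 shows "vector_bundle E" "K_equiv Y (virt_of E) (\<Sum>j\<in>J. virt_of (F j))"
proof -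
 have B: "vector_bundle (big_sum Y J F)" using virt_of_big_sum[OF J F] by blast
 show "vector_bundle E" by (rule vector_bundle_iso[OF E iso B])
 show "K_equiv Y (virt_of E) (\<Sum>j\<in>J. virt_of (F j))"
  using virt_of_big_sum[OF J F] virt_of_cong[OF E vector_bundle_prebundle[OF B] iso] by simp
qed

subsection \<open>Pull-back\<close>

text \<open>Gives two combinations a common index set, as generators may cancel in their
  sum.\<close>

lemma K_pull_superset:
 assumes "finite A" "Poly_Mapping.keys x \<subseteq> A"
 shows "K_pull Z f x = (\<Sum>E\<in>A. Poly_Mapping.single (pull_bundle Z f E) (Poly_Mapping.lookup x E))" unfolding K_pull_def
 by (rule sum.mono_neutral_left) (use assms in \<open>auto simp: in_keys_iff\<close>)

lemma K_pull_add: "K_pull Z f (x + y) = K_pull Z f x + K_pull Z f y"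
proof -
 let ?A = "Poly_Mapping.keys x \<union> Poly_Mapping.keys y"
 have "K_pull Z f (x + y) = (\<Sum>E\<in>?A. Poly_Mapping.single (pull_bundle Z f E) (Poly_Mapping.lookup (x + y) E))"
  by (rule K_pull_superset) (simp_all add: Poly_Mapping.keys_add)
 also have "\<dots> = K_pull Z f x + K_pull Z f y" by (simp add: K_pull_superset[of ?A] lookup_add single_add sum.distrib)
 finally show ?thesis .
qed

lemma K_pull_scale: "K_pull Z f (q_scale q x) = q_scale q (K_pull Z f x)"
proof -
 have "Poly_Mapping.keys (q_scale q x) \<subseteq> Poly_Mapping.keys x" by (auto simp: in_keys_iff)
 from K_pull_superset[OF _ this] show ?thesis by (simp add: K_pull_def q_scale_sum q_scale_simps)
qed

lemma K_pull_zero [simp]: "K_pull Z f 0 = 0" by (simp add: K_pull_def)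

lemma K_pull_diff: "K_pull Z f (x - y) = K_pull Z f x - K_pull Z f y"
 using K_pull_add[of Z f x "- y"] K_pull_scale[of Z f "- 1" y] by (simp add: q_scale_simps)

lemma K_pull_sum: "K_pull Z f (\<Sum>i\<in>A. x i) = (\<Sum>i\<in>A. K_pull Z f (x i))"
 by (induction A rule: infinite_finite_induct) (auto simp: K_pull_add)

lemmas K_pull_linear = K_pull_add K_pull_diff K_pull_scale K_pull_sum

lemma K_pull_single: "K_pull Z f (Poly_Mapping.single E c) = Poly_Mapping.single (pull_bundle Z f E) c"
 by (cases "c = 0") (simp_all add: K_pull_def)

lemma K_pull_virt_of:
 assumes E: "vector_bundle E" and f: "cmap Z (bbase E) f"
 shows "K_equiv Z (K_pull Z f (virt_of E)) (virt_of (pull_bundle Z f E))"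
proof -
 obtain F where F: "bundle_equiv F E" "virt_of E = Poly_Mapping.single F 1" "bbase F = bbase E" using virt_ofE[OF E] by metis
 have "bundle_equiv (pull_bundle Z f F) (pull_bundle Z f E)" by (rule bundle_equiv_pull[OF F(1)]) (simp add: F f)
 from virt_of_eq_single[OF vector_bundle_pull[OF E f] this] show ?thesis by (simp add: F K_pull_single K_equiv_sym)
qed

lemma K_pull_K_rel:
 assumes f: "cmap Z Y f" and x: "x \<in> K_rel Y"
 shows "K_pull Z f x \<in> K_rel Z" using x
proof induction
 case (sum E F H)
 have f': "cmap Z (bbase E) f" "cmap Z (bbase F) f" "cmap Z (bbase H) f" and b: "bbase E = bbase F" using f sum by simp_all
 note p = sum(1-3)[THEN vector_bundle_prebundle]
 have "bundle_equiv (pull_bundle Z f H) (pull_bundle Z f (direct_sum E F))"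
  using sum(7) p f' b by (intro bundle_equiv_pull) (simp_all add: bundle_equiv_def prebundle_direct_sum)
 also have "bundle_equiv \<dots> (direct_sum (pull_bundle Z f E) (pull_bundle Z f F))"
  by (rule bundle_equiv_pull_direct_sum[OF p(1,2) b f'(1)])
 finally show ?case unfolding K_pull_diff K_pull_single bundle_equiv_def
  by (intro K_rel.sum vector_bundle_pull sum(1-3) f') simp_all
qed (simp_all add: K_pull_add K_pull_scale K_rel.zero K_rel.add K_rel.scale)

lemma K_equiv_pull:
 "\<lbrakk>cmap Z Y f; K_equiv Y x y\<rbrakk> \<Longrightarrow> K_equiv Z (K_pull Z f x) (K_pull Z f y)"
 using K_pull_K_rel by (fastforce simp: K_equiv_def K_pull_diff)

text \<open>A formal combination may have any records as generators, bundles or not and over any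
  base. Functoriality of pull-backs is available only for genuine bundles over the right base, which
  this condition expresses.\<close>

definition bundle_virt :: "'b topology \<Rightarrow> 'b virt \<Rightarrow> bool" where
 "bundle_virt Y x \<longleftrightarrow> (\<forall>E\<in>Poly_Mapping.keys x. vector_bundle E \<and> bbase E = Y)"

lemma bundle_virt_virt_of: "\<lbrakk>vector_bundle E; bbase E = Y\<rbrakk> \<Longrightarrow> bundle_virt Y (virt_of E)"
 by (rule virt_ofE[of E]) (simp_all add: bundle_virt_def)

lemma bundle_virt_add: "\<lbrakk>bundle_virt Y x; bundle_virt Y y\<rbrakk> \<Longrightarrow> bundle_virt Y (x + y)"
 using subsetD[OF Poly_Mapping.keys_add[of x y]] by (auto simp: bundle_virt_def)

lemma bundle_virt_zero: "bundle_virt Y 0" by (simp add: bundle_virt_def)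

lemma bundle_virt_scale: "bundle_virt Y x \<Longrightarrow> bundle_virt Y (q_scale q x)"
 unfolding bundle_virt_def by (auto simp: in_keys_iff)

lemma bundle_virt_sum: "(\<And>i. i \<in> A \<Longrightarrow> bundle_virt Y (x i)) \<Longrightarrow> bundle_virt Y (\<Sum>i\<in>A. x i)"
 by (induction A rule: infinite_finite_induct) (auto simp: bundle_virt_zero intro: bundle_virt_add)

lemma bundle_virt_induct [consumes 1, case_names zero add]:
 assumes x: "bundle_virt Y x" and z: "P 0"
  and a: "\<And>E c x. \<lbrakk>vector_bundle E; bbase E = Y; P x\<rbrakk> \<Longrightarrow> P (q_scale c (Poly_Mapping.single E 1) + x)"
 shows "P x"
proof -
 have "P (\<Sum>E\<in>A. Poly_Mapping.single E (Poly_Mapping.lookup x E))" if "finite A" "A \<subseteq> Poly_Mapping.keys x" for A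
  using that
 proof (induction A rule: finite_induct)
  case (insert E A)
  then show ?case using x a[of E] by (auto simp: bundle_virt_def q_scale_simps)
 qed (simp add: z)
 moreover have "(\<Sum>E\<in>Poly_Mapping.keys x. Poly_Mapping.single E (Poly_Mapping.lookup x E)) = x"
  by (rule poly_mapping_eqI) (simp add: lookup_sum lookup_single when_def in_keys_iff)
 ultimately show ?thesis by (metis finite_keys order_refl)
qed

lemma bundle_virt_pull:
 assumes x: "bundle_virt Y x" and f: "cmap Z Y f"
 shows "bundle_virt Z (K_pull Z f x)" using x
proof (induction rule: bundle_virt_induct)
 case (add E c x)
 have "bundle_virt Z (Poly_Mapping.single (pull_bundle Z f E) 1)"
  using vector_bundle_pull[of E Z f] add f by (simp add: bundle_virt_def)
 then show ?case using add by (simp add: K_pull_linear K_pull_single bundle_virt_add bundle_virt_scale)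
qed (simp add: bundle_virt_zero)

lemma K_pull_compose:
 assumes x: "bundle_virt X x" and f: "cmap Y X f" and g: "cmap Z Y g"
 shows "K_equiv Z (K_pull Z g (K_pull Y f x)) (K_pull Z (\<lambda>z. f (g z)) x)" using x
proof (induction rule: bundle_virt_induct)
 case (add E c x)
 have "K_equiv Z (Poly_Mapping.single (pull_bundle Z g (pull_bundle Y f E)) 1)
   (Poly_Mapping.single (pull_bundle Z (\<lambda>z. f (g z)) E) 1)" using add f continuous_map_compose[OF g f, unfolded o_def]
  by (intro K_equiv_single_equiv vector_bundle_pull bundle_equiv_pull_pull vector_bundle_prebundle g) simp_all
 then show ?case using add by (simp add: K_pull_linear K_pull_single K_equiv_add K_equiv_scale)
qed simp

lemma K_pull_cong:
 assumes x: "bundle_virt Y x" and f: "cmap Z Y f" and eq: "\<And>z. z \<in> topspace Z \<Longrightarrow> f z = f' z"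
 shows "K_equiv Z (K_pull Z f x) (K_pull Z f' x)" using x
proof (induction rule: bundle_virt_induct)
 case (add E c x)
 have "K_equiv Z (Poly_Mapping.single (pull_bundle Z f E) 1) (Poly_Mapping.single (pull_bundle Z f' E) 1)"
  using add f continuous_map_eq[OF f eq]
  by (intro K_equiv_single_equiv vector_bundle_pull bundle_equiv_pull_cong vector_bundle_prebundle eq) simp_all
 then show ?case using add by (simp add: K_pull_linear K_pull_single K_equiv_add K_equiv_scale)
qed simp

lemma K_pull_via:
 assumes x: "bundle_virt B x" and f: "cmap A B f" and g: "cmap C A g" and h: "\<And>y. y \<in> topspace C \<Longrightarrow> f (g y) = h y"
 shows "K_equiv C (K_pull C g (K_pull A f x)) (K_pull C h x)"
 using K_equiv_trans[OF K_pull_compose[OF x f g] K_pull_cong[OF x _ h]] continuous_map_compose[OF g f] by (simp add: o_def)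

lemma K_pull_id: "bundle_virt Y x \<Longrightarrow> K_equiv Y (K_pull Y (\<lambda>y. y) x) x"
proof (induction rule: bundle_virt_induct)
 case (add E c x)
 have E: "prebundle E" "cmap Y (bbase E) (\<lambda>y. y)"
  using add vector_bundle_prebundle continuous_map_id[of Y] by (auto simp: id_def)
 have "bundle_equiv (pull_bundle Y (\<lambda>y. y) E) E" by (intro bundle_equiv_id prebundle_pull E)
   (use add continuous_map_compose[OF _ prebundleD(2)[OF E(1)]] in \<open>auto simp: continuous_map_into_pull[OF E] o_def\<close>)
 then show ?case using add by (simp add: K_pull_linear K_pull_single K_equiv_add K_equiv_scale K_equiv_single_equiv)
qed simp

section \<open>Tangent vectors on manifolds of class C1\<close>

lemma continuous_map_locally:
 assumes "\<And>x. x \<in> topspace X \<Longrightarrow> \<exists>U. openin X U \<and> x \<in> U \<and> cmap (subtopology X U) Y f"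
 shows "cmap X Y f"
proof -
 obtain U where U: "\<And>x. x \<in> topspace X \<Longrightarrow> openin X (U x) \<and> x \<in> U x \<and> cmap (subtopology X (U x)) Y f"
  using assms by metis
 show ?thesis by (rule pasting_lemma[of "topspace X" X U Y "\<lambda>_. f"]) (use U in auto)
qed

text \<open>Expanding \<open>w t\<close> in a fixed orthonormal basis of \<open>V\<close> reduces
  joint continuity to continuity for each fixed vector. This turns the continuity of derivatives in
  each direction, as stated by \<open>Ck\<close>, into continuity of tangent maps.\<close>

lemma continuous_map_linear_family:
 fixes L :: "'t \<Rightarrow> 'e::euclidean_space \<Rightarrow> 'f::euclidean_space"
 assumes V: "subspace V"
  and add: "\<And>t v w. \<lbrakk>t \<in> topspace T; v \<in> V; w \<in> V\<rbrakk> \<Longrightarrow> L t (v + w) = L t v + L t w"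
  and scale: "\<And>t v r. \<lbrakk>t \<in> topspace T; v \<in> V\<rbrakk> \<Longrightarrow> L t (r *\<^sub>R v) = r *\<^sub>R L t v"
  and L: "\<And>v. v \<in> V \<Longrightarrow> cmap T euclidean (\<lambda>t. L t v)"
  and w: "cmap T euclidean w" and wV: "\<And>t. t \<in> topspace T \<Longrightarrow> w t \<in> V"
 shows "cmap T euclidean (\<lambda>t. L t (w t))"
proof -
 obtain B where B: "B \<subseteq> V" "pairwise orthogonal B" "\<And>x. x \<in> B \<Longrightarrow> norm x = 1"
   "independent B" "span B = V" using orthonormal_basis_subspace[OF V] by metis
 have fB: "finite B" using B(4) by (rule independent_imp_finite)
 have sum: "L t (\<Sum>b\<in>A. r b *\<^sub>R b) = (\<Sum>b\<in>A. r b *\<^sub>R L t b) \<and> (\<Sum>b\<in>A. r b *\<^sub>R b) \<in> V"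
  if "finite A" "A \<subseteq> V" "t \<in> topspace T" for A r t using that
 proof (induction A rule: finite_induct)
  case empty
  then show ?case using scale[of t 0 0] V by (simp add: subspace_0)
 next
  case (insert b A)
  then show ?case using add[of t "r b *\<^sub>R b" "\<Sum>b\<in>A. r b *\<^sub>R b"] scale[of t b] V
   by (simp add: subspace_add subspace_scale)
 qed
 have eq: "L t (w t) = (\<Sum>b\<in>B. (w t \<bullet> b) *\<^sub>R L t b)" if "t \<in> topspace T" for t
  using sum[OF fB B(1) that, of "\<lambda>b. w t \<bullet> b"] orthonormal_basis_expand[OF B(2,3) _ fB, of "w t"] wV[OF that] B(5)
  by simp
 have "cmap T euclidean (\<lambda>t. \<Sum>b\<in>B. (w t \<bullet> b) *\<^sub>R L t b)"
 proof (rule continuous_map_sum[OF fB])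
  fix b assume "b \<in> B"
  then have "cmap T euclidean (\<lambda>t. L t b)" using L B(1) by blast
  with w show "cmap T euclidean (\<lambda>t. (w t \<bullet> b) *\<^sub>R L t b)"
   by (simp add: continuous_map_atin tendsto_scaleR tendsto_inner)
 qed
 then show ?thesis by (rule continuous_map_eq) (simp add: eq)
qed

text \<open>The chain rule for a derivative that exists only within \<open>S\<close>: the curve has
  to stay in \<open>S\<close> just for the times near 0.\<close>

lemma has_vector_derivative_curve:
 fixes f :: "'a::real_normed_vector \<Rightarrow> 'b::real_normed_vector" and \<gamma> :: "real \<Rightarrow> 'a"
 assumes f: "(f has_derivative D) (at (\<gamma> 0) within S)"
  and \<gamma>: "(\<gamma> has_vector_derivative v) (at 0)"
  and T: "open T" "0 \<in> T" "\<And>t. t \<in> T \<Longrightarrow> \<gamma> t \<in> S"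
 shows "((\<lambda>t. f (\<gamma> t)) has_vector_derivative D v) (at 0)"
proof -
 have 1: "(\<gamma> has_derivative (\<lambda>h. h *\<^sub>R v)) (at 0 within T)"
  using \<gamma> by (simp add: has_vector_derivative_def has_derivative_at_withinI)
 have "(f has_derivative D) (at (\<gamma> 0) within \<gamma> ` T)" using f by (rule has_derivative_subset) (use T in auto)
 from has_derivative_in_compose[OF 1 this]
 have "((\<lambda>t. f (\<gamma> t)) has_derivative (\<lambda>h. D (h *\<^sub>R v))) (at 0)" unfolding at_within_open[OF T(2,1)] .
 moreover have "D (h *\<^sub>R v) = h *\<^sub>R D v" for h
  by (rule linear_scale[OF bounded_linear.linear[OF has_derivative_bounded_linear[OF f]]])
 ultimately show ?thesis by (simp add: has_vector_derivative_def)
qed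

section \<open>Derivatives on relatively open subsets of a subspace\<close>

lemma line_in_relopen:
 fixes x :: "'a::euclidean_space"
 assumes V: "subspace V" and S: "openin (top_of_set V) S" and x: "x \<in> S" and v: "v \<in> V"
 obtains T where "open T" "(0::real) \<in> T" "\<And>t. t \<in> T \<Longrightarrow> x + t *\<^sub>R v \<in> S"
proof -
 obtain O' where O: "open O'" "S = V \<inter> O'" using S by (auto simp: openin_open)
 let ?T = "(\<lambda>t. x + t *\<^sub>R v) -` O'"
 have "open ?T" by (rule continuous_open_vimage[OF O(1)]) (auto intro!: continuous_intros)
 moreover have "0 \<in> ?T" using x O by simp
 moreover have "x + t *\<^sub>R v \<in> S" if "t \<in> ?T" for t using that x v O V by (simp add: subspace_add subspace_scale)
 ultimately show ?thesis using that by blast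
qed

text \<open>Lines in the directions of \<open>V\<close> stay in \<open>S\<close> for small times,
  and derivatives along them are unique. In the other directions a derivative within
  \<open>S\<close> is not determined.\<close>

lemma derivative_unique_relopen:
 fixes f :: "'a::euclidean_space \<Rightarrow> 'b::real_normed_vector"
 assumes V: "subspace V" and S: "openin (top_of_set V) S" and x: "x \<in> S" and v: "v \<in> V"
  and D: "(f has_derivative D) (at x within S)" and D': "(f has_derivative D') (at x within S)"
 shows "D v = D' v"
proof -
 obtain T where T: "open T" "(0::real) \<in> T" "\<And>t. t \<in> T \<Longrightarrow> x + t *\<^sub>R v \<in> S"
  by (rule line_in_relopen[OF V S x v]) (rule that)
 have \<gamma>: "((\<lambda>t. x + t *\<^sub>R v) has_vector_derivative v) (at 0)"
  by (auto intro!: derivative_eq_intros simp: has_vector_derivative_def)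
 have "((\<lambda>t. f (x + t *\<^sub>R v)) has_vector_derivative D v) (at 0)"
  by (rule has_vector_derivative_curve[OF _ \<gamma> T]) (use D in simp)
 moreover have "((\<lambda>t. f (x + t *\<^sub>R v)) has_vector_derivative D' v) (at 0)"
  by (rule has_vector_derivative_curve[OF _ \<gamma> T]) (use D' in simp)
 ultimately show ?thesis by (rule vector_derivative_unique_at)
qed

text \<open>The difference quotients along a line lie in \<open>W\<close>, and \<open>W\<close> is
  closed.\<close>

lemma derivative_in_subspace:
 fixes f :: "'a::euclidean_space \<Rightarrow> 'b::euclidean_space"
 assumes V: "subspace V" and S: "openin (top_of_set V) S" and x: "x \<in> S" and v: "v \<in> V"
  and D: "(f has_derivative D) (at x within S)" and W: "subspace W" and f: "f ` S \<subseteq> W"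
 shows "D v \<in> W"
proof -
 obtain T where T: "open T" "(0::real) \<in> T" "\<And>t. t \<in> T \<Longrightarrow> x + t *\<^sub>R v \<in> S"
  by (rule line_in_relopen[OF V S x v]) (rule that)
 have \<gamma>: "((\<lambda>t. x + t *\<^sub>R v) has_vector_derivative v) (at 0)"
  by (auto intro!: derivative_eq_intros simp: has_vector_derivative_def)
 have "((\<lambda>t. f (x + t *\<^sub>R v)) has_vector_derivative D v) (at 0)"
  by (rule has_vector_derivative_curve[OF _ \<gamma> T]) (use D in simp)
 then have "((\<lambda>h. norm (f (x + h *\<^sub>R v) - f x - h *\<^sub>R D v) / norm h) \<longlongrightarrow> 0) (at 0)"
  by (simp add: has_vector_derivative_def has_derivative_at)
 then have "((\<lambda>t. norm ((1 / t) *\<^sub>R (f (x + t *\<^sub>R v) - f x) - D v)) \<longlongrightarrow> 0) (at 0)"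
 proof (rule Lim_transform_eventually)
  show "\<forall>\<^sub>F t in at 0. norm (f (x + t *\<^sub>R v) - f x - t *\<^sub>R D v) / norm t =
    norm ((1 / t) *\<^sub>R (f (x + t *\<^sub>R v) - f x) - D v)"
  proof (rule eventually_neq_at_within[THEN eventually_mono])
   fix t :: real assume "t \<noteq> 0"
   then have "(1 / t) *\<^sub>R (f (x + t *\<^sub>R v) - f x) - D v = (1 / t) *\<^sub>R (f (x + t *\<^sub>R v) - f x - t *\<^sub>R D v)"
    by (simp add: algebra_simps)
   then show "norm (f (x + t *\<^sub>R v) - f x - t *\<^sub>R D v) / norm t =
    norm ((1 / t) *\<^sub>R (f (x + t *\<^sub>R v) - f x) - D v)" by simp
  qed
 qed
 then have lim: "((\<lambda>t. (1 / t) *\<^sub>R (f (x + t *\<^sub>R v) - f x)) \<longlongrightarrow> D v) (at 0)"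
  by (rule LIM_zero_cancel[OF tendsto_norm_zero_cancel])
 have "\<forall>\<^sub>F t in at 0. (1 / t) *\<^sub>R (f (x + t *\<^sub>R v) - f x) \<in> W"
  using T f x W unfolding eventually_at_topological by (intro exI[of _ T]) (auto intro!: subspace_scale subspace_diff)
 then show ?thesis by (rule Lim_in_closed_set[OF closed_subspace[OF W] _ _ lim]) simp
qed

text \<open>The case \<open>Suc 0\<close> of \<open>Ck\<close>, unfolded; as there, continuity of
  the derivative is required direction by direction.\<close>

definition C1_map :: "'a::euclidean_space set \<Rightarrow> 'a set \<Rightarrow> ('a \<Rightarrow> 'b::euclidean_space) \<Rightarrow> bool" where
 "C1_map V S f \<longleftrightarrow> (\<exists>f'. (\<forall>x\<in>S. (f has_derivative f' x) (at x within S)) \<and>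
   (\<forall>v\<in>V. continuous_on S (\<lambda>x. f' x v)))"

lemma smooth_on_imp_C1_map:
 assumes "smooth_on V S f"
 shows "C1_map V S f"
proof -
 have "Ck (Suc 0) V S f" using assms unfolding smooth_on_def by blast
 then show ?thesis by (auto simp: C1_map_def)
qed

section \<open>Manifolds and maps of class C1, read in charts\<close>

abbreviation chart_inv :: "('p, 'e) chart \<Rightarrow> 'e \<Rightarrow> 'p" where
 "chart_inv c \<equiv> inv_into (fst c) (snd c)"

definition chart_rep :: "('p \<Rightarrow> 'q) \<Rightarrow> ('p, 'e) chart \<Rightarrow> ('q, 'f) chart \<Rightarrow> 'e \<Rightarrow> 'f" where
 "chart_rep F b c = snd c \<circ> F \<circ> chart_inv b"

definition chart_dom :: "('p \<Rightarrow> 'q) \<Rightarrow> ('p, 'e) chart \<Rightarrow> ('q, 'f) chart \<Rightarrow> 'e set" where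
 "chart_dom F b c = snd b ` (fst b \<inter> F -` fst c)"

text \<open>Some derivative within the chart domain: linear everywhere, but with values determined
  only on the model space.\<close>

definition chart_deriv ::
  "('p \<Rightarrow> 'q) \<Rightarrow> ('p, 'e::euclidean_space) chart \<Rightarrow> ('q, 'f::euclidean_space) chart \<Rightarrow> 'p \<Rightarrow> 'e \<Rightarrow> 'f" where
 "chart_deriv F b c p = (SOME D. (chart_rep F b c has_derivative D) (at (snd b p) within chart_dom F b c))"

locale c1_manifold =
 fixes M :: "('p, 'e::euclidean_space) acm"
 assumes subspace_model: "subspace (model M)"
  and atlas_cover: "(\<Union>c\<in>atlas M. fst c) = points M"
  and chart_open: "c \<in> atlas M \<Longrightarrow> openin (mtop M) (fst c)"
  and chart_image_open: "c \<in> atlas M \<Longrightarrow> openin (top_of_set (model M)) (snd c ` fst c)"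
  and chart_homeo: "c \<in> atlas M \<Longrightarrow>
    homeomorphic_map (top_on M (fst c)) (top_of_set (snd c ` fst c)) (snd c)"
  and transitions: "\<lbrakk>b \<in> atlas M; c \<in> atlas M\<rbrakk> \<Longrightarrow> C1_map (model M) (chart_dom (\<lambda>x. x) b c) (chart_rep (\<lambda>x. x) b c)"
begin

lemma charts_atD:
 assumes "c \<in> charts_at M p"
 shows "c \<in> atlas M" "p \<in> fst c" "p \<in> points M" using assms atlas_cover by (auto simp: charts_at_def)

lemma charts_at_nonempty: "p \<in> points M \<Longrightarrow> \<exists>c. c \<in> charts_at M p"
 unfolding charts_at_def atlas_cover[symmetric] by blast

lemma chart_subset: "c \<in> atlas M \<Longrightarrow> fst c \<subseteq> points M" using atlas_cover by blast

lemma chart_inj: "c \<in> atlas M \<Longrightarrow> inj_on (snd c) (fst c)"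
 using homeomorphic_imp_injective_map[OF chart_homeo] chart_subset by (simp add: Int_absorb1)

lemma chart_inv [simp]: "\<lbrakk>c \<in> atlas M; p \<in> fst c\<rbrakk> \<Longrightarrow> chart_inv c (snd c p) = p"
 using chart_inj by simp

lemma chart_in_model: "\<lbrakk>c \<in> atlas M; p \<in> fst c\<rbrakk> \<Longrightarrow> snd c p \<in> model M"
 using openin_imp_subset[OF chart_image_open] by blast

lemma chart_open_image:
 assumes c: "c \<in> atlas M" and W: "openin (mtop M) W" "W \<subseteq> fst c"
 shows "openin (top_of_set (model M)) (snd c ` W)"
proof -
 have "openin (top_on M (fst c)) W" using W by (simp add: openin_subset_topspace_eq openin_open_subtopology chart_open[OF c])
 then have "openin (top_of_set (snd c ` fst c)) (snd c ` W)"
  using homeomorphic_imp_open_map[OF chart_homeo[OF c]] by (simp add: open_map_def)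
 then show ?thesis using chart_image_open[OF c] openin_trans by blast
qed

lemma continuous_chart: "c \<in> atlas M \<Longrightarrow> cmap (top_on M (fst c)) euclidean (snd c)"
 using homeomorphic_imp_continuous_map[OF chart_homeo] by (simp add: into_sub)

lemma continuous_chart_inv:
 assumes c: "c \<in> atlas M"
 shows "cmap (top_of_set (snd c ` fst c)) (mtop M) (chart_inv c)"
proof -
 have "open_map (top_on M (fst c)) (top_of_set (snd c ` fst c)) (snd c)" using homeomorphic_imp_open_map[OF chart_homeo[OF c]] .
 then have "cmap (top_of_set (snd c ` fst c)) (top_on M (fst c)) (chart_inv c)" using chart_subset[OF c] c
  by (subst (asm) open_eq_continuous_inverse_map[where g = "chart_inv c"]) (auto simp: inv_into_into)
 then show ?thesis by (simp add: into_sub)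
qed

end

lemma smooth_atlas_imp_c1_manifold:
 assumes "smooth_atlas M"
 shows "c1_manifold M"
proof
 show "C1_map (model M) (chart_dom (\<lambda>x. x) b c) (chart_rep (\<lambda>x. x) b c)" if "b \<in> atlas M" "c \<in> atlas M" for b c
  using assms that unfolding smooth_atlas_def chart_dom_def chart_rep_def
  by (fastforce intro!: smooth_on_imp_C1_map simp: o_def split: prod.splits)
qed (use assms in \<open>auto simp: smooth_atlas_def split: prod.splits\<close>)

locale c1_map = M: c1_manifold M + N: c1_manifold N
 for M :: "('p, 'e::euclidean_space) acm" and N :: "('q, 'f::euclidean_space) acm" +
 fixes F :: "'p \<Rightarrow> 'q"
 assumes continuous: "cmap (mtop M) (mtop N) F"
  and C1: "\<lbrakk>b \<in> atlas M; c \<in> atlas N\<rbrakk> \<Longrightarrow> C1_map (model M) (chart_dom F b c) (chart_rep F b c)"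
begin

lemma maps_points: "p \<in> points M \<Longrightarrow> F p \<in> points N" using continuous_map_mem[OF continuous] by simp

lemma chart_dom_open:
 assumes b: "b \<in> atlas M" and c: "c \<in> atlas N"
 shows "openin (mtop M) (fst b \<inter> F -` fst c)"
  and "openin (top_of_set (model M)) (chart_dom F b c)"
proof -
 have "openin (mtop M) {p \<in> points M. F p \<in> fst c}"
  using continuous N.chart_open[OF c] by (rule openin_continuous_map_preimage)
 from openin_Int[OF M.chart_open[OF b] this]
 have "openin (mtop M) (fst b \<inter> {p \<in> points M. F p \<in> fst c})" .
 also have "fst b \<inter> {p \<in> points M. F p \<in> fst c} = fst b \<inter> F -` fst c" using M.chart_subset[OF b] by blast
 finally show *: "openin (mtop M) (fst b \<inter> F -` fst c)" .
 show "openin (top_of_set (model M)) (chart_dom F b c)" unfolding chart_dom_def by (rule M.chart_open_image[OF b *]) auto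
qed

context
 fixes p b c assumes b: "b \<in> charts_at M p" and c: "c \<in> charts_at N (F p)"
begin

lemma chart_dom_mem: "snd b p \<in> chart_dom F b c" using M.charts_atD[OF b] N.charts_atD[OF c] by (auto simp: chart_dom_def)

lemma chart_deriv: "(chart_rep F b c has_derivative chart_deriv F b c p) (at (snd b p) within chart_dom F b c)"
proof -
 have "\<exists>D. (chart_rep F b c has_derivative D) (at (snd b p) within chart_dom F b c)"
  using C1[OF M.charts_atD(1)[OF b] N.charts_atD(1)[OF c]] chart_dom_mem unfolding C1_map_def by blast
 then show ?thesis unfolding chart_deriv_def by (rule someI_ex)
qed

lemma chart_deriv_linear:
 "chart_deriv F b c p (v + w) = chart_deriv F b c p v + chart_deriv F b c p w"
 "chart_deriv F b c p (r *\<^sub>R v) = r *\<^sub>R chart_deriv F b c p v"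
 using bounded_linear.linear[OF has_derivative_bounded_linear[OF chart_deriv]] by (simp_all add: linear_add linear_scale)

lemma chart_deriv_unique:
 assumes "v \<in> model M" "(chart_rep F b c has_derivative D) (at (snd b p) within S)"
  "openin (top_of_set (model M)) S" "snd b p \<in> S" "S \<subseteq> chart_dom F b c"
 shows "D v = chart_deriv F b c p v"
 using derivative_unique_relopen[OF M.subspace_model assms(3,4,1,2) has_derivative_subset[OF chart_deriv assms(5)]] .

text \<open>Translates the existential quantifier over derivatives, as it stands in
  \<open>tangent_space\<close> and \<open>tangent_map\<close>, into an equation with
  \<open>chart_deriv\<close>.\<close>

lemma ex_derivative_iff:
 assumes v: "v \<in> model M"
 shows "(\<exists>D. ((snd c \<circ> F \<circ> chart_inv b) has_derivative D) (at (snd b p) within snd b ` (fst b \<inter> F -` fst c))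
   \<and> u = D v) \<longleftrightarrow> u = chart_deriv F b c p v"
 using chart_deriv chart_deriv_unique[OF v _ chart_dom_open(2)[OF M.charts_atD(1)[OF b] N.charts_atD(1)[OF c]] chart_dom_mem order_refl]
 unfolding chart_rep_def chart_dom_def by blast

lemma chart_deriv_in_model:
 assumes "v \<in> model M"
 shows "chart_deriv F b c p v \<in> model N"
proof (rule derivative_in_subspace[OF M.subspace_model chart_dom_open(2) chart_dom_mem assms chart_deriv N.subspace_model])
 show "b \<in> atlas M" "c \<in> atlas N" using M.charts_atD[OF b] N.charts_atD[OF c] by auto
 then show "chart_rep F b c ` chart_dom F b c \<subseteq> model N"
  using N.chart_in_model[of c] by (auto simp: chart_dom_def chart_rep_def)
qed

end

lemma continuous_chart_deriv:
 assumes b: "b \<in> atlas M" and c: "c \<in> atlas N" and v: "v \<in> model M"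
 shows "cmap (top_on M (fst b \<inter> F -` fst c)) euclidean (\<lambda>p. chart_deriv F b c p v)"
proof -
 let ?S = "chart_dom F b c"
 obtain f' where f': "\<And>x. x \<in> ?S \<Longrightarrow> (chart_rep F b c has_derivative f' x) (at x within ?S)"
   "continuous_on ?S (\<lambda>x. f' x v)" using C1[OF b c] v unfolding C1_map_def by blast
 have cb: "cmap (top_on M (fst b \<inter> F -` fst c)) (top_of_set ?S) (snd b)"
  using continuous_map_from_subtopology_mono[OF M.continuous_chart[OF b], of "fst b \<inter> F -` fst c"]
  by (auto simp: into_sub chart_dom_def)
 have cf: "cmap (top_of_set ?S) euclidean (\<lambda>x. f' x v)" using f'(2) by simp
 have "cmap (top_on M (fst b \<inter> F -` fst c)) euclidean (\<lambda>p. f' (snd b p) v)"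
  using continuous_map_compose[OF cb cf] by (simp only: o_def)
 then show ?thesis
 proof (rule continuous_map_eq)
  fix p assume "p \<in> topspace (top_on M (fst b \<inter> F -` fst c))"
  then have p: "b \<in> charts_at M p" "c \<in> charts_at N (F p)" using b c by (auto simp: charts_at_def)
  show "f' (snd b p) v = chart_deriv F b c p v"
   by (rule chart_deriv_unique[OF p v f'(1)[OF chart_dom_mem[OF p]] chart_dom_open(2)[OF b c] chart_dom_mem[OF p] order_refl])
 qed
qed

end

text \<open>Transition maps are coordinate forms of the identity map, so they share the lemmas about
  maps, under the prefix \<open>tr\<close>.\<close>

sublocale c1_manifold \<subseteq> tr: c1_map M M "\<lambda>x. x" by unfold_locales (use transitions in auto)

lemma smooth_map_imp_c1_map: "\<lbrakk>smooth_map M N F; c1_manifold M; c1_manifold N\<rbrakk> \<Longrightarrow> c1_map M N F"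
 unfolding smooth_map_def c1_map_def c1_map_axioms_def chart_dom_def chart_rep_def
 by (auto intro!: smooth_on_imp_C1_map simp: comp_assoc split: prod.splits)

text \<open>\<open>H\<close> is a map of its own that has to agree with the composite on the points
  of \<open>M\<close> only; for group actions the law of composition is known only there.\<close>

lemma chart_deriv_compose:
 assumes F: "c1_map M N F" and G: "c1_map N L G" and H: "c1_map M L H"
  and H_eq: "\<And>x. x \<in> points M \<Longrightarrow> H x = G (F x)"
  and b: "b \<in> charts_at M p" and c: "c \<in> charts_at N (F p)" and d: "d \<in> charts_at L (H p)"
  and v: "v \<in> model M"
 shows "chart_deriv H b d p v = chart_deriv G c d (F p) (chart_deriv F b c p v)"
proof -
 interpret F: c1_map M N F by fact
 interpret G: c1_map N L G by fact
 interpret H: c1_map M L H by fact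
 note bb = F.M.charts_atD[OF b] and cc = F.N.charts_atD[OF c] and dd = G.N.charts_atD[OF d]
 \<comment> \<open>The part of the chart around \<open>p\<close> that \<open>F\<close> and
   \<open>H\<close> send into the chosen charts; all derivatives are compared within its
   image.\<close>
 let ?W = "(fst b \<inter> F -` fst c) \<inter> (fst b \<inter> H -` fst d)"
 let ?S = "snd b ` ?W"
 have W: "openin (mtop M) ?W" using F.chart_dom_open(1)[OF bb(1) cc(1)] H.chart_dom_open(1)[OF bb(1) dd(1)] by (rule openin_Int)
 have S: "openin (top_of_set (model M)) ?S" by (rule F.M.chart_open_image[OF bb(1) W]) auto
 have pS: "snd b p \<in> ?S" using bb cc dd by blast
 have 1: "(chart_rep F b c has_derivative chart_deriv F b c p) (at (snd b p) within ?S)"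
  by (rule has_derivative_subset[OF F.chart_deriv[OF b c]]) (auto simp: chart_dom_def)
 have rep: "chart_rep F b c (snd b x) = snd c (F x)" if "x \<in> fst b" for x using that bb by (simp add: chart_rep_def)
 have HW: "H x = G (F x)" if "x \<in> ?W" for x using that H_eq F.M.chart_subset[OF bb(1)] by blast
 have img: "chart_rep F b c ` ?S \<subseteq> chart_dom G c d" using rep HW by (auto simp: chart_dom_def)
 have "d \<in> charts_at L (G (F p))" using d H_eq[OF bb(3)] by simp
 from has_derivative_subset[OF G.chart_deriv[OF c this] img]
 have "(chart_rep G c d has_derivative chart_deriv G c d (F p)) (at (chart_rep F b c (snd b p)) within chart_rep F b c ` ?S)"
  using rep[OF bb(2)] by simp
 from has_derivative_in_compose[OF 1 this]
 have "(chart_rep H b d has_derivative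
   (\<lambda>v. chart_deriv G c d (F p) (chart_deriv F b c p v))) (at (snd b p) within ?S)"
  by (rule has_derivative_transform[OF pS, rotated])
   (use HW bb(1) cc(1) in \<open>auto simp: chart_rep_def\<close>)
 then show ?thesis by (rule H.chart_deriv_unique[OF b d v _ S pS, symmetric]) (auto simp: chart_dom_def)
qed

text \<open>An explicit form, through derivatives of transition maps, of the definite description
  \<open>tvec_in_chart\<close>.\<close>

definition tangent_vec :: "('p, 'e::euclidean_space) acm \<Rightarrow> 'p \<Rightarrow> ('p, 'e) chart \<Rightarrow> 'e \<Rightarrow> ('p, 'e) tvec" where
 "tangent_vec M p c w = (\<lambda>c'. if c' \<in> charts_at M p then chart_deriv (\<lambda>x. x) c c' p w else 0)"

section \<open>Tangent vectors determined by one coordinate vector\<close>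

context c1_manifold
begin

lemma chart_deriv_id_compose:
 assumes "c \<in> charts_at M p" "c' \<in> charts_at M p" "c'' \<in> charts_at M p" "v \<in> model M"
 shows "chart_deriv (\<lambda>x. x) c c'' p v = chart_deriv (\<lambda>x. x) c' c'' p (chart_deriv (\<lambda>x. x) c c' p v)"
 using chart_deriv_compose[OF tr.c1_map_axioms tr.c1_map_axioms tr.c1_map_axioms _ assms] by simp

lemma chart_deriv_self:
 assumes c: "c \<in> charts_at M p" and v: "v \<in> model M"
 shows "chart_deriv (\<lambda>x. x) c c p v = v"
proof -
 note cc = charts_atD[OF c] and pS = tr.chart_dom_mem[OF c c]
 have "(chart_rep (\<lambda>x. x) c c has_derivative (\<lambda>v. v)) (at (snd c p) within chart_dom (\<lambda>x. x) c c)"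
  by (rule has_derivative_transform[OF pS _ has_derivative_ident])
   (use cc in \<open>auto simp: chart_dom_def chart_rep_def\<close>)
 from tr.chart_deriv_unique[OF c c v this tr.chart_dom_open(2)[OF cc(1) cc(1)] pS] show ?thesis by simp
qed

lemma tangent_space_iff:
 "v \<in> \<T> M p \<longleftrightarrow> (\<forall>c. c \<notin> charts_at M p \<longrightarrow> v c = 0) \<and>
   (\<forall>c\<in>charts_at M p. v c \<in> model M) \<and>
   (\<forall>c\<in>charts_at M p. \<forall>c'\<in>charts_at M p. v c' = chart_deriv (\<lambda>x. x) c c' p (v c))"
 unfolding tangent_space_def mem_Collect_eq using tr.ex_derivative_iff by (intro conj_cong refl) (simp add: o_def)

lemma tangent_spaceD:
 assumes "v \<in> \<T> M p"
 shows "c \<notin> charts_at M p \<Longrightarrow> v c = 0"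
  and "c \<in> charts_at M p \<Longrightarrow> v c \<in> model M"
  and "\<lbrakk>c \<in> charts_at M p; c' \<in> charts_at M p\<rbrakk> \<Longrightarrow> v c' = chart_deriv (\<lambda>x. x) c c' p (v c)"
 using assms unfolding tangent_space_iff by blast+

lemma tangent_vec_in:
 assumes c: "c \<in> charts_at M p" and w: "w \<in> model M"
 shows "tangent_vec M p c w \<in> \<T> M p" and "tangent_vec M p c w c = w"
proof -
 show "tangent_vec M p c w \<in> \<T> M p" unfolding tangent_space_iff
 proof (intro conjI ballI allI impI)
  fix c' assume c': "c' \<in> charts_at M p"
  show "tangent_vec M p c w c' \<in> model M" using tr.chart_deriv_in_model[OF c c' w] c' by (simp add: tangent_vec_def)
  fix c'' assume c'': "c'' \<in> charts_at M p"
  show "tangent_vec M p c w c'' = chart_deriv (\<lambda>x. x) c' c'' p (tangent_vec M p c w c')"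
   using chart_deriv_id_compose[OF c c' c'' w] c' c'' by (simp add: tangent_vec_def)
 qed (simp add: tangent_vec_def)
 show "tangent_vec M p c w c = w" using chart_deriv_self[OF c w] c by (simp add: tangent_vec_def)
qed

lemma tangent_eqI:
 assumes v: "v \<in> \<T> M p" and v': "v' \<in> \<T> M p"
  and c: "c \<in> charts_at M p" and eq: "v c = v' c"
 shows "v = v'"
proof
 fix c'
 show "v c' = v' c'" using tangent_spaceD(1)[OF v, of c'] tangent_spaceD(1)[OF v', of c']
   tangent_spaceD(3)[OF v c, of c'] tangent_spaceD(3)[OF v' c, of c'] eq by (cases "c' \<in> charts_at M p") simp_all
qed

lemma tvec_in_chart_eq:
 assumes c: "c \<in> charts_at M p" and w: "w \<in> model M"
 shows "tvec_in_chart M p c w = tangent_vec M p c w" unfolding tvec_in_chart_def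
 by (rule the_equality) (use tangent_vec_in[OF c w] tangent_eqI[OF _ _ c] in auto)

lemma tangent_add:
 assumes "v \<in> \<T> M p" "w \<in> \<T> M p"
 shows "(\<lambda>c. v c + w c) \<in> \<T> M p" unfolding tangent_space_iff
proof (intro conjI ballI allI impI)
 fix c assume "c \<notin> charts_at M p"
 then show "v c + w c = 0" using tangent_spaceD(1)[OF assms(1)] tangent_spaceD(1)[OF assms(2)] by simp
next
 fix c assume c: "c \<in> charts_at M p"
 show "v c + w c \<in> model M"
  by (intro subspace_add subspace_model tangent_spaceD(2)[OF assms(1) c] tangent_spaceD(2)[OF assms(2) c])
 fix c' assume c': "c' \<in> charts_at M p"
 show "v c' + w c' = chart_deriv (\<lambda>x. x) c c' p (v c + w c)"
  using tangent_spaceD(3)[OF assms(1) c c'] tangent_spaceD(3)[OF assms(2) c c'] tr.chart_deriv_linear(1)[OF c c'] by simp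
qed

lemma tangent_scaleR:
 assumes "v \<in> \<T> M p"
 shows "(\<lambda>c. r *\<^sub>R v c) \<in> \<T> M p" unfolding tangent_space_iff
proof (intro conjI ballI allI impI)
 fix c assume "c \<notin> charts_at M p"
 then show "r *\<^sub>R v c = 0" using tangent_spaceD(1)[OF assms(1)] by simp
next
 fix c assume c: "c \<in> charts_at M p"
 show "r *\<^sub>R v c \<in> model M" by (intro subspace_scale subspace_model tangent_spaceD(2)[OF assms(1) c])
 fix c' assume c': "c' \<in> charts_at M p"
 show "r *\<^sub>R v c' = chart_deriv (\<lambda>x. x) c c' p (r *\<^sub>R v c)"
  using tangent_spaceD(3)[OF assms(1) c c'] tr.chart_deriv_linear(2)[OF c c'] by simp
qed

lemma tangent_zero: "(\<lambda>c. 0) \<in> \<T> M p"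
proof (cases "p \<in> points M")
 case True
 then obtain c where "c \<in> charts_at M p" using charts_at_nonempty by blast
 from tangent_scaleR[OF tangent_vec_in(1)[OF this], of 0 0] subspace_0[OF subspace_model]
 show ?thesis by simp
next
 case False
 then have "charts_at M p = {}" using charts_atD(3) by blast
 then show ?thesis by (simp add: tangent_space_iff)
qed

end

section \<open>Tangent maps\<close>

context c1_map
begin

text \<open>Both sides equal \<open>chart_deriv F b c' p (v b)\<close>, by the chain rule with a
  transition map before or after \<open>F\<close>. Hence the description in
  \<open>tangent_map\<close> has a solution.\<close>

lemma chart_deriv_consistent:
 assumes v: "v \<in> \<T> M p"
  and b: "b \<in> charts_at M p" "b' \<in> charts_at M p" and c: "c \<in> charts_at N (F p)" "c' \<in> charts_at N (F p)"
 shows "chart_deriv F b' c' p (v b') = chart_deriv (\<lambda>x. x) c c' (F p) (chart_deriv F b c p (v b))"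
proof -
 have vb: "v b \<in> model M" using M.tangent_spaceD(2)[OF v b(1)] .
 have "chart_deriv F b' c' p (v b') = chart_deriv F b' c' p (chart_deriv (\<lambda>x. x) b b' p (v b))"
  using M.tangent_spaceD(3)[OF v b] by simp
 also have "\<dots> = chart_deriv F b c' p (v b)"
  using chart_deriv_compose[OF M.tr.c1_map_axioms c1_map_axioms c1_map_axioms _ b c(2) vb] by simp
 also have "\<dots> = chart_deriv (\<lambda>x. x) c c' (F p) (chart_deriv F b c p (v b))"
  using chart_deriv_compose[OF c1_map_axioms N.tr.c1_map_axioms c1_map_axioms _ b(1) c vb] by simp
 finally show ?thesis .
qed

context
 fixes p v assumes p: "p \<in> points M" and v: "v \<in> \<T> M p"
begin

lemma tangent_in: "tangent_map M N F p v \<in> \<T> N (F p)"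
 and tangent_chart: "\<lbrakk>b \<in> charts_at M p; c \<in> charts_at N (F p)\<rbrakk> \<Longrightarrow> tangent_map M N F p v c = chart_deriv F b c p (v b)"
proof -
 obtain b0 where b0: "b0 \<in> charts_at M p" using M.charts_at_nonempty[OF p] by blast
 obtain c0 where c0: "c0 \<in> charts_at N (F p)" using N.charts_at_nonempty[OF maps_points[OF p]] by blast
 let ?P = "\<lambda>w. w \<in> \<T> N (F p) \<and>
   (\<forall>b\<in>charts_at M p. \<forall>c\<in>charts_at N (F p). w c = chart_deriv F b c p (v b))"
 have vb: "v b \<in> model M" if "b \<in> charts_at M p" for b using M.tangent_spaceD(2)[OF v that] .
 define w where "w = tangent_vec N (F p) c0 (chart_deriv F b0 c0 p (v b0))"
 have "w \<in> \<T> N (F p)" unfolding w_def by (rule N.tangent_vec_in[OF c0 chart_deriv_in_model[OF b0 c0 vb[OF b0]]])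
 moreover have "w c = chart_deriv F b c p (v b)" if "b \<in> charts_at M p" "c \<in> charts_at N (F p)" for b c
  using chart_deriv_consistent[OF v b0 that(1) c0 that(2)] that by (simp add: w_def tangent_vec_def)
 ultimately have P: "?P w" by blast
 have "tangent_map M N F p v = (THE w. ?P w)" unfolding tangent_map_def using ex_derivative_iff[OF _ _ vb]
  by (intro arg_cong[of _ _ The] ext conj_cong refl) blast
 also have "\<dots> = w"
 proof (rule the_equality)
  show "?P w" by (rule P)
  fix w' assume w': "?P w'"
  show "w' = w" by (rule N.tangent_eqI[OF _ _ c0]) (use P w' b0 c0 in \<open>auto simp del: split_paired_All\<close>)
 qed
 finally have "?P (tangent_map M N F p v)" using P by simp
 then show "tangent_map M N F p v \<in> \<T> N (F p)"
  "\<lbrakk>b \<in> charts_at M p; c \<in> charts_at N (F p)\<rbrakk> \<Longrightarrow> tangent_map M N F p v c = chart_deriv F b c p (v b)"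
  by blast+
qed

lemma tangent_map_eqI:
 assumes "w \<in> \<T> N (F p)" "b \<in> charts_at M p" "c \<in> charts_at N (F p)" "w c = chart_deriv F b c p (v b)"
 shows "tangent_map M N F p v = w"
 by (rule N.tangent_eqI[OF tangent_in assms(1,3)]) (simp add: tangent_chart[OF assms(2,3)] assms(4))

end

lemma tangent_map_linear:
 assumes p: "p \<in> points M" and v: "v \<in> \<T> M p"
 shows "w \<in> \<T> M p \<Longrightarrow>
   tangent_map M N F p (\<lambda>c. v c + w c) = (\<lambda>c. tangent_map M N F p v c + tangent_map M N F p w c)"
  and "tangent_map M N F p (\<lambda>c. r *\<^sub>R v c) = (\<lambda>c. r *\<^sub>R tangent_map M N F p v c)"
proof -
 obtain b where b: "b \<in> charts_at M p" using M.charts_at_nonempty[OF p] by blast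
 obtain c where c: "c \<in> charts_at N (F p)" using N.charts_at_nonempty[OF maps_points[OF p]] by blast
 note T = tangent_in[OF p] and Tc = tangent_chart[OF p _ b c] and lin = chart_deriv_linear[OF b c]
 show "tangent_map M N F p (\<lambda>c. v c + w c) = (\<lambda>c. tangent_map M N F p v c + tangent_map M N F p w c)"
  if w: "w \<in> \<T> M p" by (rule tangent_map_eqI[OF p M.tangent_add[OF v w] N.tangent_add[OF T[OF v] T[OF w]] b c])
   (simp add: Tc[OF v] Tc[OF w] lin)
 show "tangent_map M N F p (\<lambda>c. r *\<^sub>R v c) = (\<lambda>c. r *\<^sub>R tangent_map M N F p v c)"
  by (rule tangent_map_eqI[OF p M.tangent_scaleR[OF v] N.tangent_scaleR[OF T[OF v]] b c])
   (simp add: Tc[OF v] lin)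
qed

end

lemma tangent_map_compose:
 assumes F: "c1_map M N F" and G: "c1_map N L G" and H: "c1_map M L H"
  and H_eq: "\<And>x. x \<in> points M \<Longrightarrow> H x = G (F x)"
  and p: "p \<in> points M" and v: "v \<in> \<T> M p"
 shows "tangent_map M L H p v = tangent_map N L G (F p) (tangent_map M N F p v)"
proof -
 interpret F: c1_map M N F by fact
 interpret G: c1_map N L G by fact
 interpret H: c1_map M L H by fact
 have Fp: "F p \<in> points N" using F.maps_points[OF p] .
 obtain b where b: "b \<in> charts_at M p" using F.M.charts_at_nonempty[OF p] by blast
 obtain c where c: "c \<in> charts_at N (F p)" using F.N.charts_at_nonempty[OF Fp] by blast
 obtain d where d: "d \<in> charts_at L (H p)" using G.N.charts_at_nonempty[OF H.maps_points[OF p]] by blast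
 have d': "d \<in> charts_at L (G (F p))" using d H_eq[OF p] by simp
 note T1 = F.tangent_in[OF p v]
 show ?thesis
 proof (rule H.tangent_map_eqI[OF p v _ b d])
  show "tangent_map N L G (F p) (tangent_map M N F p v) \<in> \<T> L (H p)" using G.tangent_in[OF Fp T1] H_eq[OF p] by simp
  show "tangent_map N L G (F p) (tangent_map M N F p v) d = chart_deriv H b d p (v b)"
   using G.tangent_chart[OF Fp T1 c d'] F.tangent_chart[OF p v b c]
    chart_deriv_compose[OF F G H H_eq b c d F.M.tangent_spaceD(2)[OF v b]] by simp
 qed
qed

lemma tangent_map_eq_id:
 assumes "c1_map M M F" and eq: "\<And>x. x \<in> points M \<Longrightarrow> F x = x" and p: "p \<in> points M" and v: "v \<in> \<T> M p"
 shows "tangent_map M M F p v = v"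
proof -
 interpret c1_map M M F by fact
 obtain b where b: "b \<in> charts_at M p" using M.charts_at_nonempty[OF p] by blast
 note vb = M.tangent_spaceD(2)[OF v b]
 show ?thesis
 proof (rule tangent_map_eqI[OF p v _ b])
  show "v b = chart_deriv F b b p (v b)"
   using chart_deriv_compose[OF M.tr.c1_map_axioms M.tr.c1_map_axioms c1_map_axioms _ b b _ vb, of b] eq b p vb
   by (simp add: M.chart_deriv_self)
 qed (use v b eq[OF p] in simp_all)
qed

subsection \<open>Velocities of curves\<close>

definition velocity :: "('p, 'e::euclidean_space) acm \<Rightarrow> (real \<Rightarrow> 'p) \<Rightarrow> ('p, 'e) tvec \<Rightarrow> bool" where
 "velocity M \<gamma> v \<longleftrightarrow> (\<forall>c\<in>charts_at M (\<gamma> 0). ((snd c \<circ> \<gamma>) has_vector_derivative v c) (at 0))"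

text \<open>On the side of \<open>M\<close> a derivative in one chart is enough. With the identity
  for \<open>F\<close> this shows that a velocity may be checked in one chart.\<close>

lemma (in c1_map) velocity_image_chart:
 assumes \<gamma>: "cmap euclidean (mtop M) \<gamma>" and v: "v \<in> \<T> M (\<gamma> 0)"
  and b: "b \<in> charts_at M (\<gamma> 0)" and vel: "((snd b \<circ> \<gamma>) has_vector_derivative v b) (at 0)"
 shows "velocity N (\<lambda>t. F (\<gamma> t)) (tangent_map M N F (\<gamma> 0) v)" unfolding velocity_def
proof
 fix c assume c: "c \<in> charts_at N (F (\<gamma> 0))"
 note bb = M.charts_atD[OF b] and cc = N.charts_atD[OF c]
 define T where "T = {t. \<gamma> t \<in> fst b \<inter> F -` fst c}"
 have "openin euclidean T"
  unfolding T_def using openin_continuous_map_preimage[OF \<gamma> chart_dom_open(1)[OF bb(1) cc(1)]] by simp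
 then have T: "open T" by simp
 have T0: "0 \<in> T" using bb cc by (simp add: T_def)
 have "((\<lambda>t. chart_rep F b c ((snd b \<circ> \<gamma>) t)) has_vector_derivative chart_deriv F b c (\<gamma> 0) (v b)) (at 0)"
  by (rule has_vector_derivative_curve[OF _ vel T T0])
   (use chart_deriv[OF b c] in \<open>auto simp: T_def chart_dom_def\<close>)
 then have "((\<lambda>t. snd c (F (\<gamma> t))) has_vector_derivative chart_deriv F b c (\<gamma> 0) (v b)) (at 0)"
  by (rule has_vector_derivative_transform_within_open[OF _ T T0])
   (use bb(1) in \<open>simp add: T_def chart_rep_def\<close>)
 then show "((snd c \<circ> (\<lambda>t. F (\<gamma> t))) has_vector_derivative tangent_map M N F (\<gamma> 0) v c) (at 0)"
  using tangent_chart[OF bb(3) v b c] by (simp add: o_def)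
qed

lemma (in c1_map) velocity_image:
 assumes \<gamma>: "cmap euclidean (mtop M) \<gamma>" and v: "v \<in> \<T> M (\<gamma> 0)" and vel: "velocity M \<gamma> v"
 shows "velocity N (\<lambda>t. F (\<gamma> t)) (tangent_map M N F (\<gamma> 0) v)"
proof -
 have "\<gamma> 0 \<in> points M" using continuous_map_mem[OF \<gamma>] by simp
 then obtain b where "b \<in> charts_at M (\<gamma> 0)" using M.charts_at_nonempty by blast
 then show ?thesis using velocity_image_chart[OF \<gamma> v] vel by (simp add: velocity_def)
qed

lemma (in c1_manifold) velocity_chartI:
 assumes "cmap euclidean (mtop M) \<gamma>" "v \<in> \<T> M (\<gamma> 0)"
  "b \<in> charts_at M (\<gamma> 0)" "((snd b \<circ> \<gamma>) has_vector_derivative v b) (at 0)"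
 shows "velocity M \<gamma> v"
 using tr.velocity_image_chart[OF assms] tangent_map_eq_id[OF tr.c1_map_axioms refl charts_atD(3)[OF assms(3)] assms(2)] by simp

lemma (in c1_manifold) velocity_unique:
 assumes "velocity M \<gamma> v" "velocity M \<gamma> w" "v \<in> \<T> M (\<gamma> 0)" "w \<in> \<T> M (\<gamma> 0)"
  "\<gamma> 0 \<in> points M"
 shows "v = w"
proof -
 obtain c where c: "c \<in> charts_at M (\<gamma> 0)" using charts_at_nonempty assms(5) by blast
 have "((snd c \<circ> \<gamma>) has_vector_derivative v c) (at 0)" "((snd c \<circ> \<gamma>) has_vector_derivative w c) (at 0)"
  using assms(1,2) c by (simp_all add: velocity_def)
 then have "v c = w c" by (rule vector_derivative_unique_at)
 then show ?thesis by (rule tangent_eqI[OF assms(3,4) c])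
qed

lemma tangent_subspace_iff:
 "v \<in> tangent_subspace M Z p \<longleftrightarrow> v \<in> \<T> M p \<and>
   (\<exists>\<gamma>. cmap euclidean (mtop M) \<gamma> \<and> range \<gamma> \<subseteq> Z \<and> \<gamma> 0 = p \<and> velocity M \<gamma> v)"
 unfolding tangent_subspace_def velocity_def by (auto simp: into_sub image_subset_iff cong: conj_cong)

subsection \<open>The topology of the tangent bundle\<close>

context c1_manifold
begin

lemma topspace_tangent_topology:
 "topspace (\<TT> M) = Sigma (points M) (\<T> M)" (is "?L = ?R")
proof
 show "?L \<subseteq> ?R" using chart_subset by (fastforce simp: tangent_topology_def)
 show "?R \<subseteq> ?L"
 proof
  fix q assume "q \<in> ?R"
  then obtain p v where q: "q = (p, v)" "p \<in> points M" "v \<in> \<T> M p" by blast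
  obtain c where c: "c \<in> charts_at M p" using charts_at_nonempty[OF q(2)] by blast
  let ?B = "{(p, v). p \<in> fst c \<and> v \<in> \<T> M p \<and> (snd c p, v c) \<in> UNIV}"
  have "q \<in> ?B" using q charts_atD(2)[OF c] by simp
  moreover have "?B \<in> {{(p, v). p \<in> fst c \<and> v \<in> \<T> M p \<and> (snd c p, v c) \<in> W} | c W. c \<in> atlas M \<and> open W}"
   using charts_atD(1)[OF c] open_UNIV by blast
  ultimately show "q \<in> ?L" unfolding tangent_topology_def topology_generated_by_topspace by blast
 qed
qed

lemma openin_tangent_topology_basic:
 assumes "c \<in> atlas M" "open W"
 shows "openin (\<TT> M) {(p, v). p \<in> fst c \<and> v \<in> \<T> M p \<and> (snd c p, v c) \<in> W}"
 unfolding tangent_topology_def by (rule topology_generated_by_Basis) (use assms in blast)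

lemma continuous_map_tangent_fst: "cmap (\<TT> M) (mtop M) fst" unfolding continuous_map_def
proof (intro conjI allI impI)
 show "fst \<in> topspace (\<TT> M) \<rightarrow> points M" by (auto simp: topspace_tangent_topology)
 fix U assume U: "openin (mtop M) U"
 show "openin (\<TT> M) {q \<in> topspace (\<TT> M). fst q \<in> U}"
 proof (subst openin_subopen, rule ballI)
  fix q assume "q \<in> {q \<in> topspace (\<TT> M). fst q \<in> U}"
  then obtain p v where q: "q = (p, v)" "p \<in> points M" "v \<in> \<T> M p" "p \<in> U" by (auto simp: topspace_tangent_topology)
  obtain c where c: "c \<in> charts_at M p" using charts_at_nonempty[OF q(2)] by blast
  note cc = charts_atD[OF c]
  have "openin (top_of_set (model M)) (snd c ` (fst c \<inter> U))"
   by (rule chart_open_image[OF cc(1)]) (use chart_open[OF cc(1)] U in auto)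
  then obtain W where W: "open W" "snd c ` (fst c \<inter> U) = model M \<inter> W" by (auto simp: openin_open)
  let ?B = "{(p, v). p \<in> fst c \<and> v \<in> \<T> M p \<and> (snd c p, v c) \<in> W \<times> UNIV}"
  have "openin (\<TT> M) ?B" by (rule openin_tangent_topology_basic[OF cc(1)]) (simp add: open_Times W)
  moreover have "q \<in> ?B" using q cc W by auto
  moreover have "?B \<subseteq> {q \<in> topspace (\<TT> M). fst q \<in> U}"
  proof clarify
   fix x w assume x: "x \<in> fst c" "w \<in> \<T> M x" "snd c x \<in> W"
   then have "snd c x \<in> snd c ` (fst c \<inter> U)" using W chart_in_model[OF cc(1)] by blast
   then have "x \<in> U" using inj_onD[OF chart_inj[OF cc(1)]] x(1) by blast
   then show "(x, w) \<in> topspace (\<TT> M) \<and> fst (x, w) \<in> U"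
    using x chart_subset[OF cc(1)] by (auto simp: topspace_tangent_topology)
  qed
  ultimately show "\<exists>T. openin (\<TT> M) T \<and> q \<in> T \<and> T \<subseteq> {q \<in> topspace (\<TT> M). fst q \<in> U}"
   by blast
 qed
qed

lemma continuous_map_tangent_chart:
 assumes c: "c \<in> atlas M"
 shows "cmap (subtopology (\<TT> M) {q. fst q \<in> fst c}) euclidean (\<lambda>q. snd q c)" unfolding continuous_map_def
proof (intro conjI allI impI)
 fix U :: "'e set" assume "openin euclidean U"
 then have U: "open U" by simp
 have "openin (\<TT> M) {(p, v). p \<in> fst c \<and> v \<in> \<T> M p \<and> (snd c p, v c) \<in> UNIV \<times> U}"
  by (rule openin_tangent_topology_basic[OF c]) (simp add: open_Times U)
 moreover have "{x \<in> topspace (subtopology (\<TT> M) {q. fst q \<in> fst c}). snd x c \<in> U} =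
   {(p, v). p \<in> fst c \<and> v \<in> \<T> M p \<and> (snd c p, v c) \<in> UNIV \<times> U}"
  using chart_subset[OF c] by (auto simp: topspace_tangent_topology)
 ultimately show "openin (subtopology (\<TT> M) {q. fst q \<in> fst c})
   {x \<in> topspace (subtopology (\<TT> M) {q. fst q \<in> fst c}). snd x c \<in> U}" by (auto simp: openin_subtopology)
qed simp

text \<open>A basic open set tests the pair of base coordinates and vector coordinates in one chart;
  the former are continuous with the base point, so only the latter need attention.\<close>

lemma continuous_map_into_tangent_iff:
 "cmap T (\<TT> M) f \<longleftrightarrow>
   (\<forall>t\<in>topspace T. snd (f t) \<in> \<T> M (fst (f t))) \<and>
   cmap T (mtop M) (\<lambda>t. fst (f t)) \<and>
   (\<forall>c\<in>atlas M. cmap (subtopology T {t. fst (f t) \<in> fst c}) euclidean (\<lambda>t. snd (f t) c))"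
 (is "?L \<longleftrightarrow> ?R1 \<and> ?R2 \<and> ?R3")
proof
 assume L: ?L
 have ?R1
 proof
  fix t assume "t \<in> topspace T"
  from continuous_map_mem[OF L this] show "snd (f t) \<in> \<T> M (fst (f t))"
   unfolding topspace_tangent_topology by (cases "f t") simp
 qed
 moreover have ?R2 using continuous_map_compose[OF L continuous_map_tangent_fst] by (simp add: o_def)
 moreover have ?R3
 proof
  fix c assume c: "c \<in> atlas M"
  have "cmap (subtopology T {t. fst (f t) \<in> fst c}) (subtopology (\<TT> M) {q. fst q \<in> fst c}) f"
   using L by (auto simp: into_sub from_sub)
  from continuous_map_compose[OF this continuous_map_tangent_chart[OF c]]
  show "cmap (subtopology T {t. fst (f t) \<in> fst c}) euclidean (\<lambda>t. snd (f t) c)" by (simp add: o_def)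
 qed
 ultimately show "?R1 \<and> ?R2 \<and> ?R3" by blast
next
 assume R: "?R1 \<and> ?R2 \<and> ?R3"
 let ?S = "{{(p, v). p \<in> fst c \<and> v \<in> \<T> M p \<and> (snd c p, v c) \<in> W} | c W. c \<in> atlas M \<and> open W}"
 have tt: "topspace (\<TT> M) = \<Union>?S" by (simp add: tangent_topology_def)
 show ?L unfolding tangent_topology_def continuous_on_generated_topo_iff
 proof (intro conjI allI impI)
  show "f ` topspace T \<subseteq> \<Union>?S"
  proof (rule image_subsetI)
   fix t assume t: "t \<in> topspace T"
   have "fst (f t) \<in> points M" using R t continuous_map_mem[of T "mtop M" "\<lambda>t. fst (f t)"] by simp
   moreover have "snd (f t) \<in> \<T> M (fst (f t))" using R t by simp
   ultimately show "f t \<in> \<Union>?S" unfolding tt[symmetric] topspace_tangent_topology by (cases "f t") simp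
  qed
  fix B assume "B \<in> ?S"
  then obtain c W where B: "B = {(p, v). p \<in> fst c \<and> v \<in> \<T> M p \<and> (snd c p, v c) \<in> W}"
   and c: "c \<in> atlas M" and W: "open W" by blast
  let ?T = "subtopology T {t. fst (f t) \<in> fst c}"
  have o: "openin T {t \<in> topspace T. fst (f t) \<in> fst c}"
   using openin_continuous_map_preimage[of T "mtop M" "\<lambda>t. fst (f t)"] R chart_open[OF c] by simp
  have "cmap ?T (top_on M (fst c)) (\<lambda>t. fst (f t))" using R by (auto simp: into_sub from_sub)
  from continuous_map_compose[OF this continuous_chart[OF c]]
  have "cmap ?T euclidean (\<lambda>t. snd c (fst (f t)))" by (simp add: o_def)
  moreover have "cmap ?T euclidean (\<lambda>t. snd (f t) c)" using R c by simp
  ultimately have "cmap ?T euclidean (\<lambda>t. (snd c (fst (f t)), snd (f t) c))" by (simp add: continuous_map_atin tendsto_Pair)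
  from openin_continuous_map_preimage[OF this, of W] W
  have "openin ?T {t \<in> topspace ?T. (snd c (fst (f t)), snd (f t) c) \<in> W}" by simp
  also have "{t \<in> topspace ?T. (snd c (fst (f t)), snd (f t) c) \<in> W} = f -` B \<inter> topspace T"
   using R by (auto simp: B case_prod_unfold)
  finally have "openin ?T (f -` B \<inter> topspace T)" .
  then obtain O' where O': "openin T O'" "f -` B \<inter> topspace T = O' \<inter> {t. fst (f t) \<in> fst c}"
   by (auto simp: openin_subtopology)
  have "O' \<inter> {t. fst (f t) \<in> fst c} = O' \<inter> {t \<in> topspace T. fst (f t) \<in> fst c}"
   using openin_subset[OF O'(1)] by blast
  then show "openin T (f -` B \<inter> topspace T)" using O' openin_Int[OF O'(1) o] by simp
 qed
qed

text \<open>Near each parameter a single chart is enough: the coordinates in another chart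
  \<open>c'\<close> arise from those in \<open>c\<close> by derivatives of transition maps, which
  depend continuously on the point.\<close>

lemma continuous_map_into_tangentI:
 assumes v: "\<And>t. t \<in> topspace T \<Longrightarrow> v t \<in> \<T> M (x t)"
  and x: "cmap T (mtop M) x"
  and loc: "\<And>t. t \<in> topspace T \<Longrightarrow> \<exists>U c. openin T U \<and> t \<in> U \<and> c \<in> atlas M \<and> x ` U \<subseteq> fst c \<and>
    cmap (subtopology T U) euclidean (\<lambda>t. v t c)"
 shows "cmap T (\<TT> M) (\<lambda>t. (x t, v t))" unfolding continuous_map_into_tangent_iff fst_conv snd_conv
proof (intro conjI ballI v x)
 fix c' assume c': "c' \<in> atlas M"
 let ?T' = "subtopology T {t. x t \<in> fst c'}"
 show "cmap ?T' euclidean (\<lambda>t. v t c')"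
 proof (rule continuous_map_locally)
  fix t0 assume t0: "t0 \<in> topspace ?T'"
  then obtain U c where U: "openin T U" "t0 \<in> U" and c: "c \<in> atlas M" and xU: "x ` U \<subseteq> fst c"
   and cont: "cmap (subtopology T U) euclidean (\<lambda>t. v t c)" using loc[of t0] by auto
  define V where "V = U \<inter> {t. x t \<in> fst c'}"
  let ?TV = "subtopology T V"
  have UT: "U \<subseteq> topspace T" using U openin_subset by blast
  have VT: "t \<in> topspace ?TV \<longleftrightarrow> t \<in> V" for t using UT by (auto simp: V_def)
  have ch: "c \<in> charts_at M (x t)" "c' \<in> charts_at M (x t)" if "t \<in> V" for t
   using that xU c c' by (auto simp: charts_at_def V_def)
  have vm: "v t c \<in> model M" if "t \<in> V" for t using tangent_spaceD(2)[OF v ch(1)[OF that]] that UT by (auto simp: V_def)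
  have xc: "cmap ?TV (top_on M (fst c \<inter> (\<lambda>x. x) -` fst c')) x" using x xU by (auto simp: into_sub from_sub V_def)
  have "cmap ?TV euclidean (\<lambda>t. chart_deriv (\<lambda>x. x) c c' (x t) (v t c))"
  proof (rule continuous_map_linear_family[where L = "\<lambda>t. chart_deriv (\<lambda>x. x) c c' (x t)" and w = "\<lambda>t. v t c",
     OF subspace_model])
   fix t w w' r assume "t \<in> topspace ?TV"
   then have t: "t \<in> V" by (simp only: VT)
   then show "v t c \<in> model M" by (rule vm)
   show "chart_deriv (\<lambda>x. x) c c' (x t) (w + w') = chart_deriv (\<lambda>x. x) c c' (x t) w + chart_deriv (\<lambda>x. x) c c' (x t) w'"
    "chart_deriv (\<lambda>x. x) c c' (x t) (r *\<^sub>R w) = r *\<^sub>R chart_deriv (\<lambda>x. x) c c' (x t) w"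
    using tr.chart_deriv_linear[OF ch[OF t]] by blast+
  next
   fix w assume w: "w \<in> model M"
   show "cmap ?TV euclidean (\<lambda>t. chart_deriv (\<lambda>x. x) c c' (x t) w)"
    using continuous_map_compose[OF xc tr.continuous_chart_deriv[OF c c' w]] by (simp only: o_def)
  next
   show "cmap ?TV euclidean (\<lambda>t. v t c)" by (rule continuous_map_from_subtopology_mono[OF cont]) (simp add: V_def)
  qed
  then have "cmap ?TV euclidean (\<lambda>t. v t c')"
  proof (rule continuous_map_eq)
   fix t assume "t \<in> topspace ?TV"
   then have t: "t \<in> V" by (simp only: VT)
   show "chart_deriv (\<lambda>x. x) c c' (x t) (v t c) = v t c'"
    using tangent_spaceD(3)[OF v ch[OF t], symmetric] t UT by (auto simp: V_def)
  qed
  moreover have "subtopology ?T' V = ?TV" by (simp add: subtopology_subtopology V_def Int_ac)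
  moreover have "openin ?T' V" using U by (auto simp: openin_subtopology V_def)
  moreover have "t0 \<in> V" using t0 U by (simp add: V_def)
  ultimately show "\<exists>U. openin ?T' U \<and> t0 \<in> U \<and> cmap (subtopology ?T' U) euclidean (\<lambda>t. v t c')"
   by (intro exI[of _ V]) simp
 qed
qed

lemma continuous_map_tangent_add:
 assumes f: "cmap T (\<TT> M) (\<lambda>t. (x t, v t))"
  and g: "cmap T (\<TT> M) (\<lambda>t. (x t, w t))"
 shows "cmap T (\<TT> M) (\<lambda>t. (x t, \<lambda>c. v t c + w t c))"
 using f g tangent_add unfolding continuous_map_into_tangent_iff fst_conv snd_conv by (simp add: continuous_map_add)

lemma continuous_map_tangent_scaleR:
 assumes f: "cmap T (\<TT> M) (\<lambda>t. (x t, v t))"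
 shows "cmap T (\<TT> M) (\<lambda>t. (x t, \<lambda>c. r *\<^sub>R v t c))"
 using f tangent_scaleR unfolding continuous_map_into_tangent_iff fst_conv snd_conv
 by (simp add: continuous_map_atin tendsto_scaleR)

lemma continuous_map_tangent_zero:
 assumes x: "cmap T (mtop M) x"
 shows "cmap T (\<TT> M) (\<lambda>t. (x t, \<lambda>c. 0))"
 using x tangent_zero unfolding continuous_map_into_tangent_iff fst_conv snd_conv by simp

lemma continuous_map_tangent_vec:
 assumes c: "c \<in> atlas M" and w: "w \<in> model M"
 shows "cmap (top_on M (fst c)) (\<TT> M) (\<lambda>p. (p, tangent_vec M p c w))"
proof (rule continuous_map_into_tangentI)
 let ?T = "top_on M (fst c)"
 show "cmap ?T (mtop M) (\<lambda>p. p)" using continuous_map_id_subt[of "mtop M" "fst c"] by (simp add: id_def)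
 fix p assume "p \<in> topspace ?T"
 then have p: "p \<in> fst c" by simp
 then have "c \<in> charts_at M p" using c by (simp add: charts_at_def)
 then show "tangent_vec M p c w \<in> \<T> M p" by (rule tangent_vec_in[OF _ w])
 have ts: "topspace ?T = fst c" using chart_subset[OF c] by auto
 have "cmap (subtopology ?T (fst c)) euclidean (\<lambda>p. tangent_vec M p c w c)"
  by (rule continuous_map_eq[of _ _ "\<lambda>_. w"])
   (use tangent_vec_in(2)[OF _ w, of c] c in \<open>auto simp: charts_at_def\<close>)
 then show "\<exists>U c'. openin ?T U \<and> p \<in> U \<and> c' \<in> atlas M \<and> (\<lambda>p. p) ` U \<subseteq> fst c' \<and>
    cmap (subtopology ?T U) euclidean (\<lambda>p. tangent_vec M p c w c')"
  using p c ts openin_topspace[of ?T] by (intro exI[of _ "fst c"] exI[of _ c]) simp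
qed

end

lemma (in c1_map) continuous_map_tangent_map:
 assumes f: "cmap T (\<TT> M) (\<lambda>t. (x t, v t))"
 shows "cmap T (\<TT> N) (\<lambda>t. (F (x t), tangent_map M N F (x t) (v t)))"
proof -
 have x: "cmap T (mtop M) x" and v: "\<And>t. t \<in> topspace T \<Longrightarrow> v t \<in> \<T> M (x t)"
  and vc: "\<And>c. c \<in> atlas M \<Longrightarrow> cmap (subtopology T {t. x t \<in> fst c}) euclidean (\<lambda>t. v t c)"
  using f unfolding M.continuous_map_into_tangent_iff fst_conv snd_conv by blast+
 have xp: "x t \<in> points M" if "t \<in> topspace T" for t using continuous_map_mem[OF x that] .
 show ?thesis
 proof (rule N.continuous_map_into_tangentI)
  show "tangent_map M N F (x t) (v t) \<in> \<T> N (F (x t))" if "t \<in> topspace T" for t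
   by (rule tangent_in[OF xp[OF that] v[OF that]])
  show "cmap T (mtop N) (\<lambda>t. F (x t))" using continuous_map_compose[OF x continuous] by (simp only: o_def)
  fix t0 assume t0: "t0 \<in> topspace T"
  obtain b where b: "b \<in> charts_at M (x t0)" using M.charts_at_nonempty[OF xp[OF t0]] by blast
  obtain c where c: "c \<in> charts_at N (F (x t0))" using N.charts_at_nonempty[OF maps_points[OF xp[OF t0]]] by blast
  note bb = M.charts_atD[OF b] and cc = N.charts_atD[OF c]
  define U where "U = {t \<in> topspace T. x t \<in> fst b \<inter> F -` fst c}"
  have oU: "openin T U" unfolding U_def by (rule openin_continuous_map_preimage[OF x chart_dom_open(1)[OF bb(1) cc(1)]])
  let ?TU = "subtopology T U"
  have TU: "t \<in> topspace ?TU \<longleftrightarrow> t \<in> U" for t by (auto simp: U_def)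
  have chU: "b \<in> charts_at M (x t)" "c \<in> charts_at N (F (x t))" if "t \<in> U" for t
   using that bb cc by (auto simp: U_def charts_at_def)
  have xU: "cmap ?TU (top_on M (fst b \<inter> F -` fst c)) x" using x by (auto simp: into_sub from_sub U_def)
  have "cmap ?TU euclidean (\<lambda>t. chart_deriv F b c (x t) (v t b))"
  proof (rule continuous_map_linear_family[where L = "\<lambda>t. chart_deriv F b c (x t)" and w = "\<lambda>t. v t b",
     OF M.subspace_model])
   fix t w w' r assume "t \<in> topspace ?TU"
   then have t: "t \<in> U" by (simp only: TU)
   then show "v t b \<in> model M" by (intro M.tangent_spaceD(2)[OF v chU(1)[OF t]]) (simp add: U_def)
   show "chart_deriv F b c (x t) (w + w') = chart_deriv F b c (x t) w + chart_deriv F b c (x t) w'"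
    "chart_deriv F b c (x t) (r *\<^sub>R w) = r *\<^sub>R chart_deriv F b c (x t) w"
    using chart_deriv_linear[OF chU[OF t]] by blast+
  next
   fix w assume w: "w \<in> model M"
   show "cmap ?TU euclidean (\<lambda>t. chart_deriv F b c (x t) w)"
    using continuous_map_compose[OF xU continuous_chart_deriv[OF bb(1) cc(1) w]] by (simp only: o_def)
  next
   show "cmap ?TU euclidean (\<lambda>t. v t b)" by (rule continuous_map_from_subtopology_mono[OF vc[OF bb(1)]]) (auto simp: U_def)
  qed
  then have "cmap ?TU euclidean (\<lambda>t. tangent_map M N F (x t) (v t) c)"
  proof (rule continuous_map_eq)
   fix t assume "t \<in> topspace ?TU"
   then have t: "t \<in> U" "t \<in> topspace T" by (auto simp: U_def)
   show "chart_deriv F b c (x t) (v t b) = tangent_map M N F (x t) (v t) c"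
    using tangent_chart[OF xp[OF t(2)] v[OF t(2)] chU[OF t(1)]] by simp
  qed
  moreover have "t0 \<in> U" using t0 bb cc by (simp add: U_def)
  moreover have "(\<lambda>t. F (x t)) ` U \<subseteq> fst c" by (auto simp: U_def)
  ultimately show "\<exists>U c. openin T U \<and> t0 \<in> U \<and> c \<in> atlas N \<and> (\<lambda>t. F (x t)) ` U \<subseteq> fst c \<and>
    cmap (subtopology T U) euclidean (\<lambda>t. tangent_map M N F (x t) (v t) c)"
   using oU cc(1) by (intro exI[of _ U] exI[of _ c]) simp
 qed
qed

section \<open>Almost complex structures\<close>

text \<open>The smoothness of the coefficients of \<open>acs\<close> in charts is replaced by
  continuity of \<open>acs\<close> on the total space of the tangent bundle, the form in which it
  can be composed with other maps.\<close>

locale acm_c1 = c1_manifold M for M :: "('p, 'e::euclidean_space) acm" +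
 assumes acs_in: "\<lbrakk>p \<in> points M; v \<in> \<T> M p\<rbrakk> \<Longrightarrow> acs M p v \<in> \<T> M p"
  and acs_add: "\<lbrakk>p \<in> points M; v \<in> \<T> M p; w \<in> \<T> M p\<rbrakk> \<Longrightarrow>
    acs M p (\<lambda>c. v c + w c) = (\<lambda>c. acs M p v c + acs M p w c)"
  and acs_scaleR: "\<lbrakk>p \<in> points M; v \<in> \<T> M p\<rbrakk> \<Longrightarrow>
    acs M p (\<lambda>c. r *\<^sub>R v c) = (\<lambda>c. r *\<^sub>R acs M p v c)"
  and acs_acs: "\<lbrakk>p \<in> points M; v \<in> \<T> M p\<rbrakk> \<Longrightarrow> acs M p (acs M p v) = (\<lambda>c. - v c)"
  and continuous_acs: "cmap (\<TT> M) (\<TT> M) (\<lambda>q. (fst q, acs M (fst q) (snd q)))"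

lemma (in c1_manifold) tangent_vec_linear:
 assumes c: "c \<in> charts_at M p" and w: "w \<in> model M" and w': "w' \<in> model M"
 shows "tangent_vec M p c (w + w') = (\<lambda>c'. tangent_vec M p c w c' + tangent_vec M p c w' c')"
  and "tangent_vec M p c (r *\<^sub>R w) = (\<lambda>c'. r *\<^sub>R tangent_vec M p c w c')"
 using tr.chart_deriv_linear[OF c] by (auto simp: tangent_vec_def fun_eq_iff)

lemma (in c1_manifold) tangent_vec_chart:
 assumes "c \<in> charts_at M p" "v \<in> \<T> M p"
 shows "tangent_vec M p c (v c) = v"
 using tangent_eqI[OF tangent_vec_in(1) assms(2) assms(1)] tangent_vec_in(2) assms tangent_spaceD(2) by simp

lemma compact_acm_imp_acm_c1:
 assumes "compact_acm M"
 shows "acm_c1 M"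
proof -
 have sm: "smooth_atlas M" and ac: "almost_complex_structure M" using assms by (auto simp: compact_acm_def)
 interpret c1_manifold M by (rule smooth_atlas_imp_c1_manifold[OF sm])
 have J: "acs M p v \<in> \<T> M p"
  "w \<in> \<T> M p \<Longrightarrow> acs M p (\<lambda>c. v c + w c) = (\<lambda>c. acs M p v c + acs M p w c)"
  "acs M p (\<lambda>c. r *\<^sub>R v c) = (\<lambda>c. r *\<^sub>R acs M p v c)"
  "acs M p (acs M p v) = (\<lambda>c. - v c)" if "p \<in> points M" "v \<in> \<T> M p" for p v w r
  using ac that unfolding almost_complex_structure_def by blast+
 show ?thesis
 proof
  let ?T = "\<TT> M"
  have tT: "fst q \<in> points M" "snd q \<in> \<T> M (fst q)" if "q \<in> topspace ?T" for q
   using that by (auto simp: topspace_tangent_topology)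
  show "cmap ?T ?T (\<lambda>q. (fst q, acs M (fst q) (snd q)))"
  proof (rule continuous_map_into_tangentI)
   show "acs M (fst q) (snd q) \<in> \<T> M (fst q)" if "q \<in> topspace ?T" for q using J(1) tT[OF that] by blast
   show "cmap ?T (mtop M) fst" by (rule continuous_map_tangent_fst)
   fix q0 assume q0: "q0 \<in> topspace ?T"
   obtain c where c: "c \<in> charts_at M (fst q0)" using charts_at_nonempty[OF tT(1)[OF q0]] by blast
   note cc = charts_atD[OF c]
   define U where "U = {q \<in> topspace ?T. fst q \<in> fst c}"
   have oU: "openin ?T U" unfolding U_def
    by (rule openin_continuous_map_preimage[OF continuous_map_tangent_fst chart_open[OF cc(1)]])
   let ?U = "subtopology ?T U"
   \<comment> \<open>The complex structure at \<open>fst q\<close> read in the chart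
     \<open>c\<close>. The definition provides continuity for each fixed vector \<open>w\<close>;
     linearity extends it to the moving vector \<open>snd q c\<close>.\<close>
   let ?L = "\<lambda>q w. acs M (fst q) (tangent_vec M (fst q) c w) c"
   have ch: "c \<in> charts_at M (fst q)" "fst q \<in> points M" "snd q \<in> \<T> M (fst q)" if "q \<in> topspace ?U" for q
    using that tT[of q] cc by (auto simp: U_def charts_at_def)
   have "cmap ?U euclidean (\<lambda>q. ?L q (snd q c))"
   proof (rule continuous_map_linear_family[where L = ?L and w = "\<lambda>q. snd q c", OF subspace_model])
    fix q v w and r :: real assume q: "q \<in> topspace ?U"
    show "snd q c \<in> model M" by (rule tangent_spaceD(2)[OF ch(3)[OF q] ch(1)[OF q]])
    assume v: "v \<in> model M"
    show "?L q (r *\<^sub>R v) = r *\<^sub>R ?L q v"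
     using tangent_vec_linear(2)[OF ch(1)[OF q] v v, of r] J(3)[OF ch(2)[OF q] tangent_vec_in(1)[OF ch(1)[OF q] v], of r] by simp
    assume w: "w \<in> model M"
    show "?L q (v + w) = ?L q v + ?L q w" using tangent_vec_linear(1)[OF ch(1)[OF q] v w]
      J(2)[OF ch(2)[OF q] tangent_vec_in(1)[OF ch(1)[OF q] v] tangent_vec_in(1)[OF ch(1)[OF q] w]] by simp
   next
    fix w assume w: "w \<in> model M"
    have "smooth_on (model M) (snd c ` fst c) (\<lambda>x. let p = chart_inv c x in acs M p (tvec_in_chart M p c w) c)"
     using ac cc(1) w unfolding almost_complex_structure_def by blast
    then have "Ck 0 (model M) (snd c ` fst c) (\<lambda>x. let p = chart_inv c x in acs M p (tvec_in_chart M p c w) c)"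
     unfolding smooth_on_def by blast
    then have c1: "cmap (top_of_set (snd c ` fst c)) euclidean
      (\<lambda>x. acs M (chart_inv c x) (tvec_in_chart M (chart_inv c x) c w) c)" by (simp add: Let_def)
    have c2: "cmap ?U (top_of_set (snd c ` fst c)) (\<lambda>q. snd c (fst q))"
    proof -
     have "cmap ?U (top_on M (fst c)) fst" using continuous_map_tangent_fst by (auto simp: into_sub from_sub U_def)
     from continuous_map_compose[OF this continuous_chart[OF cc(1)]]
     show ?thesis by (auto simp: into_sub o_def U_def)
    qed
    have "cmap ?U euclidean
      (\<lambda>q. acs M (chart_inv c (snd c (fst q))) (tvec_in_chart M (chart_inv c (snd c (fst q))) c w) c)"
     using continuous_map_compose[OF c2 c1] by (simp only: o_def)
    then show "cmap ?U euclidean (\<lambda>q. ?L q w)"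
    proof (rule continuous_map_eq)
     fix q assume q: "q \<in> topspace ?U"
     show "acs M (chart_inv c (snd c (fst q))) (tvec_in_chart M (chart_inv c (snd c (fst q))) c w) c = ?L q w"
      using chart_inv[OF cc(1) charts_atD(2)[OF ch(1)[OF q]]] tvec_in_chart_eq[OF ch(1)[OF q] w] by simp
    qed
   next
    show "cmap ?U euclidean (\<lambda>q. snd q c)"
     by (rule continuous_map_from_subtopology_mono[OF continuous_map_tangent_chart[OF cc(1)]]) (auto simp: U_def)
   qed
   then have "cmap ?U euclidean (\<lambda>q. acs M (fst q) (snd q) c)"
    by (rule continuous_map_eq) (use tangent_vec_chart[OF ch(1) ch(3)] in simp)
   moreover have "q0 \<in> U" using q0 cc by (simp add: U_def)
   moreover have "fst ` U \<subseteq> fst c" by (auto simp: U_def)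
   ultimately show "\<exists>U c. openin ?T U \<and> q0 \<in> U \<and> c \<in> atlas M \<and> fst ` U \<subseteq> fst c \<and>
     cmap (subtopology ?T U) euclidean (\<lambda>q. acs M (fst q) (snd q) c)" using oU cc(1) by (intro exI[of _ U] exI[of _ c]) simp
  qed
 qed (use J in blast)+
qed

context acm_c1
begin

lemma c_scale_in:
 assumes "p \<in> points M" "v \<in> \<T> M p"
 shows "c_scale M p z v \<in> \<T> M p" unfolding c_scale_def by (intro tangent_add[OF tangent_scaleR tangent_scaleR] acs_in assms)

lemma c_scale_add:
 assumes "p \<in> points M" "v \<in> \<T> M p" "w \<in> \<T> M p"
 shows "c_scale M p z (\<lambda>c. v c + w c) = (\<lambda>c. c_scale M p z v c + c_scale M p z w c)"
 using acs_add[OF assms] by (simp add: c_scale_def algebra_simps)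

lemma c_scale_of_real: "c_scale M p (of_real r) v = (\<lambda>c. r *\<^sub>R v c)" by (simp add: c_scale_def)

lemma c_scale_one [simp]: "c_scale M p 1 v = v" by (simp add: c_scale_def)

lemma c_scale_i: "c_scale M p \<i> v = acs M p v" by (simp add: c_scale_def)

lemma c_scale_c_scale:
 assumes "p \<in> points M" "v \<in> \<T> M p"
 shows "c_scale M p z (c_scale M p z' v) = c_scale M p (z * z') v"
proof -
 have "acs M p (\<lambda>c. Re z' *\<^sub>R v c + Im z' *\<^sub>R acs M p v c) =
   (\<lambda>c. Re z' *\<^sub>R acs M p v c - Im z' *\<^sub>R v c)"
  using acs_add[OF assms(1) tangent_scaleR[OF assms(2)] tangent_scaleR[OF acs_in[OF assms]]]
   acs_scaleR[OF assms] acs_scaleR[OF assms(1) acs_in[OF assms]] acs_acs[OF assms] by simp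
 then show ?thesis by (simp add: c_scale_def algebra_simps)
qed

lemma continuous_map_c_scale:
 assumes f: "cmap T (\<TT> M) (\<lambda>t. (x t, v t))"
 shows "cmap T (\<TT> M) (\<lambda>t. (x t, c_scale M (x t) z (v t)))"
proof -
 have "cmap T (\<TT> M) (\<lambda>t. (x t, acs M (x t) (v t)))"
  using continuous_map_compose[OF f continuous_acs] by (simp add: o_def)
 then show ?thesis unfolding c_scale_def by (intro continuous_map_tangent_add continuous_map_tangent_scaleR f)
qed

end

section \<open>Subbundles of the tangent bundle\<close>

lemma tangent_subbundle_simps [simp]:
 "bbase (tangent_subbundle M Z F) = top_on M Z"
 "fibre (tangent_subbundle M Z F) = F"
 "badd (tangent_subbundle M Z F) p v w = (\<lambda>c. v c + w c)"
 "bscale (tangent_subbundle M Z F) p = c_scale M p" by (simp_all add: tangent_subbundle_def)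

lemma continuous_map_into_subbundle:
 "cmap T (btotal (tangent_subbundle M Z F)) f \<longleftrightarrow>
   cmap T (\<TT> M) f \<and> (\<forall>t\<in>topspace T. fst (f t) \<in> Z \<and> snd (f t) \<in> F (fst (f t)))"
 by (auto simp: tangent_subbundle_def into_sub image_subset_iff mem_Sigma_iff
   simp flip: mem_Sigma_iff)

definition c_subspace :: "('p, 'e::euclidean_space) acm \<Rightarrow> 'p \<Rightarrow> ('p, 'e) tvec set \<Rightarrow> bool" where
 "c_subspace M p F \<longleftrightarrow> F \<subseteq> \<T> M p \<and> (\<forall>v\<in>F. \<forall>w\<in>F. (\<lambda>c. v c + w c) \<in> F) \<and>
   (\<forall>v\<in>F. \<forall>z. c_scale M p z v \<in> F)"

lemma c_subspaceD: "\<lbrakk>c_subspace M p F; v \<in> F\<rbrakk> \<Longrightarrow> v \<in> \<T> M p" by (auto simp: c_subspace_def)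

lemma (in acm_c1) prebundle_tangent_subbundle:
 assumes Z: "Z \<subseteq> points M" and F: "\<And>p. p \<in> Z \<Longrightarrow> c_subspace M p (F p)"
 shows "prebundle (tangent_subbundle M Z F)" unfolding prebundle_def
proof (intro conjI)
 let ?E = "tangent_subbundle M Z F"
 have "Sigma Z F \<subseteq> Sigma (points M) (\<T> M)" using Z F unfolding c_subspace_def by blast
 then show tE: "topspace (btotal ?E) = Sigma (topspace (bbase ?E)) (fibre ?E)"
  using Z by (auto simp: tangent_subbundle_def topspace_tangent_topology)
 show "cmap (btotal ?E) (bbase ?E) fst" using continuous_map_tangent_fst by (auto simp: tangent_subbundle_def into_sub from_sub)
 show "\<forall>y\<in>topspace (bbase ?E). \<forall>v\<in>fibre ?E y.
    (\<forall>w\<in>fibre ?E y. badd ?E y v w \<in> fibre ?E y) \<and> (\<forall>z. bscale ?E y z v \<in> fibre ?E y)"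
  using F by (simp add: c_subspace_def)
qed

lemma (in acm_c1) continuous_map_from_subbundle:
 assumes Z: "Z \<subseteq> points M" and F: "\<And>p. p \<in> Z \<Longrightarrow> c_subspace M p (F p)"
 shows "cmap (btotal (tangent_subbundle M Z F)) (\<TT> M) (\<lambda>q. (fst q, snd q))"
 by (simp add: tangent_subbundle_def from_sub)

subsection \<open>Complex frames\<close>

text \<open>A complex generating set of least size is linearly independent over the complex numbers;
  a real orthonormal basis shows that generating sets exist. The result is an isomorphism
  \<open>\<kappa>\<close> of C^m onto \<open>V\<close> with inverse \<open>\<iota>\<close>, where i
  acts on \<open>V\<close> as \<open>J\<close>.\<close>

lemma complex_frame:
 fixes V :: "'e::euclidean_space set" and J :: "'e \<Rightarrow> 'e"
 assumes V: "subspace V"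
  and J_add: "\<And>v w. \<lbrakk>v \<in> V; w \<in> V\<rbrakk> \<Longrightarrow> J (v + w) = J v + J w"
  and J_scale: "\<And>v r. v \<in> V \<Longrightarrow> J (r *\<^sub>R v) = r *\<^sub>R J v"
  and J_in: "\<And>v. v \<in> V \<Longrightarrow> J v \<in> V" and J_J: "\<And>v. v \<in> V \<Longrightarrow> J (J v) = - v"
 obtains m :: nat and \<kappa> :: "(nat \<Rightarrow> complex) \<Rightarrow> 'e" and \<iota> :: "'e \<Rightarrow> nat \<Rightarrow> complex"
 where "\<And>u. \<kappa> u \<in> V" "\<And>u. u \<in> cvec m \<Longrightarrow> \<iota> (\<kappa> u) = u"
  "\<And>v. v \<in> V \<Longrightarrow> \<iota> v \<in> cvec m" "\<And>v. v \<in> V \<Longrightarrow> \<kappa> (\<iota> v) = v"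
  "\<And>u u'. \<kappa> (\<lambda>i\<in>{..<m}. u i + u' i) = \<kappa> u + \<kappa> u'"
  "\<And>u z. \<kappa> (\<lambda>i\<in>{..<m}. z * u i) = Re z *\<^sub>R \<kappa> u + Im z *\<^sub>R J (\<kappa> u)"
  "cmap (cvec_top m) euclidean \<kappa>"
proof -
 define cs where "cs = (\<lambda>z v. Re z *\<^sub>R v + Im z *\<^sub>R J v)"
 have J0: "J 0 = 0" using J_scale[of 0 0] V by (simp add: subspace_0)
 have cs_in: "cs z v \<in> V" if "v \<in> V" for z v unfolding cs_def by (intro subspace_add subspace_scale V that J_in)
 have cs_0 [simp]: "cs 0 v = 0" for v by (simp add: cs_def)
 have cs_plus: "cs (z + z') v = cs z v + cs z' v" for z z' v by (simp add: cs_def algebra_simps)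
 have cs_add: "cs z (v + w) = cs z v + cs z w" if "v \<in> V" "w \<in> V" for z v w
  using that by (simp add: cs_def J_add algebra_simps)
 have cs_cs: "cs z (cs z' v) = cs (z * z') v" if "v \<in> V" for z z' v
  using that by (simp add: cs_def J_add J_scale J_J J_in subspace_scale[OF V] algebra_simps)
 have cs_sum: "cs z (\<Sum>b\<in>S. cs (y b) b) = (\<Sum>b\<in>S. cs (z * y b) b) \<and> (\<Sum>b\<in>S. cs (y b) b) \<in> V"
  if "finite S" "S \<subseteq> V" for z S y using that
 proof (induction S rule: finite_induct)
  case empty
  then show ?case by (simp add: cs_def J0 subspace_0[OF V])
 next
  case (insert b S)
  then show ?case by (simp add: cs_add cs_cs cs_in subspace_add[OF V])
 qed
 let ?P = "\<lambda>n. \<exists>S. finite S \<and> card S = n \<and> S \<subseteq> V \<and> (\<forall>v\<in>V. \<exists>y. v = (\<Sum>b\<in>S. cs (y b) b))"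
 obtain B where B: "B \<subseteq> V" "pairwise orthogonal B" "\<And>x. x \<in> B \<Longrightarrow> norm x = 1" "independent B" "span B = V"
  using orthonormal_basis_subspace[OF V] by metis
 have fB: "finite B" using B(4) by (rule independent_imp_finite)
 have expand: "v = (\<Sum>b\<in>B. cs (of_real (v \<bullet> b)) b)" if "v \<in> V" for v
  using orthonormal_basis_expand[OF B(2,3) _ fB, of v] B(5) that by (simp add: cs_def)
 have "?P (card B)" by (intro exI[of _ B] conjI ballI fB B(1) refl) (rule exI, erule expand)
 define m where "m = (LEAST n. ?P n)"
 have "?P m" unfolding m_def by (rule LeastI[of ?P]) (rule \<open>?P (card B)\<close>)
 then obtain S where S: "finite S" "card S = m" "S \<subseteq> V" "\<And>v. v \<in> V \<Longrightarrow> \<exists>y. v = (\<Sum>b\<in>S. cs (y b) b)"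
  by blast
 have indep: "z b = 0" if eq: "(\<Sum>b\<in>S. cs (z b) b) = 0" and b: "b \<in> S" for z b
 proof (rule ccontr)
  assume nz: "z b \<noteq> 0"
  have "\<exists>y. v = (\<Sum>x\<in>S - {b}. cs (y x) x)" if v: "v \<in> V" for v
  proof -
   obtain y where y: "v = (\<Sum>x\<in>S. cs (y x) x)" using S(4)[OF v] by blast
   \<comment> \<open>Adding this multiple of the relation cancels the coefficient of
     \<open>b\<close>, so that \<open>S - {b}\<close> would still generate, against the minimality
     of \<open>m\<close>.\<close>
   let ?k = "- y b / z b"
   have "v = v + cs ?k (\<Sum>x\<in>S. cs (z x) x)" using eq by (simp add: cs_def J0)
   also have "\<dots> = (\<Sum>x\<in>S. cs (y x) x) + (\<Sum>x\<in>S. cs (?k * z x) x)" using cs_sum[OF S(1,3), of ?k z] y by simp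
   also have "\<dots> = (\<Sum>x\<in>S. cs (y x + ?k * z x) x)" by (simp only: cs_plus sum.distrib)
   also have "\<dots> = (\<Sum>x\<in>S - {b}. cs (y x + ?k * z x) x)" using nz b S(1) by (simp add: sum.remove[of S b])
   finally have "v = (\<Sum>x\<in>S - {b}. cs (y x + ?k * z x) x)" .
   then show ?thesis by (intro exI[of _ "\<lambda>x. y x + ?k * z x"])
  qed
  then have "?P (m - 1)" using S(1-3) b by (intro exI[of _ "S - {b}"] conjI ballI) auto
  then have "m \<le> m - 1" unfolding m_def by (rule Least_le)
  moreover have "m > 0" using S(1,2) b card_gt_0_iff by blast
  ultimately show False by simp
 qed
 obtain e where e: "bij_betw e {..<m} S" using ex_bij_betw_nat_finite[OF S(1)] S(2) by (metis atLeast0LessThan)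
 define \<kappa> where "\<kappa> = (\<lambda>u. \<Sum>i<m. cs (u i) (e i))"
 have eV: "e i \<in> V" if "i < m" for i using e that S(3) by (auto simp: bij_betw_def)
 have reidx: "(\<Sum>b\<in>S. cs (y b) b) = (\<Sum>i<m. cs (y (e i)) (e i))" for y by (rule sum.reindex_bij_betw[OF e, symmetric])
 have \<kappa>_in: "\<kappa> u \<in> V" for u unfolding \<kappa>_def by (rule subspace_sum[OF V]) (use eV cs_in in auto)
 have ex: "\<exists>u\<in>cvec m. \<kappa> u = v" if v: "v \<in> V" for v
 proof -
  obtain y where "v = (\<Sum>b\<in>S. cs (y b) b)" using S(4)[OF v] by blast
  then have "\<kappa> (\<lambda>i\<in>{..<m}. y (e i)) = v" by (simp add: \<kappa>_def reidx)
  then show ?thesis by (intro bexI[of _ "\<lambda>i\<in>{..<m}. y (e i)"]) auto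
 qed
 have inj: "u = u'" if u: "u \<in> cvec m" "u' \<in> cvec m" and eq: "\<kappa> u = \<kappa> u'" for u u'
 proof -
  define z where "z = (\<lambda>b. u (inv_into {..<m} e b) - u' (inv_into {..<m} e b))"
  have ze: "z (e i) = u i - u' i" if "i < m" for i using that e by (simp add: z_def bij_betw_inv_into_left)
  have "(\<Sum>b\<in>S. cs (z b) b) = (\<Sum>i<m. cs (u i - u' i) (e i))" by (simp add: reidx ze)
  also have "\<dots> = \<kappa> u - \<kappa> u'" unfolding \<kappa>_def sum_subtractf[symmetric] by (simp add: cs_def algebra_simps)
  finally have "z (e i) = 0" if "i < m" for i using indep[of z "e i"] e that eq by (auto simp: bij_betw_def)
  then show ?thesis using u ze by (intro PiE_ext[of u "{..<m}" _ u']) auto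
 qed
 define \<iota> where "\<iota> = (\<lambda>v. SOME u. u \<in> cvec m \<and> \<kappa> u = v)"
 have \<iota>: "\<iota> v \<in> cvec m \<and> \<kappa> (\<iota> v) = v" if "v \<in> V" for v
  unfolding \<iota>_def by (rule someI_ex[OF ex[OF that, unfolded Bex_def]])
 have 5: "\<kappa> (\<lambda>i\<in>{..<m}. u i + u' i) = \<kappa> u + \<kappa> u'" for u u'
  by (simp add: \<kappa>_def cs_plus sum.distrib)
 have 6: "\<kappa> (\<lambda>i\<in>{..<m}. z * u i) = cs z (\<kappa> u)" for u z
  using cs_sum[OF S(1,3), of z "\<lambda>b. u (inv_into {..<m} e b)"] e by (simp add: \<kappa>_def reidx bij_betw_inv_into_left)
 have 7: "cmap (cvec_top m) euclidean \<kappa>" unfolding \<kappa>_def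
 proof (rule continuous_map_sum)
  fix i assume i: "i \<in> {..<m}"
  have "cmap (cvec_top m) euclidean (\<lambda>u. u i)" by (rule continuous_map_product_projection[OF i])
  then show "cmap (cvec_top m) euclidean (\<lambda>u. cs (u i) (e i))"
   by (simp add: cs_def continuous_map_atin tendsto_add tendsto_scaleR tendsto_Re tendsto_Im)
 qed simp
 show ?thesis by (rule that[of \<kappa> m \<iota>]) (use \<kappa>_in \<iota> inj 5 6 7 in \<open>auto simp: cs_def\<close>)
qed

section \<open>Bundles cut out by continuous projections\<close>

text \<open>The bound gives \<open>norm w \<le> 2 * norm (A t w)\<close> uniformly in
  \<open>t\<close>. Hence \<open>u t - u t0\<close> is controlled by
  \<open>y t - A t (u t0)\<close>, which tends to 0 and no longer involves
  \<open>u t\<close>.\<close>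

lemma linear_family_inverse_continuous:
 fixes A :: "'t \<Rightarrow> 'e::euclidean_space \<Rightarrow> 'e"
 assumes lin: "\<And>t. t \<in> topspace T \<Longrightarrow> linear (A t)"
  and near: "\<And>t w. t \<in> topspace T \<Longrightarrow> norm (A t w - w) \<le> norm w / 2"
  and cont: "\<And>w. cmap T euclidean (\<lambda>t. A t w)"
  and y: "cmap T euclidean y" and u: "\<And>t. t \<in> topspace T \<Longrightarrow> A t (u t) = y t"
 shows "cmap T euclidean u" unfolding continuous_map_atin limitin_canonical_iff
proof
 fix t0 assume t0: "t0 \<in> topspace T"
 have "((\<lambda>t. y t - A t (u t0)) \<longlongrightarrow> y t0 - A t0 (u t0)) (atin T t0)"
  using y cont[of "u t0"] t0 unfolding continuous_map_atin limitin_canonical_iff by (intro tendsto_diff) blast+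
 then have "((\<lambda>t. norm (y t - A t (u t0))) \<longlongrightarrow> 0) (atin T t0)"
  using u[OF t0] tendsto_norm_zero by fastforce
 from tendsto_mult_right_zero[OF this, of 2]
 have lim: "((\<lambda>t. 2 * norm (y t - A t (u t0))) \<longlongrightarrow> 0) (atin T t0)" .
 have bound: "norm (u t - u t0) \<le> 2 * norm (y t - A t (u t0))" if t: "t \<in> topspace T" for t
 proof -
  have "A t (u t - u t0) = y t - A t (u t0)" using linear_diff[OF lin[OF t]] u[OF t] by simp
  then have "norm (u t - u t0) \<le> norm (A t (u t - u t0) - (u t - u t0)) + norm (y t - A t (u t0))"
   by (metis norm_minus_commute norm_triangle_sub add.commute)
  with near[OF t, of "u t - u t0"] show ?thesis by simp
 qed
 have "((\<lambda>t. u t - u t0) \<longlongrightarrow> 0) (atin T t0)"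
 proof (rule Lim_null_comparison[OF _ lim])
  show "\<forall>\<^sub>F t in atin T t0. norm (u t - u t0) \<le> 2 * norm (y t - A t (u t0))"
   unfolding eventually_atin using bound t0 openin_topspace[of T] openin_subset by blast
 qed
 then show "(u \<longlongrightarrow> u t0) (atin T t0)" by (rule LIM_zero_cancel)
qed

lemma orthogonal_projection:
 fixes V :: "'e::euclidean_space set"
 assumes V: "subspace V"
 obtains Q where "linear Q" "\<And>w. Q w \<in> V" "\<And>w. w \<in> V \<Longrightarrow> Q w = w"
proof -
 obtain B where B: "B \<subseteq> V" "pairwise orthogonal B" "\<And>x. x \<in> B \<Longrightarrow> norm x = 1" "independent B" "span B = V"
  using orthonormal_basis_subspace[OF V] by metis
 have fB: "finite B" using B(4) by (rule independent_imp_finite)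
 show ?thesis
 proof (rule that[of "\<lambda>w. \<Sum>b\<in>B. (w \<bullet> b) *\<^sub>R b"])
  show "linear (\<lambda>w. \<Sum>b\<in>B. (w \<bullet> b) *\<^sub>R b)"
   by (rule linearI) (simp_all add: inner_add_left algebra_simps sum.distrib scaleR_sum_right)
  show "(\<Sum>b\<in>B. (w \<bullet> b) *\<^sub>R b) \<in> V" for w
   by (rule subspace_sum[OF V]) (use B(1) subspace_scale[OF V] in blast)
  show "(\<Sum>b\<in>B. (w \<bullet> b) *\<^sub>R b) = w" if "w \<in> V" for w
   by (rule orthonormal_basis_expand[OF B(2,3) _ fB]) (use that B(5) in auto)
 qed
qed

lemma (in c1_manifold) continuous_map_tangent_chartD:
 assumes f: "cmap T (\<TT> M) (\<lambda>t. (x t, v t))" and c: "c \<in> atlas M"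
  and x: "\<And>t. t \<in> topspace T \<Longrightarrow> x t \<in> fst c"
 shows "cmap T euclidean (\<lambda>t. v t c)"
proof -
 have "cmap (subtopology T {t. x t \<in> fst c}) euclidean (\<lambda>t. v t c)"
  using f c unfolding continuous_map_into_tangent_iff fst_conv snd_conv by blast
 moreover have "subtopology T {t. x t \<in> fst c} = T" using x by (auto intro: subtopology_superset)
 ultimately show ?thesis by simp
qed

context acm_c1
begin

text \<open>For a projection \<open>L\<^sub>p\<close> and a complex structure \<open>J\<^sub>p\<close>, depending continuously on \<open>p\<close>, the map
 \<open>L\<^sub>p B\<^sub>p L\<^sub>0 + (1 - L\<^sub>p) B\<^sub>p (1 - L\<^sub>0)\<close> with \<open>B\<^sub>p = (1 - J\<^sub>p J\<^sub>0) / 2\<close> intertwines \<open>(L\<^sub>0, J\<^sub>0)\<close> with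
 \<open>(L\<^sub>p, J\<^sub>p)\<close> and is the identity at \<open>0\<close>; hence it trivializes the image of \<open>L\<close> near \<open>0\<close>.\<close>

lemma vector_bundle_projection:
 fixes P :: "'p \<Rightarrow> ('p, 'e) tvec \<Rightarrow> ('p, 'e) tvec"
 assumes Z: "Z \<subseteq> points M"
  and P_in: "\<And>p v. \<lbrakk>p \<in> Z; v \<in> \<T> M p\<rbrakk> \<Longrightarrow> P p v \<in> \<T> M p"
  and P_add: "\<And>p v w. \<lbrakk>p \<in> Z; v \<in> \<T> M p; w \<in> \<T> M p\<rbrakk> \<Longrightarrow>
    P p (\<lambda>c. v c + w c) = (\<lambda>c. P p v c + P p w c)"
  and P_scale: "\<And>p v z. \<lbrakk>p \<in> Z; v \<in> \<T> M p\<rbrakk> \<Longrightarrow> P p (c_scale M p z v) = c_scale M p z (P p v)"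
  and P_P: "\<And>p v. \<lbrakk>p \<in> Z; v \<in> \<T> M p\<rbrakk> \<Longrightarrow> P p (P p v) = P p v"
  and P_cont: "cmap (subtopology (\<TT> M) {q. fst q \<in> Z}) (\<TT> M)
    (\<lambda>q. (fst q, P (fst q) (snd q)))"
 shows "vector_bundle (tangent_subbundle M Z (\<lambda>p. {v \<in> \<T> M p. P p v = v}))"
proof -
 define F where "F = (\<lambda>p. {v \<in> \<T> M p. P p v = v})"
 let ?E = "tangent_subbundle M Z F" and ?Y = "top_on M Z" and ?V = "model M"
 have cF: "c_subspace M p (F p)" if "p \<in> Z" for p using that Z P_add[OF that] P_scale[OF that] tangent_add c_scale_in
  by (auto simp: c_subspace_def F_def)
 have pE: "prebundle ?E" by (rule prebundle_tangent_subbundle[OF Z cF])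
 have "\<exists>U n. p0 \<in> U \<and> trivial_on ?E U n" if "p0 \<in> topspace ?Y" for p0
 proof -
  have p0: "p0 \<in> Z" "p0 \<in> points M" using that by auto
  obtain c where c: "c \<in> charts_at M p0" using charts_at_nonempty[OF p0(2)] by blast
  note cc = charts_atD[OF c]
  define U where "U = Z \<inter> fst c"
  have p0U: "p0 \<in> U" using p0 cc by (simp add: U_def)
  have oU: "openin ?Y U" using chart_open[OF cc(1)] by (auto simp: openin_subtopology U_def)
  have UZ: "p \<in> Z" and Up: "p \<in> points M" and ch: "c \<in> charts_at M p" and Uc: "p \<in> fst c" if "p \<in> U" for p
   using that Z cc by (auto simp: U_def charts_at_def)
  \<comment> \<open>Charts take values in the subspace \<open>?V\<close>. Composed with a projection
    \<open>Q\<close> onto it, the operators read in the chart become linear maps of the whole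
    Euclidean space.\<close>
  obtain Q where Q: "linear Q" "\<And>w. Q w \<in> ?V" "\<And>w. w \<in> ?V \<Longrightarrow> Q w = w"
   using orthogonal_projection[OF subspace_model] by blast
  define tv where "tv = (\<lambda>p w. tangent_vec M p c (Q w))"
  define L where "L = (\<lambda>p w. P p (tv p w) c)"
  define J where "J = (\<lambda>p w. acs M p (tv p w) c)"
  have tv_in: "tv p w \<in> \<T> M p" and tv_c: "tv p w c = Q w" if "p \<in> U" for p w
   using tangent_vec_in[OF ch[OF that] Q(2)] by (simp_all add: tv_def)
  have tv_chart: "tv p (v c) = v" if "p \<in> U" "v \<in> \<T> M p" for p v
   using tangent_vec_chart[OF ch[OF that(1)] that(2)] Q(3)[OF tangent_spaceD(2)[OF that(2) ch[OF that(1)]]] by (simp add: tv_def)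
  have tv_add: "tv p (w + w') = (\<lambda>c. tv p w c + tv p w' c)" and tv_scale: "tv p (r *\<^sub>R w) = (\<lambda>c. r *\<^sub>R tv p w c)"
   if "p \<in> U" for p w w' r using tangent_vec_linear[OF ch[OF that] Q(2) Q(2)] linear_add[OF Q(1)] linear_scale[OF Q(1)]
   by (simp_all add: tv_def)
  have P_scaleR: "P p (\<lambda>c. r *\<^sub>R v c) = (\<lambda>c. r *\<^sub>R P p v c)" if "p \<in> U" "v \<in> \<T> M p" for p v r
   using P_scale[OF UZ[OF that(1)] that(2), of "of_real r"] by (simp add: c_scale_of_real)
  have P_acs: "P p (acs M p v) = acs M p (P p v)" if "p \<in> U" "v \<in> \<T> M p" for p v
   using P_scale[OF UZ[OF that(1)] that(2), of \<i>] by (simp add: c_scale_i)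
  have linL: "linear (L p)" if "p \<in> U" for p
   by (rule linearI) (simp_all add: L_def tv_add[OF that] tv_scale[OF that] P_add[OF UZ[OF that] tv_in[OF that] tv_in[OF that]]
     P_scaleR[OF that tv_in[OF that]])
  have linJ: "linear (J p)" if "p \<in> U" for p
   by (rule linearI) (simp_all add: J_def tv_add[OF that] tv_scale[OF that] acs_add[OF Up[OF that] tv_in[OF that] tv_in[OF that]]
     acs_scaleR[OF Up[OF that] tv_in[OF that]])
  have tvL: "tv p (L p w) = P p (tv p w)" and tvJ: "tv p (J p w) = acs M p (tv p w)" if "p \<in> U" for p w
   unfolding L_def J_def using tv_chart[OF that] P_in[OF UZ[OF that] tv_in[OF that]] acs_in[OF Up[OF that] tv_in[OF that]] by blast+
  have tvQ: "tv p (Q w) = tv p w" for p w using Q(2,3) by (simp add: tv_def)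
  have LV: "L p w \<in> ?V" and JV: "J p w \<in> ?V" if "p \<in> U" for p w unfolding L_def J_def
   using tangent_spaceD(2)[OF P_in[OF UZ[OF that] tv_in[OF that]] ch[OF that]]
    tangent_spaceD(2)[OF acs_in[OF Up[OF that] tv_in[OF that]] ch[OF that]] by blast+
  have LQ: "L p (Q w) = L p w" and JQ: "J p (Q w) = J p w" for p w by (simp_all add: L_def J_def tvQ)
  have LL: "L p (L p w) = L p w" and JJ: "J p (J p w) = - Q w" and LJ: "L p (J p w) = J p (L p w)"
   and QL: "Q (L p w) = L p w" and QJ: "Q (J p w) = J p w" if "p \<in> U" for p w
  proof -
   note i = tv_in[OF that, of w]
   show "L p (L p w) = L p w" using P_P[OF UZ[OF that] i] by (simp add: L_def[of] tvL[OF that, unfolded L_def])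
   show "J p (J p w) = - Q w" using acs_acs[OF Up[OF that] i] tv_c[OF that] by (simp add: J_def tvJ[OF that, unfolded J_def])
   have "L p (J p w) = P p (tv p (J p w)) c" by (simp add: L_def)
   also have "\<dots> = acs M p (P p (tv p w)) c" by (simp add: tvJ[OF that] P_acs[OF that i])
   also have "\<dots> = J p (L p w)" by (simp add: J_def tvL[OF that])
   finally show "L p (J p w) = J p (L p w)" .
  qed (simp_all add: Q(3)[OF LV[OF that]] Q(3)[OF JV[OF that]])
  let ?TU = "top_on M U"
  have TU: "p \<in> topspace ?TU \<longleftrightarrow> p \<in> U" for p using Up by auto
  have ctv: "cmap ?TU (\<TT> M) (\<lambda>p. (p, tv p w))" for w
   using continuous_map_from_subtopology_mono[OF continuous_map_tangent_vec[OF cc(1) Q(2)], of U] by (simp add: tv_def U_def)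
  have contL: "cmap ?TU euclidean (\<lambda>p. L p w)" for w
  proof -
   have "cmap ?TU (subtopology (\<TT> M) {q. fst q \<in> Z}) (\<lambda>p. (p, tv p w))" using ctv[of w] UZ by (auto simp: into_sub)
   from continuous_map_compose[OF this P_cont]
   have "cmap ?TU (\<TT> M) (\<lambda>p. (p, P p (tv p w)))" by (simp add: o_def)
   then show ?thesis unfolding L_def by (rule continuous_map_tangent_chartD[OF _ cc(1)]) (auto simp: U_def)
  qed
  have contJ: "cmap ?TU euclidean (\<lambda>p. J p w)" for w
  proof -
   have "cmap ?TU (\<TT> M) (\<lambda>p. (p, acs M p (tv p w)))"
    using continuous_map_compose[OF ctv continuous_acs] by (simp add: o_def)
   then show ?thesis unfolding J_def by (rule continuous_map_tangent_chartD[OF _ cc(1)]) (auto simp: U_def)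
  qed
  define B where "B = (\<lambda>p w. (1 / 2) *\<^sub>R (Q w - J p (J p0 w)))"
  \<comment> \<open>The last summand makes \<open>A p\<close> the identity on the kernel of
    \<open>Q\<close>, so that \<open>A p0\<close> is the identity of the whole space.\<close>
  define A where "A = (\<lambda>p w. L p (B p (L p0 w)) + (B p (w - L p0 w) - L p (B p (w - L p0 w))) + (w - Q w))"
  have lins: "linear (L p)" "linear (J p)" "linear (L p0)" "linear (J p0)" if "p \<in> U" for p using linL linJ that p0U by blast+
  have linB: "linear (B p)" if "p \<in> U" for p unfolding B_def using lins[OF that] Q(1)
   by (intro linearI) (simp_all add: linear_add linear_scale algebra_simps)
  have linA: "linear (A p)" if "p \<in> U" for p unfolding A_def using lins[OF that] Q(1) linB[OF that]
   by (intro linearI) (simp_all add: linear_add linear_scale linear_diff algebra_simps)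
  have contB: "cmap ?TU euclidean (\<lambda>p. B p w)" for w
   unfolding B_def using contJ[of "J p0 w"] by (simp add: continuous_map_atin tendsto_scaleR tendsto_diff)
  have contLB: "cmap ?TU euclidean (\<lambda>p. L p (B p w))" for w
   by (rule continuous_map_linear_family[where L = L and w = "\<lambda>p. B p w" and V = UNIV])
    (use linear_add[OF linL] linear_scale[OF linL] contL contB TU in simp_all)
  have contA: "cmap ?TU euclidean (\<lambda>p. A p w)" for w
   unfolding A_def using contB contLB by (simp add: continuous_map_add continuous_map_diff)
  have B_p0: "B p0 w = Q w" for w by (simp add: B_def JJ[OF p0U] scaleR_half_double)
  have A_p0: "A p0 w = w" for w using linear_diff[OF linL[OF p0U]] linear_diff[OF Q(1)]
   by (simp add: A_def B_p0 QL[OF p0U] LL[OF p0U] LQ)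
  have A_L: "A p (L p0 w) = L p (A p w)" if "p \<in> U" for p w
   using linear_diff[OF linL[OF that]] linear_add[OF linL[OF that]] linear_0[OF linL[OF that]] linear_0[OF linB[OF that]]
   by (simp add: A_def LL[OF that] LL[OF p0U] LQ QL[OF p0U])
  \<comment> \<open>Both sides are half of \<open>J p0 w + J p w\<close>, because the square of
    \<open>J\<close> is \<open>- Q\<close>.\<close>
  have B_J: "B p (J p0 w) = J p (B p w)" if "p \<in> U" for p w using linear_diff[OF linJ[OF that]] linear_scale[OF linJ[OF that]]
   by (simp add: B_def JJ[OF that] JJ[OF p0U] QJ[OF p0U] JQ linear_neg[OF linJ[OF that]] add.commute)
  have A_J: "A p (J p0 w) = J p (A p w)" if "p \<in> U" for p w
  proof -
   have "J p (A p w) = J p (L p (B p (L p0 w))) + (J p (B p (w - L p0 w)) - J p (L p (B p (w - L p0 w)))) + J p (w - Q w)"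
    using linear_diff[OF linJ[OF that]] linear_add[OF linJ[OF that]] by (simp add: A_def)
   also have "J p (w - Q w) = 0" using linear_diff[OF linJ[OF that]] by (simp add: JQ)
   finally show ?thesis using linear_diff[OF linJ[OF p0U]]
    by (simp add: A_def LJ[OF that, symmetric] LJ[OF p0U] B_J[OF that, symmetric] QJ[OF p0U])
  qed
  \<comment> \<open>A bound for the operator norm of \<open>A p - 1\<close> by its values on the
    basis: continuous in \<open>p\<close> and zero at \<open>p0\<close>. Where it is below 1/2,
    \<open>A p\<close> is invertible.\<close>
  define g where "g = (\<lambda>p. \<Sum>b\<in>Basis. norm (A p b - b))"
  have contg: "cmap ?TU euclideanreal g"
   unfolding g_def using contA by (intro continuous_map_sum continuous_map_norm continuous_map_diff) auto
  define U1 where "U1 = {p \<in> topspace ?TU. g p \<in> {..<1/2}}"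
  have "openin ?TU U1" unfolding U1_def by (rule openin_continuous_map_preimage[OF contg]) simp
  moreover have "?TU = subtopology ?Y U" by (simp add: subtopology_subtopology U_def Int_absorb1)
  ultimately have oU1: "openin ?Y U1" using oU openin_trans_full by metis
  have U1U: "p \<in> U" if "p \<in> U1" for p using that TU by (simp add: U1_def)
  have p0U1: "p0 \<in> U1" using p0U p0 by (simp add: U1_def g_def A_p0)
  have near: "norm (A p w - w) \<le> norm w / 2" if p: "p \<in> U1" for p w
  proof -
   have lin: "linear (\<lambda>w. A p w - w)" using linear_compose_sub[OF linA[OF U1U[OF p]] linear_id] by (simp add: id_def)
   have "A p w - w = (\<Sum>b\<in>Basis. (w \<bullet> b) *\<^sub>R (A p b - b))"
    using linear_sum[OF lin, of "\<lambda>b. (w \<bullet> b) *\<^sub>R b" Basis] linear_scale[OF lin]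
    by (simp add: euclidean_representation)
   then have "norm (A p w - w) \<le> (\<Sum>b\<in>Basis. norm w * norm (A p b - b))"
    using sum_norm_le[of Basis "\<lambda>b. (w \<bullet> b) *\<^sub>R (A p b - b)" "\<lambda>b. norm w * norm (A p b - b)"]
    by (simp add: Basis_le_norm mult_right_mono)
   also have "\<dots> = norm w * g p" by (simp add: g_def sum_distrib_left)
   also have "\<dots> \<le> norm w * (1 / 2)" using p by (intro mult_left_mono) (auto simp: U1_def)
   finally show ?thesis by simp
  qed
  have injA: "w = w'" if p: "p \<in> U1" and eq: "A p w = A p w'" for p w w'
  proof -
   have "norm (w - w') \<le> norm (w - w') / 2"
    using near[OF p, of "w - w'"] linear_diff[OF linA[OF U1U[OF p]]] eq by (simp add: norm_minus_commute)
   then show ?thesis by simp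
  qed
  have surjA: "\<exists>w. A p w = x" if p: "p \<in> U1" for p x
   using linear_injective_imp_surjective[OF linA[OF U1U[OF p]]] injA[OF p] unfolding inj_def surj_def by metis
  define Ai where "Ai = (\<lambda>p x. SOME w. A p w = x)"
  have A_Ai: "A p (Ai p x) = x" if "p \<in> U1" for p x unfolding Ai_def using surjA[OF that, of x] by (rule someI_ex)
  define V0 where "V0 = {w. L p0 w = w}"
  have V0: "subspace V0" using linear_0[OF linL[OF p0U]] linear_add[OF linL[OF p0U]] linear_scale[OF linL[OF p0U]]
   by (auto simp: subspace_def V0_def)
  have QV0: "Q w = w" if "w \<in> V0" for w using QL[OF p0U, of w] that by (simp add: V0_def)
  obtain m \<kappa> \<iota> where \<kappa>: "\<And>u. \<kappa> u \<in> V0" "\<And>u. u \<in> cvec m \<Longrightarrow> \<iota> (\<kappa> u) = u"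
   "\<And>v. v \<in> V0 \<Longrightarrow> \<iota> v \<in> cvec m" "\<And>v. v \<in> V0 \<Longrightarrow> \<kappa> (\<iota> v) = v"
   "\<And>u u'. \<kappa> (\<lambda>i\<in>{..<m}. u i + u' i) = \<kappa> u + \<kappa> u'"
   "\<And>u z. \<kappa> (\<lambda>i\<in>{..<m}. z * u i) = Re z *\<^sub>R \<kappa> u + Im z *\<^sub>R J p0 (\<kappa> u)"
   "cmap (cvec_top m) euclidean \<kappa>"
  proof (rule complex_frame[OF V0, of "J p0"])
   show "J p0 (v + w) = J p0 v + J p0 w" "J p0 (r *\<^sub>R v) = r *\<^sub>R J p0 v" for v w r
    using linear_add[OF linJ[OF p0U]] linear_scale[OF linJ[OF p0U]] by auto
   show "J p0 v \<in> V0" if "v \<in> V0" for v using that LJ[OF p0U] by (simp add: V0_def)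
   show "J p0 (J p0 v) = - v" if "v \<in> V0" for v using JJ[OF p0U] QV0[OF that] by simp
  qed (rule that, assumption+)
  have \<iota>_add: "\<iota> (v + w) = (\<lambda>i\<in>{..<m}. \<iota> v i + \<iota> w i)" if "v \<in> V0" "w \<in> V0" for v w
   using \<kappa>(2)[of "\<lambda>i\<in>{..<m}. \<iota> v i + \<iota> w i"] \<kappa>(5)[of "\<iota> v" "\<iota> w"] \<kappa>(4) that by simp
  have \<iota>_scale: "\<iota> (Re z *\<^sub>R v + Im z *\<^sub>R J p0 v) = (\<lambda>i\<in>{..<m}. z * \<iota> v i)" if "v \<in> V0" for v z
   using \<kappa>(2)[of "\<lambda>i\<in>{..<m}. z * \<iota> v i"] \<kappa>(6)[of z "\<iota> v"] \<kappa>(4) that by simp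
  \<comment> \<open>\<open>A p\<close> maps \<open>V0\<close>, the fibre at \<open>p0\<close> in
    coordinates, onto the fibre at \<open>p\<close>; \<open>W p v\<close> is the vector of
    \<open>V0\<close> that corresponds to \<open>v\<close>.\<close>
  define W where "W = (\<lambda>p v. Ai p (v c))"
  have L_chart: "L p (v c) = v c" if "p \<in> U" "v \<in> F p" for p v using that tv_chart[of p v] by (simp add: L_def F_def)
  have A_W: "A p (W p v) = v c" if "p \<in> U1" for p v using A_Ai[OF that] by (simp add: W_def)
  have W_V0: "W p v \<in> V0" if p: "p \<in> U1" and v: "v \<in> F p" for p v
  proof -
   have "A p (L p0 (W p v)) = A p (W p v)" using A_L[OF U1U[OF p]] A_W[OF p] L_chart[OF U1U[OF p] v] by simp
   then show ?thesis using injA[OF p] unfolding V0_def by blast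
  qed
  define \<phi> where "\<phi> = (\<lambda>p v. \<iota> (W p v))"
  define \<psi> where "\<psi> = (\<lambda>p u. tv p (A p (\<kappa> u)))"
  have LA: "L p (A p (\<kappa> u)) = A p (\<kappa> u)" if "p \<in> U1" for p u
   using A_L[OF U1U[OF that], of "\<kappa> u"] \<kappa>(1)[of u] by (simp add: V0_def)
  have QA: "Q (A p (\<kappa> u)) = A p (\<kappa> u)" if "p \<in> U1" for p u
   using QL[OF U1U[OF that], of "A p (\<kappa> u)"] LA[OF that] by simp
  let ?S = "subtopology (btotal ?E) (Sigma U1 (fibre ?E))"
  have tS: "fst q \<in> U1" "snd q \<in> F (fst q)" if "q \<in> topspace ?S" for q using that by auto
  have qS: "cmap ?S (\<TT> M) (\<lambda>q. (fst q, snd q))" by (rule from_sub[OF continuous_map_from_subbundle[OF Z cF]])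
  have fS: "cmap ?S ?TU fst" using continuous_map_compose[OF qS continuous_map_tangent_fst] U1U tS by (auto simp: into_sub o_def)
  have "trivial_on ?E U1 m"
  proof (rule trivial_onI[OF pE, where \<phi> = \<phi> and \<psi> = \<psi>])
   show "openin (bbase ?E) U1" using oU1 by simp
   have cW: "cmap ?S euclidean (\<lambda>q. W (fst q) (snd q))"
   proof (rule linear_family_inverse_continuous[where A = "\<lambda>q. A (fst q)" and y = "\<lambda>q. snd q c"])
    show "cmap ?S euclidean (\<lambda>q. A (fst q) w)" for w using continuous_map_compose[OF fS contA[of w]] by (simp add: o_def)
    show "cmap ?S euclidean (\<lambda>q. snd q c)" by (rule continuous_map_tangent_chartD[OF qS cc(1)]) (use tS(1) U1U Uc in blast)
   qed (use tS(1) linA[OF U1U] near A_W in blast)+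
   have "cmap ?S euclidean (\<lambda>q. \<iota> (W (fst q) (snd q)) i)" if i: "i < m" for i
   proof (rule continuous_map_linear_family[where L = "\<lambda>q w. \<iota> w i" and w = "\<lambda>q. W (fst q) (snd q)", OF V0])
    show "\<iota> (v + w) i = \<iota> v i + \<iota> w i" if "v \<in> V0" "w \<in> V0" for v w using \<iota>_add[OF that] i by simp
    show "\<iota> (r *\<^sub>R v) i = r *\<^sub>R \<iota> v i" if "v \<in> V0" for v r
     using \<iota>_scale[OF that, of "of_real r"] i by (simp add: scaleR_conv_of_real)
   qed (use cW W_V0 tS in auto)
   then show "cmap ?S (cvec_top m) (\<lambda>q. \<phi> (fst q) (snd q))" unfolding continuous_map_componentwise \<phi>_def
    using \<kappa>(3)[OF W_V0[OF tS]] by (auto simp: PiE_def)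
   let ?C = "prod_topology (subtopology (bbase ?E) U1) (cvec_top m)"
   have tC: "fst t \<in> U1" if "t \<in> topspace ?C" for t
    using that by (simp only: topspace_prod_topology mem_Times_iff topspace_subtopology Int_iff)
   have cC: "cmap ?C ?TU fst" using continuous_map_fst_subtopology[of ?Y U1 "cvec_top m"] tC U1U by (auto simp: into_sub)
   show "cmap ?C (btotal ?E) (\<lambda>t. (fst t, \<psi> (fst t) (snd t)))" unfolding continuous_map_into_subbundle
   proof (intro conjI ballI)
    show "cmap ?C (\<TT> M) (\<lambda>t. (fst t, \<psi> (fst t) (snd t)))"
    proof (rule continuous_map_into_tangentI)
     show "\<psi> (fst t) (snd t) \<in> \<T> M (fst t)" if "t \<in> topspace ?C" for t
      unfolding \<psi>_def by (rule tv_in[OF U1U[OF tC[OF that]]])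
     show "cmap ?C (mtop M) fst" using cC by (simp add: into_sub)
     fix t assume t: "t \<in> topspace ?C"
     have c\<kappa>: "cmap ?C euclidean (\<lambda>t. \<kappa> (snd t))"
      using continuous_map_compose[OF continuous_map_snd \<kappa>(7)] by (simp only: o_def)
     have cA': "cmap ?C euclidean (\<lambda>t. A (fst t) w)" for w
      using continuous_map_compose[OF cC contA[of w]] by (simp only: o_def)
     have "cmap ?C euclidean (\<lambda>t. A (fst t) (\<kappa> (snd t)))"
     proof (rule continuous_map_linear_family[where L = "\<lambda>t. A (fst t)" and w = "\<lambda>t. \<kappa> (snd t)" and V = UNIV])
      fix t v w and r :: real assume t: "t \<in> topspace ?C"
      show "A (fst t) (v + w) = A (fst t) v + A (fst t) w" "A (fst t) (r *\<^sub>R v) = r *\<^sub>R A (fst t) v"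
       using linA[OF U1U[OF tC[OF t]]] by (simp_all add: linear_add linear_scale)
     qed (use cA' c\<kappa> in simp_all)
     then have K1: "cmap ?C euclidean (\<lambda>t. \<psi> (fst t) (snd t) c)"
      by (rule continuous_map_eq) (simp add: \<psi>_def tv_c[OF U1U[OF tC]] QA[OF tC])
     have K2: "fst ` topspace ?C \<subseteq> fst c" using tC U1U Uc by blast
     show "\<exists>U c. openin ?C U \<and> t \<in> U \<and> c \<in> atlas M \<and> fst ` U \<subseteq> fst c \<and>
      cmap (subtopology ?C U) euclidean (\<lambda>t. \<psi> (fst t) (snd t) c)" by (rule exI[of _ "topspace ?C"], rule exI[of _ c])
       (simp only: openin_topspace t cc(1) K1 K2 subtopology_topspace simp_thms)
    qed
    fix t assume t: "t \<in> topspace ?C"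
    note p = tC[OF t]
    show "fst (fst t, \<psi> (fst t) (snd t)) \<in> Z" using UZ[OF U1U[OF p]] by simp
    show "snd (fst t, \<psi> (fst t) (snd t)) \<in> F (fst (fst t, \<psi> (fst t) (snd t)))"
     using tv_in[OF U1U[OF p]] tvL[OF U1U[OF p], symmetric] LA[OF p] by (simp add: F_def \<psi>_def)
   qed
  next
   fix p u assume p: "p \<in> U1" and u: "u \<in> cvec m"
   show "\<psi> p u \<in> fibre ?E p"
    using tv_in[OF U1U[OF p]] tvL[OF U1U[OF p], symmetric] LA[OF p] by (simp add: F_def \<psi>_def)
   have "A p (W p (\<psi> p u)) = A p (\<kappa> u)" using A_W[OF p] tv_c[OF U1U[OF p]] QA[OF p] by (simp add: \<psi>_def)
   then have "W p (\<psi> p u) = \<kappa> u" by (rule injA[OF p])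
   then show "\<phi> p (\<psi> p u) = u" using \<kappa>(2)[OF u] by (simp add: \<phi>_def)
  next
   fix p v assume p: "p \<in> U1" and v: "v \<in> fibre ?E p"
   then have vF: "v \<in> F p" by simp
   then have vT: "v \<in> \<T> M p" by (simp add: F_def)
   show "\<phi> p v \<in> cvec m" using \<kappa>(3)[OF W_V0[OF p vF]] by (simp add: \<phi>_def)
   show "\<psi> p (\<phi> p v) = v"
    using \<kappa>(4)[OF W_V0[OF p vF]] A_W[OF p] tv_chart[OF U1U[OF p] vT] by (simp add: \<phi>_def \<psi>_def)
   show "\<phi> p (bscale ?E p z v) = (\<lambda>i\<in>{..<m}. z * \<phi> p v i)" for z
   proof -
    have "A p (Re z *\<^sub>R W p v + Im z *\<^sub>R J p0 (W p v)) = Re z *\<^sub>R v c + Im z *\<^sub>R J p (v c)"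
     using linear_add[OF linA[OF U1U[OF p]]] linear_scale[OF linA[OF U1U[OF p]]] A_W[OF p] A_J[OF U1U[OF p]] by simp
    also have "J p (v c) = acs M p v c" using tv_chart[OF U1U[OF p] vT] by (simp add: J_def)
    also have "Re z *\<^sub>R v c + Im z *\<^sub>R acs M p v c = A p (W p (c_scale M p z v))"
     using A_W[OF p] by (simp add: c_scale_def)
    finally have "W p (c_scale M p z v) = Re z *\<^sub>R W p v + Im z *\<^sub>R J p0 (W p v)" using injA[OF p] by metis
    then show ?thesis using \<iota>_scale[OF W_V0[OF p vF]] by (simp add: \<phi>_def)
   qed
   fix w assume w: "w \<in> fibre ?E p"
   have "A p (W p v + W p w) = A p (W p (\<lambda>c. v c + w c))" using linear_add[OF linA[OF U1U[OF p]]] A_W[OF p] by simp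
   then have "W p (\<lambda>c. v c + w c) = W p v + W p w" using injA[OF p] by metis
   then show "\<phi> p (badd ?E p v w) = (\<lambda>i\<in>{..<m}. \<phi> p v i + \<phi> p w i)"
    using \<iota>_add[OF W_V0[OF p vF] W_V0[OF p]] w by (simp add: \<phi>_def)
  qed
  then show ?thesis using p0U1 by (intro exI conjI)
 qed
 then have "vector_bundle ?E" unfolding vector_bundle_iff using pE by simp
 then show ?thesis by (simp add: F_def)
qed

end

section \<open>Splitting a subbundle into pulled-back pieces\<close>

lemma continuous_map_into_pull_subbundle:
 assumes E: "prebundle (tangent_subbundle X Z F)" and f: "cmap Y (top_on X Z) f"
 shows "cmap T (btotal (pull_bundle Y f (tangent_subbundle X Z F))) g \<longleftrightarrow>
   cmap T Y (\<lambda>t. fst (g t)) \<and>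
   cmap T (\<TT> X) (\<lambda>t. (f (fst (g t)), snd (g t))) \<and>
   (\<forall>t\<in>topspace T. snd (g t) \<in> F (f (fst (g t))))"
proof -
 have f': "cmap Y (bbase (tangent_subbundle X Z F)) f" using f by simp
 have "f (fst (g t)) \<in> Z" if "cmap T Y (\<lambda>t. fst (g t))" "t \<in> topspace T" for t
  using continuous_map_mem[OF f continuous_map_mem[OF that]] by simp
 then show ?thesis by (auto simp: continuous_map_into_pull[OF E f'] continuous_map_into_subbundle)
qed

lemma continuous_map_from_pull_subbundle:
 assumes E: "prebundle (tangent_subbundle X Z F)" and f: "cmap Y (top_on X Z) f"
 shows "cmap (btotal (pull_bundle Y f (tangent_subbundle X Z F))) Y fst"
  and "cmap (btotal (pull_bundle Y f (tangent_subbundle X Z F))) (\<TT> X) (\<lambda>q. (f (fst q), snd q))"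
 using continuous_map_into_pull_subbundle[OF assms, of "btotal (pull_bundle Y f (tangent_subbundle X Z F))" "\<lambda>q. q"] by auto

text \<open>The common form of all decompositions below, with components \<open>\<phi> j\<close> and
  a joint inverse \<open>\<psi>\<close>. Continuity of \<open>\<psi>\<close> is asked for every
  topology on the tuples whose base point and components are continuous, so that its verification
  does not have to deal with the topology of \<open>big_sum\<close>.\<close>

lemma subbundle_decomposition:
 fixes M :: "('p, 'e::euclidean_space) acm" and X :: "('q, 'f::euclidean_space) acm"
 assumes acm: "acm_c1 M" "acm_c1 X"
  and N: "N \<subseteq> points M" and F: "\<And>x. x \<in> N \<Longrightarrow> c_subspace M x (F x)" and J: "finite J"
  and Z: "\<And>j. j \<in> J \<Longrightarrow> Z j \<subseteq> points X" and E: "\<And>j y. \<lbrakk>j \<in> J; y \<in> Z j\<rbrakk> \<Longrightarrow> c_subspace X y (E j y)"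
  and vb: "\<And>j. j \<in> J \<Longrightarrow> vector_bundle (tangent_subbundle X (Z j) (E j))"
  and q: "\<And>j. j \<in> J \<Longrightarrow> cmap (top_on M N) (top_on X (Z j)) (q j)"
  and \<phi>_cont: "\<And>j. j \<in> J \<Longrightarrow> cmap (subtopology (\<TT> M) (Sigma N F)) (\<TT> X)
    (\<lambda>t. (q j (fst t), \<phi> j (fst t) (snd t)))"
  and \<psi>_cont: "\<And>T :: ('p \<times> ('j \<Rightarrow> ('q, 'f) tvec)) topology.
    \<lbrakk>cmap T (top_on M N) fst; topspace T = Sigma N (\<lambda>x. \<Pi>\<^sub>E j\<in>J. E j (q j x));
     \<And>j. j \<in> J \<Longrightarrow> cmap T (\<TT> X) (\<lambda>t. (q j (fst t), snd t j))\<rbrakk> \<Longrightarrow>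
    cmap T (\<TT> M) (\<lambda>t. (fst t, \<psi> (fst t) (snd t)))"
  and \<phi>: "\<And>j x v. \<lbrakk>j \<in> J; x \<in> N; v \<in> F x\<rbrakk> \<Longrightarrow> \<phi> j x v \<in> E j (q j x)"
  and \<psi>\<phi>: "\<And>x v. \<lbrakk>x \<in> N; v \<in> F x\<rbrakk> \<Longrightarrow> \<psi> x (\<lambda>j\<in>J. \<phi> j x v) = v"
  and \<psi>: "\<And>x u. \<lbrakk>x \<in> N; u \<in> (\<Pi>\<^sub>E j\<in>J. E j (q j x))\<rbrakk> \<Longrightarrow> \<psi> x u \<in> F x \<and> (\<forall>j\<in>J. \<phi> j x (\<psi> x u) = u j)"
  and \<phi>_add: "\<And>j x v w. \<lbrakk>j \<in> J; x \<in> N; v \<in> F x; w \<in> F x\<rbrakk> \<Longrightarrow> \<phi> j x (\<lambda>c. v c + w c) = (\<lambda>c. \<phi> j x v c + \<phi> j x w c)"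
  and \<phi>_scale: "\<And>j x v z. \<lbrakk>j \<in> J; x \<in> N; v \<in> F x\<rbrakk> \<Longrightarrow> \<phi> j x (c_scale M x z v) = c_scale X (q j x) z (\<phi> j x v)"
 shows "vector_bundle (tangent_subbundle M N F)"
  and "K_equiv (top_on M N) (virt_of (tangent_subbundle M N F))
   (\<Sum>j\<in>J. K_pull (top_on M N) (q j) (virt_of (tangent_subbundle X (Z j) (E j))))"
proof -
 interpret M: acm_c1 M by fact
 interpret X: acm_c1 X by fact
 let ?Y = "top_on M N" and ?E = "tangent_subbundle M N F"
 let ?P = "\<lambda>j. pull_bundle ?Y (q j) (tangent_subbundle X (Z j) (E j))"
 have tY: "topspace ?Y = N" using N by auto
 have pE: "prebundle ?E" by (rule M.prebundle_tangent_subbundle[OF N F])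
 note pX = vector_bundle_prebundle[OF vb]
 have vP: "\<forall>j\<in>J. vector_bundle (?P j) \<and> bbase (?P j) = ?Y" by (auto intro!: vector_bundle_pull[OF vb] simp: q)
 then have fam: "\<forall>j\<in>J. prebundle (?P j) \<and> bbase (?P j) = ?Y" using vector_bundle_prebundle by blast
 let ?B = "big_sum ?Y J ?P"
 have tE: "topspace (btotal ?E) = Sigma N F" using prebundleD(1)[OF pE] tY by simp
 have tB: "topspace (btotal ?B) = Sigma N (\<lambda>x. \<Pi>\<^sub>E j\<in>J. E j (q j x))" using topspace_big_sum[OF fam] tY by simp
 have iso: "bundle_iso_by ?E ?B (\<lambda>x v. \<lambda>j\<in>J. \<phi> j x v) \<psi>" unfolding bundle_iso_by_def
 proof (intro conjI ballI)
  have bE: "cmap (btotal ?E) ?Y fst" using prebundleD(2)[OF pE] by simp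
  show "cmap (btotal ?E) (btotal ?B) (\<lambda>t. (fst t, \<lambda>j\<in>J. \<phi> j (fst t) (snd t)))"
   unfolding continuous_map_into_big_sum[OF fam] fst_conv snd_conv
  proof (intro conjI ballI bE)
   fix j assume j: "j \<in> J"
   show "cmap (btotal ?E) (btotal (?P j)) (\<lambda>t. (fst t, (\<lambda>j\<in>J. \<phi> j (fst t) (snd t)) j))"
    unfolding continuous_map_into_pull_subbundle[OF pX[OF j] q[OF j]]
    using bE \<phi>_cont[OF j] \<phi>[OF j] j tE by (auto simp: tangent_subbundle_def)
  qed simp
  have bB: "cmap (btotal ?B) ?Y fst" by (rule continuous_map_from_big_sum(1)[OF fam])
  have "cmap (btotal ?B) (\<TT> M) (\<lambda>t. (fst t, \<psi> (fst t) (snd t)))" by (rule \<psi>_cont[OF bB tB])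
    (use continuous_map_compose[OF continuous_map_from_big_sum(2)[OF fam] continuous_map_from_pull_subbundle(2)[OF pX q]] in \<open>simp add: o_def\<close>)
  then show "cmap (btotal ?B) (btotal ?E) (\<lambda>t. (fst t, \<psi> (fst t) (snd t)))"
   unfolding continuous_map_into_subbundle using \<psi> by (auto simp: tB)
 next
  fix x v assume "x \<in> topspace (bbase ?E)" "v \<in> fibre ?E x"
  then show "(\<lambda>j\<in>J. \<phi> j x v) \<in> fibre ?B x" "\<psi> x (\<lambda>j\<in>J. \<phi> j x v) = v" using \<phi> \<psi>\<phi> by auto
 next
  fix x u assume "x \<in> topspace (bbase ?E)" "u \<in> fibre ?B x"
  then have xu: "x \<in> N" "u \<in> (\<Pi>\<^sub>E j\<in>J. E j (q j x))" by auto
  show "\<psi> x u \<in> fibre ?E x" using \<psi>[OF xu] by simp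
  show "(\<lambda>j\<in>J. \<phi> j x (\<psi> x u)) = u" using \<psi>[OF xu] xu(2) by (intro extensionalityI[of _ J]) (auto simp: PiE_iff)
 next
  show "fibre_linear ?E ?B (\<lambda>x v. \<lambda>j\<in>J. \<phi> j x v)"
   unfolding fibre_linear_def by (simp add: \<phi>_add \<phi>_scale cong: restrict_cong)
 qed simp
 show "vector_bundle ?E" by (rule virt_of_decomposition(1)[OF J vP pE iso])
 have "K_equiv ?Y (virt_of ?E) (\<Sum>j\<in>J. virt_of (?P j))" by (rule virt_of_decomposition(2)[OF J vP pE iso])
 also have "K_equiv ?Y \<dots> (\<Sum>j\<in>J. K_pull ?Y (q j) (virt_of (tangent_subbundle X (Z j) (E j))))"
  by (rule K_equiv_sum, rule K_equiv_sym, rule K_pull_virt_of[OF vb]) (simp_all add: q)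
 finally show "K_equiv ?Y (virt_of ?E) (\<Sum>j\<in>J. K_pull ?Y (q j) (virt_of (tangent_subbundle X (Z j) (E j))))" .
qed

section \<open>Finite group actions\<close>

locale c1_action = acm_c1 M + group \<Gamma>
 for \<Gamma> :: "('g, 'm) monoid_scheme" (structure) and M :: "('p, 'e::euclidean_space) acm" +
 fixes \<rho> :: "'g \<Rightarrow> 'p \<Rightarrow> 'p"
 assumes finite_carrier: "finite (carrier \<Gamma>)"
  and act_one: "p \<in> points M \<Longrightarrow> \<rho> \<one> p = p"
  and act_mult: "\<lbrakk>a \<in> carrier \<Gamma>; b \<in> carrier \<Gamma>; p \<in> points M\<rbrakk> \<Longrightarrow> \<rho> (a \<otimes> b) p = \<rho> b (\<rho> a p)"
  and act_c1: "a \<in> carrier \<Gamma> \<Longrightarrow> c1_map M M (\<rho> a)"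
  and act_acs: "\<lbrakk>a \<in> carrier \<Gamma>; p \<in> points M; v \<in> \<T> M p\<rbrakk> \<Longrightarrow>
    tangent_map M M (\<rho> a) p (acs M p v) = acs M (\<rho> a p) (tangent_map M M (\<rho> a) p v)"

lemma c1_action_of_acm_action:
 assumes "group \<Gamma>" "finite (carrier \<Gamma>)" "compact_acm M" "acm_action \<Gamma> M \<rho>"
 shows "c1_action \<Gamma> M \<rho>"
proof -
 interpret acm_c1 M by (rule compact_acm_imp_acm_c1[OF assms(3)])
 show ?thesis using assms smooth_map_imp_c1_map[OF _ c1_manifold_axioms c1_manifold_axioms]
  by (intro c1_action.intro c1_action_axioms.intro acm_c1_axioms) (auto simp: acm_action_def)
qed

context acm_c1
begin

lemma tangent_sum:
 assumes "\<And>j. j \<in> J \<Longrightarrow> v j \<in> \<T> M p"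
 shows "(\<lambda>c. \<Sum>j\<in>J. v j c) \<in> \<T> M p" using assms
proof (induction J rule: infinite_finite_induct)
 case (insert j J)
 then show ?case using tangent_add[of "v j" p "\<lambda>c. \<Sum>j\<in>J. v j c"] by simp
qed (simp_all add: tangent_zero)

lemma additive_sum:
 fixes f :: "('p, 'e) tvec \<Rightarrow> 'c \<Rightarrow> 'b::real_vector"
 assumes add: "\<And>v w. \<lbrakk>v \<in> \<T> M p; w \<in> \<T> M p\<rbrakk> \<Longrightarrow> f (\<lambda>c. v c + w c) = (\<lambda>c. f v c + f w c)"
  and "\<And>j. j \<in> J \<Longrightarrow> v j \<in> \<T> M p"
 shows "f (\<lambda>c. \<Sum>j\<in>J. v j c) = (\<lambda>c. \<Sum>j\<in>J. f (v j) c)" using assms(2)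
proof (induction J rule: infinite_finite_induct)
 case (insert j J)
 then show ?case using add[of "v j" "\<lambda>c. \<Sum>j\<in>J. v j c"] tangent_sum[of J v p] by simp
\<comment> \<open>The empty sum: additivity at zero vectors gives f 0 = f 0 + f 0.\<close>
qed (use add[OF tangent_zero tangent_zero] in \<open>simp_all add: fun_eq_iff\<close>)

lemma c_scale_zero: "p \<in> points M \<Longrightarrow> c_scale M p z (\<lambda>c. 0) = (\<lambda>c. 0)"
 using acs_scaleR[OF _ tangent_zero, of p 0] by (simp add: c_scale_def fun_eq_iff)

lemma c_scale_sum:
 assumes "p \<in> points M" "\<And>j. j \<in> J \<Longrightarrow> v j \<in> \<T> M p"
 shows "c_scale M p z (\<lambda>c. \<Sum>j\<in>J. v j c) = (\<lambda>c. \<Sum>j\<in>J. c_scale M p z (v j) c)"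
 by (rule additive_sum[OF c_scale_add[OF assms(1)] assms(2)])

lemma continuous_map_tangent_sum:
 assumes x: "cmap T (mtop M) x"
  and "\<And>j. j \<in> J \<Longrightarrow> cmap T (\<TT> M) (\<lambda>t. (x t, v j t))"
 shows "cmap T (\<TT> M) (\<lambda>t. (x t, \<lambda>c. \<Sum>j\<in>J. v j t c))" using assms(2)
proof (induction J rule: infinite_finite_induct)
 case (insert j J)
 then show ?case using continuous_map_tangent_add[of T x "v j" "\<lambda>t c. \<Sum>j\<in>J. v j t c"] by simp
qed (simp_all add: continuous_map_tangent_zero[OF x])

end

section \<open>Fixed loci and averages over group elements\<close>

context c1_action
begin

abbreviation Fix :: "'g set \<Rightarrow> 'p set" where
 "Fix \<equiv> fixed_locus \<Gamma> M \<rho>"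

abbreviation push :: "'g \<Rightarrow> 'p \<Rightarrow> ('p, 'e) tvec \<Rightarrow> ('p, 'e) tvec" where
 "push a \<equiv> tangent_map M M (\<rho> a)"

abbreviation eigenspace :: "'g \<Rightarrow> complex \<Rightarrow> 'p \<Rightarrow> ('p, 'e) tvec set" where
 "eigenspace a \<mu> p \<equiv> {v \<in> \<T> M p. push a p v = c_scale M p \<mu> v}"

lemma act_in: "\<lbrakk>a \<in> carrier \<Gamma>; p \<in> points M\<rbrakk> \<Longrightarrow> \<rho> a p \<in> points M"
 by (rule c1_map.maps_points[OF act_c1])

lemma push_in: "\<lbrakk>a \<in> carrier \<Gamma>; p \<in> points M; v \<in> \<T> M p\<rbrakk> \<Longrightarrow> push a p v \<in> \<T> M (\<rho> a p)"
 by (rule c1_map.tangent_in[OF act_c1])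

lemma push_add:
 "\<lbrakk>a \<in> carrier \<Gamma>; p \<in> points M; v \<in> \<T> M p; w \<in> \<T> M p\<rbrakk> \<Longrightarrow>
   push a p (\<lambda>c. v c + w c) = (\<lambda>c. push a p v c + push a p w c)" by (rule c1_map.tangent_map_linear(1)[OF act_c1])

lemma push_scaleR:
 "\<lbrakk>a \<in> carrier \<Gamma>; p \<in> points M; v \<in> \<T> M p\<rbrakk> \<Longrightarrow>
   push a p (\<lambda>c. r *\<^sub>R v c) = (\<lambda>c. r *\<^sub>R push a p v c)"
 by (rule c1_map.tangent_map_linear(2)[OF act_c1])

lemma push_c_scale:
 assumes "a \<in> carrier \<Gamma>" "p \<in> points M" "v \<in> \<T> M p"
 shows "push a p (c_scale M p z v) = c_scale M (\<rho> a p) z (push a p v)"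
 using push_add[OF assms(1,2) tangent_scaleR[OF assms(3)] tangent_scaleR[OF acs_in[OF assms(2,3)]], of "Re z" "Im z"]
  push_scaleR[OF assms] push_scaleR[OF assms(1,2) acs_in[OF assms(2,3)]] act_acs[OF assms] by (simp add: c_scale_def)

lemma push_one: "\<lbrakk>p \<in> points M; v \<in> \<T> M p\<rbrakk> \<Longrightarrow> push \<one> p v = v"
 by (rule tangent_map_eq_id[OF act_c1]) (auto simp: act_one)

lemma push_mult:
 assumes "a \<in> carrier \<Gamma>" "b \<in> carrier \<Gamma>" "p \<in> points M" "v \<in> \<T> M p"
 shows "push (a \<otimes> b) p v = push b (\<rho> a p) (push a p v)"
 by (rule tangent_map_compose[OF act_c1[OF assms(1)] act_c1[OF assms(2)]
    act_c1[OF m_closed[OF assms(1,2)]] _ assms(3,4)])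
  (rule act_mult[OF assms(1,2)])

lemma push_sum:
 assumes "a \<in> carrier \<Gamma>" "p \<in> points M" "\<And>j. j \<in> J \<Longrightarrow> v j \<in> \<T> M p"
 shows "push a p (\<lambda>c. \<Sum>j\<in>J. v j c) = (\<lambda>c. \<Sum>j\<in>J. push a p (v j) c)"
 by (rule additive_sum[OF push_add[OF assms(1,2)] assms(3)])

lemma continuous_map_push:
 assumes "a \<in> carrier \<Gamma>" "cmap T (\<TT> M) (\<lambda>t. (x t, v t))"
 shows "cmap T (\<TT> M) (\<lambda>t. (\<rho> a (x t), push a (x t) (v t)))"
 by (rule c1_map.continuous_map_tangent_map[OF act_c1[OF assms(1)] assms(2)])

lemma continuous_act: "a \<in> carrier \<Gamma> \<Longrightarrow> cmap (mtop M) (mtop M) (\<rho> a)"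
 by (rule c1_map.continuous[OF act_c1])

lemma fixed_locus_eq:
 assumes "A \<subseteq> carrier \<Gamma>"
 shows "Fix A = {p \<in> points M. \<forall>a\<in>A. \<rho> a p = p}"
proof -
 have *: "\<rho> g p = p" if p: "p \<in> points M" "\<forall>a\<in>A. \<rho> a p = p" and g: "g \<in> generate \<Gamma> A" for g p
  using g
 proof induction
  case (inv h)
  then have h: "h \<in> carrier \<Gamma>" using assms by blast
  have "\<rho> (inv h) p = \<rho> (inv h) (\<rho> h p)" using inv p by simp
  also have "\<dots> = \<rho> (h \<otimes> inv h) p" using act_mult[OF h inv_closed[OF h] p(1)] by simp
  also have "\<dots> = p" using r_inv[OF h] act_one[OF p(1)] by simp
  finally show ?case .
 next
  case (eng h1 h2)
  then show ?case using act_mult[OF generate_in_carrier[OF assms] generate_in_carrier[OF assms] p(1)] by simp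
 qed (use p act_one in auto)
 show ?thesis unfolding fixed_locus_def by (auto intro: generate.incl *)
qed

lemma fixed_locus_subset: "Fix A \<subseteq> points M" by (auto simp: fixed_locus_def)

lemma fixed_locusD: "\<lbrakk>p \<in> Fix A; h \<in> generate \<Gamma> A\<rbrakk> \<Longrightarrow> \<rho> h p = p"
 by (auto simp: fixed_locus_def)

lemma c_subspace_tangent: "p \<in> points M \<Longrightarrow> c_subspace M p (\<T> M p)"
 by (auto simp: c_subspace_def tangent_add c_scale_in)

lemma c_subspace_eigen:
 assumes a: "a \<in> carrier \<Gamma>" and p: "p \<in> points M" "\<rho> a p = p"
 shows "c_subspace M p (eigenspace a \<mu> p)" using push_add[OF a p(1)] push_c_scale[OF a p(1)] p
 by (auto simp: c_subspace_def tangent_add c_scale_in c_scale_add c_scale_c_scale mult.commute)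

text \<open>One formula for three projections: the identity (one element), the projection onto an
  eigenspace (the powers of an element, weighted by a character), and the projection onto the
  invariant vectors (a subgroup with equal weights).\<close>

definition average :: "'j set \<Rightarrow> ('j \<Rightarrow> 'g) \<Rightarrow> ('j \<Rightarrow> complex) \<Rightarrow> 'p \<Rightarrow> ('p, 'e) tvec \<Rightarrow> ('p, 'e) tvec" where
 "average J h w p v = (\<lambda>c. \<Sum>j\<in>J. c_scale M p (w j) (push (h j) p v) c)"

context
 fixes Z :: "'p set" and J :: "'j set" and h :: "'j \<Rightarrow> 'g" and w :: "'j \<Rightarrow> complex"
 assumes Z: "Z \<subseteq> points M" and h: "\<And>j. j \<in> J \<Longrightarrow> h j \<in> carrier \<Gamma>"
  and fixp: "\<And>j p. \<lbrakk>j \<in> J; p \<in> Z\<rbrakk> \<Longrightarrow> \<rho> (h j) p = p"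
begin

lemma push_fixed: "\<lbrakk>j \<in> J; p \<in> Z; v \<in> \<T> M p\<rbrakk> \<Longrightarrow> push (h j) p v \<in> \<T> M p"
 using push_in[OF h, of j p v] fixp Z by auto

lemma average_in: "\<lbrakk>p \<in> Z; v \<in> \<T> M p\<rbrakk> \<Longrightarrow> average J h w p v \<in> \<T> M p"
 unfolding average_def by (rule tangent_sum) (use push_fixed c_scale_in Z in blast)

lemma average_add:
 assumes "p \<in> Z" "v \<in> \<T> M p" "v' \<in> \<T> M p"
 shows "average J h w p (\<lambda>c. v c + v' c) = (\<lambda>c. average J h w p v c + average J h w p v' c)"
proof -
 have p: "p \<in> points M" using assms Z by blast
 have "c_scale M p (w j) (push (h j) p (\<lambda>c. v c + v' c)) =
   (\<lambda>c. c_scale M p (w j) (push (h j) p v) c + c_scale M p (w j) (push (h j) p v') c)" if "j \<in> J" for j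
  using push_add[OF h[OF that] p assms(2,3)] c_scale_add[OF p push_fixed[OF that assms(1,2)] push_fixed[OF that assms(1,3)]] by simp
 then show ?thesis by (simp add: average_def sum.distrib)
qed

lemma average_c_scale:
 assumes "p \<in> Z" "v \<in> \<T> M p"
 shows "average J h w p (c_scale M p z v) = c_scale M p z (average J h w p v)"
proof -
 have p: "p \<in> points M" using assms Z by blast
 have "c_scale M p (w j) (push (h j) p (c_scale M p z v)) = c_scale M p z (c_scale M p (w j) (push (h j) p v))" if "j \<in> J" for j
  using push_c_scale[OF h[OF that] p assms(2)] fixp[OF that assms(1)] c_scale_c_scale[OF p push_fixed[OF that assms]]
  by (simp add: mult.commute)
 then show ?thesis unfolding average_def using c_scale_sum[OF p, of J "\<lambda>j. c_scale M p (w j) (push (h j) p v)" z]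
   c_scale_in[OF p push_fixed[OF _ assms]] by simp
qed

lemma average_continuous:
 "cmap (subtopology (\<TT> M) {q. fst q \<in> Z}) (\<TT> M)
   (\<lambda>q. (fst q, average J h w (fst q) (snd q)))"
proof -
 let ?T = "subtopology (\<TT> M) {q. fst q \<in> Z}"
 have q: "cmap ?T (\<TT> M) (\<lambda>q. (fst q, snd q))" by (simp add: from_sub)
 have x: "cmap ?T (mtop M) fst" by (rule from_sub[OF continuous_map_tangent_fst])
 have "cmap ?T (\<TT> M) (\<lambda>q. (fst q, push (h j) (fst q) (snd q)))" if "j \<in> J" for j
  by (rule continuous_map_eq[OF continuous_map_push[OF h[OF that] q]]) (use fixp[OF that] in simp)
 then show ?thesis unfolding average_def by (intro continuous_map_tangent_sum x continuous_map_c_scale)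
qed

lemma vector_bundle_average:
 assumes into: "\<And>p v. \<lbrakk>p \<in> Z; v \<in> \<T> M p\<rbrakk> \<Longrightarrow> average J h w p v \<in> F p"
  and idF: "\<And>p v. \<lbrakk>p \<in> Z; v \<in> F p\<rbrakk> \<Longrightarrow> average J h w p v = v"
  and F: "\<And>p. p \<in> Z \<Longrightarrow> c_subspace M p (F p)"
 shows "vector_bundle (tangent_subbundle M Z F)"
proof -
 \<comment> \<open>\<open>F'\<close> and \<open>F\<close> agree over \<open>Z\<close> but possibly
   not elsewhere, so the two bundles are isomorphic rather than equal as records.\<close>
 define F' where "F' = (\<lambda>p. {v \<in> \<T> M p. average J h w p v = v})"
 have vb: "vector_bundle (tangent_subbundle M Z F')" unfolding F'_def
  by (rule vector_bundle_projection[OF Z average_in average_add average_c_scale _ average_continuous])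
   (use idF[OF _ into] in simp_all)
 have eq: "F' p = F p" if "p \<in> Z" for p using into[OF that] idF[OF that] F[OF that] by (force simp: F'_def c_subspace_def)
 have "Sigma Z F' = Sigma Z F" using eq by auto
 then have "bundle_iso_by (tangent_subbundle M Z F) (tangent_subbundle M Z F') (\<lambda>_ v. v) (\<lambda>_ v. v)"
  using eq by (auto simp: bundle_iso_by_def fibre_linear_def tangent_subbundle_def)
 then show ?thesis using vector_bundle_iso[OF prebundle_tangent_subbundle[OF Z F] _ vb] by blast
qed

end

lemma vector_bundle_TM:
 assumes "Z \<subseteq> points M"
 shows "vector_bundle (TM_restricted M Z)" unfolding TM_restricted_def
proof (rule vector_bundle_average[where J = "{()}" and h = "\<lambda>_. \<one>" and w = "\<lambda>_. 1", OF assms])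
 fix p v assume p: "p \<in> Z" and v: "v \<in> \<T> M p"
 then have p': "p \<in> points M" using assms by blast
 show "average {()} (\<lambda>_. \<one>) (\<lambda>_. 1) p v = v" "average {()} (\<lambda>_. \<one>) (\<lambda>_. 1) p v \<in> \<T> M p"
  using push_one[OF p' v] v by (simp_all add: average_def)
qed (use assms act_one c_subspace_tangent in auto)

definition eig :: "'g \<Rightarrow> complex \<Rightarrow> ('p, ('p, 'e) tvec) cbundle" where
 "eig a \<mu> = tangent_subbundle M (Fix {a})
   (eigenspace a \<mu>)"

section \<open>Eigenbundles\<close>

lemma eigenbundle_eq_eig:
 "eigenbundle \<Gamma> M \<rho> a k = eig a (exp (- (2 * of_real pi * \<i> * of_nat k / of_nat (ord a))))"
 by (simp add: eigenbundle_def eig_def)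

lemma eig_simps [simp]:
 "bbase (eig a \<mu>) = top_on M (Fix {a})"
 "fibre (eig a \<mu>) = (eigenspace a \<mu>)" by (simp_all add: eig_def)

lemma fixed_locus_single:
 assumes "a \<in> carrier \<Gamma>"
 shows "Fix {a} = {p \<in> points M. \<rho> a p = p}" using fixed_locus_eq[of "{a}"] assms by simp

lemma act_pow:
 assumes a: "a \<in> carrier \<Gamma>" and p: "p \<in> points M" "\<rho> a p = p"
 shows "\<rho> (a [^] (k::nat)) p = p" by (induction k) (use act_one act_mult[OF nat_pow_closed[OF a] a] p in auto)

lemma push_pow_eigen:
 assumes a: "a \<in> carrier \<Gamma>" and p: "p \<in> points M" "\<rho> a p = p"
  and v: "v \<in> \<T> M p" "push a p v = c_scale M p \<mu> v"
 shows "push (a [^] (k::nat)) p v = c_scale M p (\<mu> ^ k) v"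
proof (induction k)
 case 0
 then show ?case using push_one p v by simp
next
 case (Suc k)
 have "push (a [^] Suc k) p v = push a p (push (a [^] k) p v)"
  using push_mult[OF nat_pow_closed[OF a] a p(1) v(1), of k] act_pow[OF a p, of k] by simp
 also have "\<dots> = c_scale M p (\<mu> ^ Suc k) v"
  using Suc push_c_scale[OF a p(1) v(1)] v p c_scale_c_scale[OF p(1) v(1)] by (simp add: mult.commute)
 finally show ?case .
qed

lemma prebundle_eig:
 assumes a: "a \<in> carrier \<Gamma>"
 shows "prebundle (eig a \<mu>)" unfolding eig_def
 by (rule prebundle_tangent_subbundle[OF fixed_locus_subset]) (use c_subspace_eigen[OF a] fixed_locus_single[OF a] in auto)

text \<open>Applying \<open>a\<close> as often as its order multiplies an eigenvector by
  \<open>\<mu> ^ ord a\<close> and is the identity, so only the zero vector is left. The sums over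
  many roots of unity below rely on such terms being zero.\<close>

lemma eig_zero:
 assumes a: "a \<in> carrier \<Gamma>" and \<mu>: "\<mu> ^ ord a \<noteq> 1"
 shows "vector_bundle (eig a \<mu>)"
  and "K_equiv (top_on M (Fix {a})) (virt_of (eig a \<mu>)) 0"
proof -
 let ?Y = "top_on M (Fix {a})"
 have fib: "fibre (eig a \<mu>) p = {\<lambda>c. 0}" if "p \<in> topspace ?Y" for p
 proof -
  have p: "p \<in> points M" "\<rho> a p = p" using that fixed_locus_single[OF a] by auto
  have "v = (\<lambda>c. 0)" if v: "v \<in> \<T> M p" "push a p v = c_scale M p \<mu> v" for v
  proof -
   have "c_scale M p 1 v = c_scale M p (\<mu> ^ ord a) v"
    using push_pow_eigen[OF a p v, of "ord a"] pow_ord_eq_1[OF a] push_one[OF p(1) v(1)] by simp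
   then have "c_scale M p (1 - \<mu> ^ ord a) v = (\<lambda>c. 0)" by (simp add: c_scale_def fun_eq_iff algebra_simps)
   then have "c_scale M p (1 / (1 - \<mu> ^ ord a)) (c_scale M p (1 - \<mu> ^ ord a) v) = (\<lambda>c. 0)"
    using c_scale_zero[OF p(1)] by simp
   then show ?thesis using \<mu> by (simp add: c_scale_c_scale[OF p(1) v(1)])
  qed
  moreover have "push a p (\<lambda>c. 0) = (\<lambda>c. 0)" using push_scaleR[OF a p(1) tangent_zero, of 0] by simp
  ultimately show ?thesis using tangent_zero c_scale_zero[OF p(1)] by auto
 qed
 have ct: "cmap ?Y (btotal (eig a \<mu>)) (\<lambda>y. (y, \<lambda>c. 0))" unfolding eig_def continuous_map_into_subbundle
 proof (intro conjI ballI)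
  have "cmap ?Y (mtop M) (\<lambda>y. y)" using continuous_map_id_subt[of "mtop M"] by (simp add: id_def)
  then show "cmap ?Y (\<TT> M) (\<lambda>y. (y, \<lambda>c. 0))" by (rule continuous_map_tangent_zero)
  fix y assume y: "y \<in> topspace ?Y"
  then show "fst (y, \<lambda>c. 0) \<in> Fix {a}" by simp
  show "snd (y, \<lambda>c. 0) \<in> {v \<in> \<T> M (fst (y, \<lambda>c. 0)). push a (fst (y, \<lambda>c. 0)) v = c_scale M (fst (y, \<lambda>c. 0)) \<mu> v}"
   using fib[OF y] by (simp add: eig_def set_eq_iff)
 qed
 show "vector_bundle (eig a \<mu>)" "K_equiv ?Y (virt_of (eig a \<mu>)) 0"
  using virt_of_zero[OF prebundle_eig[OF a] eig_simps(1) fib ct] by auto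
qed

text \<open>The character projection for the cyclic group of \<open>a\<close>: pushing by
  \<open>a\<close> shifts the index of summation and releases a factor \<open>\<mu>\<close>.\<close>

lemma eig_projection:
 assumes a: "a \<in> carrier \<Gamma>" and \<mu>: "\<mu> ^ ord a = 1" and p: "p \<in> points M" "\<rho> a p = p"
 defines "P \<equiv> average {..<ord a} (\<lambda>k. a [^] k) (\<lambda>k. inverse (\<mu> ^ k) / of_nat (ord a)) p"
 shows "v \<in> \<T> M p \<Longrightarrow> P v \<in> eigenspace a \<mu> p"
  and "\<lbrakk>v \<in> \<T> M p; push a p v = c_scale M p \<mu> v\<rbrakk> \<Longrightarrow> P v = v"
proof -
 let ?s = "ord a"
 have s0: "?s > 0" using ord_ge_1[OF finite_carrier a] by simp
 have nz: "\<mu> \<noteq> 0" using \<mu> s0 by (cases "\<mu> = 0") (auto simp: power_0_left)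
 have pk: "push (a [^] k) p v \<in> \<T> M p" if "v \<in> \<T> M p" for k :: nat and v
  using push_in[OF nat_pow_closed[OF a] p(1) that] act_pow[OF a p] by simp
 show "P v = v" if v: "v \<in> \<T> M p" "push a p v = c_scale M p \<mu> v"
 proof -
  have "P v = (\<lambda>c. \<Sum>k<?s. c_scale M p (1 / of_nat ?s) v c)"
   unfolding P_def average_def using push_pow_eigen[OF a p v] c_scale_c_scale[OF p(1) v(1)] nz by (simp add: field_simps)
  also have "\<dots> = (\<lambda>c. of_nat ?s *\<^sub>R c_scale M p (of_real (1 / of_nat ?s)) v c)"
   by (simp add: sum_constant_scaleR)
  also have "\<dots> = v" unfolding c_scale_of_real using s0 by simp
  finally show ?thesis .
 qed
 show "P v \<in> eigenspace a \<mu> p" if v: "v \<in> \<T> M p"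
 proof -
  let ?w = "\<lambda>k. c_scale M p (inverse (\<mu> ^ k) / of_nat ?s) (push (a [^] k) p v)"
  have wT: "?w k \<in> \<T> M p" for k :: nat by (intro c_scale_in p pk v)
  have P: "P v = (\<lambda>c. \<Sum>k<?s. ?w k c)" by (simp add: P_def average_def)
  have step: "push a p (?w k) = c_scale M p \<mu> (?w (Suc k))" for k
  proof -
   have "push a p (?w k) = c_scale M p (inverse (\<mu> ^ k) / of_nat ?s) (push (a [^] Suc k) p v)"
    using push_c_scale[OF a p(1) pk[OF v, of k]] p push_mult[OF nat_pow_closed[OF a] a p(1) v, of k] act_pow[OF a p, of k] by simp
   then show ?thesis using c_scale_c_scale[OF p(1) pk[OF v, of "Suc k"]] nz by (simp add: field_simps)
  qed
  \<comment> \<open>The shift closes up because \<open>a\<close> and \<open>\<mu>\<close> both have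
    trivial \<open>ord a\<close>-th power.\<close>
  have ws: "?w ?s = ?w 0" using pow_ord_eq_1[OF a] \<mu> by simp
  have shift: "(\<Sum>k<?s. ?w (Suc k) c) = (\<Sum>k<?s. ?w k c)" for c
  proof -
   have "(\<Sum>k<?s. ?w (Suc k) c) + ?w 0 c = (\<Sum>k<Suc ?s. ?w k c)" by (subst sum.lessThan_Suc_shift) (simp add: add.commute)
   also have "\<dots> = (\<Sum>k<?s. ?w k c) + ?w 0 c" using ws by simp
   finally show ?thesis by simp
  qed
  have "push a p (P v) = (\<lambda>c. \<Sum>k<?s. push a p (?w k) c)" unfolding P by (rule push_sum[OF a p(1) wT])
  also have "\<dots> = (\<lambda>c. \<Sum>k<?s. c_scale M p \<mu> (?w (Suc k)) c)" by (simp only: step)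
  also have "\<dots> = c_scale M p \<mu> (\<lambda>c. \<Sum>k<?s. ?w (Suc k) c)" by (rule c_scale_sum[OF p(1) wT, symmetric])
  also have "\<dots> = c_scale M p \<mu> (P v)" unfolding P by (simp only: shift)
  finally have "push a p (P v) = c_scale M p \<mu> (P v)" .
  moreover have "P v \<in> \<T> M p" unfolding P by (rule tangent_sum[OF wT])
  ultimately show ?thesis by simp
 qed
qed

lemma vector_bundle_eig:
 assumes a: "a \<in> carrier \<Gamma>"
 shows "vector_bundle (eig a \<mu>)"
proof (cases "\<mu> ^ ord a = 1")
 case True
 show ?thesis unfolding eig_def
  by (rule vector_bundle_average[where J = "{..<ord a}" and h = "\<lambda>k. a [^] k" and w = "\<lambda>k. inverse (\<mu> ^ k) / of_nat (ord a)",
    OF fixed_locus_subset])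
   (use eig_projection[OF a True] c_subspace_eigen[OF a] act_pow[OF a] a in \<open>auto simp: fixed_locus_single[OF a]\<close>)
qed (rule eig_zero[OF a])

end

subsection \<open>Tangent spaces of fixed loci\<close>

context c1_action
begin

text \<open>Averaging a chart \<open>\<phi>\<close> at a fixed point to \<open>\<psi> = |H|\<^sup>-\<^sup>1 \<Sum>\<^sub>h (dh)\<^sup>-\<^sup>1 \<circ> \<phi> \<circ> h\<close> makes it equivariant for the
 linearized action; by the inverse function theorem it is still a chart, and it maps fixed points
 to fixed vectors.\<close>

lemma fixed_curve:
 assumes H: "subgroup H \<Gamma>" and p: "p \<in> points M" and fixp: "\<And>h. h \<in> H \<Longrightarrow> \<rho> h p = p"
  and v: "v \<in> \<T> M p" and fixv: "\<And>h. h \<in> H \<Longrightarrow> push h p v = v"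
 obtains \<gamma> where "cmap euclidean (mtop M) \<gamma>" "\<gamma> 0 = p" "velocity M \<gamma> v"
  "\<And>t h. h \<in> H \<Longrightarrow> \<rho> h (\<gamma> t) = \<gamma> t"
proof -
 have HG: "H \<subseteq> carrier \<Gamma>" using H by (rule subgroup.subset)
 have Hc: "h \<in> carrier \<Gamma>" if "h \<in> H" for h using HG that by blast
 have fH: "finite H" using finite_subset[OF HG finite_carrier] .
 have oneH: "\<one> \<in> H" using H by (rule subgroup.one_closed)
 have multH: "h \<otimes> k \<in> H" if "h \<in> H" "k \<in> H" for h k using subgroup.m_closed[OF H that] .
 have invH: "inv h \<in> H" if "h \<in> H" for h using subgroup.m_inv_closed[OF H that] .
 define n where "n = real (card H)"
 have n0: "n > 0" using fH oneH by (auto simp: n_def card_gt_0_iff)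
 obtain c where c: "c \<in> charts_at M p" using charts_at_nonempty[OF p] by blast
 note cc = charts_atD[OF c]
 have ch: "c \<in> charts_at M x" if "x \<in> fst c" for x using cc(1) that by (simp add: charts_at_def)
 let ?V = "model M"
 note V = subspace_model
 \<comment> \<open>All translates of a point of \<open>U\<close> by \<open>H\<close> stay in the
   chart, so they can be averaged in it; moreover \<open>U\<close> is stable under
   \<open>H\<close>.\<close>
 define U where "U = {x \<in> points M. \<forall>h\<in>H. \<rho> h x \<in> fst c}"
 have Uc: "x \<in> fst c" and Up: "x \<in> points M" and Uh: "h \<in> H \<Longrightarrow> \<rho> h x \<in> fst c" if "x \<in> U" for x h
  using that oneH act_one[of x] by (auto simp: U_def)
 have pU: "p \<in> U" using p fixp cc by (simp add: U_def)
 have actU: "\<rho> h x \<in> U" if x: "x \<in> U" and h: "h \<in> H" for h x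
 proof -
  have "\<rho> k (\<rho> h x) \<in> fst c" if k: "k \<in> H" for k
   using act_mult[OF Hc[OF h] Hc[OF k] Up[OF x]] Uh[OF x multH[OF h k]] by simp
  then show ?thesis using act_in[OF Hc[OF h] Up[OF x]] by (simp add: U_def)
 qed
 have oU: "openin (mtop M) U"
 proof -
  have "U = (\<Inter>h\<in>H. {x \<in> points M. \<rho> h x \<in> fst c})" using oneH by (auto simp: U_def)
  moreover have "openin (mtop M) (\<Inter>h\<in>H. {x \<in> points M. \<rho> h x \<in> fst c})"
   by (rule openin_INT2[OF fH]) (use oneH openin_continuous_map_preimage[OF continuous_act[OF Hc] chart_open[OF cc(1)]] in auto)
  ultimately show ?thesis by simp
 qed
 define S where "S = snd c ` U"
 have oS: "openin (top_of_set ?V) S" unfolding S_def by (rule chart_open_image[OF cc(1) oU]) (use Uc in blast)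
 then obtain O' where O': "open O'" "S = ?V \<inter> O'" by (auto simp: openin_open)
 define a where "a = snd c p"
 have aS: "a \<in> S" using pU by (simp add: a_def S_def)
 have cS: "chart_inv c y \<in> U" "snd c (chart_inv c y) = y" if "y \<in> S" for y
  using that Uc chart_inv[OF cc(1)] by (auto simp: S_def)
 define f where "f = (\<lambda>h y. snd c (\<rho> h (chart_inv c y)))"
 have fS: "f h y \<in> S" if "h \<in> H" "y \<in> S" for h y unfolding f_def S_def using actU[OF cS(1)[OF that(2)] that(1)] by blast
 have f_f: "f h (f k y) = f (k \<otimes> h) y" if "h \<in> H" "k \<in> H" "y \<in> S" for h k y
 proof -
  note x = cS(1)[OF that(3)]
  have "chart_inv c (f k y) = \<rho> k (chart_inv c y)" unfolding f_def by (rule chart_inv[OF cc(1) Uh[OF x that(2)]])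
  then show ?thesis using act_mult[OF Hc[OF that(2)] Hc[OF that(1)] Up[OF x]] by (simp add: f_def)
 qed
 have f_a: "f h a = a" if "h \<in> H" for h using fixp[OF that] chart_inv[OF cc(1,2)] by (simp add: f_def a_def)
 define D where "D = (\<lambda>h y. chart_deriv (\<rho> h) c c (chart_inv c y))"
 define L where "L = (\<lambda>h. chart_deriv (\<rho> h) c c p)"
 have S_dom: "S \<subseteq> chart_dom (\<rho> h) c c" if "h \<in> H" for h
  using Uc Uh[OF _ that] by (auto simp: S_def chart_dom_def)
 have D: "(f h has_derivative D h y) (at y within S)" if "h \<in> H" "y \<in> S" for h y
 proof -
  note x = cS[OF that(2)]
  have "(chart_rep (\<rho> h) c c has_derivative D h y) (at (snd c (chart_inv c y)) within chart_dom (\<rho> h) c c)"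
   unfolding D_def by (rule c1_map.chart_deriv[OF act_c1[OF Hc[OF that(1)]] ch[OF Uc[OF x(1)]] ch[OF Uh[OF x(1) that(1)]]])
  then have "(chart_rep (\<rho> h) c c has_derivative D h y) (at y within S)"
   using has_derivative_subset[OF _ S_dom[OF that(1)]] x(2) by simp
  moreover have "chart_rep (\<rho> h) c c = f h" by (simp add: chart_rep_def f_def fun_eq_iff)
  ultimately show ?thesis by simp
 qed
 have Da: "D h a = L h" for h using chart_inv[OF cc(1,2)] by (simp add: D_def L_def a_def)
 have contD: "continuous_on S (\<lambda>y. D h y w)" if "h \<in> H" "w \<in> ?V" for h w
 proof -
  have "cmap (top_of_set S) (top_on M (fst c \<inter> \<rho> h -` fst c)) (chart_inv c)"
  proof -
   have "cmap (top_of_set S) (mtop M) (chart_inv c)"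
    using continuous_map_from_subtopology_mono[OF continuous_chart_inv[OF cc(1)], of S] Uc
    by (auto simp: S_def subtopology_subtopology)
   then show ?thesis using cS Uc Uh[OF _ that(1)] by (auto simp: into_sub)
  qed
  from continuous_map_compose[OF this c1_map.continuous_chart_deriv[OF act_c1[OF Hc[OF that(1)]] cc(1) cc(1) that(2)]]
  show ?thesis by (simp add: o_def D_def)
 qed
 have linL: "linear (L h)" if "h \<in> H" for h
  using has_derivative_bounded_linear[OF D[OF that aS]] Da bounded_linear.linear by metis
 define tv where "tv = tangent_vec M p c"
 have tv: "tv w \<in> \<T> M p" "tv w c = w" if "w \<in> ?V" for w using tangent_vec_in[OF c that] by (simp_all add: tv_def)
 have L_push: "L h w = push h p (tv w) c" if "h \<in> H" "w \<in> ?V" for h w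
  using c1_map.tangent_chart[OF act_c1[OF Hc[OF that(1)]] p tv(1)[OF that(2)] c, of c] c fixp[OF that(1)] tv(2)[OF that(2)]
  by (simp add: L_def)
 have LV: "L h w \<in> ?V" if "h \<in> H" "w \<in> ?V" for h w
  using c1_map.chart_deriv_in_model[OF act_c1[OF Hc[OF that(1)]] c _ that(2)] fixp[OF that(1)] c by (simp add: L_def)
 have tvL: "tv (L h w) = push h p (tv w)" if "h \<in> H" "w \<in> ?V" for h w
  using tangent_vec_chart[OF c, of "push h p (tv w)"] push_in[OF Hc[OF that(1)] p tv(1)[OF that(2)]] fixp[OF that(1)]
   L_push[OF that] by (simp add: tv_def)
 have L_L: "L k (L h w) = L (h \<otimes> k) w" if "h \<in> H" "k \<in> H" "w \<in> ?V" for h k w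
  using L_push[OF that(2) LV[OF that(1,3)]] tvL[OF that(1,3)] push_mult[OF Hc[OF that(1)] Hc[OF that(2)] p tv(1)[OF that(3)]]
   L_push[OF multH[OF that(1,2)] that(3)] fixp[OF that(1)] by simp
 have L_one: "L \<one> w = w" if "w \<in> ?V" for w using L_push[OF oneH that] push_one[OF p tv(1)[OF that]] tv(2)[OF that] by simp
 have L_v: "L h (v c) = v c" if "h \<in> H" for h
  using L_push[OF that tangent_spaceD(2)[OF v c]] tangent_vec_chart[OF c v] fixv[OF that] by (simp add: tv_def)
 have SV: "y \<in> ?V" if "y \<in> S" for y using that O' by blast
 define \<psi> where "\<psi> = (\<lambda>y. (1 / n) *\<^sub>R (\<Sum>h\<in>H. L (inv h) (f h y)))"
 have \<psi>V: "\<psi> y \<in> ?V" if "y \<in> S" for y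
  unfolding \<psi>_def by (intro subspace_scale[OF V] subspace_sum[OF V] LV invH SV[OF fS] that)
 \<comment> \<open>Equivariance of the average, by the substitution of \<open>k \<otimes> h\<close>
   for \<open>h\<close> in the sum.\<close>
 have \<psi>_f: "\<psi> (f k y) = L k (\<psi> y)" if k: "k \<in> H" and y: "y \<in> S" for k y
 proof -
  have bij: "bij_betw (\<lambda>h. k \<otimes> h) H H"
  proof (rule bij_betwI[where g = "\<lambda>h. inv k \<otimes> h"])
   show "inv k \<otimes> (k \<otimes> h) = h" if "h \<in> H" for h using Hc[OF k] Hc[OF that] by (simp add: m_assoc[symmetric])
   show "k \<otimes> (inv k \<otimes> h) = h" if "h \<in> H" for h using Hc[OF k] Hc[OF that] by (simp add: m_assoc[symmetric])
  qed (use k multH invH in auto)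
  have "L k (\<psi> y) = (1 / n) *\<^sub>R (\<Sum>h\<in>H. L k (L (inv h) (f h y)))"
   using linear_scale[OF linL[OF k]] linear_sum[OF linL[OF k], of "\<lambda>h. L (inv h) (f h y)" H] by (simp add: \<psi>_def)
  also have "(\<Sum>h\<in>H. L k (L (inv h) (f h y))) = (\<Sum>h\<in>H. L (inv h \<otimes> k) (f h y))"
   by (rule sum.cong[OF refl]) (use L_L[OF invH k SV[OF fS[OF _ y]]] in simp)
  also have "\<dots> = (\<Sum>h\<in>H. L (inv (k \<otimes> h) \<otimes> k) (f (k \<otimes> h) y))"
   by (rule sum.reindex_bij_betw[OF bij, symmetric])
  also have "\<dots> = (\<Sum>h\<in>H. L (inv h) (f h (f k y)))"
  proof (rule sum.cong[OF refl])
   fix h assume h: "h \<in> H"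
   have "inv (k \<otimes> h) \<otimes> k = inv h" using Hc[OF k] Hc[OF h] by (simp add: inv_mult_group m_assoc)
   then show "L (inv (k \<otimes> h) \<otimes> k) (f (k \<otimes> h) y) = L (inv h) (f h (f k y))" using f_f[OF h k y] by simp
  qed
  finally show ?thesis by (simp add: \<psi>_def)
 qed
 obtain Q where Q: "linear Q" "\<And>w. Q w \<in> ?V" "\<And>w. w \<in> ?V \<Longrightarrow> Q w = w"
  using orthogonal_projection[OF V] by blast
 define W where "W = Q -` O'"
 have contQ: "continuous_on UNIV Q" by (rule linear_continuous_on[OF linear_conv_bounded_linear[THEN iffD1, OF Q(1)]])
 have oW: "open W" unfolding W_def using open_vimage[OF O'(1) contQ] .
 have WS: "Q y \<in> S" if "y \<in> W" for y using that Q(2) O'(2) by (simp add: W_def)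
 have aW: "a \<in> W" using aS Q(3) O'(2) by (simp add: W_def)
 have Qa: "Q a = a" using Q(3) SV[OF aS] by simp
 \<comment> \<open>The inverse function theorem wants an open set of the whole Euclidean space;
   \<open>\<psi>\<close> is extended by the identity in the directions that \<open>Q\<close>
   kills.\<close>
 define \<Psi> where "\<Psi> = (\<lambda>y. \<psi> (Q y) + (y - Q y))"
 define d where "d = (\<lambda>y w. (1 / n) *\<^sub>R (\<Sum>h\<in>H. L (inv h) (D h (Q y) (Q w))) + (w - Q w))"
 have d\<Psi>: "(\<Psi> has_derivative d y) (at y)" if y: "y \<in> W" for y
 proof -
  have dQ: "(Q has_derivative Q) (at y within W)" by (rule linear_imp_has_derivative[OF Q(1)])
  have "((\<lambda>y. f h (Q y)) has_derivative (\<lambda>w. D h (Q y) (Q w))) (at y within W)" if "h \<in> H" for h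
   by (rule has_derivative_in_compose[OF dQ has_derivative_subset[OF D[OF that WS[OF y]]]]) (use WS in blast)
  then have "((\<lambda>y. L (inv h) (f h (Q y))) has_derivative (\<lambda>w. L (inv h) (D h (Q y) (Q w)))) (at y within W)"
   if "h \<in> H" for h using has_derivative_in_compose[OF _ linear_imp_has_derivative[OF linL[OF invH[OF that]]]] that by blast
  then have "(\<Psi> has_derivative d y) (at y within W)" unfolding \<Psi>_def d_def \<psi>_def
   by (intro has_derivative_add has_derivative_diff has_derivative_scaleR_right has_derivative_sum has_derivative_ident dQ)
  then show ?thesis using at_within_open[OF y oW] by simp
 qed
 have bl: "bounded_linear (d y)" if "y \<in> W" for y using has_derivative_bounded_linear[OF d\<Psi>[OF that]] .
 define d' where "d' = (\<lambda>y. Blinfun (d y))"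
 have d': "blinfun_apply (d' y) = d y" if "y \<in> W" for y unfolding d'_def by (rule bounded_linear_Blinfun_apply[OF bl[OF that]])
 have contd: "continuous_on W d'"
 proof (rule continuous_on_blinfun_componentwise)
  fix i :: 'e
  have QW: "continuous_on W Q" using contQ continuous_on_subset by blast
  have cD: "continuous_on W (\<lambda>y. D h (Q y) (Q i))" if "h \<in> H" for h
   by (rule continuous_on_compose2[OF contD[OF that Q(2)] QW]) (use WS in blast)
  have cL: "continuous_on UNIV (L h)" if "h \<in> H" for h
   by (rule linear_continuous_on[OF linear_conv_bounded_linear[THEN iffD1, OF linL[OF that]]])
  have "continuous_on W (\<lambda>y. L (inv h) (D h (Q y) (Q i)))" if "h \<in> H" for h
   by (rule continuous_on_compose2[OF cL[OF invH[OF that]] cD[OF that]]) simp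
  then have "continuous_on W (\<lambda>y. d y i)" unfolding d_def by (intro continuous_intros) auto
  then show "continuous_on W (\<lambda>y. blinfun_apply (d' y) i)" by (rule continuous_on_eq) (simp add: d')
 qed
 \<comment> \<open>The inverses in the definition of \<open>\<psi>\<close> pay off here: each
   summand of the derivative at \<open>a\<close> is \<open>L (inv h)\<close> after
   \<open>L h\<close>, the identity on the model.\<close>
 have da: "d a w = w" for w
 proof -
  have "L (inv h) (L h (Q w)) = Q w" if "h \<in> H" for h
   using L_L[OF that invH[OF that] Q(2)] L_one[OF Q(2)] r_inv[OF Hc[OF that]] by simp
  then have "(\<Sum>h\<in>H. L (inv h) (D h (Q a) (Q w))) = n *\<^sub>R Q w" by (simp add: Qa Da n_def sum_constant_scaleR)
  then show ?thesis using n0 by (simp add: d_def)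
 qed
 have "id_blinfun o\<^sub>L d' a = id_blinfun" by (rule blinfun_eqI) (simp add: d'[OF aW] da)
 from inverse_function_theorem[OF oW _ contd aW this, of \<Psi>] d\<Psi> d'
 obtain U1 V1 g g' where U1: "open U1" "U1 \<subseteq> W" "a \<in> U1" and V1: "open V1" "\<Psi> a \<in> V1"
  and hom: "homeomorphism U1 V1 \<Psi> g"
  and dg: "\<And>y. y \<in> V1 \<Longrightarrow> (g has_derivative g' y) (at y)"
  and g': "\<And>y. y \<in> V1 \<Longrightarrow> g' y = inv_into UNIV (blinfun_apply (d' (g y)))" by (metis (no_types, lifting))
 have g\<Psi>: "g (\<Psi> y) = y" if "y \<in> U1" for y using hom that by (simp add: homeomorphism_def)
 have \<Psi>g: "\<Psi> (g y) = y" and gU1: "g y \<in> U1" if "y \<in> V1" for y using hom that by (auto simp: homeomorphism_def)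
 have contg: "continuous_on V1 g" using hom by (simp add: homeomorphism_def)
 define b where "b = \<Psi> a"
 have b\<psi>: "b = \<psi> a" by (simp add: b_def \<Psi>_def Qa)
 have bV: "b \<in> ?V" using \<psi>V[OF aS] b\<psi> by simp
 have Lb: "L k b = b" if "k \<in> H" for k using \<psi>_f[OF that aS] f_a[OF that] b\<psi> by simp
 have gb: "g b = a" using g\<Psi>[OF U1(3)] by (simp add: b_def)
 \<comment> \<open>Hence applying \<open>g\<close> to a line through \<open>b\<close> keeps its
   direction.\<close>
 have "g' b = id"
 proof -
  have "g' b = inv_into UNIV (d a)" using g'[of b] V1(2) gb d'[OF aW] by (simp add: b_def)
  moreover have "d a = id" using da by (simp add: fun_eq_iff)
  ultimately show ?thesis by (simp add: inv_id)
 qed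
 then have dgb: "(g has_derivative (\<lambda>w. w)) (at b)" using dg[of b] V1(2) by (simp add: b_def id_def)
 define u where "u = v c"
 have uV: "u \<in> ?V" using tangent_spaceD(2)[OF v c] by (simp add: u_def)
 have contf: "continuous_on S (f h)" if "h \<in> H" for h by (rule has_derivative_continuous_on[OF D[OF that]])
 \<comment> \<open>On \<open>N\<close> all the points \<open>f h y\<close> lie in \<open>U1\<close>,
   where \<open>\<Psi>\<close> is injective; this will allow \<open>f h y = y\<close> to be deduced
   from equal images.\<close>
 define N where "N = (\<Inter>h\<in>H. {y \<in> S. f h y \<in> U1})"
 have "openin (top_of_set S) N" unfolding N_def
 proof (rule openin_INT2[OF fH])
  show "H \<noteq> {}" using oneH by blast
  fix h assume "h \<in> H"
  have "openin (top_of_set S) (S \<inter> f h -` U1)"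
   by (rule continuous_openin_preimage_gen[OF contf[OF \<open>h \<in> H\<close>] U1(1)])
  then show "openin (top_of_set S) {y \<in> S. f h y \<in> U1}" by (simp add: Int_def vimage_def)
 qed
 then obtain O2 where O2: "open O2" "N = S \<inter> O2" by (auto simp: openin_open)
 have aN: "a \<in> N" using aS f_a U1(3) by (simp add: N_def)
 \<comment> \<open>A straight line fixed by all \<open>L h\<close>, because \<open>b\<close> and
   \<open>u\<close> are; its preimage under \<open>\<Psi>\<close> is the wanted curve in the
   chart.\<close>
 define line where "line = (\<lambda>t::real. b + t *\<^sub>R u)"
 have contl: "continuous_on UNIV line" unfolding line_def by (intro continuous_intros)
 define T where "T = {t. line t \<in> V1 \<and> g (line t) \<in> O2}"
 have "open T"
 proof -
  have "openin (top_of_set V1) (V1 \<inter> g -` O2)" by (rule continuous_openin_preimage_gen[OF contg O2(1)])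
  then have "open (V1 \<inter> g -` O2)" using V1(1) openin_open_eq by blast
  then have "open (line -` (V1 \<inter> g -` O2))" using open_vimage[OF _ contl] by blast
  moreover have "line -` (V1 \<inter> g -` O2) = T" by (auto simp: T_def)
  ultimately show ?thesis by simp
 qed
 moreover have "0 \<in> T" using V1(2) gb aN O2(2) by (simp add: T_def line_def b_def)
 ultimately obtain \<delta> where \<delta>: "\<delta> > 0" "cball 0 \<delta> \<subseteq> T" using open_contains_cball by blast
 \<comment> \<open>Clamping the time to \<open>[- \<delta>, \<delta>]\<close> defines the curve on
   all real numbers without changing it near 0.\<close>
 define \<tau> where "\<tau> = (\<lambda>t. max (- \<delta>) (min \<delta> t))"
 have \<tau>T: "\<tau> t \<in> T" for t
 proof -
  have "\<bar>\<tau> t\<bar> \<le> \<delta>" using \<delta>(1) by (auto simp: \<tau>_def)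
  then show ?thesis using \<delta>(2) by (auto simp: dist_real_def)
 qed
 have gS: "g (line t) \<in> S" "g (line t) \<in> N" if t: "t \<in> T" for t
 proof -
  have tV1: "line t \<in> V1" using t by (simp add: T_def)
  have lV: "line t \<in> ?V" unfolding line_def by (intro subspace_add[OF V] subspace_scale[OF V] bV uV)
  let ?y = "g (line t)"
  have yW: "?y \<in> W" using gU1[OF tV1] U1(2) by blast
  \<comment> \<open>\<open>\<Psi>\<close> alters points only by vectors of the model, so a preimage
    of a point of the model lies in the model again, and there \<open>Q\<close> is the
    identity.\<close>
  have "\<psi> (Q ?y) + (?y - Q ?y) = line t" using \<Psi>g[OF tV1] by (simp add: \<Psi>_def)
  then have "?y - Q ?y = line t - \<psi> (Q ?y)" by (simp add: algebra_simps)
  then have "?y - Q ?y \<in> ?V" using subspace_diff[OF V lV \<psi>V[OF WS[OF yW]]] by simp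
  from subspace_add[OF V this Q(2)[of ?y]] have "?y \<in> ?V" by simp
  then show "?y \<in> S" using Q(3) WS[OF yW] by simp
  then show "?y \<in> N" using t O2(2) by (simp add: T_def)
 qed
 have fg: "f h (g (line t)) = g (line t)" if h: "h \<in> H" and t: "t \<in> T" for h t
 proof -
  let ?y = "g (line t)"
  have tV1: "line t \<in> V1" using t by (simp add: T_def)
  have \<Psi>S: "\<Psi> y = \<psi> y" if "y \<in> S" for y using Q(3)[OF SV[OF that]] by (simp add: \<Psi>_def)
  have "L h (line t) = line t"
   using linear_add[OF linL[OF h]] linear_scale[OF linL[OF h]] Lb[OF h] L_v[OF h] by (simp add: line_def u_def)
  moreover have "\<psi> ?y = line t" using \<Psi>g[OF tV1] \<Psi>S[OF gS(1)[OF t]] by simp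
  ultimately have "\<Psi> (f h ?y) = \<Psi> ?y"
   using \<psi>_f[OF h gS(1)[OF t]] \<Psi>S[OF gS(1)[OF t]] \<Psi>S[OF fS[OF h gS(1)[OF t]]] by simp
  moreover have "f h ?y \<in> U1" using gS(2)[OF t] h by (simp add: N_def)
  ultimately show ?thesis using g\<Psi> gU1[OF tV1] by metis
 qed
 define \<gamma> where "\<gamma> = (\<lambda>t. chart_inv c (g (line (\<tau> t))))"
 have \<tau>0: "\<tau> 0 = 0" using \<delta>(1) by (simp add: \<tau>_def)
 show ?thesis
 proof (rule that)
  have c\<tau>: "continuous_on UNIV \<tau>" unfolding \<tau>_def by (intro continuous_intros)
  have "continuous_on UNIV (\<lambda>t. line (\<tau> t))" by (rule continuous_on_compose2[OF contl c\<tau>]) simp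
  then have "continuous_on UNIV (\<lambda>t. g (line (\<tau> t)))"
   by (rule continuous_on_compose2[OF contg]) (use \<tau>T in \<open>auto simp: T_def\<close>)
  then have "cmap euclidean (top_of_set (snd c ` fst c)) (\<lambda>t. g (line (\<tau> t)))"
   using gS(1)[OF \<tau>T] Uc by (auto simp: into_sub S_def)
  from continuous_map_compose[OF this continuous_chart_inv[OF cc(1)]]
  show cont\<gamma>: "cmap euclidean (mtop M) \<gamma>" by (simp add: \<gamma>_def o_def)
  show \<gamma>0: "\<gamma> 0 = p" using gb chart_inv[OF cc(1,2)] by (simp add: \<gamma>_def \<tau>0 line_def a_def)
  show "\<rho> h (\<gamma> t) = \<gamma> t" if "h \<in> H" for h t
  proof -
   let ?y = "g (line (\<tau> t))"
   have x: "\<gamma> t \<in> U" using cS(1)[OF gS(1)[OF \<tau>T]] by (simp add: \<gamma>_def)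
   have "snd c (\<rho> h (\<gamma> t)) = snd c (\<gamma> t)"
    using fg[OF that \<tau>T[of t]] cS(2)[OF gS(1)[OF \<tau>T[of t]]] by (simp add: f_def \<gamma>_def)
   then show ?thesis using inj_onD[OF chart_inj[OF cc(1)]] Uh[OF x that] Uc[OF x] by blast
  qed
  have dl: "(line has_vector_derivative u) (at 0)"
   unfolding line_def by (auto intro!: derivative_eq_intros simp: has_vector_derivative_def)
  have "((\<lambda>t. g (line t)) has_vector_derivative u) (at 0)"
   by (rule has_vector_derivative_curve[OF _ dl open_UNIV]) (use dgb in \<open>auto simp: line_def\<close>)
  then have "((snd c \<circ> \<gamma>) has_vector_derivative v c) (at 0)" unfolding u_def
  proof (rule has_vector_derivative_transform_within_open)
   show "open {- \<delta><..<\<delta>}" "0 \<in> {- \<delta><..<\<delta>}" using \<delta>(1) by auto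
   fix t assume "t \<in> {- \<delta><..<\<delta>}"
   then have "\<tau> t = t" by (auto simp: \<tau>_def)
   then show "g (line t) = (snd c \<circ> \<gamma>) t" using cS(2)[OF gS(1)[OF \<tau>T[of t]]] by (simp add: \<gamma>_def)
  qed
  then show "velocity M \<gamma> v" using velocity_chartI[OF cont\<gamma>] v c \<gamma>0 by simp
 qed
qed

text \<open>A curve of fixed points is unchanged by the group, hence so is its velocity; conversely
  \<open>fixed_curve\<close> realises each invariant vector. The definition by curves thereby
  becomes a linear condition, which makes tangent spaces of fixed loci accessible to
  averaging.\<close>

lemma tangent_subspace_fixed_locus:
 assumes A: "A \<subseteq> carrier \<Gamma>" and p: "p \<in> Fix A"
 shows "tangent_subspace M (Fix A) p = {v \<in> \<T> M p. \<forall>h\<in>generate \<Gamma> A. push h p v = v}"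
  (is "?L = ?R")
proof
 let ?H = "generate \<Gamma> A" and ?Z = "Fix A"
 have H: "subgroup ?H \<Gamma>" using generate_is_subgroup[OF A] .
 have pM: "p \<in> points M" using p fixed_locus_subset by blast
 show "?L \<subseteq> ?R"
 proof
  fix v assume "v \<in> ?L"
  then obtain \<gamma> where v: "v \<in> \<T> M p" and \<gamma>: "cmap euclidean (mtop M) \<gamma>" "range \<gamma> \<subseteq> ?Z" "\<gamma> 0 = p" "velocity M \<gamma> v"
   unfolding tangent_subspace_iff by blast
  have "push h p v = v" if h: "h \<in> ?H" for h
  proof -
   have hc: "h \<in> carrier \<Gamma>" using generate_in_carrier[OF A h] .
   have "velocity M (\<lambda>t. \<rho> h (\<gamma> t)) (push h (\<gamma> 0) v)"
    by (rule c1_map.velocity_image[OF act_c1[OF hc] \<gamma>(1)]) (use v \<gamma>(3,4) in auto)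
   moreover have "(\<lambda>t. \<rho> h (\<gamma> t)) = \<gamma>"
    using \<gamma>(2) fixed_locusD[OF _ h] by (auto simp: fun_eq_iff image_subset_iff)
   ultimately have "velocity M \<gamma> (push h p v)" using \<gamma>(3) by simp
   moreover have "push h p v \<in> \<T> M p" using push_in[OF hc pM v] fixed_locusD[OF p h] by simp
   ultimately show ?thesis using velocity_unique[of \<gamma> "push h p v" v] \<gamma>(3,4) v pM by simp
  qed
  then show "v \<in> ?R" using v by blast
 qed
 show "?R \<subseteq> ?L"
 proof
  fix v assume "v \<in> ?R"
  then have v: "v \<in> \<T> M p" "\<And>h. h \<in> ?H \<Longrightarrow> push h p v = v" by auto
  obtain \<gamma> where \<gamma>: "cmap euclidean (mtop M) \<gamma>" "\<gamma> 0 = p" "velocity M \<gamma> v"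
   "\<And>t h. h \<in> ?H \<Longrightarrow> \<rho> h (\<gamma> t) = \<gamma> t"
   using fixed_curve[OF H pM fixed_locusD[OF p] v] by blast
  have "\<gamma> t \<in> ?Z" for t using \<gamma>(4) continuous_map_mem[OF \<gamma>(1), of t] by (simp add: fixed_locus_def)
  then show "v \<in> ?L" unfolding tangent_subspace_iff using v(1) \<gamma>(1-3) by blast
 qed
qed

lemma c_subspace_fixed:
 assumes A: "A \<subseteq> carrier \<Gamma>" and p: "p \<in> Fix A"
 shows "c_subspace M p (tangent_subspace M (Fix A) p)"
proof -
 have pM: "p \<in> points M" using p fixed_locus_subset by blast
 have h: "h \<in> carrier \<Gamma>" "\<rho> h p = p" if "h \<in> generate \<Gamma> A" for h
  using generate_in_carrier[OF A that] fixed_locusD[OF p that] .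
 show ?thesis unfolding tangent_subspace_fixed_locus[OF A p] c_subspace_def
  using push_add[OF h(1) pM] push_c_scale[OF h(1) pM] h(2) pM by (auto simp: tangent_add c_scale_in)
qed

lemma vector_bundle_T_submanifold:
 assumes A: "A \<subseteq> carrier \<Gamma>"
 shows "vector_bundle (T_submanifold M (Fix A))" unfolding T_submanifold_def
proof (rule vector_bundle_average[where J = "generate \<Gamma> A" and h = "\<lambda>h. h"
   and w = "\<lambda>_. of_real (1 / card (generate \<Gamma> A))", OF fixed_locus_subset])
 let ?H = "generate \<Gamma> A" and ?Z = "Fix A"
 let ?P = "average ?H (\<lambda>h. h) (\<lambda>_. of_real (1 / card ?H))"
 have H: "subgroup ?H \<Gamma>" using generate_is_subgroup[OF A] .
 have Hc: "h \<in> carrier \<Gamma>" if "h \<in> ?H" for h using generate_in_carrier[OF A that] .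
 have fH: "finite ?H" by (rule finite_subset[OF _ finite_carrier]) (use Hc in blast)
 have n0: "card ?H > 0" using fH generate.one[of \<Gamma> A] by (auto simp: card_gt_0_iff)
 show "h \<in> carrier \<Gamma>" if "h \<in> ?H" for h using Hc[OF that] .
 show "\<rho> h p = p" if "h \<in> ?H" "p \<in> ?Z" for h p using fixed_locusD that by blast
 show "c_subspace M p (tangent_subspace M ?Z p)" if "p \<in> ?Z" for p by (rule c_subspace_fixed[OF A that])
 fix p v assume p: "p \<in> ?Z"
 have pM: "p \<in> points M" using p fixed_locus_subset by blast
 have hp: "\<rho> h p = p" if "h \<in> ?H" for h using fixed_locusD[OF p that] .
 show "?P p v = v" if "v \<in> tangent_subspace M ?Z p"
 proof -
  have "push h p v = v" if "h \<in> ?H" for h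
   using \<open>v \<in> tangent_subspace M ?Z p\<close> that unfolding tangent_subspace_fixed_locus[OF A p] by blast
  then show ?thesis unfolding average_def c_scale_of_real using n0 by (simp add: sum_constant_scaleR)
 qed
 assume v: "v \<in> \<T> M p"
 have pv: "push h p v \<in> \<T> M p" if "h \<in> ?H" for h using push_in[OF Hc[OF that] pM v] hp[OF that] by simp
 have "push k p (?P p v) = ?P p v" if k: "k \<in> ?H" for k
 proof -
  have bij: "bij_betw (\<lambda>h. h \<otimes> k) ?H ?H"
  proof (rule bij_betwI[where g = "\<lambda>h. h \<otimes> inv k"])
   show "h \<otimes> k \<otimes> inv k = h" "h \<otimes> inv k \<otimes> k = h" if "h \<in> ?H" for h
    using Hc[OF k] Hc[OF that] by (simp_all add: m_assoc)
  qed (use k subgroup.m_closed[OF H] subgroup.m_inv_closed[OF H] in auto)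
  have "push k p (?P p v) = (\<lambda>c. \<Sum>h\<in>?H. push k p (\<lambda>c. (1 / card ?H) *\<^sub>R push h p v c) c)"
   unfolding average_def c_scale_of_real by (rule push_sum[OF Hc[OF k] pM tangent_scaleR[OF pv]])
  also have "\<dots> = (\<lambda>c. \<Sum>h\<in>?H. (1 / card ?H) *\<^sub>R push (h \<otimes> k) p v c)"
   using push_scaleR[OF Hc[OF k] pM pv] push_mult[OF Hc Hc[OF k] pM v] hp by (simp add: fun_eq_iff)
  also have "\<dots> = (\<lambda>c. \<Sum>h\<in>?H. (1 / card ?H) *\<^sub>R push h p v c)"
   by (rule ext) (rule sum.reindex_bij_betw[OF bij, of "\<lambda>h. (1 / card ?H) *\<^sub>R push h p v _"])
  finally show ?thesis unfolding average_def c_scale_of_real .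
 qed
 moreover have "?P p v \<in> \<T> M p" unfolding average_def c_scale_of_real by (rule tangent_sum[OF tangent_scaleR[OF pv]])
 ultimately show "?P p v \<in> tangent_subspace M ?Z p" unfolding tangent_subspace_fixed_locus[OF A p] by blast
qed

end

subsection \<open>Naturality of the obstruction classes\<close>

lemma (in c1_map) tangent_subspace_image:
 assumes v: "v \<in> tangent_subspace M Z p" and Z: "F ` Z \<subseteq> Z'" and p: "p \<in> points M"
 shows "tangent_map M N F p v \<in> tangent_subspace N Z' (F p)"
proof -
 obtain \<gamma> where \<gamma>: "cmap euclidean (mtop M) \<gamma>" "range \<gamma> \<subseteq> Z" "\<gamma> 0 = p" "velocity M \<gamma> v"
  and vT: "v \<in> \<T> M p" using v unfolding tangent_subspace_iff by blast
 have "cmap euclidean (mtop N) (\<lambda>t. F (\<gamma> t))"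
  using continuous_map_compose[OF \<gamma>(1) continuous] by (simp add: o_def)
 moreover have "velocity N (\<lambda>t. F (\<gamma> t)) (tangent_map M N F p v)" using velocity_image[OF \<gamma>(1)] vT \<gamma>(3,4) by blast
 ultimately show ?thesis unfolding tangent_subspace_iff using tangent_in[OF p vT] \<gamma>(2,3) Z
  by (intro conjI exI[of _ "\<lambda>t. F (\<gamma> t)"]) auto
qed

context c1_action
begin

lemma act_inv:
 assumes "a \<in> carrier \<Gamma>" "p \<in> points M"
 shows "\<rho> (inv a) (\<rho> a p) = p" "\<rho> a (\<rho> (inv a) p) = p"
 using act_mult[OF assms(1) inv_closed[OF assms(1)] assms(2)] act_mult[OF inv_closed[OF assms(1)] assms]
  r_inv[OF assms(1)] l_inv[OF assms(1)] act_one[OF assms(2)] by simp_all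

lemma push_inv:
 assumes "a \<in> carrier \<Gamma>" "p \<in> points M"
 shows "v \<in> \<T> M p \<Longrightarrow> push (inv a) (\<rho> a p) (push a p v) = v"
  and "w \<in> \<T> M (\<rho> a p) \<Longrightarrow> push (inv a) (\<rho> a p) w \<in> \<T> M p"
  and "w \<in> \<T> M (\<rho> a p) \<Longrightarrow> push a p (push (inv a) (\<rho> a p) w) = w"
proof -
 note i = inv_closed[OF assms(1)] and ap = act_in[OF assms]
 show "push (inv a) (\<rho> a p) (push a p v) = v" if "v \<in> \<T> M p"
  using push_mult[OF assms(1) i assms(2) that] r_inv[OF assms(1)] push_one[OF assms(2) that] by simp
 show "push (inv a) (\<rho> a p) w \<in> \<T> M p" if "w \<in> \<T> M (\<rho> a p)"
  using push_in[OF i ap that] act_inv(1)[OF assms] by simp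
 show "push a p (push (inv a) (\<rho> a p) w) = w" if "w \<in> \<T> M (\<rho> a p)"
  using push_mult[OF i assms(1) ap that] l_inv[OF assms(1)] push_one[OF ap that] act_inv(1)[OF assms] by simp
qed

text \<open>The case of one summand in \<open>subbundle_decomposition\<close>; the fibrewise inverse
  of pushing by \<open>g\<close> is pushing by its inverse.\<close>

lemma virt_of_natural:
 assumes g: "g \<in> carrier \<Gamma>" and Z': "Z' \<subseteq> points M" and Z: "Z \<subseteq> points M" and map: "\<And>p. p \<in> Z' \<Longrightarrow> \<rho> g p \<in> Z"
  and F': "\<And>p. p \<in> Z' \<Longrightarrow> c_subspace M p (F' p)" and F: "\<And>p. p \<in> Z \<Longrightarrow> c_subspace M p (F p)"
  and iff: "\<And>p v. \<lbrakk>p \<in> Z'; v \<in> \<T> M p\<rbrakk> \<Longrightarrow> v \<in> F' p \<longleftrightarrow> push g p v \<in> F (\<rho> g p)"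
  and vb: "vector_bundle (tangent_subbundle M Z F)"
 shows "K_equiv (top_on M Z') (virt_of (tangent_subbundle M Z' F'))
   (K_pull (top_on M Z') (\<rho> g) (virt_of (tangent_subbundle M Z F)))"
proof -
 let ?i = "inv g"
 have FT: "v \<in> \<T> M p" if "p \<in> Z'" "v \<in> F' p" for p v by (rule c_subspaceD[OF F'[OF that(1)] that(2)])
 have inv: "push ?i (\<rho> g p) w \<in> F' p" "push g p (push ?i (\<rho> g p) w) = w" if p: "p \<in> Z'" and w: "w \<in> F (\<rho> g p)" for p w
 proof -
  have "w \<in> \<T> M (\<rho> g p)" by (rule c_subspaceD[OF F[OF map[OF p]] w])
  note P = push_inv(2,3)[OF g subsetD[OF Z' p] this]
  show "push g p (push ?i (\<rho> g p) w) = w" by (rule P(2))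
  then show "push ?i (\<rho> g p) w \<in> F' p" using iff[OF p P(1)] w by simp
 qed
 have "K_equiv (top_on M Z') (virt_of (tangent_subbundle M Z' F'))
   (\<Sum>j\<in>{()}. K_pull (top_on M Z') (\<rho> g) (virt_of (tangent_subbundle M Z F)))"
 proof (rule subbundle_decomposition(2)[OF acm_c1_axioms acm_c1_axioms Z' F' _ Z F vb,
    where \<phi> = "\<lambda>_ p v. push g p v" and \<psi> = "\<lambda>p u. push ?i (\<rho> g p) (u ())"])
  show "cmap (top_on M Z') (top_on M Z) (\<rho> g)" using from_sub[OF continuous_act[OF g]] map by (auto simp: into_sub)
  show "cmap (subtopology (\<TT> M) (Sigma Z' F')) (\<TT> M) (\<lambda>t. (\<rho> g (fst t), push g (fst t) (snd t)))"
   by (rule continuous_map_push[OF g]) (simp add: from_sub)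
  fix T :: "('p \<times> (unit \<Rightarrow> ('p, 'e) tvec)) topology"
  assume T: "topspace T = Sigma Z' (\<lambda>x. \<Pi>\<^sub>E j\<in>{()}. F (\<rho> g x))"
   "\<And>j. j \<in> {()} \<Longrightarrow> cmap T (\<TT> M) (\<lambda>t. (\<rho> g (fst t), snd t j))"
  show "cmap T (\<TT> M) (\<lambda>t. (fst t, push ?i (\<rho> g (fst t)) (snd t ())))"
   by (rule continuous_map_eq[OF continuous_map_push[OF inv_closed[OF g] T(2)]])
    (use act_inv(1)[OF g] Z' in \<open>auto simp: T(1)\<close>)
 next
  fix p v assume p: "p \<in> Z'" and v: "v \<in> F' p"
  note pM = subsetD[OF Z' p] and vT = FT[OF p v]
  show "push g p v \<in> F (\<rho> g p)" using iff[OF p vT] v by simp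
  show "push ?i (\<rho> g p) ((\<lambda>j\<in>{()}. push g p v) ()) = v" using push_inv(1)[OF g pM vT] by simp
  show "push g p (c_scale M p z v) = c_scale M (\<rho> g p) z (push g p v)" for z by (rule push_c_scale[OF g pM vT])
  show "push g p (\<lambda>c. v c + w c) = (\<lambda>c. push g p v c + push g p w c)" if "w \<in> F' p" for w
   by (rule push_add[OF g pM vT FT[OF p that]])
 qed (use map inv in auto)
 then show ?thesis by simp
qed

lemma S_virt_eq:
 "S_virt \<Gamma> M \<rho> a = (\<Sum>k<ord a. q_scale (of_nat k / of_nat (ord a))
   (virt_of (eig a (exp (- (2 * of_real pi * \<i> * of_nat k / of_nat (ord a)))))))" by (simp add: S_virt_def eigenbundle_eq_eig)

lemma bundle_virt_S:
 assumes "a \<in> carrier \<Gamma>"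
 shows "bundle_virt (top_on M (Fix {a})) (S_virt \<Gamma> M \<rho> a)" unfolding S_virt_eq
 by (intro bundle_virt_sum bundle_virt_scale bundle_virt_virt_of vector_bundle_eig assms) simp

section \<open>Conjugate elements\<close>

lemma inv_mult_cancel:
 assumes "g \<in> carrier \<Gamma>" "x \<in> carrier \<Gamma>"
 shows "inv g \<otimes> (g \<otimes> x) = x" "g \<otimes> (inv g \<otimes> x) = x" using assms by (simp_all add: m_assoc[symmetric])

lemma conj_pow:
 assumes g: "g \<in> carrier \<Gamma>" and a: "a \<in> carrier \<Gamma>"
 shows "(g \<otimes> a \<otimes> inv g) [^] (n::nat) = g \<otimes> a [^] n \<otimes> inv g"
proof (induction n)
 case (Suc n)
 then show ?case using g a by (simp add: m_assoc inv_mult_cancel)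
qed (use g in simp)

lemma ord_conj:
 assumes g: "g \<in> carrier \<Gamma>" and a: "a \<in> carrier \<Gamma>"
 shows "ord (g \<otimes> a \<otimes> inv g) = ord a"
proof -
 have "g \<otimes> x \<otimes> inv g = \<one> \<longleftrightarrow> x = \<one>" if x: "x \<in> carrier \<Gamma>" for x
 proof
  assume "g \<otimes> x \<otimes> inv g = \<one>"
  then have "g \<otimes> x = g" using inv_equality[of "g \<otimes> x" "inv g"] g x by simp
  then show "x = \<one>" using l_cancel_one[OF g x] by simp
 qed (use g in simp)
 then have "ord a dvd n \<longleftrightarrow> ord (g \<otimes> a \<otimes> inv g) dvd n" for n
  using pow_eq_id[OF a, of n] pow_eq_id[of "g \<otimes> a \<otimes> inv g" n] conj_pow[OF g a, of n] g a by simp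
 then show ?thesis by (metis dvd_antisym dvd_refl)
qed

context
 fixes g a a' assumes g: "g \<in> carrier \<Gamma>" and a: "a \<in> carrier \<Gamma>"
  and a': "a' = g \<otimes> a \<otimes> inv g"
begin

lemma conj_carrier: "a' \<in> carrier \<Gamma>" using g a a' by simp

lemma conj_commute: "a' \<otimes> g = g \<otimes> a" using g a by (simp add: a' m_assoc)

text \<open>For a right action it is \<open>g\<close> itself, not its inverse, that carries the
  fixed locus of g a g^-1 to that of \<open>a\<close>.\<close>

lemma conj_act: "p \<in> points M \<Longrightarrow> \<rho> a (\<rho> g p) = \<rho> g (\<rho> a' p)"
 using act_mult[OF g a, of p] act_mult[OF conj_carrier g, of p] conj_commute by simp

lemma conj_fixed: "p \<in> points M \<Longrightarrow> \<rho> a (\<rho> g p) = \<rho> g p \<longleftrightarrow> \<rho> a' p = p"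
 using conj_act[of p] act_inv(1)[OF g] act_in[OF conj_carrier] by metis

lemma conj_push:
 assumes "p \<in> points M" "\<rho> a' p = p" "v \<in> \<T> M p"
 shows "push a (\<rho> g p) (push g p v) = push g p (push a' p v)"
 using push_mult[OF g a assms(1,3)] push_mult[OF conj_carrier g assms(1,3)] conj_commute assms(2) by simp

text \<open>Pushing by \<open>g\<close> intertwines \<open>a'\<close> and \<open>a\<close>, so it
  matches eigenspaces with equal eigenvalue; the weights match because conjugate elements have the
  same order.\<close>

lemma S_virt_conj:
 "K_equiv (top_on M (Fix {a'})) (S_virt \<Gamma> M \<rho> a')
   (K_pull (top_on M (Fix {a'})) (\<rho> g) (S_virt \<Gamma> M \<rho> a))"
proof -
 have o: "ord a' = ord a" unfolding a' by (rule ord_conj[OF g a])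
 note ca = conj_carrier
 have "K_equiv (top_on M (Fix {a'})) (virt_of (eig a' \<mu>))
   (K_pull (top_on M (Fix {a'})) (\<rho> g) (virt_of (eig a \<mu>)))" for \<mu> unfolding eig_def
 proof (rule virt_of_natural[OF g fixed_locus_subset fixed_locus_subset])
  show "\<rho> g p \<in> Fix {a}" if "p \<in> Fix {a'}" for p
   using that conj_fixed[of p] act_in[OF g, of p] by (simp add: fixed_locus_single[OF a] fixed_locus_single[OF ca])
  show "c_subspace M p (eigenspace a' \<mu> p)" if "p \<in> Fix {a'}" for p
   using that c_subspace_eigen[OF ca] by (simp add: fixed_locus_single[OF ca])
  show "c_subspace M p (eigenspace a \<mu> p)" if "p \<in> Fix {a}" for p
   using that c_subspace_eigen[OF a] by (simp add: fixed_locus_single[OF a])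
  show "vector_bundle (tangent_subbundle M (Fix {a}) (eigenspace a \<mu>))" using vector_bundle_eig[OF a] unfolding eig_def .
  fix p v assume p: "p \<in> Fix {a'}" and v: "v \<in> \<T> M p"
  then have pM: "p \<in> points M" and fx: "\<rho> a' p = p" by (auto simp: fixed_locus_single[OF ca])
  have "push g p (push a' p v) = push g p (c_scale M p \<mu> v) \<longleftrightarrow> push a' p v = c_scale M p \<mu> v"
   using push_inv(1)[OF g pM] push_in[OF ca pM v] fx c_scale_in[OF pM v] by metis
  then show "v \<in> eigenspace a' \<mu> p \<longleftrightarrow>
    push g p v \<in> eigenspace a \<mu> (\<rho> g p)"
   using conj_push[OF pM fx v] push_c_scale[OF g pM v] push_in[OF g pM v] v by simp
 qed
 then show ?thesis unfolding S_virt_eq o K_pull_linear by (intro K_equiv_sum K_equiv_scale)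
qed

lemma S_virt_conj_restrict:
 assumes Z': "Z' \<subseteq> Fix {a'}" and Z: "Z \<subseteq> Fix {a}"
  and map: "\<And>p. p \<in> Z' \<Longrightarrow> \<rho> g p \<in> Z"
 shows "K_equiv (top_on M Z') (K_restrict (mtop M) Z' (S_virt \<Gamma> M \<rho> a'))
   (K_pull (top_on M Z') (\<rho> g) (K_restrict (mtop M) Z (S_virt \<Gamma> M \<rho> a)))"
proof -
 let ?Y' = "top_on M Z'" and ?Y = "top_on M Z"
 let ?F' = "top_on M (Fix {a'})" and ?F = "top_on M (Fix {a})"
 have c1: "cmap ?Y' ?F' id" using Z' by (auto simp: into_sub)
 have c2: "cmap ?F' ?F (\<rho> g)" using from_sub[OF continuous_act[OF g]] conj_fixed act_in[OF g]
  by (auto simp: into_sub fixed_locus_single[OF a] fixed_locus_single[OF conj_carrier])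
 have c3: "cmap ?Y ?F id" using Z by (auto simp: into_sub)
 have c4: "cmap ?Y' ?Y (\<rho> g)" using from_sub[OF continuous_act[OF g]] map by (auto simp: into_sub)
 have "K_equiv ?Y' (K_pull ?Y' id (S_virt \<Gamma> M \<rho> a')) (K_pull ?Y' id (K_pull ?F' (\<rho> g) (S_virt \<Gamma> M \<rho> a)))"
  by (rule K_equiv_pull[OF c1 S_virt_conj])
 also have "K_equiv ?Y' \<dots> (K_pull ?Y' (\<rho> g) (S_virt \<Gamma> M \<rho> a))"
  using K_pull_compose[OF bundle_virt_S[OF a] c2 c1] by simp
 also have "K_equiv ?Y' \<dots> (K_pull ?Y' (\<rho> g) (K_pull ?Y id (S_virt \<Gamma> M \<rho> a)))"
  using K_equiv_sym[OF K_pull_compose[OF bundle_virt_S[OF a] c3 c4]] by simp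
 finally show ?thesis .
qed

end

lemma fixed_locus_pair_subset:
 assumes "x \<in> carrier \<Gamma>" "y \<in> carrier \<Gamma>"
 shows "Fix {x, y} \<subseteq> Fix {x}" "Fix {x, y} \<subseteq> Fix {y}"
  "Fix {x, y} \<subseteq> Fix {inv (x \<otimes> y)}"
proof -
 have xy: "{x, y} \<subseteq> carrier \<Gamma>" "{x} \<subseteq> carrier \<Gamma>" "{y} \<subseteq> carrier \<Gamma>" "{inv (x \<otimes> y)} \<subseteq> carrier \<Gamma>" using assms by auto
 show "Fix {x, y} \<subseteq> Fix {x}" "Fix {x, y} \<subseteq> Fix {y}" using xy by (auto simp: fixed_locus_eq)
 have "x \<otimes> y \<in> generate \<Gamma> {x, y}" by (intro generate.eng generate.incl) auto
 then have "inv (x \<otimes> y) \<in> generate \<Gamma> {x, y}" by (rule generate_m_inv_closed[OF xy(1)])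
 then show "Fix {x, y} \<subseteq> Fix {inv (x \<otimes> y)}" unfolding fixed_locus_eq[OF xy(4)] by (auto simp: fixed_locus_def)
qed

text \<open>All five terms are natural under \<open>g\<close>: the tangent bundle of the fixed locus
  through curves, the classes S through eigenspaces. The last of them fits since conjugation
  respects products and inverses.\<close>

theorem obstruction_virt_conj:
 assumes g: "g \<in> carrier \<Gamma>" and a: "a \<in> carrier \<Gamma>" and b: "b \<in> carrier \<Gamma>"
  and a': "a' = g \<otimes> a \<otimes> inv g" and b': "b' = g \<otimes> b \<otimes> inv g"
 shows "K_equiv (top_on M (Fix {a', b'})) (obstruction_virt \<Gamma> M \<rho> a' b')
   (K_pull (top_on M (Fix {a', b'})) (\<rho> g) (obstruction_virt \<Gamma> M \<rho> a b))"
proof -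
 let ?Z' = "Fix {a', b'}" and ?Z = "Fix {a, b}"
 note ca = conj_carrier[OF g a a'] conj_carrier[OF g b b']
 have sub: "{a', b'} \<subseteq> carrier \<Gamma>" "{a, b} \<subseteq> carrier \<Gamma>" using a b ca by auto
 note fx = fixed_locus_eq[OF sub(1)] fixed_locus_eq[OF sub(2)]
 have map: "\<rho> g p \<in> ?Z" if "p \<in> ?Z'" for p
  using that conj_fixed[OF g a a'] conj_fixed[OF g b b'] act_in[OF g] unfolding fx by auto
 have map': "\<rho> (inv g) p \<in> ?Z'" if "p \<in> ?Z" for p
 proof -
  have p: "p \<in> points M" "\<rho> a p = p" "\<rho> b p = p" using that unfolding fx by auto
  have q: "\<rho> (inv g) p \<in> points M" using act_in[OF inv_closed[OF g] p(1)] .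
  show ?thesis using conj_fixed[OF g a a' q] conj_fixed[OF g b b' q] act_inv(2)[OF g p(1)] p q unfolding fx by simp
 qed
 have c: "inv (a \<otimes> b) \<in> carrier \<Gamma>" using a b by simp
 have c': "inv (a' \<otimes> b') = g \<otimes> inv (a \<otimes> b) \<otimes> inv g"
 proof -
  have "a' \<otimes> b' = g \<otimes> (a \<otimes> b) \<otimes> inv g"
   unfolding a' b' using g a b by (simp add: m_assoc inv_mult_cancel)
  then show ?thesis using g a b by (simp add: inv_mult_group m_assoc)
 qed
 note sub_fix = fixed_locus_pair_subset
 have T: "K_equiv (top_on M ?Z') (virt_of (T_submanifold M ?Z'))
   (K_pull (top_on M ?Z') (\<rho> g) (virt_of (T_submanifold M ?Z)))" unfolding T_submanifold_def
 proof (rule virt_of_natural[OF g fixed_locus_subset fixed_locus_subset map c_subspace_fixed[OF sub(1)] c_subspace_fixed[OF sub(2)]])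
  show "vector_bundle (tangent_subbundle M ?Z (tangent_subspace M ?Z))"
   using vector_bundle_T_submanifold[OF sub(2)] unfolding T_submanifold_def .
  fix p v assume p: "p \<in> ?Z'" and v: "v \<in> \<T> M p"
  have pM: "p \<in> points M" using p fixed_locus_subset by blast
  show "v \<in> tangent_subspace M ?Z' p \<longleftrightarrow> push g p v \<in> tangent_subspace M ?Z (\<rho> g p)"
  proof
   assume "v \<in> tangent_subspace M ?Z' p"
   then show "push g p v \<in> tangent_subspace M ?Z (\<rho> g p)"
    by (rule c1_map.tangent_subspace_image[OF act_c1[OF g] _ _ pM]) (use map in blast)
  next
   assume "push g p v \<in> tangent_subspace M ?Z (\<rho> g p)"
   then have "push (inv g) (\<rho> g p) (push g p v) \<in> tangent_subspace M ?Z' (\<rho> (inv g) (\<rho> g p))"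
    by (rule c1_map.tangent_subspace_image[OF act_c1[OF inv_closed[OF g]] _ _ act_in[OF g pM]])
     (use map' in blast)
   then show "v \<in> tangent_subspace M ?Z' p" using push_inv(1)[OF g pM v] act_inv(1)[OF g pM] by simp
  qed
 qed
 have TM: "K_equiv (top_on M ?Z') (virt_of (TM_restricted M ?Z'))
   (K_pull (top_on M ?Z') (\<rho> g) (virt_of (TM_restricted M ?Z)))" unfolding TM_restricted_def
 proof (rule virt_of_natural[OF g fixed_locus_subset fixed_locus_subset map])
  show "vector_bundle (tangent_subbundle M ?Z (\<T> M))" using vector_bundle_TM[OF fixed_locus_subset] unfolding TM_restricted_def .
 qed (auto intro: c_subspace_tangent push_in[OF g] dest: subsetD[OF fixed_locus_subset])
 show ?thesis unfolding obstruction_virt_def Let_def K_pull_linear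
  by (intro K_equiv_add K_equiv_diff T TM S_virt_conj_restrict[OF g a a'] S_virt_conj_restrict[OF g b b']
    S_virt_conj_restrict[OF g c c'] sub_fix a b ca map)
qed

end

section \<open>Powers of a manifold\<close>

lemma power_manifold_simps [simp]:
 "mtop (power_manifold_with J I X) = product_topology (\<lambda>_. mtop X) I"
 "model (power_manifold_with J I X) = {v. (\<forall>i\<in>I. v $ i \<in> model X) \<and> (\<forall>i. i \<notin> I \<longrightarrow> v $ i = 0)}"
 "atlas (power_manifold_with J I X) = {product_chart I c | c. \<forall>i\<in>I. c i \<in> atlas X}"
 "acs (power_manifold_with J I X) = J" by (simp_all add: power_manifold_with_def)

lemma product_chart_simps [simp]:
 "fst (product_chart I c) = (\<Pi>\<^sub>E i\<in>I. fst (c i))"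
 "snd (product_chart I c) x = (\<chi> i. if i \<in> I then snd (c i) (x i) else 0)" by (simp_all add: product_chart_def)

lemma has_derivative_vec_componentwise:
 fixes f :: "'a::real_normed_vector \<Rightarrow> 'e::euclidean_space ^ 'i::finite"
 assumes "\<And>i. ((\<lambda>x. f x $ i) has_derivative (\<lambda>h. f' h $ i)) F"
 shows "(f has_derivative f') F"
proof -
 have bounded_linear_axis: "bounded_linear (axis i :: 'e \<Rightarrow> 'e ^ 'i)" for i
  unfolding linear_conv_bounded_linear[symmetric] by (rule linearI) (simp_all add: vec_eq_iff axis_def)
 have "((\<lambda>x. \<Sum>i\<in>UNIV. axis i (f x $ i)) has_derivative (\<lambda>h. \<Sum>i\<in>UNIV. axis i (f' h $ i))) F"
  by (intro has_derivative_sum bounded_linear.has_derivative[OF bounded_linear_axis] assms)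
 moreover have "(\<Sum>i\<in>UNIV. axis i (v $ i)) = v" for v :: "'e ^ 'i"
  by (simp add: vec_eq_iff axis_def sum_component if_distrib cong: if_cong)
 ultimately show ?thesis by simp
qed

section \<open>Product charts\<close>

context c1_manifold
begin

context
 fixes I :: "'i::finite set" and b :: "'i \<Rightarrow> ('p, 'e) chart"
 assumes b: "\<And>i. i \<in> I \<Longrightarrow> b i \<in> atlas M"
begin

lemma product_chart_inj: "inj_on (snd (product_chart I b)) (fst (product_chart I b))"
proof (rule inj_onI)
 fix x y assume x: "x \<in> fst (product_chart I b)" and y: "y \<in> fst (product_chart I b)"
  and eq: "snd (product_chart I b) x = snd (product_chart I b) y"
 have "x i = y i" if i: "i \<in> I" for i
 proof -
  have "snd (b i) (x i) = snd (b i) (y i)" using eq i by (simp add: vec_eq_iff) (metis (full_types))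
  then show ?thesis using inj_onD[OF chart_inj[OF b[OF i]]] x y i by (auto simp: PiE_iff)
 qed
 then show "x = y" using x y by (auto intro: PiE_ext)
qed

lemma product_chart_inv:
 assumes v: "v \<in> snd (product_chart I b) ` fst (product_chart I b)"
 shows "chart_inv (product_chart I b) v = (\<lambda>i\<in>I. chart_inv (b i) (v $ i))"
proof -
 obtain x where x: "x \<in> fst (product_chart I b)" "v = snd (product_chart I b) x" using v by blast
 have "chart_inv (product_chart I b) v = x" using x inv_into_f_f[OF product_chart_inj x(1)] by simp
 moreover have "x = (\<lambda>i\<in>I. chart_inv (b i) (v $ i))"
 proof
  fix i
  show "x i = (\<lambda>i\<in>I. chart_inv (b i) (v $ i)) i"
   using x chart_inv[OF b, of i "x i"] by (cases "i \<in> I") (auto simp: PiE_iff extensional_def)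
 qed
 ultimately show ?thesis by simp
qed

lemma product_chart_image:
 "snd (product_chart I b) ` fst (product_chart I b) =
   {v. (\<forall>i\<in>I. v $ i \<in> snd (b i) ` fst (b i)) \<and> (\<forall>i. i \<notin> I \<longrightarrow> v $ i = 0)}" (is "?L = ?R")
proof
 show "?L \<subseteq> ?R" by (auto simp: PiE_iff)
 show "?R \<subseteq> ?L"
 proof
  fix v assume v: "v \<in> ?R"
  define x where "x = (\<lambda>i\<in>I. chart_inv (b i) (v $ i))"
  have "x \<in> fst (product_chart I b)" using v by (auto simp: x_def inv_into_into)
  moreover have "snd (product_chart I b) x = v" using v by (auto simp: x_def vec_eq_iff f_inv_into_f)
  ultimately show "v \<in> ?L" by blast
 qed
qed

end

end

lemma (in c1_map) C1_power_component:
 fixes I :: "'i::finite set"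
 assumes j: "j \<in> I" and b: "\<And>i. i \<in> I \<Longrightarrow> b i \<in> atlas M" and c: "c \<in> atlas N"
 shows "C1_map (model (power_manifold_with J I M)) (chart_dom (\<lambda>x. F (x j)) (product_chart I b) c)
   (chart_rep (\<lambda>x. F (x j)) (product_chart I b) c)"
proof -
 obtain f' where f': "\<And>x. x \<in> chart_dom F (b j) c \<Longrightarrow>
   (chart_rep F (b j) c has_derivative f' x) (at x within chart_dom F (b j) c)"
  "\<And>v. v \<in> model M \<Longrightarrow> continuous_on (chart_dom F (b j) c) (\<lambda>x. f' x v)"
  using C1[OF b[OF j] c] unfolding C1_map_def by blast
 let ?S = "chart_dom (\<lambda>x. F (x j)) (product_chart I b) c"
 have S: "v $ j \<in> chart_dom F (b j) c" if v: "v \<in> ?S" for v using v j by (auto simp: chart_dom_def PiE_iff)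
 have rep: "chart_rep (\<lambda>x. F (x j)) (product_chart I b) c v = chart_rep F (b j) c (v $ j)" if v: "v \<in> ?S" for v
 proof -
  have "v \<in> snd (product_chart I b) ` fst (product_chart I b)" using v by (auto simp: chart_dom_def)
  from M.product_chart_inv[OF b this] show ?thesis using j by (simp add: chart_rep_def)
 qed
 have nth: "((\<lambda>v. v $ j) has_derivative (\<lambda>w. w $ j)) (at v within ?S)" for v :: "'e ^ 'i"
  by (rule bounded_linear_imp_has_derivative[OF bounded_linear_vec_nth])
 have "(chart_rep (\<lambda>x. F (x j)) (product_chart I b) c has_derivative (\<lambda>w. f' (v $ j) (w $ j))) (at v within ?S)"
  if v: "v \<in> ?S" for v
 proof (rule has_derivative_transform[OF v rep])
  show "((\<lambda>v. chart_rep F (b j) c (v $ j)) has_derivative (\<lambda>w. f' (v $ j) (w $ j))) (at v within ?S)"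
   by (rule has_derivative_in_compose[OF nth has_derivative_subset[OF f'(1)[OF S[OF v]]]]) (use S in blast)
 qed
 moreover have "continuous_on ?S (\<lambda>v. f' (v $ j) (w $ j))" if "w \<in> model (power_manifold_with J I M)" for w
  by (rule continuous_on_compose2[OF f'(2), of "w $ j" ?S "\<lambda>v. v $ j"])
   (use that j S in \<open>auto intro!: continuous_intros\<close>)
 ultimately show ?thesis unfolding C1_map_def by (intro exI[of _ "\<lambda>v w. f' (v $ j) (w $ j)"]) blast
qed

lemma C1_map_into_power:
 fixes I :: "'i::finite set" and b :: "('q, 'f::euclidean_space) chart" and c :: "'i \<Rightarrow> ('p, 'e::euclidean_space) chart"
 assumes F: "\<And>i. i \<in> I \<Longrightarrow> C1_map V (chart_dom (\<lambda>y. F y i) b (c i)) (chart_rep (\<lambda>y. F y i) b (c i))"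
 shows "C1_map V (chart_dom F b (product_chart I c)) (chart_rep F b (product_chart I c))"
proof -
 let ?S = "chart_dom F b (product_chart I c)"
 have "\<exists>f'. (\<forall>x\<in>chart_dom (\<lambda>y. F y i) b (c i). (chart_rep (\<lambda>y. F y i) b (c i) has_derivative f' x) (at x within chart_dom (\<lambda>y. F y i) b (c i))) \<and>
   (\<forall>v\<in>V. continuous_on (chart_dom (\<lambda>y. F y i) b (c i)) (\<lambda>x. f' x v))" if "i \<in> I" for i
  using F[OF that] unfolding C1_map_def by blast
 then obtain f' where f': "\<And>i x. \<lbrakk>i \<in> I; x \<in> chart_dom (\<lambda>y. F y i) b (c i)\<rbrakk> \<Longrightarrow>
   (chart_rep (\<lambda>y. F y i) b (c i) has_derivative f' i x) (at x within chart_dom (\<lambda>y. F y i) b (c i))"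
  "\<And>i v. \<lbrakk>i \<in> I; v \<in> V\<rbrakk> \<Longrightarrow> continuous_on (chart_dom (\<lambda>y. F y i) b (c i)) (\<lambda>x. f' i x v)"
  by metis
 have S: "?S \<subseteq> chart_dom (\<lambda>y. F y i) b (c i)" if "i \<in> I" for i
  using that by (auto simp: chart_dom_def PiE_iff)
 define d where "d = (\<lambda>x v. \<chi> i. if i \<in> I then f' i x v else 0)"
 have "(chart_rep F b (product_chart I c) has_derivative d x) (at x within ?S)" if x: "x \<in> ?S" for x
 proof (rule has_derivative_vec_componentwise)
  fix i
  show "((\<lambda>x. chart_rep F b (product_chart I c) x $ i) has_derivative (\<lambda>h. d x h $ i)) (at x within ?S)"
  proof (cases "i \<in> I")
   case True
   have "(chart_rep (\<lambda>y. F y i) b (c i) has_derivative f' i x) (at x within ?S)"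
    by (rule has_derivative_subset[OF f'(1)[OF True] S[OF True]]) (use x S[OF True] in blast)
   moreover have "(\<lambda>x. chart_rep F b (product_chart I c) x $ i) = chart_rep (\<lambda>y. F y i) b (c i)"
    using True by (simp add: chart_rep_def fun_eq_iff)
   ultimately show ?thesis using True by (simp add: d_def)
  next
   case False
   then show ?thesis by (simp add: d_def chart_rep_def)
  qed
 qed
 moreover have "continuous_on ?S (\<lambda>x. d x v)" if v: "v \<in> V" for v
 proof -
  have "continuous_on ?S (\<lambda>x. if i \<in> I then f' i x v else 0)" for i
   by (cases "i \<in> I") (use continuous_on_subset[OF f'(2)[OF _ v] S] in auto)
  then show ?thesis unfolding d_def by (intro continuous_on_vec_lambda)
 qed
 ultimately show ?thesis unfolding C1_map_def by (intro exI[of _ d]) blast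
qed

text \<open>The field \<open>J\<close> is arbitrary, since \<open>acm_power\<close> finds its
  complex structure by means of tangent maps of an auxiliary power with a provisional field.\<close>

lemma c1_manifold_power:
 fixes I :: "'i::finite set" and X :: "('x, 'e::euclidean_space) acm"
 assumes X: "c1_manifold X"
 shows "c1_manifold (power_manifold_with J I X)"
proof -
 interpret X: c1_manifold X by fact
 let ?M = "power_manifold_with J I X"
 have chartE: "\<exists>b. c = product_chart I b \<and> (\<forall>i\<in>I. b i \<in> atlas X)" if "c \<in> atlas ?M" for c
  using that by auto
 have cover: "(\<Union>c\<in>atlas ?M. fst c) = points ?M"
 proof
  show "(\<Union>c\<in>atlas ?M. fst c) \<subseteq> points ?M"
  proof (rule UN_least)
   fix c assume "c \<in> atlas ?M"
   then obtain b where c: "c = product_chart I b" "\<forall>i\<in>I. b i \<in> atlas X" using chartE by blast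
   have "fst (b i) \<subseteq> points X" if "i \<in> I" for i by (rule X.chart_subset) (use c(2) that in blast)
   then have "(\<Pi>\<^sub>E i\<in>I. fst (b i)) \<subseteq> (\<Pi>\<^sub>E i\<in>I. points X)" by (rule PiE_mono)
   then show "fst c \<subseteq> points ?M" unfolding c(1) by simp
  qed
  show "points ?M \<subseteq> (\<Union>c\<in>atlas ?M. fst c)"
  proof
   fix x assume x: "x \<in> points ?M"
   have "\<forall>i\<in>I. \<exists>c. c \<in> charts_at X (x i)" using x X.charts_at_nonempty by (auto simp: PiE_iff)
   then obtain b where b: "\<And>i. i \<in> I \<Longrightarrow> b i \<in> charts_at X (x i)" by metis
   have "x \<in> fst (product_chart I b)" using x X.charts_atD(2)[OF b] by (auto simp: PiE_iff)
   moreover have "product_chart I b \<in> atlas ?M" using X.charts_atD(1)[OF b] by auto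
   ultimately show "x \<in> (\<Union>c\<in>atlas ?M. fst c)" by blast
  qed
 qed
 show ?thesis
 proof
  show "subspace (model ?M)" using X.subspace_model by (auto simp: subspace_def)
  show "(\<Union>c\<in>atlas ?M. fst c) = points ?M" by (rule cover)
 next
  fix c assume "c \<in> atlas ?M"
  then obtain b where c: "c = product_chart I b" and b: "\<And>i. i \<in> I \<Longrightarrow> b i \<in> atlas X" using chartE by blast
  show "openin (mtop ?M) (fst c)" using X.chart_open[OF b] by (simp add: c openin_PiE_gen)
  have img: "snd c ` fst c = {v. (\<forall>i\<in>I. v $ i \<in> snd (b i) ` fst (b i)) \<and> (\<forall>i. i \<notin> I \<longrightarrow> v $ i = 0)}"
   unfolding c by (rule X.product_chart_image[OF b])
  have "\<forall>i\<in>I. \<exists>W. open W \<and> snd (b i) ` fst (b i) = model X \<inter> W"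
   using X.chart_image_open[OF b] by (simp add: openin_open)
  then obtain W where W: "\<And>i. i \<in> I \<Longrightarrow> open (W i) \<and> snd (b i) ` fst (b i) = model X \<inter> W i" by metis
  have "open (\<Inter>i\<in>I. (\<lambda>v :: 'e ^ 'i. v $ i) -` W i)"
   by (intro open_INT ballI open_vimage) (use W in \<open>auto intro!: continuous_intros\<close>)
  moreover have "snd c ` fst c = model ?M \<inter> (\<Inter>i\<in>I. (\<lambda>v. v $ i) -` W i)" unfolding img using W by auto
  ultimately show "openin (top_of_set (model ?M)) (snd c ` fst c)" by (simp only: openin_open_Int)
  have inv: "chart_inv c v = (\<lambda>i\<in>I. chart_inv (b i) (v $ i))" if "v \<in> snd c ` fst c" for v
   using X.product_chart_inv[OF b that[unfolded c]] unfolding c .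
  have "homeomorphic_maps (top_on ?M (fst c)) (top_of_set (snd c ` fst c)) (snd c) (chart_inv c)" unfolding homeomorphic_maps_def
  proof (intro conjI ballI)
   have "cmap (top_on ?M (fst c)) euclidean (\<lambda>x. if i \<in> I then snd (b i) (x i) else 0)" for i
   proof (cases "i \<in> I")
    case True
    have "cmap (top_on ?M (fst c)) (top_on X (fst (b i))) (\<lambda>x. x i)"
     using from_sub[OF continuous_map_product_projection[OF True, of "\<lambda>_. mtop X"]] True by (auto simp: into_sub c PiE_iff)
    from continuous_map_compose[OF this X.continuous_chart[OF b[OF True]]] show ?thesis using True by (simp add: o_def)
   qed simp
   then have "cmap (top_on ?M (fst c)) euclidean (\<lambda>x. \<chi> i. if i \<in> I then snd (b i) (x i) else 0)"
    unfolding continuous_map_atin limitin_canonical_iff by (intro ballI vec_tendstoI) simp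
   then show "cmap (top_on ?M (fst c)) (top_of_set (snd c ` fst c)) (snd c)" unfolding into_sub by (simp add: c product_chart_def)
   have "cmap (top_of_set (snd c ` fst c)) (mtop X) (\<lambda>v. chart_inv (b i) (v $ i))" if i: "i \<in> I" for i
   proof -
    have "cmap (top_of_set (snd c ` fst c)) (top_of_set (snd (b i) ` fst (b i))) (\<lambda>v. v $ i)"
     using i img by (auto simp: into_sub intro!: continuous_intros)
    from continuous_map_compose[OF this X.continuous_chart_inv[OF b[OF i]]] show ?thesis by (simp add: o_def)
   qed
   then have "cmap (top_of_set (snd c ` fst c)) (mtop ?M) (\<lambda>v. \<lambda>i\<in>I. chart_inv (b i) (v $ i))"
    by (auto simp: continuous_map_componentwise)
   then have "cmap (top_of_set (snd c ` fst c)) (mtop ?M) (chart_inv c)" by (rule continuous_map_eq) (simp add: inv)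
   then show "cmap (top_of_set (snd c ` fst c)) (top_on ?M (fst c)) (chart_inv c)"
    by (simp add: into_sub inv_into_into image_subset_iff)
  next
   fix x assume "x \<in> topspace (top_on ?M (fst c))"
   then have x: "x \<in> fst c" by simp
   show "chart_inv c (snd c x) = x" by (rule inv_into_f_f[OF _ x]) (use X.product_chart_inj[OF b] in \<open>simp add: c\<close>)
  next
   fix v assume "v \<in> topspace (top_of_set (snd c ` fst c))"
   then show "snd c (chart_inv c v) = v" by (simp add: f_inv_into_f)
  qed
  then show "homeomorphic_map (top_on ?M (fst c)) (top_of_set (snd c ` fst c)) (snd c)" using homeomorphic_maps_imp_map by blast
 next
  fix c c' assume cc: "c \<in> atlas ?M" "c' \<in> atlas ?M"
  obtain b where c: "c = product_chart I b" "\<And>i. i \<in> I \<Longrightarrow> b i \<in> atlas X" using chartE[OF cc(1)] by blast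
  obtain b' where c': "c' = product_chart I b'" "\<And>i. i \<in> I \<Longrightarrow> b' i \<in> atlas X" using chartE[OF cc(2)] by blast
  show "C1_map (model ?M) (chart_dom (\<lambda>x. x) c c') (chart_rep (\<lambda>x. x) c c')"
   unfolding c(1) c'(1) by (rule C1_map_into_power) (rule X.tr.C1_power_component[OF _ c(2) c'(2)])
 qed
qed

lemma (in c1_map) c1_map_power_component:
 fixes I :: "'i::finite set"
 assumes j: "j \<in> I"
 shows "c1_map (power_manifold_with J I M) N (\<lambda>x. F (x j))"
proof (intro c1_map.intro c1_map_axioms.intro c1_manifold_power M.c1_manifold_axioms N.c1_manifold_axioms)
 show "cmap (mtop (power_manifold_with J I M)) (mtop N) (\<lambda>x. F (x j))"
  using continuous_map_compose[OF continuous_map_product_projection[OF j, of "\<lambda>_. mtop M"] continuous] by (simp add: o_def)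
qed (use C1_power_component[OF j] in auto)

lemma c1_map_into_power:
 fixes I :: "'i::finite set"
 assumes "c1_manifold N" "c1_manifold X"
  and F: "\<And>i. i \<in> I \<Longrightarrow> c1_map N X (\<lambda>y. F y i)" and ext: "\<And>y. y \<in> points N \<Longrightarrow> F y \<in> extensional I"
 shows "c1_map N (power_manifold_with J I X) F"
proof (intro c1_map.intro c1_map_axioms.intro c1_manifold_power assms(1,2))
 show "cmap (mtop N) (mtop (power_manifold_with J I X)) F"
  using c1_map.continuous[OF F] ext by (auto simp: continuous_map_componentwise)
 fix b c assume b: "b \<in> atlas N" and "c \<in> atlas (power_manifold_with J I X)"
 then obtain c' where c: "c = product_chart I c'" "\<forall>i\<in>I. c' i \<in> atlas X" by auto
 show "C1_map (model N) (chart_dom F b c) (chart_rep F b c)"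
  unfolding c(1) by (rule C1_map_into_power) (rule c1_map.C1[OF F b bspec[OF c(2)]])
qed

section \<open>Tangent vectors and complex structure of a power\<close>

locale acm_c1_power = X: acm_c1 X for X :: "('x, 'e::euclidean_space) acm" +
 fixes I :: "'i::finite set"
begin

abbreviation M :: "('i \<Rightarrow> 'x, 'e ^ 'i) acm" where "M \<equiv> acm_power I X"

abbreviation pr :: "'i \<Rightarrow> ('i \<Rightarrow> 'x) \<Rightarrow> ('i \<Rightarrow> 'x, 'e ^ 'i) tvec \<Rightarrow> ('x, 'e) tvec" where
 "pr i \<equiv> tangent_map M X (\<lambda>y. y i)"

lemma acm_power_fields:
 "mtop M = product_topology (\<lambda>_. mtop X) I"
 "model M = {v. (\<forall>i\<in>I. v $ i \<in> model X) \<and> (\<forall>i. i \<notin> I \<longrightarrow> v $ i = 0)}"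
 "atlas M = {product_chart I c | c. \<forall>i\<in>I. c i \<in> atlas X}" by (simp_all add: acm_power_def Let_def)

lemma points_M: "points M = (\<Pi>\<^sub>E i\<in>I. points X)" by (simp add: acm_power_fields)

sublocale M: c1_manifold M unfolding acm_power_def Let_def by (rule c1_manifold_power[OF X.c1_manifold_axioms])

text \<open>Tangent spaces and tangent maps do not read the field \<open>acs\<close>, so the
  auxiliary manifold in the definition may be replaced by \<open>M\<close> itself.\<close>

lemma acs_M:
 "acs M x v = (THE w. w \<in> \<T> M x \<and> (\<forall>i\<in>I. pr i x w = acs X (x i) (pr i x v)))"
proof -
 have ts: "\<T> (power_manifold_with J I X) = \<T> (power_manifold_with J' I X)" for J J'
  by (simp add: fun_eq_iff tangent_space_def charts_at_def)
 have tm: "tangent_map (power_manifold_with J I X) X = tangent_map (power_manifold_with J' I X) X" for J J'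
  by (simp add: fun_eq_iff tangent_map_def charts_at_def)
 let ?J = "\<lambda>x v. THE w. w \<in> \<T> (power_manifold_with (\<lambda>_ v. v) I X) x \<and>
  (\<forall>i\<in>I. tangent_map (power_manifold_with (\<lambda>_ v. v) I X) X (\<lambda>y. y i) x w =
   acs X (x i) (tangent_map (power_manifold_with (\<lambda>_ v. v) I X) X (\<lambda>y. y i) x v))"
 have M: "M = power_manifold_with ?J I X" by (simp add: acm_power_def Let_def)
 have "acs M x v = ?J x v" by (simp add: M)
 then show ?thesis unfolding M using ts[of ?J "\<lambda>_ v. v"] tm[of ?J "\<lambda>_ v. v"] by metis
qed

lemma c1_map_component:
 assumes "c1_map X N F" "i \<in> I"
 shows "c1_map M N (\<lambda>x. F (x i))" using c1_map.c1_map_power_component[OF assms] by (simp add: acm_power_def Let_def)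

lemma c1_map_pr: "i \<in> I \<Longrightarrow> c1_map M X (\<lambda>y. y i)" by (rule c1_map_component[OF X.tr.c1_map_axioms])

lemma c1_map_into_M:
 assumes "c1_manifold N" "\<And>i. i \<in> I \<Longrightarrow> c1_map N X (\<lambda>y. F y i)" "\<And>y. y \<in> points N \<Longrightarrow> F y \<in> extensional I"
 shows "c1_map N M F" unfolding acm_power_def Let_def by (rule c1_map_into_power[OF assms(1) X.c1_manifold_axioms assms(2,3)])

lemma pr_in: "\<lbrakk>i \<in> I; x \<in> points M; v \<in> \<T> M x\<rbrakk> \<Longrightarrow> pr i x v \<in> \<T> X (x i)"
 by (rule c1_map.tangent_in[OF c1_map_pr])

lemma component_point: "\<lbrakk>x \<in> points M; i \<in> I\<rbrakk> \<Longrightarrow> x i \<in> points X" by (auto simp: points_M)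

lemma product_chart_at:
 assumes x: "x \<in> points M" and b: "\<And>i. i \<in> I \<Longrightarrow> b i \<in> charts_at X (x i)"
 shows "product_chart I b \<in> charts_at M x"
 using X.charts_atD(1,2)[OF b] x by (auto simp: charts_at_def acm_power_fields PiE_iff)

text \<open>In product charts the projection to a factor is the restriction of a linear map, hence
  equal to its own derivative.\<close>

lemma pr_chart:
 assumes x: "x \<in> points M" and b: "\<And>i. i \<in> I \<Longrightarrow> b i \<in> charts_at X (x i)"
  and v: "v \<in> \<T> M x" and i: "i \<in> I"
 shows "pr i x v (b i) = v (product_chart I b) $ i"
proof -
 let ?b = "product_chart I b"
 have b': "?b \<in> charts_at M x" by (rule product_chart_at[OF x b])
 interpret p: c1_map M X "\<lambda>y. y i" by (rule c1_map_pr[OF i])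
 have ba: "\<And>i. i \<in> I \<Longrightarrow> b i \<in> atlas X" using X.charts_atD(1)[OF b] .
 note xS = p.chart_dom_mem[OF b' b[OF i]]
 let ?S = "chart_dom (\<lambda>y. y i) ?b (b i)"
 have rep: "chart_rep (\<lambda>y. y i) ?b (b i) u = u $ i" if "u \<in> ?S" for u
 proof -
  have u: "u \<in> snd ?b ` fst ?b" using that by (auto simp: chart_dom_def)
  then have "u $ i \<in> snd (b i) ` fst (b i)" using X.product_chart_image[OF ba] i by auto
  then show ?thesis using X.product_chart_inv[OF ba u] i by (simp add: chart_rep_def f_inv_into_f)
 qed
 have D: "(chart_rep (\<lambda>y. y i) ?b (b i) has_derivative (\<lambda>w. w $ i)) (at (snd ?b x) within ?S)"
  by (rule has_derivative_transform[OF xS rep bounded_linear_imp_has_derivative[OF bounded_linear_vec_nth]])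
 show ?thesis using p.tangent_chart[OF x v b' b[OF i]]
   p.chart_deriv_unique[OF b' b[OF i] M.tangent_spaceD(2)[OF v b'] D
    p.chart_dom_open(2)[OF M.charts_atD(1)[OF b'] ba[OF i]] xS order_refl] by simp
qed

lemma charts_ex:
 assumes "x \<in> points M"
 obtains b where "\<And>i. i \<in> I \<Longrightarrow> b i \<in> charts_at X (x i)" "product_chart I b \<in> charts_at M x"
proof -
 have "\<forall>i\<in>I. \<exists>c. c \<in> charts_at X (x i)" using X.charts_at_nonempty component_point[OF assms] by blast
 then obtain b where "\<And>i. i \<in> I \<Longrightarrow> b i \<in> charts_at X (x i)" by metis
 then show ?thesis using that product_chart_at[OF assms] by blast
qed

lemma pr_inj:
 assumes x: "x \<in> points M" and v: "v \<in> \<T> M x" and w: "w \<in> \<T> M x"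
  and eq: "\<And>i. i \<in> I \<Longrightarrow> pr i x v = pr i x w"
 shows "v = w"
proof -
 obtain b where b: "\<And>i. i \<in> I \<Longrightarrow> b i \<in> charts_at X (x i)" and b': "product_chart I b \<in> charts_at M x"
  by (rule charts_ex[OF x]) (rule that)
 let ?b = "product_chart I b"
 have "v ?b $ i = w ?b $ i" for i
 proof (cases "i \<in> I")
  case True
  then show ?thesis using pr_chart[OF x b v True] pr_chart[OF x b w True] eq[OF True] by simp
 next
  case False
  then show ?thesis using M.tangent_spaceD(2)[OF v b'] M.tangent_spaceD(2)[OF w b'] by (simp add: acm_power_fields)
 qed
 then show ?thesis by (intro M.tangent_eqI[OF v w b']) (simp add: vec_eq_iff)
qed

lemma pr_surj:
 assumes x: "x \<in> points M" and u: "\<And>i. i \<in> I \<Longrightarrow> u i \<in> \<T> X (x i)"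
 shows "\<exists>v. v \<in> \<T> M x \<and> (\<forall>i\<in>I. pr i x v = u i)"
proof -
 obtain b where b: "\<And>i. i \<in> I \<Longrightarrow> b i \<in> charts_at X (x i)" and b': "product_chart I b \<in> charts_at M x"
  by (rule charts_ex[OF x]) (rule that)
 let ?b = "product_chart I b" and ?w = "\<chi> i. if i \<in> I then u i (b i) else 0"
 have w: "?w \<in> model M" using X.tangent_spaceD(2)[OF u b] by (simp add: acm_power_fields)
 define v where "v = tangent_vec M x ?b ?w"
 have v: "v \<in> \<T> M x" "v ?b = ?w" unfolding v_def by (rule M.tangent_vec_in[OF b' w])+
 have "pr i x v = u i" if i: "i \<in> I" for i by (rule X.tangent_eqI[OF pr_in[OF i x v(1)] u[OF i] b[OF i]])
   (use pr_chart[OF x b v(1) i] v(2) i in simp)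
 then show ?thesis using v(1) by blast
qed

text \<open>The inverse of the passage to components; its value is unique by
  \<open>pr_inj\<close>.\<close>

definition merge :: "('i \<Rightarrow> 'x) \<Rightarrow> ('i \<Rightarrow> ('x, 'e) tvec) \<Rightarrow> ('i \<Rightarrow> 'x, 'e ^ 'i) tvec" where
 "merge x u = (SOME v. v \<in> \<T> M x \<and> (\<forall>i\<in>I. pr i x v = u i))"

lemma merge:
 assumes x: "x \<in> points M" and u: "\<And>i. i \<in> I \<Longrightarrow> u i \<in> \<T> X (x i)"
 shows "merge x u \<in> \<T> M x" and "i \<in> I \<Longrightarrow> pr i x (merge x u) = u i"
 using someI_ex[OF pr_surj[OF x u]] unfolding merge_def by auto

lemma acs_M_in:
 assumes x: "x \<in> points M" and v: "v \<in> \<T> M x"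
 shows "acs M x v \<in> \<T> M x" and "i \<in> I \<Longrightarrow> pr i x (acs M x v) = acs X (x i) (pr i x v)"
proof -
 let ?u = "\<lambda>i. acs X (x i) (pr i x v)" and ?P = "\<lambda>w. w \<in> \<T> M x \<and> (\<forall>i\<in>I. pr i x w = acs X (x i) (pr i x v))"
 have u: "?u i \<in> \<T> X (x i)" if "i \<in> I" for i using X.acs_in[OF component_point[OF x that] pr_in[OF that x v]] .
 have P: "?P (merge x ?u)" using merge[OF x u] by blast
 have "acs M x v = merge x ?u" unfolding acs_M
 proof (rule the_equality)
  show "?P (merge x ?u)" by (rule P)
  show "w = merge x ?u" if "?P w" for w using pr_inj[OF x, of w "merge x ?u"] that P by simp
 qed
 with P show "acs M x v \<in> \<T> M x" "i \<in> I \<Longrightarrow> pr i x (acs M x v) = acs X (x i) (pr i x v)" by auto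
qed

lemma pr_add:
 assumes "i \<in> I" "x \<in> points M" "v \<in> \<T> M x" "w \<in> \<T> M x"
 shows "pr i x (\<lambda>c. v c + w c) = (\<lambda>c. pr i x v c + pr i x w c)"
 using c1_map.tangent_map_linear(1)[OF c1_map_pr[OF assms(1)] assms(2-4)] .

lemma pr_scaleR:
 assumes "i \<in> I" "x \<in> points M" "v \<in> \<T> M x"
 shows "pr i x (\<lambda>c. r *\<^sub>R v c) = (\<lambda>c. r *\<^sub>R pr i x v c)"
 using c1_map.tangent_map_linear(2)[OF c1_map_pr[OF assms(1)] assms(2-3)] .

text \<open>The tangent bundle of the power has the universal property of a product of copies of the
  tangent bundle of \<open>X\<close>; continuity of maps into it is afterwards checked componentwise
  and without charts.\<close>

lemma continuous_map_into_tangent_power: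
 assumes v: "\<And>t. t \<in> topspace T \<Longrightarrow> v t \<in> \<T> M (x t)"
  and x: "cmap T (mtop M) x"
  and c: "\<And>i. i \<in> I \<Longrightarrow> cmap T (\<TT> X) (\<lambda>t. (x t i, pr i (x t) (v t)))"
 shows "cmap T (\<TT> M) (\<lambda>t. (x t, v t))"
proof (rule M.continuous_map_into_tangentI[OF v x])
 have xM: "x t \<in> points M" if "t \<in> topspace T" for t using continuous_map_mem[OF x that] .
 fix t0 assume t0: "t0 \<in> topspace T"
 obtain b where b: "\<And>i. i \<in> I \<Longrightarrow> b i \<in> charts_at X (x t0 i)" and b': "product_chart I b \<in> charts_at M (x t0)"
  by (rule charts_ex[OF xM[OF t0]]) (rule that)
 let ?b = "product_chart I b"
 note bb = M.charts_atD[OF b']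
 define U where "U = {t \<in> topspace T. x t \<in> fst ?b}"
 have oU: "openin T U" unfolding U_def by (rule openin_continuous_map_preimage[OF x M.chart_open[OF bb(1)]])
 let ?T = "subtopology T U"
 have bt: "b i \<in> charts_at X (x t i)" if "i \<in> I" "t \<in> U" for i t
  using that X.charts_atD(1)[OF b] by (auto simp: U_def charts_at_def PiE_iff)
 have eq: "v t ?b $ i = (if i \<in> I then pr i (x t) (v t) (b i) else 0)" if t: "t \<in> U" for t i
 proof (cases "i \<in> I")
  case True
  then show ?thesis using pr_chart[OF xM bt v True] t by (simp add: U_def)
 next
  case False
  have "?b \<in> charts_at M (x t)" using t bb(1) by (simp add: U_def charts_at_def)
  from M.tangent_spaceD(2)[OF v this] t False show ?thesis by (simp add: U_def acm_power_fields)
 qed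
 have "cmap ?T euclidean (\<lambda>t. if i \<in> I then pr i (x t) (v t) (b i) else 0)" for i
 proof (cases "i \<in> I")
  case True
  have "cmap ?T euclidean (\<lambda>t. pr i (x t) (v t) (b i))"
   by (rule X.continuous_map_tangent_chartD[OF from_sub[OF c[OF True]] X.charts_atD(1)[OF b[OF True]]])
    (use X.charts_atD(2)[OF bt[OF True]] in simp)
  then show ?thesis using True by simp
 qed simp
 then have "cmap ?T euclidean (\<lambda>t. \<chi> i. if i \<in> I then pr i (x t) (v t) (b i) else 0)"
  unfolding continuous_map_atin limitin_canonical_iff by (intro ballI vec_tendstoI) simp
 then have "cmap ?T euclidean (\<lambda>t. v t ?b)" by (rule continuous_map_eq) (use eq in \<open>simp add: vec_eq_iff\<close>)
 moreover have "x ` U \<subseteq> fst ?b" "t0 \<in> U" using t0 bb(2) by (auto simp: U_def)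
 ultimately show "\<exists>U c. openin T U \<and> t0 \<in> U \<and> c \<in> atlas M \<and> x ` U \<subseteq> fst c \<and>
    cmap (subtopology T U) euclidean (\<lambda>t. v t c)" using oU bb(1) by (intro exI[of _ U] exI[of _ ?b]) blast
qed

lemma continuous_map_pr:
 assumes "cmap T (\<TT> M) (\<lambda>t. (x t, v t))" "i \<in> I"
 shows "cmap T (\<TT> X) (\<lambda>t. (x t i, pr i (x t) (v t)))"
 by (rule c1_map.continuous_map_tangent_map[OF c1_map_pr[OF assms(2)] assms(1)])

text \<open>All identities descend from \<open>X\<close>, as the projections are jointly injective
  on tangent vectors.\<close>

sublocale M: acm_c1 M
proof
 fix x v assume x: "x \<in> points M" and v: "v \<in> \<T> M x"
 note J = acs_M_in[OF x]
 show "acs M x v \<in> \<T> M x" by (rule J(1)[OF v])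
 show "acs M x (\<lambda>c. r *\<^sub>R v c) = (\<lambda>c. r *\<^sub>R acs M x v c)" for r
  by (rule pr_inj[OF x J(1)[OF M.tangent_scaleR[OF v]] M.tangent_scaleR[OF J(1)[OF v]]])
   (simp add: J(2)[OF M.tangent_scaleR[OF v]] pr_scaleR[OF _ x v] pr_scaleR[OF _ x J(1)[OF v]] J(2)[OF v]
    X.acs_scaleR[OF component_point[OF x] pr_in[OF _ x v]])
 show "acs M x (acs M x v) = (\<lambda>c. - v c)"
 proof (rule pr_inj[OF x J(1)[OF J(1)[OF v]]])
  show "(\<lambda>c. - v c) \<in> \<T> M x" using M.tangent_scaleR[OF v, of "-1"] by simp
  show "pr i x (acs M x (acs M x v)) = pr i x (\<lambda>c. - v c)" if i: "i \<in> I" for i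
   using J(2)[OF J(1)[OF v] i] J(2)[OF v i] X.acs_acs[OF component_point[OF x i] pr_in[OF i x v]]
    pr_scaleR[OF i x v, of "-1"] by simp
 qed
 fix w assume w: "w \<in> \<T> M x"
 show "acs M x (\<lambda>c. v c + w c) = (\<lambda>c. acs M x v c + acs M x w c)"
  by (rule pr_inj[OF x J(1)[OF M.tangent_add[OF v w]] M.tangent_add[OF J(1)[OF v] J(1)[OF w]]])
   (simp add: J(2)[OF M.tangent_add[OF v w]] pr_add[OF _ x v w] pr_add[OF _ x J(1)[OF v] J(1)[OF w]] J(2)[OF v] J(2)[OF w]
    X.acs_add[OF component_point[OF x] pr_in[OF _ x v] pr_in[OF _ x w]])
next
 let ?T = "\<TT> M"
 have q: "cmap ?T ?T (\<lambda>q. (fst q, snd q))" by simp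
 have tT: "fst q \<in> points M" "snd q \<in> \<T> M (fst q)" if "q \<in> topspace ?T" for q
  using that by (auto simp: M.topspace_tangent_topology)
 show "cmap ?T ?T (\<lambda>q. (fst q, acs M (fst q) (snd q)))"
 proof (rule continuous_map_into_tangent_power)
  show "acs M (fst q) (snd q) \<in> \<T> M (fst q)" if "q \<in> topspace ?T" for q by (rule acs_M_in(1)[OF tT[OF that]])
  show "cmap ?T (mtop M) fst" by (rule M.continuous_map_tangent_fst)
  fix i assume i: "i \<in> I"
  have "cmap ?T (\<TT> X) (\<lambda>q. (fst q i, acs X (fst q i) (pr i (fst q) (snd q))))"
   using continuous_map_compose[OF continuous_map_pr[OF q i] X.continuous_acs] by (simp add: o_def)
  then show "cmap ?T (\<TT> X) (\<lambda>q. (fst q i, pr i (fst q) (acs M (fst q) (snd q))))"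
   by (rule continuous_map_eq) (simp add: acs_M_in(2)[OF tT i])
 qed
qed

lemma pr_c_scale:
 assumes i: "i \<in> I" and x: "x \<in> points M" and v: "v \<in> \<T> M x"
 shows "pr i x (c_scale M x z v) = c_scale X (x i) z (pr i x v)"
 using pr_add[OF i x M.tangent_scaleR[OF v] M.tangent_scaleR[OF acs_M_in(1)[OF x v]], of "Re z" "Im z"]
  pr_scaleR[OF i x v] pr_scaleR[OF i x acs_M_in(1)[OF x v]] acs_M_in(2)[OF x v i] by (simp add: c_scale_def)

lemma velocity_power:
 assumes \<gamma>: "cmap euclidean (mtop M) \<gamma>" and v: "v \<in> \<T> M (\<gamma> 0)"
  and vel: "\<And>i. i \<in> I \<Longrightarrow> velocity X (\<lambda>t. \<gamma> t i) (pr i (\<gamma> 0) v)"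
 shows "velocity M \<gamma> v"
proof -
 have x: "\<gamma> 0 \<in> points M" using continuous_map_mem[OF \<gamma>] by simp
 obtain b where b: "\<And>i. i \<in> I \<Longrightarrow> b i \<in> charts_at X (\<gamma> 0 i)" and b': "product_chart I b \<in> charts_at M (\<gamma> 0)"
  by (rule charts_ex[OF x]) (rule that)
 let ?b = "product_chart I b"
 have "((snd ?b \<circ> \<gamma>) has_vector_derivative v ?b) (at 0)" unfolding has_vector_derivative_def
 proof (rule has_derivative_vec_componentwise)
  fix i
  show "((\<lambda>t. (snd ?b \<circ> \<gamma>) t $ i) has_derivative (\<lambda>h. (h *\<^sub>R v ?b) $ i)) (at 0)"
  proof (cases "i \<in> I")
   case True
   have "((\<lambda>t. snd (b i) (\<gamma> t i)) has_vector_derivative pr i (\<gamma> 0) v (b i)) (at 0)"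
    using vel[OF True] b[OF True] by (simp add: velocity_def o_def)
   then show ?thesis using True pr_chart[OF x b v True] by (simp add: has_vector_derivative_def)
  next
   case False
   have "v ?b $ i = 0" using M.tangent_spaceD(2)[OF v b'] False by (simp add: acm_power_fields)
   then show ?thesis using False by simp
  qed
 qed
 then show ?thesis by (rule M.velocity_chartI[OF \<gamma> v b'])
qed

end

section \<open>Wreath products acting on powers\<close>

lemma wreath_simps [simp]:
 "carrier (wreath G I) = (I \<rightarrow>\<^sub>E carrier G) \<times> {\<pi>. \<pi> permutes I}"
 "(g, \<sigma>) \<otimes>\<^bsub>wreath G I\<^esub> (h, \<tau>) = (\<lambda>i\<in>I. g i \<otimes>\<^bsub>G\<^esub> h (inv_into UNIV \<sigma> i), \<sigma> \<circ> \<tau>)"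
 "\<one>\<^bsub>wreath G I\<^esub> = (\<lambda>i\<in>I. \<one>\<^bsub>G\<^esub>, id)" by (simp_all add: wreath_def)

lemma permutes_inv_in: "\<lbrakk>\<sigma> permutes I; i \<in> I\<rbrakk> \<Longrightarrow> inv_into UNIV \<sigma> i \<in> I"
 using permutes_in_image[OF permutes_inv] by fastforce

lemma wreath_inverse:
 assumes "group G" and g: "g \<in> I \<rightarrow>\<^sub>E carrier G" and \<sigma>: "\<sigma> permutes I"
 shows "(\<lambda>i\<in>I. inv\<^bsub>G\<^esub> g (\<sigma> i), inv_into UNIV \<sigma>) \<otimes>\<^bsub>wreath G I\<^esub> (g, \<sigma>) = \<one>\<^bsub>wreath G I\<^esub>"
proof -
 interpret group G by fact
 have "inv_into UNIV (inv_into UNIV \<sigma>) = \<sigma>" using permutes_inv_inv[OF \<sigma>] .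
 moreover have "g (\<sigma> i) \<in> carrier G" if "i \<in> I" for i using g \<sigma> that by (auto simp: permutes_in_image)
 moreover have "inv_into UNIV \<sigma> \<circ> \<sigma> = id" by (rule permutes_inv_o(2)[OF \<sigma>])
 ultimately show ?thesis by (auto simp: fun_eq_iff restrict_def)
qed

lemma group_wreath:
 assumes "group G"
 shows "group (wreath G I)"
proof -
 interpret group G by fact
 show ?thesis
 proof (rule groupI)
  fix x y assume "x \<in> carrier (wreath G I)" "y \<in> carrier (wreath G I)"
  then obtain g \<sigma> h \<tau> where x: "x = (g, \<sigma>)" "g \<in> I \<rightarrow>\<^sub>E carrier G" "\<sigma> permutes I"
   and y: "y = (h, \<tau>)" "h \<in> I \<rightarrow>\<^sub>E carrier G" "\<tau> permutes I" by auto
  show "x \<otimes>\<^bsub>wreath G I\<^esub> y \<in> carrier (wreath G I)"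
   using x y permutes_compose[OF y(3) x(3)] permutes_inv_in[OF x(3)] by (auto simp: PiE_iff)
  fix z assume "z \<in> carrier (wreath G I)"
  then obtain k \<upsilon> where z: "z = (k, \<upsilon>)" "k \<in> I \<rightarrow>\<^sub>E carrier G" "\<upsilon> permutes I" by auto
  have "inv_into UNIV (\<sigma> \<circ> \<tau>) = inv_into UNIV \<tau> \<circ> inv_into UNIV \<sigma>"
   by (rule o_inv_distrib[OF permutes_bij[OF x(3)] permutes_bij[OF y(3)]])
  then show "x \<otimes>\<^bsub>wreath G I\<^esub> y \<otimes>\<^bsub>wreath G I\<^esub> z = x \<otimes>\<^bsub>wreath G I\<^esub> (y \<otimes>\<^bsub>wreath G I\<^esub> z)"
   using x y z permutes_inv_in[OF x(3)] permutes_inv_in[OF y(3)] by (auto simp: fun_eq_iff restrict_def PiE_iff m_assoc)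
 next
  show "\<one>\<^bsub>wreath G I\<^esub> \<in> carrier (wreath G I)" by (auto simp: permutes_id)
 next
  fix x assume "x \<in> carrier (wreath G I)"
  then obtain g \<sigma> where x: "x = (g, \<sigma>)" "g \<in> I \<rightarrow>\<^sub>E carrier G" "\<sigma> permutes I" by auto
  show "\<one>\<^bsub>wreath G I\<^esub> \<otimes>\<^bsub>wreath G I\<^esub> x = x"
   using x by (auto simp: fun_eq_iff restrict_def PiE_iff extensional_def inv_id)
  show "\<exists>y\<in>carrier (wreath G I). y \<otimes>\<^bsub>wreath G I\<^esub> x = \<one>\<^bsub>wreath G I\<^esub>"
  proof (rule bexI)
   show "(\<lambda>i\<in>I. inv\<^bsub>G\<^esub> g (\<sigma> i), inv_into UNIV \<sigma>) \<otimes>\<^bsub>wreath G I\<^esub> x = \<one>\<^bsub>wreath G I\<^esub>"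
    unfolding x(1) by (rule wreath_inverse[OF assms x(2,3)])
   show "(\<lambda>i\<in>I. inv\<^bsub>G\<^esub> g (\<sigma> i), inv_into UNIV \<sigma>) \<in> carrier (wreath G I)"
    using x permutes_inv[OF x(3)] permutes_in_image[OF x(3)] by (auto simp: PiE_iff)
  qed
 qed
qed

lemma wreath_inv:
 assumes "group G" and g: "g \<in> I \<rightarrow>\<^sub>E carrier G" and \<sigma>: "\<sigma> permutes I"
 shows "inv\<^bsub>wreath G I\<^esub> (g, \<sigma>) = (\<lambda>i\<in>I. inv\<^bsub>G\<^esub> g (\<sigma> i), inv_into UNIV \<sigma>)"
proof -
 interpret group G by fact
 interpret W: group "wreath G I" by (rule group_wreath[OF assms(1)])
 show ?thesis by (rule W.inv_equality[OF wreath_inverse[OF assms]])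
   (use g \<sigma> permutes_inv[OF \<sigma>] permutes_in_image[OF \<sigma>] in \<open>auto simp: PiE_iff\<close>)
qed

lemma finite_carrier_wreath:
 assumes "finite (carrier G)" "finite I"
 shows "finite (carrier (wreath G I))"
 using finite_PiE[OF assms(2), of "\<lambda>_. carrier G"] finite_permutations[OF assms(2)] assms(1) by simp

lemma wreath_act_apply [simp]:
 "wreath_act \<rho> I (g, \<sigma>) x = (\<lambda>i\<in>I. \<rho> (g (\<sigma> i)) (x (\<sigma> i)))" by (simp add: wreath_act_def)

section \<open>The action of the wreath product on points and tangent vectors\<close>

locale wreath_action = X: c1_action G X \<rho> + P: acm_c1_power X I
 for G :: "('g, 'm) monoid_scheme" (structure) and X :: "('x, 'e::euclidean_space) acm" and \<rho> :: "'g \<Rightarrow> 'x \<Rightarrow> 'x"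
  and I :: "'i::finite set"
begin

abbreviation "M \<equiv> P.M"
abbreviation "W \<equiv> wreath G I"
abbreviation "\<rho>W \<equiv> wreath_act \<rho> I"

lemma c1_component: "\<lbrakk>a \<in> carrier G; i \<in> I\<rbrakk> \<Longrightarrow> c1_map M X (\<lambda>x. \<rho> a (x i))"
 by (rule P.c1_map_component[OF X.act_c1])

lemma continuous_component: "\<lbrakk>a \<in> carrier G; i \<in> I\<rbrakk> \<Longrightarrow> cmap (mtop M) (mtop X) (\<lambda>x. \<rho> a (x i))"
 by (rule c1_map.continuous[OF c1_component])

lemma tangent_map_component:
 assumes "a \<in> carrier G" "i \<in> I" "x \<in> points M" "v \<in> \<T> M x"
 shows "tangent_map M X (\<lambda>y. \<rho> a (y i)) x v = X.push a (x i) (P.pr i x v)"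
 by (rule tangent_map_compose[OF P.c1_map_pr[OF assms(2)] X.act_c1[OF assms(1)] c1_component[OF assms(1,2)] _ assms(3,4)]) simp

lemma c1_map_wreath_act:
 assumes "\<kappa> \<in> carrier W"
 shows "c1_map M M (\<rho>W \<kappa>)"
proof -
 obtain g \<pi> where \<kappa>: "\<kappa> = (g, \<pi>)" "g \<in> I \<rightarrow>\<^sub>E carrier G" "\<pi> permutes I" using assms by auto
 show ?thesis
 proof (rule P.c1_map_into_M)
  show "c1_map M X (\<lambda>y. \<rho>W \<kappa> y i)" if i: "i \<in> I" for i
  proof -
   have \<pi>i: "\<pi> i \<in> I" using permutes_in_image[OF \<kappa>(3)] i by simp
   have "c1_map M X (\<lambda>x. \<rho> (g (\<pi> i)) (x (\<pi> i)))"
    by (rule c1_component[OF _ \<pi>i]) (use \<kappa>(2) \<pi>i in auto)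
   then show ?thesis using i by (simp add: \<kappa>)
  qed
 qed (use P.M.c1_manifold_axioms in \<open>auto simp: \<kappa>\<close>)
qed

lemma wreath_act_mult:
 assumes a: "a \<in> carrier W" and b: "b \<in> carrier W" and x: "x \<in> points M"
 shows "\<rho>W (a \<otimes>\<^bsub>W\<^esub> b) x = \<rho>W b (\<rho>W a x)"
proof -
 obtain g \<sigma> where a': "a = (g, \<sigma>)" "g \<in> I \<rightarrow>\<^sub>E carrier G" "\<sigma> permutes I" using a by auto
 obtain h \<tau> where b': "b = (h, \<tau>)" "h \<in> I \<rightarrow>\<^sub>E carrier G" "\<tau> permutes I" using b by auto
 have "\<rho> (g (\<sigma> (\<tau> i)) \<otimes> h (\<tau> i)) (x (\<sigma> (\<tau> i))) = \<rho> (h (\<tau> i)) (\<rho> (g (\<sigma> (\<tau> i))) (x (\<sigma> (\<tau> i))))"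
  if "i \<in> I" for i
 proof -
  have i: "\<tau> i \<in> I" "\<sigma> (\<tau> i) \<in> I" using that permutes_in_image[OF a'(3)] permutes_in_image[OF b'(3)] by simp_all
  show ?thesis by (rule X.act_mult) (use a'(2) b'(2) i P.component_point[OF x i(2)] in auto)
 qed
 \<comment> \<open>The permutation in the multiplication of the wreath product cancels against the
   index \<open>\<sigma> (\<tau> i)\<close> at which the action evaluates its factor.\<close>
 moreover have "inv_into UNIV \<sigma> (\<sigma> j) = j" for j using permutes_inverses(2)[OF a'(3)] .
 ultimately show ?thesis using permutes_in_image[OF a'(3)] permutes_in_image[OF b'(3)] unfolding a' b' by (simp add: fun_eq_iff)
qed

lemma pr_tangent_wreath:
 assumes g: "g \<in> I \<rightarrow>\<^sub>E carrier G" and \<pi>: "\<pi> permutes I" and x: "x \<in> points M" and v: "v \<in> \<T> M x"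
  and i: "i \<in> I"
 shows "P.pr i (\<rho>W (g, \<pi>) x) (tangent_map M M (\<rho>W (g, \<pi>)) x v) = X.push (g (\<pi> i)) (x (\<pi> i)) (P.pr (\<pi> i) x v)"
proof -
 have \<pi>i: "\<pi> i \<in> I" using permutes_in_image[OF \<pi>] i by simp
 have gi: "g (\<pi> i) \<in> carrier G" using g \<pi>i by auto
 have \<kappa>: "(g, \<pi>) \<in> carrier W" using g \<pi> by simp
 have "P.pr i (\<rho>W (g, \<pi>) x) (tangent_map M M (\<rho>W (g, \<pi>)) x v) = tangent_map M X (\<lambda>y. \<rho> (g (\<pi> i)) (y (\<pi> i))) x v"
  by (rule tangent_map_compose[OF c1_map_wreath_act[OF \<kappa>] P.c1_map_pr[OF i] c1_component[OF gi \<pi>i] _ x v, symmetric]) (use i in simp)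
 also have "\<dots> = X.push (g (\<pi> i)) (x (\<pi> i)) (P.pr (\<pi> i) x v)" by (rule tangent_map_component[OF gi \<pi>i x v])
 finally show ?thesis .
qed

lemma wreath_act_in: "\<lbrakk>\<kappa> \<in> carrier W; x \<in> points M\<rbrakk> \<Longrightarrow> \<rho>W \<kappa> x \<in> points M"
 by (rule c1_map.maps_points[OF c1_map_wreath_act])

sublocale W: c1_action W M \<rho>W
proof -
 interpret W: group W by (rule group_wreath) (rule X.is_group)
 show "c1_action W M \<rho>W"
 proof (intro c1_action.intro c1_action_axioms.intro P.M.acm_c1_axioms W.is_group)
  show "finite (carrier W)" by (rule finite_carrier_wreath[OF X.finite_carrier]) simp
  show "\<rho>W \<one>\<^bsub>W\<^esub> x = x" if x: "x \<in> points M" for x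
   using x X.act_one[OF P.component_point[OF x]] by (auto simp: P.points_M PiE_iff fun_eq_iff extensional_def)
  show "\<rho>W (a \<otimes>\<^bsub>W\<^esub> b) x = \<rho>W b (\<rho>W a x)" if "a \<in> carrier W" "b \<in> carrier W" "x \<in> points M" for a b x
   by (rule wreath_act_mult[OF that])
  show "c1_map M M (\<rho>W a)" if "a \<in> carrier W" for a by (rule c1_map_wreath_act[OF that])
  fix a x v assume a: "a \<in> carrier W" and x: "x \<in> points M" and v: "v \<in> \<T> M x"
  obtain g \<pi> where a': "a = (g, \<pi>)" "g \<in> I \<rightarrow>\<^sub>E carrier G" "\<pi> permutes I" using a by auto
  have ax: "\<rho>W a x \<in> points M" by (rule wreath_act_in[OF a x])
  note T = c1_map.tangent_in[OF c1_map_wreath_act[OF a] x]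
  show "tangent_map M M (\<rho>W a) x (acs M x v) = acs M (\<rho>W a x) (tangent_map M M (\<rho>W a) x v)"
  proof (rule P.pr_inj[OF ax T[OF P.M.acs_in[OF x v]] P.M.acs_in[OF ax T[OF v]]])
   fix i assume i: "i \<in> I"
   have \<pi>i: "\<pi> i \<in> I" using permutes_in_image[OF a'(3)] i by simp
   have gi: "g (\<pi> i) \<in> carrier G" using a'(2) \<pi>i by auto
   note c = P.component_point[OF x \<pi>i] and pv = P.pr_in[OF \<pi>i x v]
   have ai: "\<rho>W a x i = \<rho> (g (\<pi> i)) (x (\<pi> i))" using i by (simp add: a')
   show "P.pr i (\<rho>W a x) (tangent_map M M (\<rho>W a) x (acs M x v)) = P.pr i (\<rho>W a x) (acs M (\<rho>W a x) (tangent_map M M (\<rho>W a) x v))"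
    using pr_tangent_wreath[OF a'(2,3) x P.M.acs_in[OF x v] i] pr_tangent_wreath[OF a'(2,3) x v i]
     P.acs_M_in(2)[OF x v \<pi>i] P.acs_M_in(2)[OF ax T[OF v] i] X.act_acs[OF gi c pv] ai unfolding a'(1) by simp
  qed
 qed
qed

lemma pr_push:
 assumes "(g, \<pi>) \<in> carrier W" "x \<in> points M" "v \<in> \<T> M x" "i \<in> I"
 shows "P.pr i (\<rho>W (g, \<pi>) x) (W.push (g, \<pi>) x v) = X.push (g (\<pi> i)) (x (\<pi> i)) (P.pr (\<pi> i) x v)"
 using pr_tangent_wreath assms by simp

text \<open>The bundles over \<open>N \<subseteq> X\<^sup>I\<close> below are all described by finitely many components, each moved
 to \<open>X\<close> by a group element, from which the other components are recovered.\<close>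

lemma decomposition:
 fixes J :: "'j set" and E :: "'j \<Rightarrow> 'x \<Rightarrow> ('x, 'e) tvec set"
 assumes N: "N \<subseteq> points M" and F: "\<And>x. x \<in> N \<Longrightarrow> c_subspace M x (F x)" and J: "finite J"
  and Z: "\<And>j. j \<in> J \<Longrightarrow> Z j \<subseteq> points X" and E: "\<And>j y. \<lbrakk>j \<in> J; y \<in> Z j\<rbrakk> \<Longrightarrow> c_subspace X y (E j y)"
  and vb: "\<And>j. j \<in> J \<Longrightarrow> vector_bundle (tangent_subbundle X (Z j) (E j))"
  and \<iota>: "\<And>j. j \<in> J \<Longrightarrow> \<iota> j \<in> I" and e: "\<And>j. j \<in> J \<Longrightarrow> e j \<in> carrier G"
  and q: "\<And>x j. \<lbrakk>x \<in> N; j \<in> J\<rbrakk> \<Longrightarrow> q j x = \<rho> (e j) (x (\<iota> j))" and qZ: "\<And>x j. \<lbrakk>x \<in> N; j \<in> J\<rbrakk> \<Longrightarrow> q j x \<in> Z j"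
  and fwd: "\<And>x v j. \<lbrakk>x \<in> N; v \<in> F x; j \<in> J\<rbrakk> \<Longrightarrow> X.push (e j) (x (\<iota> j)) (P.pr (\<iota> j) x v) \<in> E j (q j x)"
  and \<kappa>: "\<And>i. i \<in> I \<Longrightarrow> \<kappa> i \<in> J" and k: "\<And>i. i \<in> I \<Longrightarrow> k i \<in> carrier G"
  and kq: "\<And>x i. \<lbrakk>x \<in> N; i \<in> I\<rbrakk> \<Longrightarrow> \<rho> (k i) (q (\<kappa> i) x) = x i"
  and bwd: "\<And>x u w. \<lbrakk>x \<in> N; \<And>j. j \<in> J \<Longrightarrow> u j \<in> E j (q j x); w \<in> \<T> M x;
    \<And>i. i \<in> I \<Longrightarrow> P.pr i x w = c_scale X (x i) (z i) (X.push (k i) (q (\<kappa> i) x) (u (\<kappa> i)))\<rbrakk> \<Longrightarrow>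
    w \<in> F x \<and> (\<forall>j\<in>J. X.push (e j) (x (\<iota> j)) (P.pr (\<iota> j) x w) = u j)"
  and recon: "\<And>x v i. \<lbrakk>x \<in> N; v \<in> F x; i \<in> I\<rbrakk> \<Longrightarrow>
    P.pr i x v = c_scale X (x i) (z i) (X.push (k i) (q (\<kappa> i) x) (X.push (e (\<kappa> i)) (x (\<iota> (\<kappa> i))) (P.pr (\<iota> (\<kappa> i)) x v)))"
 shows "vector_bundle (tangent_subbundle M N F)"
  and "K_equiv (top_on M N) (virt_of (tangent_subbundle M N F))
   (\<Sum>j\<in>J. K_pull (top_on M N) (q j) (virt_of (tangent_subbundle X (Z j) (E j))))"
proof -
 have xM: "x \<in> points M" if "x \<in> N" for x using that N by blast
 have FT: "v \<in> \<T> M x" if "x \<in> N" "v \<in> F x" for x v by (rule c_subspaceD[OF F[OF that(1)] that(2)])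
 have ET: "u \<in> \<T> X y" if "j \<in> J" "y \<in> Z j" "u \<in> E j y" for j y u
  by (rule c_subspaceD[OF E[OF that(1,2)] that(3)])
 define \<phi> where "\<phi> = (\<lambda>j x v. X.push (e j) (x (\<iota> j)) (P.pr (\<iota> j) x v))"
 define U where "U = (\<lambda>x u i. c_scale X (x i) (z i) (X.push (k i) (q (\<kappa> i) x) (u (\<kappa> i))))"
 have UT: "U x u i \<in> \<T> X (x i)" if x: "x \<in> N" and u: "u \<in> (\<Pi>\<^sub>E j\<in>J. E j (q j x))" and i: "i \<in> I" for x u i
 proof -
  have "q (\<kappa> i) x \<in> points X" "u (\<kappa> i) \<in> \<T> X (q (\<kappa> i) x)"
   using qZ[OF x \<kappa>[OF i]] Z[OF \<kappa>[OF i]] ET[OF \<kappa>[OF i] qZ[OF x \<kappa>[OF i]]] u \<kappa>[OF i] by auto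
  from X.push_in[OF k[OF i] this] show ?thesis
   unfolding U_def kq[OF x i] by (rule X.c_scale_in[OF P.component_point[OF xM[OF x] i]])
 qed
 define \<psi> where "\<psi> = (\<lambda>x u. P.merge x (U x u))"
 have \<psi>: "\<psi> x u \<in> \<T> M x" "\<And>i. i \<in> I \<Longrightarrow> P.pr i x (\<psi> x u) = U x u i"
  if x: "x \<in> N" and u: "u \<in> (\<Pi>\<^sub>E j\<in>J. E j (q j x))" for x u
  unfolding \<psi>_def using P.merge[OF xM[OF x] UT[OF x u]] by auto
 have \<phi>E: "(\<lambda>j\<in>J. \<phi> j x v) \<in> (\<Pi>\<^sub>E j\<in>J. E j (q j x))" if "x \<in> N" "v \<in> F x" for x v
  using fwd[OF that] by (simp add: \<phi>_def)
 have q_cont: "cmap (top_on M N) (top_on X (Z j)) (q j)" if j: "j \<in> J" for j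
 proof -
  have "cmap (top_on M N) (mtop X) (q j)"
   by (rule continuous_map_eq[OF from_sub[OF continuous_component[OF e[OF j] \<iota>[OF j]]]]) (use q j in simp)
  then show ?thesis using qZ[OF _ j] by (auto simp: into_sub)
 qed
 have \<phi>_cont: "cmap (subtopology (\<TT> M) (Sigma N F)) (\<TT> X) (\<lambda>t. (q j (fst t), \<phi> j (fst t) (snd t)))"
  if j: "j \<in> J" for j by (rule continuous_map_eq[OF X.continuous_map_push[OF e[OF j] P.continuous_map_pr[OF _ \<iota>[OF j]]]])
   (use j q in \<open>auto simp: \<phi>_def from_sub\<close>)
 have \<psi>_cont: "cmap T (\<TT> M) (\<lambda>t. (fst t, \<psi> (fst t) (snd t)))"
  if T: "cmap T (top_on M N) fst" "topspace T = Sigma N (\<lambda>x. \<Pi>\<^sub>E j\<in>J. E j (q j x))"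
   "\<And>j. j \<in> J \<Longrightarrow> cmap T (\<TT> X) (\<lambda>t. (q j (fst t), snd t j))"
  for T :: "(('i \<Rightarrow> 'x) \<times> ('j \<Rightarrow> ('x, 'e) tvec)) topology"
 proof (rule P.continuous_map_into_tangent_power)
  show "cmap T (mtop M) fst" using T(1) by (simp add: into_sub)
  show "\<psi> (fst t) (snd t) \<in> \<T> M (fst t)" if "t \<in> topspace T" for t using \<psi>(1) that by (auto simp: T(2))
  fix i assume i: "i \<in> I"
  have "cmap T (\<TT> X) (\<lambda>t. (\<rho> (k i) (q (\<kappa> i) (fst t)),
    c_scale X (\<rho> (k i) (q (\<kappa> i) (fst t))) (z i) (X.push (k i) (q (\<kappa> i) (fst t)) (snd t (\<kappa> i)))))"
   by (rule X.continuous_map_c_scale[OF X.continuous_map_push[OF k[OF i] T(3)[OF \<kappa>[OF i]]]])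
  then show "cmap T (\<TT> X) (\<lambda>t. (fst t i, P.pr i (fst t) (\<psi> (fst t) (snd t))))"
   by (rule continuous_map_eq) (use \<psi>(2)[OF _ _ i] kq[OF _ i] in \<open>auto simp: T(2) U_def\<close>)
 qed
 have \<psi>\<phi>: "\<psi> x (\<lambda>j\<in>J. \<phi> j x v) = v" if x: "x \<in> N" and v: "v \<in> F x" for x v
  by (rule P.pr_inj[OF xM[OF x] \<psi>(1)[OF x \<phi>E[OF x v]] FT[OF x v]])
   (use \<psi>(2)[OF x \<phi>E[OF x v]] recon[OF x v] \<kappa> in \<open>simp add: U_def \<phi>_def\<close>)
 have \<phi>\<psi>: "\<psi> x u \<in> F x \<and> (\<forall>j\<in>J. \<phi> j x (\<psi> x u) = u j)" if x: "x \<in> N" and u: "u \<in> (\<Pi>\<^sub>E j\<in>J. E j (q j x))" for x u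
  unfolding \<phi>_def by (rule bwd[OF x _ \<psi>(1)[OF x u]]) (use u in \<open>auto simp: \<psi>(2)[OF x u] U_def PiE_iff\<close>)
 have pv: "P.pr (\<iota> j) x v \<in> \<T> X (x (\<iota> j))" "x (\<iota> j) \<in> points X" if "x \<in> N" "v \<in> F x" "j \<in> J" for x v j
  using P.pr_in[OF \<iota>[OF that(3)] xM[OF that(1)] FT[OF that(1,2)]] P.component_point[OF xM[OF that(1)] \<iota>[OF that(3)]] .
 have \<phi>_add: "\<phi> j x (\<lambda>c. v c + w c) = (\<lambda>c. \<phi> j x v c + \<phi> j x w c)" if "j \<in> J" "x \<in> N" "v \<in> F x" "w \<in> F x" for j x v w
  unfolding \<phi>_def P.pr_add[OF \<iota>[OF that(1)] xM[OF that(2)] FT[OF that(2,3)] FT[OF that(2,4)]]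
  by (rule X.push_add[OF e[OF that(1)] pv(2)[OF that(2,3,1)] pv(1)[OF that(2,3,1)] pv(1)[OF that(2,4,1)]])
 have \<phi>_scale: "\<phi> j x (c_scale M x y v) = c_scale X (q j x) y (\<phi> j x v)" if "j \<in> J" "x \<in> N" "v \<in> F x" for j x v y
  unfolding \<phi>_def P.pr_c_scale[OF \<iota>[OF that(1)] xM[OF that(2)] FT[OF that(2,3)]] q[OF that(2,1)]
  by (rule X.push_c_scale[OF e[OF that(1)] pv(2)[OF that(2,3,1)] pv(1)[OF that(2,3,1)]])
 have fwd': "\<phi> j x v \<in> E j (q j x)" if "j \<in> J" "x \<in> N" "v \<in> F x" for j x v
  using fwd that by (simp add: \<phi>_def)
 note S = subbundle_decomposition[where \<phi> = \<phi> and \<psi> = \<psi>, OF P.M.acm_c1_axioms X.acm_c1_axioms N F J Z E vb q_cont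
   \<phi>_cont \<psi>_cont fwd' \<psi>\<phi> \<phi>\<psi> \<phi>_add \<phi>_scale]
 show "vector_bundle (tangent_subbundle M N F)" by (rule S(1))
 show "K_equiv (top_on M N) (virt_of (tangent_subbundle M N F))
   (\<Sum>j\<in>J. K_pull (top_on M N) (q j) (virt_of (tangent_subbundle X (Z j) (E j))))" by (rule S(2))
qed

end

section \<open>Orbits and cycle products\<close>

lemma group_perm_group: "group (perm_group I)"
proof (rule groupI)
 show "\<exists>y\<in>carrier (perm_group I). y \<otimes>\<^bsub>perm_group I\<^esub> x = \<one>\<^bsub>perm_group I\<^esub>" if "x \<in> carrier (perm_group I)" for x
  using that permutes_inv[of x I] permutes_inv_o(2)[of x I] by (auto simp: perm_group_def)
qed (auto simp: perm_group_def permutes_id permutes_compose o_assoc)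

lemma perm_group_inv:
 assumes "\<pi> permutes I"
 shows "inv\<^bsub>perm_group I\<^esub> \<pi> = inv_into UNIV \<pi>" by (rule group.inv_equality[OF group_perm_group])
  (use assms permutes_inv[OF assms] permutes_inv_o(2)[OF assms] in \<open>auto simp: perm_group_def\<close>)

section \<open>Orbits of a set of permutations\<close>

context
 fixes I :: "'i set" and P :: "('i \<Rightarrow> 'i) set"
 assumes P: "\<forall>\<pi>\<in>P. \<pi> permutes I"
begin

lemma perm_carrier: "P \<subseteq> carrier (perm_group I)" using P by (auto simp: perm_group_def)

lemma orbit_on_self: "i \<in> orbit_on I P i"
 using imageI[OF generate.one[of "perm_group I" P], of "\<lambda>p. p i"] by (simp add: orbit_on_def perm_group_def)

lemma orbit_on_step:
 assumes "j \<in> orbit_on I P i" "\<pi> \<in> generate (perm_group I) P"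
 shows "\<pi> j \<in> orbit_on I P i"
proof -
 obtain p where p: "p \<in> generate (perm_group I) P" "j = p i" using assms(1) by (auto simp: orbit_on_def)
 have "\<pi> \<circ> p \<in> generate (perm_group I) P" using generate.eng[OF assms(2) p(1)] by (simp add: perm_group_def)
 from imageI[OF this, of "\<lambda>p. p i"] show ?thesis using p(2) by (simp add: orbit_on_def)
qed

lemma orbit_on_eq:
 assumes "j \<in> orbit_on I P i"
 shows "orbit_on I P j = orbit_on I P i"
proof
 obtain p where p: "p \<in> generate (perm_group I) P" "j = p i" using assms by (auto simp: orbit_on_def)
 have pI: "p permutes I" using group.generate_in_carrier[OF group_perm_group perm_carrier p(1)] by (simp add: perm_group_def)
 have "inv_into UNIV p \<in> generate (perm_group I) P"
  using group.generate_m_inv_closed[OF group_perm_group perm_carrier p(1)] perm_group_inv[OF pI] by simp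
 moreover have "inv_into UNIV p j = i" using p(2) permutes_inverses(2)[OF pI] by simp
 ultimately have i: "i \<in> orbit_on I P j" by (force simp: orbit_on_def)
 show "orbit_on I P j \<subseteq> orbit_on I P i" using orbit_on_step[OF assms] by (auto simp: orbit_on_def[of I P j])
 show "orbit_on I P i \<subseteq> orbit_on I P j" using orbit_on_step[OF i] by (auto simp: orbit_on_def[of I P i])
qed

lemma orbit_on_subset:
 assumes "i \<in> I"
 shows "orbit_on I P i \<subseteq> I" using group.generate_in_carrier[OF group_perm_group perm_carrier] assms
 by (auto simp: orbit_on_def perm_group_def permutes_in_image)

lemma orbits_onD:
 assumes "a \<in> orbits_on I P" "i \<in> a"
 shows "i \<in> I" "orbit_on I P i = a" using assms orbit_on_subset orbit_on_eq by (auto simp: orbits_on_def)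

lemma orbits_on_nonempty: "a \<in> orbits_on I P \<Longrightarrow> a \<noteq> {}" using orbit_on_self by (auto simp: orbits_on_def)

lemma orbits_on_mem: "i \<in> I \<Longrightarrow> orbit_on I P i \<in> orbits_on I P" by (simp add: orbits_on_def)

lemma orbits_on_unique: "\<lbrakk>a \<in> orbits_on I P; b \<in> orbits_on I P; i \<in> a; i \<in> b\<rbrakk> \<Longrightarrow> a = b"
 using orbits_onD(2) by metis

lemma orbit_on_refine:
 assumes "\<pi> \<in> generate (perm_group I) P"
 shows "orbit_on I {\<pi>} i \<subseteq> orbit_on I P i"
proof -
 have "generate (perm_group I) {\<pi>} \<subseteq> generate (perm_group I) P"
  by (rule group.generate_subgroup_incl[OF group_perm_group _ group.generate_is_subgroup[OF group_perm_group perm_carrier]])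
   (use assms in simp)
 then show ?thesis by (auto simp: orbit_on_def)
qed

end

lemma sum_orbits_on:
 assumes I: "finite I" and P: "\<forall>\<pi>\<in>P. \<pi> permutes I"
 shows "(\<Sum>i\<in>I. h i) = (\<Sum>a\<in>orbits_on I P. \<Sum>i\<in>a. h i)"
proof -
 have "finite (orbits_on I P)" "\<forall>a\<in>orbits_on I P. finite a"
  using I finite_subset[OF orbit_on_subset[OF P]] by (auto simp: orbits_on_def)
 moreover have "\<Union>(orbits_on I P) = I" using orbits_onD(1)[OF P] orbit_on_self[OF P] orbits_on_mem[OF P] by blast
 moreover have "\<forall>a\<in>orbits_on I P. \<forall>b\<in>orbits_on I P. a \<noteq> b \<longrightarrow> a \<inter> b = {}" using orbits_on_unique[OF P] by blast
 ultimately show ?thesis using sum.Union_disjoint[of "orbits_on I P" h] by simp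
qed

context
 fixes I :: "'i set" and P :: "('i \<Rightarrow> 'i) set" and \<pi> :: "'i \<Rightarrow> 'i"
 assumes I: "finite I" and P: "\<forall>\<pi>\<in>P. \<pi> permutes I"
  and \<pi>: "\<pi> permutes I" and \<pi>P: "\<pi> \<in> generate (perm_group I) P"
begin

text \<open>A cycle of \<open>\<pi>\<close> that meets \<open>d\<close> lies in \<open>d\<close>,
  because \<open>\<pi>\<close> belongs to the group of which \<open>d\<close> is an orbit.\<close>

lemma orbits_in_iff:
 assumes d: "d \<in> orbits_on I P"
 shows "a \<in> orbits_in I \<pi> d \<longleftrightarrow> a \<in> orbits_on I {\<pi>} \<and> (\<exists>i\<in>a. i \<in> d)"
proof -
 have "a \<subseteq> d" if a: "a \<in> orbits_on I {\<pi>}" "i \<in> a" "i \<in> d" for i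
 proof -
  have "a = orbit_on I {\<pi>} i" using orbits_onD(2)[of "{\<pi>}", OF _ a(1,2)] \<pi> by auto
  then show ?thesis using orbit_on_refine[OF P \<pi>P, of i] orbits_onD(2)[OF P d a(3)] by simp
 qed
 then show ?thesis using orbits_on_nonempty[of "{\<pi>}" I a] \<pi> by (auto simp: orbits_in_def)
qed

lemma sum_orbits_in:
 assumes d: "d \<in> orbits_on I P"
 shows "(\<Sum>i\<in>d. h i) = (\<Sum>a\<in>orbits_in I \<pi> d. \<Sum>i\<in>a. h i)"
proof -
 have d': "d \<subseteq> I" using orbits_onD(1)[OF P d] by blast
 have sub: "orbits_in I \<pi> d \<subseteq> Pow d" by (auto simp: orbits_in_def)
 have "\<Union>(orbits_in I \<pi> d) = d"
 proof (intro equalityI subsetI)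
  fix i assume i: "i \<in> d"
  have "i \<in> orbit_on I {\<pi>} i" "orbit_on I {\<pi>} i \<in> orbits_on I {\<pi>}"
   using orbit_on_self[of "{\<pi>}"] orbits_on_mem[of "{\<pi>}" I] \<pi> d' i by auto
  then show "i \<in> \<Union>(orbits_in I \<pi> d)" using orbits_in_iff[OF d] i by blast
 qed (auto simp: orbits_in_def)
 moreover have "\<forall>a\<in>orbits_in I \<pi> d. \<forall>b\<in>orbits_in I \<pi> d. a \<noteq> b \<longrightarrow> a \<inter> b = {}"
  using orbits_on_unique[of "{\<pi>}" I] \<pi> by (auto simp: orbits_in_def)
 moreover have "finite (orbits_in I \<pi> d)" "\<forall>a\<in>orbits_in I \<pi> d. finite a"
  using finite_subset[OF sub] finite_subset[OF d' I] finite_subset[OF _ finite_subset[OF d' I]] sub by auto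
 ultimately show ?thesis using sum.Union_disjoint[of "orbits_in I \<pi> d" h] by simp
qed

lemma sum_orbits_on_blocks: "(\<Sum>a\<in>orbits_on I {\<pi>}. h a) = (\<Sum>d\<in>orbits_on I P. \<Sum>a\<in>orbits_in I \<pi> d. h a)"
proof -
 have fin: "finite (orbits_on I {\<pi>})" "finite (orbits_on I P)" using I by (auto simp: orbits_on_def)
 have ex: "\<exists>!d. d \<in> orbits_on I P \<and> a \<in> orbits_in I \<pi> d" if a: "a \<in> orbits_on I {\<pi>}" for a
 proof -
  obtain i where i: "i \<in> a" using orbits_on_nonempty[of "{\<pi>}" I a] \<pi> a by auto
  have iI: "i \<in> I" using orbits_onD(1)[of "{\<pi>}", OF _ a i] \<pi> by auto
  note d = orbits_on_mem[OF P iI]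
  have "a \<in> orbits_in I \<pi> (orbit_on I P i)" using orbits_in_iff[OF d] a i orbit_on_self[OF P] by blast
  moreover have "d = orbit_on I P i" if "d \<in> orbits_on I P" "a \<in> orbits_in I \<pi> d" for d
   using orbits_onD(2)[OF P that(1), of i] that(2) i by (auto simp: orbits_in_def)
  ultimately show ?thesis using d by blast
 qed
 have "orbits_on I {\<pi>} = \<Union>(orbits_in I \<pi> ` orbits_on I P)" using ex1_implies_ex[OF ex] by (auto simp: orbits_in_def)
 moreover have "sum h (\<Union>(orbits_in I \<pi> ` orbits_on I P)) = (\<Sum>d\<in>orbits_on I P. \<Sum>a\<in>orbits_in I \<pi> d. h a)"
 proof (rule sum.UNION_disjoint[OF fin(2)])
  show "\<forall>d\<in>orbits_on I P. finite (orbits_in I \<pi> d)" using fin(1) by (auto simp: orbits_in_def)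
  show "\<forall>d\<in>orbits_on I P. \<forall>d'\<in>orbits_on I P. d \<noteq> d' \<longrightarrow> orbits_in I \<pi> d \<inter> orbits_in I \<pi> d' = {}"
   using ex by (auto simp: orbits_in_def)
 qed
 ultimately show ?thesis by simp
qed

end

text \<open>Needed for the third class S in the obstruction class: its element has the permutation
  inverse to \<sigma>\<tau>, while the data are indexed by the cycles of \<sigma>\<tau>.\<close>

lemma orbit_on_inv:
 assumes "\<pi> permutes I"
 shows "orbit_on I {inv_into UNIV \<pi>} = orbit_on I {\<pi>}"
proof -
 have "orbit_on I {inv_into UNIV \<pi>} i \<subseteq> orbit_on I {\<pi>} i" if \<pi>: "\<pi> permutes I" for \<pi> i
 proof (rule orbit_on_refine)
  show "inv_into UNIV \<pi> \<in> generate (perm_group I) {\<pi>}"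
   using generate.inv[of \<pi> "{\<pi>}" "perm_group I"] perm_group_inv[OF \<pi>] by simp
 qed (use \<pi> in simp)
 from this[OF assms] this[OF permutes_inv[OF assms]] show ?thesis
  by (auto simp: permutes_inv_inv[OF assms] fun_eq_iff intro!: equalityI)
qed

lemma orbits_on_inv: "\<pi> permutes I \<Longrightarrow> orbits_on I {inv_into UNIV \<pi>} = orbits_on I {\<pi>}"
 by (simp add: orbits_on_def orbit_on_inv)

section \<open>Cycles of one permutation\<close>

locale cyclic_orbits =
 fixes I :: "'i set" and \<pi> :: "'i \<Rightarrow> 'i"
 assumes finite_I: "finite I" and \<pi>: "\<pi> permutes I"
begin

lemma \<pi>_permutes: "\<forall>p\<in>{\<pi>}. p permutes I" using \<pi> by simp

abbreviation "orb i \<equiv> orbit_on I {\<pi>} i"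
abbreviation "orbs \<equiv> orbits_on I {\<pi>}"

lemma orb_in: "i \<in> I \<Longrightarrow> orb i \<in> orbs" by (rule orbits_on_mem[OF \<pi>_permutes])

lemma in_orb: "i \<in> orb i" by (rule orbit_on_self[OF \<pi>_permutes])

lemma finite_orbs: "finite orbs" "a \<in> orbs \<Longrightarrow> finite a"
 using finite_I finite_subset[OF orbit_on_subset[OF \<pi>_permutes]] by (auto simp: orbits_on_def)

lemma funpow_in_orb: "(\<pi> ^^ k) i \<in> orb i"
proof (induction k)
 case 0
 then show ?case using in_orb by simp
next
 case (Suc k)
 then show ?case using orbit_on_step[OF \<pi>_permutes Suc generate.incl[of \<pi> "{\<pi>}"]] by simp
qed

lemma \<pi>_in_orb: "a \<in> orbs \<Longrightarrow> i \<in> a \<Longrightarrow> \<pi> i \<in> a"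
 using funpow_in_orb[of 1 i] orbits_onD(2)[OF \<pi>_permutes, of a i] by simp

text \<open>Orbits are defined by the generated group, which contains inverses. The set of forward
  iterates is finite and mapped injectively to itself, hence onto itself; so it is stable under
  inverses too and exhausts the orbit.\<close>

lemma orb_cycle:
 shows "inj_on (\<lambda>k. (\<pi> ^^ k) i) {..<card (orb i)}" "(\<lambda>k. (\<pi> ^^ k) i) ` {..<card (orb i)} = orb i"
  and "(\<pi> ^^ card (orb i)) i = i" "0 < card (orb i)"
proof -
 let ?n = "least_power \<pi> i" let ?S = "(\<lambda>k. (\<pi> ^^ k) i) ` {..<?n}"
 have perm: "permutation \<pi>" using \<pi> finite_I by (auto simp: permutation_permutes)
 have inj: "inj_on (\<lambda>k. (\<pi> ^^ k) i) {..<?n}"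
  using cycle_of_permutation[OF perm, of i] by (simp add: distinct_map atLeast_upt)
 have R: "range (\<lambda>k. (\<pi> ^^ k) i) = ?S" using support_set[OF perm, of i] by (simp add: atLeast_upt)
 have S\<pi>: "\<pi> ` ?S = ?S"
 proof (rule endo_inj_surj)
  show "\<pi> ` ?S \<subseteq> ?S"
  proof (rule image_subsetI)
   fix j assume "j \<in> ?S"
   then obtain k where "j = (\<pi> ^^ k) i" by auto
   then have "\<pi> j = (\<pi> ^^ Suc k) i" by simp
   then show "\<pi> j \<in> ?S" unfolding R[symmetric] by blast
  qed
  show "inj_on \<pi> ?S" using permutes_inj[OF \<pi>] by (rule inj_on_subset) simp
 qed simp
 have closed: "p ` ?S = ?S" if "p \<in> generate (perm_group I) {\<pi>}" for p using that
 proof (induction rule: generate.induct)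
  case one
  then show ?case by (simp add: perm_group_def)
 next
  case (incl h)
  then show ?case using S\<pi> by simp
 next
  case (inv h)
  then have "(inv\<^bsub>perm_group I\<^esub> h) ` ?S = inv_into UNIV \<pi> ` \<pi> ` ?S" using perm_group_inv[OF \<pi>] S\<pi> by simp
  also have "\<dots> = ?S" unfolding image_image permutes_inverses(2)[OF \<pi>] by simp
  finally show ?case .
 next
  case (eng h1 h2)
  have "(h1 \<otimes>\<^bsub>perm_group I\<^esub> h2) ` ?S = h1 ` (h2 ` ?S)" by (simp add: image_comp perm_group_def o_assoc)
  then show ?case unfolding eng.IH .
 qed
 have lp: "(\<pi> ^^ ?n) i = i" "0 < ?n" using least_power_of_permutation[OF perm] by auto
 then have "i \<in> ?S" by (auto intro!: image_eqI[of _ _ 0])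
 have "orb i = ?S"
 proof
  have "p i \<in> ?S" if "p \<in> generate (perm_group I) {\<pi>}" for p
   using imageI[OF \<open>i \<in> ?S\<close>, of p] unfolding closed[OF that] .
  then show "orb i \<subseteq> ?S" unfolding orbit_on_def by (rule image_subsetI)
  show "?S \<subseteq> orb i" using funpow_in_orb by blast
 qed
 moreover from this have "card (orb i) = ?n" using card_image[OF inj] by simp
 ultimately show "inj_on (\<lambda>k. (\<pi> ^^ k) i) {..<card (orb i)}" "(\<lambda>k. (\<pi> ^^ k) i) ` {..<card (orb i)} = orb i"
  and "(\<pi> ^^ card (orb i)) i = i" "0 < card (orb i)" using inj lp by simp_all
qed

end

locale orbit_representatives = cyclic_orbits I \<pi> for I :: "'i set" and \<pi> +
 fixes r :: "'i set \<Rightarrow> 'i"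
 assumes r: "representatives I \<pi> r"
begin

lemma r_in: "a \<in> orbs \<Longrightarrow> r a \<in> a" using r by (simp add: representatives_def)

lemma orb_r: "a \<in> orbs \<Longrightarrow> orb (r a) = a" using orbits_onD(2)[OF \<pi>_permutes _ r_in] by blast

text \<open>Steps are counted forward to the representative, because the component
  \<open>x i\<close> of a fixed point is determined by \<open>x (\<pi> i)\<close>. The count in
  \<open>nu\<close> starts from the representative instead.\<close>

definition ahead :: "'i \<Rightarrow> nat" where
 "ahead i = (LEAST k. (\<pi> ^^ k) i = r (orb i))"

lemma ahead_r: "a \<in> orbs \<Longrightarrow> ahead (r a) = 0" by (simp add: ahead_def orb_r)

lemma ahead_Suc:
 assumes i: "i \<in> I" and ne: "i \<noteq> r (orb i)"
 shows "ahead i = Suc (ahead (\<pi> i))"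
proof -
 have \<pi>i: "orb (\<pi> i) = orb i" using orbit_on_eq[OF \<pi>_permutes funpow_in_orb[of 1 i]] by simp
 have "r (orb i) \<in> orb i" by (rule r_in[OF orb_in[OF i]])
 then have "r (orb i) \<in> (\<lambda>k. (\<pi> ^^ k) i) ` {..<card (orb i)}" by (simp only: orb_cycle(2))
 then obtain k where k: "(\<pi> ^^ k) i = r (orb i)" by auto
 show ?thesis unfolding ahead_def \<pi>i
  using Least_Suc[of "\<lambda>k. (\<pi> ^^ k) i = r (orb i)", OF k] ne by (simp add: funpow_swap1)
qed

text \<open>The successor of the representative has the longest way to go: all of the cycle but one
  step.\<close>

lemma ahead_last:
 assumes a: "a \<in> orbs"
 shows "ahead (\<pi> (r a)) = card a - 1"
proof -
 note cyc = orb_cycle[of "r a", unfolded orb_r[OF a]]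
 have "orb (\<pi> (r a)) = a" using orbits_onD(2)[OF \<pi>_permutes a \<pi>_in_orb[OF a r_in[OF a]]] .
 moreover have "(LEAST k. (\<pi> ^^ k) (\<pi> (r a)) = r a) = card a - 1"
 proof (rule Least_equality)
  have eq: "(\<pi> ^^ k) (\<pi> (r a)) = (\<pi> ^^ Suc k) (r a)" for k by (simp add: funpow_swap1)
  show "(\<pi> ^^ (card a - 1)) (\<pi> (r a)) = r a" using cyc(3,4) unfolding eq by simp
  show "card a - 1 \<le> k" if k: "(\<pi> ^^ k) (\<pi> (r a)) = r a" for k
  proof (rule ccontr)
   assume "\<not> card a - 1 \<le> k"
   then have "Suc k \<in> {..<card a}" "0 \<in> {..<card a}" using cyc(4) by auto
   from inj_onD[OF cyc(1) _ this] k show False unfolding eq by simp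
  qed
 qed
 ultimately show ?thesis by (simp add: ahead_def)
qed

end

section \<open>Products along cycles\<close>

locale wreath_element = orbit_representatives I \<pi> r + G: comm_group G
 for G :: "('g, 'm) monoid_scheme" (structure) and I :: "'i set" and \<pi> r +
 fixes g :: "'i \<Rightarrow> 'g"
 assumes g: "g \<in> I \<rightarrow>\<^sub>E carrier G"
begin

lemma funpow_in: "i \<in> I \<Longrightarrow> (\<pi> ^^ k) i \<in> I" using permutes_in_image[OF permutes_funpow[OF \<pi>]] by simp

lemma \<pi>_in: "i \<in> I \<Longrightarrow> \<pi> i \<in> I" using permutes_in_image[OF \<pi>] by simp

lemma g_in: "i \<in> I \<Longrightarrow> g i \<in> carrier G" using g by auto

lemma orbs_subset: "a \<in> orbs \<Longrightarrow> a \<subseteq> I" using orbits_onD(1)[OF \<pi>_permutes] by blast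

lemma r_in_I: "a \<in> orbs \<Longrightarrow> r a \<in> I" using orbs_subset r_in by blast

lemma finprod_shift:
 assumes a: "a \<in> orbs" and h: "h \<in> I \<rightarrow> carrier G"
 shows "finprod G (\<lambda>i. h (\<pi> i)) a = finprod G h a"
proof -
 have inj: "inj_on \<pi> a" using permutes_inj[OF \<pi>] by (rule inj_on_subset) simp
 have "\<pi> ` a = a" using endo_inj_surj[OF finite_orbs(2)[OF a] _ inj] \<pi>_in_orb[OF a] by blast
 moreover have "h \<in> a \<rightarrow> carrier G" using h orbs_subset[OF a] by blast
 ultimately show ?thesis using G.finprod_reindex[of h \<pi> a, OF _ inj] by simp
qed

abbreviation "pcp \<equiv> partial_cycle_product G \<pi> g"

lemma pcp_in: "i \<in> I \<Longrightarrow> pcp i k \<in> carrier G" by (induction k) (use g_in funpow_in[of i "Suc _"] in auto)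

text \<open>The defining recursion adds a factor at the far end of the path; this one splits off the
  factor at its start.\<close>

lemma pcp_Suc: "i \<in> I \<Longrightarrow> pcp i (Suc k) = pcp (\<pi> i) k \<otimes> g i"
proof (induction k)
 case (Suc k)
 have "g ((\<pi> ^^ Suc (Suc k)) i) \<in> carrier G" by (rule g_in[OF funpow_in[OF Suc.prems]])
 moreover have "(\<pi> ^^ Suc (Suc k)) i = (\<pi> ^^ Suc k) (\<pi> i)" by (simp add: funpow_swap1)
 ultimately show ?case using Suc pcp_in[OF \<pi>_in[OF Suc.prems], of k] g_in[OF Suc.prems] by (simp add: G.m_assoc)
qed simp

lemma pcp_finprod:
 assumes i: "i \<in> I" and inj: "inj_on (\<lambda>k. (\<pi> ^^ k) i) {..k}"
 shows "pcp i k = finprod G g ((\<lambda>k. (\<pi> ^^ k) i) ` {..k})" using inj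
proof (induction k)
 case 0
 then show ?case using g_in[OF i] by simp
next
 case (Suc k)
 let ?A = "(\<lambda>k. (\<pi> ^^ k) i) ` {..k}"
 have "(\<pi> ^^ Suc k) i \<notin> ?A" using Suc.prems by (auto simp: inj_on_def atMost_Suc)
 moreover have "g \<in> ?A \<rightarrow> carrier G" using g_in funpow_in[OF i] by auto
 moreover have "inj_on (\<lambda>k. (\<pi> ^^ k) i) {..k}" by (rule inj_on_subset[OF Suc.prems]) auto
 moreover have "(\<lambda>k. (\<pi> ^^ k) i) ` {..Suc k} = insert ((\<pi> ^^ Suc k) i) ?A" by (simp add: atMost_Suc)
 ultimately show ?case using Suc.IH g_in[OF funpow_in[OF i, of "Suc k"]] by simp
qed

text \<open>Around a full cycle the starting point does not matter in a commutative group, so cycle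
  products become products over orbits.\<close>

lemma pcp_orbit:
 assumes a: "a \<in> orbs" and i: "i \<in> a"
 shows "pcp i (card a - 1) = finprod G g a"
proof -
 have "orb i = a" by (rule orbits_onD(2)[OF \<pi>_permutes a i])
 note cyc = orb_cycle[of i, unfolded this]
 have "{..card a - 1} = {..<card a}" using cyc(4) by auto
 then show ?thesis using pcp_finprod[of i "card a - 1"] cyc orbs_subset[OF a] i by auto
qed

lemma cycle_product_eq: "a \<in> orbs \<Longrightarrow> cycle_product G I \<pi> r g a = finprod G g a"
 using pcp_orbit[OF _ r_in] by (simp add: cycle_product_def)

text \<open>The product of the \<open>g\<close> from the representative back to
  \<open>\<pi> i\<close>; it moves the component of a fixed point at the representative to the
  component at \<open>i\<close>. At the representative the product is empty, and the case
  distinction keeps \<open>ahead i - 1\<close> from truncating there.\<close>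

definition transport :: "'i \<Rightarrow> 'g" where
 "transport i = (if ahead i = 0 then \<one> else pcp (\<pi> i) (ahead i - 1))"

lemma transport_in: "i \<in> I \<Longrightarrow> transport i \<in> carrier G" by (simp add: transport_def pcp_in \<pi>_in)

lemma transport_r: "a \<in> orbs \<Longrightarrow> transport (r a) = \<one>" by (simp add: transport_def ahead_r)

lemma transport_step:
 assumes "i \<in> I" "i \<noteq> r (orb i)"
 shows "transport i = transport (\<pi> i) \<otimes> g (\<pi> i)"
 using ahead_Suc[OF assms] pcp_Suc[OF \<pi>_in[OF assms(1)], of "ahead (\<pi> i) - 1"] g_in[OF \<pi>_in[OF assms(1)]]
 by (cases "ahead (\<pi> i)") (auto simp: transport_def simp del: partial_cycle_product.simps(2))

text \<open>From the representative to its successor and one step further is once around the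
  cycle.\<close>

lemma transport_last:
 assumes a: "a \<in> orbs"
 shows "transport (\<pi> (r a)) \<otimes> g (\<pi> (r a)) = finprod G g a"
proof -
 let ?i = "\<pi> (r a)"
 have i: "?i \<in> a" "?i \<in> I" using \<pi>_in_orb[OF a r_in[OF a]] orbs_subset[OF a] by auto
 have "transport ?i \<otimes> g ?i = pcp ?i (card a - 1)"
  unfolding ahead_last[OF a, symmetric] using pcp_Suc[OF i(2), of "ahead ?i - 1"] g_in[OF i(2)]
  by (cases "ahead ?i") (auto simp: transport_def simp del: partial_cycle_product.simps(2))
 then show ?thesis using pcp_orbit[OF a i(1)] by simp
qed

lemma nu_funpow:
 assumes a: "a \<in> orbs" and k: "k < card a"
 shows "nu G I \<pi> r g ((\<pi> ^^ k) (r a)) = pcp (r a) k"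
proof -
 note cyc = orb_cycle[of "r a", unfolded orb_r[OF a]]
 let ?j = "(\<pi> ^^ k) (r a)"
 have "orb ?j = a" using orbit_on_eq[OF \<pi>_permutes funpow_in_orb] orb_r[OF a] by simp
 moreover have "(LEAST m. (\<pi> ^^ m) (r a) = ?j) = k"
 proof (rule Least_equality)
  show "k \<le> m" if "(\<pi> ^^ m) (r a) = ?j" for m using inj_onD[OF cyc(1) that] k by (cases "m < card a") auto
 qed simp
 ultimately show ?thesis using funpow_in[OF r_in_I[OF a]] by (simp add: nu_def)
qed

lemma nu_in: "nu G I \<pi> r g \<in> I \<rightarrow>\<^sub>E carrier G"
 using pcp_in r_in_I[OF orb_in] by (auto simp: nu_def Let_def)

text \<open>The conjugation of g\<pi> to its normal form, read in one component: along a cycle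
  \<open>nu\<close> picks up one factor of \<open>g\<close> per step, and \<open>eps_tuple\<close>
  contributes only where the cycle closes.\<close>

lemma nu_step:
 assumes i: "i \<in> I"
 shows "g (\<pi> i) \<otimes> nu G I \<pi> r g i = nu G I \<pi> r g (\<pi> i) \<otimes> eps_tuple G I \<pi> r (cycle_product G I \<pi> r g) (\<pi> i)"
proof -
 define a where "a = orb i"
 have a: "a \<in> orbs" unfolding a_def by (rule orb_in[OF i])
 note cyc = orb_cycle[of "r a", unfolded orb_r[OF a]]
 have ra: "r a \<in> I" by (rule r_in_I[OF a])
 have ia: "i \<in> a" unfolding a_def by (rule in_orb)
 then obtain k where k: "k < card a" "i = (\<pi> ^^ k) (r a)" using cyc(2) by blast
 have \<pi>i: "\<pi> i = (\<pi> ^^ Suc k) (r a)" "orb (\<pi> i) = a"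
  using k orbits_onD(2)[OF \<pi>_permutes a \<pi>_in_orb[OF a ia]] by simp_all
 note nui = nu_funpow[OF a k(1), folded k(2)]
 show ?thesis
 proof (cases "Suc k = card a")
  \<comment> \<open>The closing step: \<open>nu\<close> has run through the whole cycle at
    \<open>i\<close> and restarts at the representative, so both sides are \<open>g (r a)\<close>
    times the cycle product.\<close>
  case True
  then have r: "\<pi> i = r a" using \<pi>i(1) cyc(3) by simp
  have "nu G I \<pi> r g (r a) = g (r a)" using nu_funpow[OF a cyc(4)] by simp
  moreover have "cycle_product G I \<pi> r g a = pcp (r a) k" using a True by (simp add: cycle_product_def flip: True)
  ultimately show ?thesis using nui ra orb_r[OF a] by (simp add: r eps_tuple_def)
 next
  case False
  then have Sk: "Suc k < card a" using k(1) by simp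
  have ne: "\<pi> i \<noteq> r a"
  proof
   assume "\<pi> i = r a"
   then have "(\<pi> ^^ Suc k) (r a) = (\<pi> ^^ 0) (r a)" using \<pi>i(1) by simp
   from inj_onD[OF cyc(1) this] Sk cyc(4) show False by simp
  qed
  have "nu G I \<pi> r g (\<pi> i) = g (\<pi> i) \<otimes> pcp (r a) k" using nu_funpow[OF a Sk] \<pi>i(1) by simp
  moreover have "eps_tuple G I \<pi> r (cycle_product G I \<pi> r g) (\<pi> i) = \<one>"
   using ne \<pi>i(2) \<pi>_in[OF i] by (simp add: eps_tuple_def)
  ultimately show ?thesis using nui pcp_in[OF ra, of k] g_in[OF \<pi>_in[OF i]] by simp
 qed
qed

end

lemma (in orbit_representatives) eps_tuple_in:
 assumes "comm_group G" and \<gg>: "\<gg> \<in> orbs \<rightarrow>\<^sub>E carrier G"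
 shows "eps_tuple G I \<pi> r \<gg> \<in> I \<rightarrow>\<^sub>E carrier G"
proof -
 interpret G: comm_group G by fact
 show ?thesis using \<gg> orb_in by (auto simp: eps_tuple_def)
qed

lemma (in orbit_representatives) finprod_eps_tuple:
 assumes "comm_group G" and \<gg>: "\<gg> \<in> orbs \<rightarrow>\<^sub>E carrier G" and a: "a \<in> orbs"
 shows "finprod G (eps_tuple G I \<pi> r \<gg>) a = \<gg> a"
proof -
 interpret G: comm_group G by fact
 have "finprod G (eps_tuple G I \<pi> r \<gg>) a = finprod G (\<lambda>i. if i = r a then (\<lambda>_. \<gg> a) i else \<one>\<^bsub>G\<^esub>) a"
  using \<gg> a orbits_onD[OF \<pi>_permutes a] by (intro G.finprod_cong') (auto simp: eps_tuple_def)
 also have "\<dots> = \<gg> a" by (rule G.finprod_singleton_swap[OF r_in[OF a] finite_orbs(2)[OF a]]) (use \<gg> a in auto)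
 finally show ?thesis .
qed

section \<open>The classes \<open>\<S>\<close> for wreath products\<close>

lemma root_of_unity_sum:
 fixes w :: complex
 assumes "w ^ s = 1" "w \<noteq> 1"
 shows "(\<Sum>k<s. w ^ k) = 0" using assms geometric_sum[of w s] by simp

lemma exp_root_of_unity:
 fixes s :: nat
 assumes "0 < s"
 shows "exp (- (2 * of_real pi * \<i> * of_nat k / of_nat s)) = exp (- (2 * of_real pi * \<i> / of_nat s)) ^ k"
  and "exp (- (2 * of_real pi * \<i> / of_nat s)) ^ k = 1 \<longleftrightarrow> s dvd k"
proof -
 show 1: "exp (- (2 * of_real pi * \<i> * of_nat k / of_nat s)) = exp (- (2 * of_real pi * \<i> / of_nat s)) ^ k"
  by (simp add: exp_of_nat_mult[symmetric] algebra_simps)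
 show "exp (- (2 * of_real pi * \<i> / of_nat s)) ^ k = 1 \<longleftrightarrow> s dvd k"
  unfolding 1[symmetric] unfolding exp_minus inverse_eq_1_iff using complex_root_unity_eq_1[of s k] assms by simp
qed

context c1_action
begin

lemma c_scale_sum_left: "c_scale M p (\<Sum>j\<in>J. z j) v = (\<lambda>c. \<Sum>j\<in>J. c_scale M p (z j) v c)"
 by (simp add: c_scale_def fun_eq_iff Re_sum Im_sum scaleR_sum_left sum.distrib)

text \<open>Fourier decomposition under the cyclic group of \<open>a\<close>: the averages
  \<open>P j\<close> are complementary projections, by the two orthogonality relations of its
  characters.\<close>

lemma TM_eq_sum_eig:
 assumes a: "a \<in> carrier \<Gamma>"
 shows "K_equiv (top_on M (Fix {a})) (virt_of (TM_restricted M (Fix {a})))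
  (\<Sum>j<ord a. virt_of (eig a (exp (- (2 * of_real pi * \<i> * of_nat j / of_nat (ord a))))))"
proof -
 define s where "s = ord a"
 have s: "0 < s" using ord_ge_1[OF finite_carrier a] by (simp add: s_def)
 define \<omega> :: complex where "\<omega> = exp (- (2 * of_real pi * \<i> / of_nat s))"
 have \<omega>0: "\<omega> \<noteq> 0" by (simp add: \<omega>_def)
 have \<omega>1: "\<omega> ^ k = 1 \<longleftrightarrow> s dvd k" for k unfolding \<omega>_def by (rule exp_root_of_unity(2)[OF s])
 have \<omega>j: "(\<omega> ^ j) ^ ord a = 1" for j using \<omega>1[of s] unfolding s_def[symmetric] by (simp add: power_mult[symmetric] \<omega>1)
 let ?Z = "Fix {a}" let ?Y = "top_on M ?Z"
 let ?E = "TM_restricted M ?Z" and ?J = "{..<s}"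
 define P where "P = (\<lambda>j. average {..<ord a} (\<lambda>k. a [^] k) (\<lambda>k. inverse ((\<omega> ^ j) ^ k) / of_nat (ord a)))"
 have Z: "p \<in> points M" "\<rho> a p = p" if "p \<in> ?Z" for p using that fixed_locus_single[OF a] by auto
 have hk: "a [^] (k::nat) \<in> carrier \<Gamma>" "p \<in> ?Z \<Longrightarrow> \<rho> (a [^] k) p = p" for k p
  using a act_pow[OF a Z] by auto
 let ?F = "\<lambda>j. eigenspace a (\<omega> ^ j)"
 have Pin: "P j p v \<in> ?F j p" if "p \<in> ?Z" "v \<in> \<T> M p" for j p v
  using eig_projection(1)[OF a \<omega>j Z[OF that(1)] that(2)] by (simp add: P_def)
 \<comment> \<open>On the eigenspace of index \<open>j\<close>, the average \<open>P i\<close> is a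
   multiple of the sum over the powers of a root of unity, which vanishes unless the root is
   1.\<close>
 have Pu: "P i p u = (if i = j then u else (\<lambda>c. 0))"
  if p: "p \<in> ?Z" and ij: "i < s" "j < s" and u: "u \<in> ?F j p" for i j p u
 proof (cases "i = j")
  case True
  then show ?thesis using eig_projection(2)[OF a \<omega>j Z[OF p], of u j] u by (simp add: P_def)
 next
  case False
  let ?w = "\<omega> ^ j / \<omega> ^ i"
  have "?w ^ s = 1" using \<omega>j[of i] \<omega>j[of j] by (simp add: power_divide s_def)
  moreover have "?w \<noteq> 1"
  proof
   assume "?w = 1"
   then have "\<omega> ^ i = \<omega> ^ j" using \<omega>0 by simp
   have "i = j"
   proof (rule ccontr)
    assume ne: "i \<noteq> j"
    have *: "\<omega> ^ (m - n) = 1" if "\<omega> ^ m = \<omega> ^ n" "n < m" for m n using that \<omega>0 by (simp add: power_diff)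
    show False
     using ne *[of i j] *[of j i] \<open>\<omega> ^ i = \<omega> ^ j\<close> ij \<omega>1[of "i - j"] \<omega>1[of "j - i"]
     by (cases i j rule: linorder_cases) (auto dest: dvd_imp_le)
   qed
   then show False using False by simp
  qed
  ultimately have w0: "(\<Sum>k<s. ?w ^ k) = 0" by (rule root_of_unity_sum)
  have uT: "u \<in> \<T> M p" using u by simp
  have "P i p u = (\<lambda>c. \<Sum>k<s. c_scale M p (?w ^ k / of_nat s) u c)" unfolding P_def average_def s_def[symmetric]
   using push_pow_eigen[OF a Z[OF p], of u "\<omega> ^ j"] u c_scale_c_scale[OF Z(1)[OF p] uT] by (simp add: field_simps)
  also have "\<dots> = c_scale M p ((\<Sum>k<s. ?w ^ k) / of_nat s) u" unfolding sum_divide_distrib c_scale_sum_left ..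
  also have "\<dots> = (\<lambda>c. 0)" unfolding w0 by (simp add: c_scale_def)
  finally show ?thesis using False by simp
 qed
 \<comment> \<open>After exchanging the sums only the power \<open>k = 0\<close>, the identity, has
   a nonzero total coefficient.\<close>
 have Psum: "(\<lambda>c. \<Sum>j<s. P j p v c) = v" if p: "p \<in> ?Z" and v: "v \<in> \<T> M p" for p v
 proof -
  have w0: "(\<Sum>j<s. inverse ((\<omega> ^ j) ^ k) / of_nat s) = (if k = 0 then 1 else 0)" if "k < s" for k
  proof (cases "k = 0")
   case False
   have "(\<Sum>j<s. inverse (\<omega> ^ k) ^ j) = 0" by (rule root_of_unity_sum)
     (use \<omega>1[of k] False that in \<open>auto simp: power_inverse power_mult[symmetric] \<omega>1 mult.commute dest: dvd_imp_le\<close>)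
   moreover have "inverse ((\<omega> ^ j) ^ k) = inverse (\<omega> ^ k) ^ j" for j
    by (simp add: power_inverse power_mult[symmetric] mult.commute)
   ultimately show ?thesis using False by (simp add: sum_divide_distrib[symmetric])
  qed (use s in simp)
  have "(\<lambda>c. \<Sum>j<s. P j p v c) = (\<lambda>c. \<Sum>k<s. c_scale M p (\<Sum>j<s. inverse ((\<omega> ^ j) ^ k) / of_nat s) (push (a [^] k) p v) c)"
   unfolding P_def average_def s_def[symmetric] c_scale_sum_left by (subst sum.swap) simp
  also have "\<dots> = (\<lambda>c. \<Sum>k<s. if k = 0 then c_scale M p 1 (push (a [^] k) p v) c else 0)"
   using w0 by (intro ext sum.cong) (auto simp: c_scale_def)
  also have "\<dots> = v" using s push_one[OF Z(1)[OF p] v] by simp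
  finally show ?thesis .
 qed
 have cF: "c_subspace M p (?F j p)" if "p \<in> ?Z" for j p by (rule c_subspace_eigen[OF a Z[OF that]])
 have id: "cmap ?Y ?Y (\<lambda>p. p)" using continuous_map_id[of ?Y] by (simp add: id_def)
 have "K_equiv ?Y (virt_of (tangent_subbundle M ?Z (\<T> M)))
   (\<Sum>j\<in>?J. K_pull ?Y (\<lambda>p. p) (virt_of (tangent_subbundle M ?Z (?F j))))"
 proof (rule subbundle_decomposition(2)[OF acm_c1_axioms acm_c1_axioms fixed_locus_subset _ _ fixed_locus_subset cF _ id,
    where \<phi> = P and \<psi> = "\<lambda>p u c. \<Sum>j<s. u j c"])
  show "c_subspace M p (\<T> M p)" if "p \<in> ?Z" for p using c_subspace_tangent Z(1)[OF that] .
  show "vector_bundle (tangent_subbundle M ?Z (?F j))" for j using vector_bundle_eig[OF a] by (simp add: eig_def)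
  fix j
  have "cmap (subtopology (\<TT> M) (Sigma ?Z (\<T> M))) (subtopology (\<TT> M) {q. fst q \<in> ?Z}) (\<lambda>q. q)"
   using continuous_map_id_subt[of "\<TT> M" "Sigma ?Z (\<T> M)"] by (auto simp: into_sub id_def)
  from continuous_map_compose[OF this average_continuous[where J = "{..<ord a}" and h = "\<lambda>k. a [^] k", OF fixed_locus_subset hk]]
  show "cmap (subtopology (\<TT> M) (Sigma ?Z (\<T> M))) (\<TT> M) (\<lambda>q. (fst q, P j (fst q) (snd q)))"
   by (simp add: o_def P_def)
 next
  fix T :: "('p \<times> (nat \<Rightarrow> ('p, 'e) tvec)) topology"
  assume T: "cmap T ?Y fst" "\<And>j. j \<in> ?J \<Longrightarrow> cmap T (\<TT> M) (\<lambda>t. (fst t, snd t j))"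
  show "cmap T (\<TT> M) (\<lambda>t. (fst t, \<lambda>c. \<Sum>j<s. snd t j c))"
   by (rule continuous_map_tangent_sum) (use T in \<open>auto simp: into_sub\<close>)
 next
  fix p v assume pv: "p \<in> ?Z" "v \<in> \<T> M p"
  show "(\<lambda>c. \<Sum>j<s. (\<lambda>j\<in>?J. P j p v) j c) = v" using Psum[OF pv] by simp
  show "P j p v \<in> ?F j p" for j by (rule Pin[OF pv])
  show "P j p (c_scale M p y v) = c_scale M p y (P j p v)" for j y
   unfolding P_def by (rule average_c_scale[OF fixed_locus_subset hk(1,2) pv])
  show "P j p (\<lambda>c. v c + w c) = (\<lambda>c. P j p v c + P j p w c)" if "w \<in> \<T> M p" for j w
   unfolding P_def by (rule average_add[OF fixed_locus_subset hk(1,2) pv that])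
 next
  fix p u assume p: "p \<in> ?Z" and u: "u \<in> (\<Pi>\<^sub>E j\<in>?J. ?F j p)"
  have uF: "u j \<in> ?F j p" if "j \<in> ?J" for j using u that by auto
  then have uT: "u j \<in> \<T> M p" if "j \<in> ?J" for j using that by blast
  have "P i p (\<lambda>c. \<Sum>j<s. u j c) = u i" if i: "i < s" for i
  proof -
   have "P i p (\<lambda>c. \<Sum>j<s. u j c) = (\<lambda>c. \<Sum>j<s. P i p (u j) c)"
    unfolding P_def by (rule additive_sum[OF average_add[OF fixed_locus_subset hk(1,2) p] uT])
   also have "\<dots> = (\<lambda>c. \<Sum>j<s. if i = j then u j c else 0)" using Pu[OF p i _ uF] by (intro ext sum.cong) auto
   also have "\<dots> = u i" using i by simp
   finally show ?thesis .
  qed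
  then show "(\<lambda>c. \<Sum>j<s. u j c) \<in> \<T> M p \<and> (\<forall>j\<in>?J. P j p (\<lambda>c. \<Sum>j<s. u j c) = u j)"
   using tangent_sum[where J = ?J and v = u, OF uT] by simp
 qed simp_all
 also have "K_equiv ?Y \<dots> (\<Sum>j\<in>?J. virt_of (tangent_subbundle M ?Z (?F j)))"
  by (intro K_equiv_sum K_pull_id bundle_virt_virt_of) (use vector_bundle_eig[OF a] in \<open>simp_all add: eig_def\<close>)
 finally show ?thesis using exp_root_of_unity(1)[OF s] unfolding s_def[symmetric] \<omega>_def TM_restricted_def eig_def by simp
qed

end

section \<open>Weights of roots of unity\<close>

lemma sum_multiples:
 fixes t :: nat
 assumes "0 < t"
 shows "(\<Sum>k<t * N. if t dvd k then f (k div t) else 0) = (\<Sum>m<N. f m)"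
proof -
 have "(\<Sum>k<t * N. if t dvd k then f (k div t) else 0) = (\<Sum>k\<in>{k\<in>{..<t * N}. t dvd k}. f (k div t))"
  by (rule sum.inter_filter[symmetric]) simp
 also have "\<dots> = (\<Sum>m<N. f m)"
  by (rule sum.reindex_bij_witness[of _ "\<lambda>m. t * m" "\<lambda>k. k div t"]) (use assms in auto)
 finally show ?thesis .
qed

lemma sum_div_mod:
 fixes s :: nat
 assumes "0 < s"
 shows "(\<Sum>m<n * s. f (m div s) (m mod s)) = (\<Sum>j<s. \<Sum>l<n. f l j)"
proof -
 have "(\<Sum>m<n * s. f (m div s) (m mod s)) = (\<Sum>(l, j)\<in>{..<n} \<times> {..<s}. f l j)"
 proof (rule sum.reindex_bij_witness[of _ "\<lambda>(l, j). l * s + j" "\<lambda>m. (m div s, m mod s)"])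
  fix q assume "q \<in> {..<n} \<times> {..<s}"
  then obtain l j where q: "q = (l, j)" "l < n" "j < s" by auto
  have "l * s + j < Suc l * s" using q by simp
  also have "\<dots> \<le> n * s" using q by (intro mult_le_mono1) simp
  finally show "(case q of (l, j) \<Rightarrow> l * s + j) \<in> {..<n * s}" using q by simp
 qed (use assms in \<open>auto simp: less_mult_imp_div_less\<close>)
 then show ?thesis by (simp add: sum.cartesian_product[symmetric] sum.swap[of _ "{..<n}"])
qed

text \<open>The roots of order \<open>n\<close> of one \<open>s\<close>-th root of unity have
  weights spaced by 1/n; the spacing accounts for the term (n - 1)/2.\<close>

lemma sum_residues:
 fixes n s j :: nat
 assumes "0 < n" "0 < s"
 shows "(\<Sum>l<n. of_nat (l * s + j) / of_nat (n * s)) = (of_nat j / of_nat s + (of_nat n - 1) / 2 :: rat)"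
proof -
 have g: "(\<Sum>l<n. of_nat l) = (of_nat n * (of_nat n - 1) / 2 :: rat)" for n by (induction n) (simp_all add: field_simps)
 have "(\<Sum>l<n. of_nat (l * s + j) / of_nat (n * s)) = ((\<Sum>l<n. of_nat l) * of_nat s + of_nat n * of_nat j) / (of_nat n * of_nat s :: rat)"
  by (simp add: sum_divide_distrib[symmetric] sum.distrib sum_distrib_right)
 also have "\<dots> = of_nat j / of_nat s + (of_nat n - 1) / 2" using assms by (simp add: g field_simps)
 finally show ?thesis .
qed

context c1_action
begin

text \<open>Taking \<open>n = 1\<close> shows that \<open>S_virt\<close> may be computed with any multiple \<open>R\<close> of the order of \<open>a\<close>.\<close>

lemma weighted_eig_sum:
 assumes a: "a \<in> carrier \<Gamma>" and n: "0 < n" and R: "0 < R" "n * ord a dvd R"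
 shows "K_equiv (top_on M (Fix {a}))
  (\<Sum>k<R. q_scale (of_nat k / of_nat R) (virt_of (eig a (exp (- (2 * of_real pi * \<i> * of_nat k / of_nat R)) ^ n))))
  (S_virt \<Gamma> M \<rho> a + q_scale ((of_nat n - 1) / 2) (virt_of (TM_restricted M (Fix {a}))))"
proof -
 define s where "s = ord a"
 have s: "0 < s" using ord_ge_1[OF finite_carrier a] by (simp add: s_def)
 obtain t where t: "R = t * (n * s)" using R(2) by (auto simp: s_def dvd_def mult.commute)
 have t0: "0 < t" using R(1) t by simp
 let ?Y = "top_on M (Fix {a})"
 define \<omega> :: complex where "\<omega> = exp (- (2 * of_real pi * \<i> / of_nat R))"
 define V where "V = (\<lambda>j. virt_of (eig a (exp (- (2 * of_real pi * \<i> * of_nat j / of_nat s)))))"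
 have \<omega>k: "exp (- (2 * of_real pi * \<i> * of_nat k / of_nat R)) ^ n = \<omega> ^ (k * n)" for k
  unfolding exp_root_of_unity(1)[OF R(1)] \<omega>_def by (simp add: power_mult)
 have \<omega>1: "\<omega> ^ m = 1 \<longleftrightarrow> R dvd m" for m unfolding \<omega>_def by (rule exp_root_of_unity(2)[OF R(1)])
 \<comment> \<open>The number \<open>\<omega> ^ (k * n)\<close> is an \<open>s\<close>-th root of
   unity exactly if \<open>t\<close> divides \<open>k\<close>; the other terms vanish by
   \<open>eig_zero\<close>. For \<open>k = t * m\<close> the weight is m/(n s), and the eigenvalue
   depends on \<open>m\<close> modulo \<open>s\<close> only.\<close>
 have each: "K_equiv ?Y (q_scale (of_nat k / of_nat R) (virt_of (eig a (\<omega> ^ (k * n)))))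
   (if t dvd k then q_scale (of_nat (k div t) / of_nat (n * s)) (V (k div t mod s)) else 0)" for k
 proof (cases "t dvd k")
  case False
  have "(\<omega> ^ (k * n)) ^ ord a \<noteq> 1"
   using False n s t0 unfolding power_mult[symmetric] \<omega>1 t s_def[symmetric] by (simp add: mult.assoc)
  from K_equiv_scale[OF eig_zero(2)[OF a this]] show ?thesis using False by (simp add: q_scale_simps)
 next
  case True
  then obtain m where m: "k = t * m" by auto
  have "\<omega> ^ (k * n) = exp (- (2 * of_real pi * \<i> * of_nat m / of_nat s))"
   unfolding \<omega>k[symmetric] exp_of_nat_mult[symmetric] using t0 n by (simp add: t m field_simps)
  also have "\<dots> = exp (- (2 * of_real pi * \<i> * of_nat (m mod s) / of_nat s))"
  proof -
   have "exp (- (2 * of_real pi * \<i> / of_nat s)) ^ (s * (m div s)) = 1"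
    using exp_root_of_unity(2)[OF s, of "s * (m div s)"] by simp
   then show ?thesis
    unfolding exp_root_of_unity(1)[OF s] using power_add[of "exp (- (2 * of_real pi * \<i> / of_nat s))" "s * (m div s)" "m mod s"]
    by simp
  qed
  finally have "virt_of (eig a (\<omega> ^ (k * n))) = V (m mod s)" by (simp add: V_def)
  then show ?thesis using t0 by (simp add: m t)
 qed
 have "K_equiv ?Y (\<Sum>k<R. q_scale (of_nat k / of_nat R) (virt_of (eig a (\<omega> ^ (k * n)))))
   (\<Sum>k<R. if t dvd k then q_scale (of_nat (k div t) / of_nat (n * s)) (V (k div t mod s)) else 0)"
  by (rule K_equiv_sum[OF each])
 also have "(\<Sum>k<R. if t dvd k then q_scale (of_nat (k div t) / of_nat (n * s)) (V (k div t mod s)) else 0) =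
   (\<Sum>m<n * s. q_scale (of_nat m / of_nat (n * s)) (V (m mod s)))" unfolding t by (rule sum_multiples[OF t0])
 also have "\<dots> = (\<Sum>m<n * s. q_scale (of_nat (m div s * s + m mod s) / of_nat (n * s)) (V (m mod s)))"
  by (simp only: div_mult_mod_eq)
 also have "\<dots> = (\<Sum>j<s. \<Sum>l<n. q_scale (of_nat (l * s + j) / of_nat (n * s)) (V j))" by (rule sum_div_mod[OF s])
 also have "\<dots> = S_virt \<Gamma> M \<rho> a + q_scale ((of_nat n - 1) / 2) (\<Sum>j<s. V j)"
  unfolding q_scale_sum_left[symmetric] sum_residues[OF n s]
  by (simp add: q_scale_simps sum.distrib q_scale_sum S_virt_eq V_def s_def)
 also have "K_equiv ?Y \<dots> (S_virt \<Gamma> M \<rho> a + q_scale ((of_nat n - 1) / 2) (virt_of (TM_restricted M (Fix {a}))))"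
  unfolding V_def s_def by (intro K_equiv_add K_equiv_scale K_equiv_refl K_equiv_sym[OF TM_eq_sum_eig[OF a]])
 finally show ?thesis unfolding \<omega>k .
qed

end

section \<open>Fixed points and eigenvectors of an element of the wreath product\<close>

locale wreath_action_element = wreath_action G X \<rho> I + wreath_element G I \<pi> r g
 for G :: "('g, 'm) monoid_scheme" (structure) and X :: "('x, 'e::euclidean_space) acm" and \<rho>
  and I :: "'i::finite set" and \<pi> r g
begin

abbreviation "\<kappa> \<equiv> (g, \<pi>)"
abbreviation "\<psi> \<equiv> finprod G g"
abbreviation "N\<kappa> \<equiv> W.Fix {\<kappa>}"

lemma \<kappa>_in: "\<kappa> \<in> carrier W" using g \<pi> by simp

lemma \<psi>_in: "a \<in> orbs \<Longrightarrow> \<psi> a \<in> carrier G"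
 by (rule G.finprod_closed) (use g_in orbs_subset in blast)

lemma N\<kappa>_points: "x \<in> N\<kappa> \<Longrightarrow> x \<in> points M" using W.fixed_locus_subset by blast

lemma N\<kappa>_comp: "\<lbrakk>x \<in> N\<kappa>; i \<in> I\<rbrakk> \<Longrightarrow> x i \<in> points X"
 by (rule P.component_point[OF N\<kappa>_points])

lemma N\<kappa>_step:
 assumes "x \<in> N\<kappa>" "i \<in> I"
 shows "\<rho> (g (\<pi> i)) (x (\<pi> i)) = x i"
proof -
 have "\<rho>W \<kappa> x = x" using assms(1) W.fixed_locus_single[OF \<kappa>_in] by auto
 from fun_cong[OF this, of i] show ?thesis using assms(2) by simp
qed

text \<open>Induction against the direction of the cycle: the index \<open>i\<close> is reached
  after \<open>\<pi> i\<close>, starting from the representative.\<close>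

lemma ahead_induct [consumes 1, case_names rep step]:
 assumes i: "i \<in> I"
  and rep: "\<And>a. a \<in> orbs \<Longrightarrow> P (r a)"
  and step: "\<And>i. \<lbrakk>i \<in> I; i \<noteq> r (orb i); P (\<pi> i)\<rbrakk> \<Longrightarrow> P i"
 shows "P i" using i
proof (induction "ahead i" arbitrary: i rule: less_induct)
 case less
 show ?case
 proof (cases "i = r (orb i)")
  case True
  then show ?thesis using rep[OF orb_in[OF less.prems]] by simp
 next
  case False
  show ?thesis by (rule step[OF less.prems False less.hyps[OF _ \<pi>_in[OF less.prems]]])
    (use ahead_Suc[OF less.prems False] in simp)
 qed
qed

lemma orb_\<pi>: "orb (\<pi> i) = orb i" using orbit_on_eq[OF \<pi>_permutes funpow_in_orb[of 1 i]] by simp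

lemma N\<kappa>_transport:
 assumes x: "x \<in> N\<kappa>" and i: "i \<in> I"
 shows "\<rho> (transport i) (x (r (orb i))) = x i" using i
proof (induction rule: ahead_induct)
 case (rep a)
 then show ?case using X.act_one[OF N\<kappa>_comp[OF x r_in_I]] by (simp add: transport_r orb_r)
next
 case (step i)
 have "x (r (orb i)) \<in> points X" by (rule N\<kappa>_comp[OF x r_in_I[OF orb_in[OF step(1)]]])
 then show ?case using step N\<kappa>_step[OF x step(1)] transport_step[OF step(1,2)]
   X.act_mult[OF transport_in[OF \<pi>_in[OF step(1)]] g_in[OF \<pi>_in[OF step(1)]]] by (simp add: orb_\<pi>)
qed

lemma N\<kappa>_r:
 assumes x: "x \<in> N\<kappa>" and a: "a \<in> orbs"
 shows "x (r a) \<in> X.Fix {\<psi> a}"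
proof -
 have p: "x (r a) \<in> points X" by (rule N\<kappa>_comp[OF x r_in_I[OF a]])
 note i = \<pi>_in[OF r_in_I[OF a]]
 have "\<rho> (\<psi> a) (x (r a)) = \<rho> (g (\<pi> (r a))) (\<rho> (transport (\<pi> (r a))) (x (r a)))"
  unfolding transport_last[OF a, symmetric] by (rule X.act_mult[OF transport_in[OF i] g_in[OF i] p])
 also have "\<dots> = x (r a)"
  using N\<kappa>_transport[OF x i] N\<kappa>_step[OF x r_in_I[OF a]] by (simp add: orb_\<pi> orb_r[OF a])
 finally show ?thesis using p X.fixed_locus_single[OF \<psi>_in[OF a]] by simp
qed

end

context wreath_action_element
begin

lemma N\<kappa>_rep: "\<lbrakk>x \<in> N\<kappa>; a \<in> orbs\<rbrakk> \<Longrightarrow> x (r a) \<in> points X"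
 by (rule N\<kappa>_comp[OF _ r_in_I])

lemma continuous_rep:
 assumes "a \<in> orbs"
 shows "cmap (top_on M N\<kappa>) (top_on X (X.Fix {\<psi> a})) (\<lambda>x. x (r a))"
 using c1_map.continuous[OF P.c1_map_pr[OF r_in_I[OF assms]]] N\<kappa>_r[OF _ assms] by (auto simp: into_sub from_sub)

lemma push_transport:
 assumes x: "x \<in> N\<kappa>" and a: "a \<in> orbs" and i: "i \<in> a" and u: "u \<in> \<T> X (x (r a))"
 shows "X.push (transport i) (x (r a)) u \<in> \<T> X (x i)"
  and "X.push (g i) (x i) (X.push (transport i) (x (r a)) u) = X.push (transport i \<otimes> g i) (x (r a)) u"
proof -
 have iI: "i \<in> I" and oi: "orb i = a" using orbs_subset[OF a] orbits_onD(2)[OF \<pi>_permutes a] i by auto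
 have t: "\<rho> (transport i) (x (r a)) = x i" using N\<kappa>_transport[OF x iI] oi by simp
 show "X.push (transport i) (x (r a)) u \<in> \<T> X (x i)"
  using X.push_in[OF transport_in[OF iI] N\<kappa>_rep[OF x a] u] t by simp
 show "X.push (g i) (x i) (X.push (transport i) (x (r a)) u) = X.push (transport i \<otimes> g i) (x (r a)) u"
  using X.push_mult[OF transport_in[OF iI] g_in[OF iI] N\<kappa>_rep[OF x a] u] t by simp
qed

lemma pr_push_\<kappa>:
 assumes "x \<in> N\<kappa>" "v \<in> \<T> M x" "i \<in> I"
 shows "P.pr i x (W.push \<kappa> x v) = X.push (g (\<pi> i)) (x (\<pi> i)) (P.pr (\<pi> i) x v)"
proof -
 have "\<rho>W \<kappa> x = x" using assms(1) W.fixed_locus_single[OF \<kappa>_in] by blast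
 then show ?thesis using pr_push[OF \<kappa>_in N\<kappa>_points[OF assms(1)] assms(2,3)] by simp
qed

context
 fixes \<mu> :: complex and x
 assumes \<mu>: "\<mu> \<noteq> 0" and x: "x \<in> N\<kappa>"
begin

text \<open>The eigenvector equation solved backwards along a cycle: each step contributes a push by
  \<open>g\<close> and a factor \<open>inverse \<mu>\<close>.\<close>

lemma eigen_transport:
 assumes v: "v \<in> \<T> M x" "W.push \<kappa> x v = c_scale M x \<mu> v" and i: "i \<in> I"
 shows "P.pr i x v = c_scale X (x i) (inverse \<mu> ^ ahead i) (X.push (transport i) (x (r (orb i))) (P.pr (r (orb i)) x v))"
 using i
proof (induction rule: ahead_induct)
 case (rep a)
 note ra = N\<kappa>_rep[OF x rep] P.pr_in[OF r_in_I[OF rep] N\<kappa>_points[OF x] v(1)]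
 show ?case using X.push_one[OF ra] ra by (simp add: transport_r[OF rep] ahead_r[OF rep] orb_r[OF rep])
next
 case (step i)
 define a where "a = orb i"
 have a: "a \<in> orbs" unfolding a_def by (rule orb_in[OF step(1)])
 have ia: "i \<in> a" "\<pi> i \<in> a" using \<pi>_in_orb[OF a] in_orb by (auto simp: a_def)
 let ?u = "P.pr (r a) x v"
 have u: "?u \<in> \<T> X (x (r a))" by (rule P.pr_in[OF r_in_I[OF a] N\<kappa>_points[OF x] v(1)])
 note p = N\<kappa>_comp[OF x step(1)] and q = N\<kappa>_comp[OF x \<pi>_in[OF step(1)]]
 note pv = P.pr_in[OF step(1) N\<kappa>_points[OF x] v(1)]
 have "c_scale X (x i) \<mu> (P.pr i x v) = X.push (g (\<pi> i)) (x (\<pi> i)) (P.pr (\<pi> i) x v)"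
  using pr_push_\<kappa>[OF x v(1) step(1)] P.pr_c_scale[OF step(1) N\<kappa>_points[OF x] v(1)] v(2) by simp
 also have "\<dots> = X.push (g (\<pi> i)) (x (\<pi> i)) (c_scale X (x (\<pi> i)) (inverse \<mu> ^ ahead (\<pi> i)) (X.push (transport (\<pi> i)) (x (r a)) ?u))"
  using step(3) by (simp add: orb_\<pi> a_def)
 also have "\<dots> = c_scale X (x i) (inverse \<mu> ^ ahead (\<pi> i)) (X.push (transport i) (x (r a)) ?u)"
  using X.push_c_scale[OF g_in[OF \<pi>_in[OF step(1)]] q push_transport(1)[OF x a ia(2) u]]
   push_transport(2)[OF x a ia(2) u] N\<kappa>_step[OF x step(1)] transport_step[OF step(1,2)] by simp
 finally have "c_scale X (x i) (inverse \<mu>) (c_scale X (x i) \<mu> (P.pr i x v)) =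
   c_scale X (x i) (inverse \<mu>) (c_scale X (x i) (inverse \<mu> ^ ahead (\<pi> i)) (X.push (transport i) (x (r a)) ?u))" by simp
 then show ?case using \<mu> ahead_Suc[OF step(1,2)]
  by (simp add: X.c_scale_c_scale[OF p pv] X.c_scale_c_scale[OF p push_transport(1)[OF x a ia(1) u]] flip: a_def)
qed

text \<open>Once around the cycle: the pushes compose to the cycle product, and one factor
  \<open>\<mu>\<close> arises for each element of the cycle.\<close>

lemma eigen_rep:
 assumes v: "v \<in> \<T> M x" "W.push \<kappa> x v = c_scale M x \<mu> v" and a: "a \<in> orbs"
 shows "X.push (\<psi> a) (x (r a)) (P.pr (r a) x v) = c_scale X (x (r a)) (\<mu> ^ card a) (P.pr (r a) x v)"
proof -
 let ?u = "P.pr (r a) x v" and ?i = "\<pi> (r a)" and ?p = "x (r a)"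
 note ra = r_in_I[OF a]
 have ia: "?i \<in> a" by (rule \<pi>_in_orb[OF a r_in[OF a]])
 have p: "?p \<in> points X" by (rule N\<kappa>_rep[OF x a])
 have u: "?u \<in> \<T> X ?p" by (rule P.pr_in[OF ra N\<kappa>_points[OF x] v(1)])
 have "\<rho> (\<psi> a) ?p = ?p" using N\<kappa>_r[OF x a] X.fixed_locus_single[OF \<psi>_in[OF a]] by blast
 then have \<psi>u: "X.push (\<psi> a) ?p ?u \<in> \<T> X ?p" using X.push_in[OF \<psi>_in[OF a] p u] by simp
 have "c_scale X ?p \<mu> ?u = X.push (g ?i) (x ?i) (P.pr ?i x v)"
  using pr_push_\<kappa>[OF x v(1) ra] P.pr_c_scale[OF ra N\<kappa>_points[OF x] v(1)] v(2) by simp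
 also have "P.pr ?i x v = c_scale X (x ?i) (inverse \<mu> ^ (card a - 1)) (X.push (transport ?i) ?p ?u)"
  using eigen_transport[OF v \<pi>_in[OF ra]] by (simp add: orb_\<pi> orb_r[OF a] ahead_last[OF a])
 also have "X.push (g ?i) (x ?i) \<dots> = c_scale X ?p (inverse \<mu> ^ (card a - 1)) (X.push (\<psi> a) ?p ?u)"
  using X.push_c_scale[OF g_in[OF \<pi>_in[OF ra]] N\<kappa>_comp[OF x \<pi>_in[OF ra]] push_transport(1)[OF x a ia u]]
   push_transport(2)[OF x a ia u] N\<kappa>_step[OF x ra] transport_last[OF a] by simp
 finally have "c_scale X ?p (\<mu> ^ (card a - 1)) (c_scale X ?p \<mu> ?u) =
   c_scale X ?p (\<mu> ^ (card a - 1)) (c_scale X ?p (inverse \<mu> ^ (card a - 1)) (X.push (\<psi> a) ?p ?u))" by simp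
 moreover have "\<mu> ^ (card a - 1) * \<mu> = \<mu> ^ card a" using orb_cycle(4)[of "r a"] orb_r[OF a] by (cases "card a") auto
 ultimately show ?thesis
  using \<mu> by (simp add: X.c_scale_c_scale[OF p u] X.c_scale_c_scale[OF p \<psi>u] power_mult_distrib[symmetric])
qed

text \<open>The converse of the two preceding facts: eigenvectors of the cycle products, chosen
  freely at the representatives and spread over the cycles, form an eigenvector.\<close>

lemma eigen_glue:
 assumes w: "w \<in> \<T> M x" and u: "\<And>a. a \<in> orbs \<Longrightarrow> u a \<in> \<T> X (x (r a))"
  and \<psi>u: "\<And>a. a \<in> orbs \<Longrightarrow> X.push (\<psi> a) (x (r a)) (u a) = c_scale X (x (r a)) (\<mu> ^ card a) (u a)"
  and wu: "\<And>i. i \<in> I \<Longrightarrow> P.pr i x w = c_scale X (x i) (inverse \<mu> ^ ahead i) (X.push (transport i) (x (r (orb i))) (u (orb i)))"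
 shows "W.push \<kappa> x w = c_scale M x \<mu> w" and "a \<in> orbs \<Longrightarrow> P.pr (r a) x w = u a"
proof -
 show rep: "P.pr (r a) x w = u a" if a: "a \<in> orbs" for a
  using wu[OF r_in_I[OF a]] X.push_one[OF N\<kappa>_rep[OF x a] u[OF a]] by (simp add: transport_r ahead_r orb_r a)
 have \<kappa>x: "\<rho>W \<kappa> x = x" using x W.fixed_locus_single[OF \<kappa>_in] by blast
 have T: "W.push \<kappa> x w \<in> \<T> M x" using W.push_in[OF \<kappa>_in N\<kappa>_points[OF x] w] \<kappa>x by simp
 show "W.push \<kappa> x w = c_scale M x \<mu> w"
 proof (rule P.pr_inj[OF N\<kappa>_points[OF x] T P.M.c_scale_in[OF N\<kappa>_points[OF x] w]])
  fix i assume i: "i \<in> I"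
  define a where "a = orb i"
  have a: "a \<in> orbs" unfolding a_def by (rule orb_in[OF i])
  have ia: "i \<in> a" "\<pi> i \<in> a" using \<pi>_in_orb[OF a] in_orb by (auto simp: a_def)
  note p = N\<kappa>_comp[OF x i] and q = N\<kappa>_comp[OF x \<pi>_in[OF i]]
  have "P.pr i x (W.push \<kappa> x w) = X.push (g (\<pi> i)) (x (\<pi> i)) (P.pr (\<pi> i) x w)" by (rule pr_push_\<kappa>[OF x w i])
  also have "P.pr (\<pi> i) x w = c_scale X (x (\<pi> i)) (inverse \<mu> ^ ahead (\<pi> i)) (X.push (transport (\<pi> i)) (x (r a)) (u a))"
   using wu[OF \<pi>_in[OF i]] by (simp add: orb_\<pi> a_def)
  also have "X.push (g (\<pi> i)) (x (\<pi> i)) \<dots> = c_scale X (x i) (inverse \<mu> ^ ahead (\<pi> i)) (X.push (transport (\<pi> i) \<otimes> g (\<pi> i)) (x (r a)) (u a))"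
   using X.push_c_scale[OF g_in[OF \<pi>_in[OF i]] q push_transport(1)[OF x a ia(2) u[OF a]]]
    push_transport(2)[OF x a ia(2) u[OF a]] N\<kappa>_step[OF x i] by simp
  also have "\<dots> = c_scale X (x i) \<mu> (P.pr i x w)"
  proof (cases "i = r a")
   \<comment> \<open>The cycle closes here, and this is where the eigenvector property of
     \<open>u a\<close> enters: its factor \<open>\<mu> ^ card a\<close> compensates the
     \<open>card a - 1\<close> inverse factors and leaves one \<open>\<mu>\<close>.\<close>
   case True
   have "\<mu> ^ card a = \<mu> ^ (card a - 1) * \<mu>" using orb_cycle(4)[of "r a"] orb_r[OF a] by (cases "card a") auto
   then have "inverse \<mu> ^ (card a - 1) * \<mu> ^ card a = \<mu>" using \<mu> by (simp add: field_simps)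
   then show ?thesis
    using transport_last[OF a] ahead_last[OF a] \<psi>u[OF a] rep[OF a] X.c_scale_c_scale[OF N\<kappa>_rep[OF x a] u[OF a]]
    by (simp add: True)
  next
   case False
   then have ne: "i \<noteq> r (orb i)" by (simp add: a_def)
   show ?thesis using transport_step[OF i ne] ahead_Suc[OF i ne] wu[OF i] \<mu>
     X.c_scale_c_scale[OF p push_transport(1)[OF x a ia(1) u[OF a]]] by (simp add: a_def mult.assoc[symmetric])
  qed
  also have "\<dots> = P.pr i x (c_scale M x \<mu> w)" using P.pr_c_scale[OF i N\<kappa>_points[OF x] w] by simp
  finally show "P.pr i x (W.push \<kappa> x w) = P.pr i x (c_scale M x \<mu> w)" .
 qed
qed

end

text \<open>An instance of \<open>decomposition\<close> with one component for each cycle; the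
  weight \<open>inverse \<mu> ^ ahead i\<close> is the one with which the component at the
  representative reappears at \<open>i\<close>.\<close>

lemma eig_wreath:
 assumes \<mu>: "\<mu> \<noteq> 0"
 shows "K_equiv (top_on M N\<kappa>) (virt_of (W.eig \<kappa> \<mu>))
  (\<Sum>a\<in>orbs. K_pull (top_on M N\<kappa>) (\<lambda>x. x (r a)) (virt_of (X.eig (\<psi> a) (\<mu> ^ card a))))"
 unfolding W.eig_def X.eig_def
proof (rule decomposition(2)[where \<iota> = r and e = "\<lambda>_. \<one>" and \<kappa> = orb and k = transport and z = "\<lambda>i. inverse \<mu> ^ ahead i"])
 let ?F = "W.eigenspace \<kappa> \<mu>"
 let ?E = "\<lambda>a. X.eigenspace (\<psi> a) (\<mu> ^ card a)"
 have one: "X.push \<one> (x (r a)) (P.pr (r a) x v) = P.pr (r a) x v" "P.pr (r a) x v \<in> \<T> X (x (r a))"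
  if "x \<in> N\<kappa>" "v \<in> \<T> M x" "a \<in> orbs" for x v a
  using X.push_one[OF N\<kappa>_rep[OF that(1,3)]] P.pr_in[OF r_in_I[OF that(3)] N\<kappa>_points[OF that(1)] that(2)] by auto
 show "N\<kappa> \<subseteq> points M" by (rule W.fixed_locus_subset)
 show "finite orbs" by (rule finite_orbs)
 show "c_subspace M x (?F x)" if "x \<in> N\<kappa>" for x
  by (rule W.c_subspace_eigen[OF \<kappa>_in]) (use that W.fixed_locus_single[OF \<kappa>_in] in auto)
 fix a assume a: "a \<in> orbs"
 show "X.Fix {\<psi> a} \<subseteq> points X" by (rule X.fixed_locus_subset)
 show "c_subspace X y (?E a y)" if "y \<in> X.Fix {\<psi> a}" for y
  by (rule X.c_subspace_eigen[OF \<psi>_in[OF a]]) (use that X.fixed_locus_single[OF \<psi>_in[OF a]] in auto)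
 show "vector_bundle (tangent_subbundle X (X.Fix {\<psi> a}) (?E a))"
  using X.vector_bundle_eig[OF \<psi>_in[OF a]] by (simp add: X.eig_def)
 show "r a \<in> I" by (rule r_in_I[OF a])
 show "\<one> \<in> carrier G" by simp
 show "x (r a) = \<rho> \<one> (x (r a))" if "x \<in> N\<kappa>" for x using X.act_one[OF N\<kappa>_rep[OF that a]] by simp
 show "x (r a) \<in> X.Fix {\<psi> a}" if "x \<in> N\<kappa>" for x by (rule N\<kappa>_r[OF that a])
 show "X.push \<one> (x (r a)) (P.pr (r a) x v) \<in> ?E a (x (r a))" if "x \<in> N\<kappa>" "v \<in> ?F x" for x v
  using one[OF that(1) _ a] eigen_rep[OF \<mu> that(1) _ _ a] that(2) by auto
next
 fix i assume i: "i \<in> I"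
 show "orb i \<in> orbs" by (rule orb_in[OF i])
 show "transport i \<in> carrier G" by (rule transport_in[OF i])
 fix x assume x: "x \<in> N\<kappa>"
 show "\<rho> (transport i) (x (r (orb i))) = x i" by (rule N\<kappa>_transport[OF x i])
 fix v assume v: "v \<in> W.eigenspace \<kappa> \<mu> x"
 have "X.push \<one> (x (r (orb i))) (P.pr (r (orb i)) x v) = P.pr (r (orb i)) x v"
  using X.push_one[OF N\<kappa>_rep[OF x orb_in[OF i]] P.pr_in[OF r_in_I[OF orb_in[OF i]] N\<kappa>_points[OF x]]] v by simp
 then show "P.pr i x v = c_scale X (x i) (inverse \<mu> ^ ahead i)
   (X.push (transport i) (x (r (orb i))) (X.push \<one> (x (r (orb i))) (P.pr (r (orb i)) x v)))"
  using eigen_transport[OF \<mu> x _ _ i] v by simp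
next
 fix x u w
 assume x: "x \<in> N\<kappa>" and u: "\<And>a. a \<in> orbs \<Longrightarrow> u a \<in> X.eigenspace (\<psi> a) (\<mu> ^ card a) (x (r a))"
  and w: "w \<in> \<T> M x"
  and wu: "\<And>i. i \<in> I \<Longrightarrow> P.pr i x w = c_scale X (x i) (inverse \<mu> ^ ahead i) (X.push (transport i) (x (r (orb i))) (u (orb i)))"
 have uT: "u a \<in> \<T> X (x (r a))" "X.push (\<psi> a) (x (r a)) (u a) = c_scale X (x (r a)) (\<mu> ^ card a) (u a)"
  if "a \<in> orbs" for a using u[OF that] by auto
 note glue = eigen_glue[OF \<mu> x w uT wu]
 show "w \<in> W.eigenspace \<kappa> \<mu> x \<and>
   (\<forall>a\<in>orbs. X.push \<one> (x (r a)) (P.pr (r a) x w) = u a)"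
  using w glue X.push_one[OF N\<kappa>_rep[OF x] uT(1)] by simp
qed

lemma S_virt_wreath:
 "K_equiv (top_on M N\<kappa>) (S_virt W M \<rho>W \<kappa>)
  (\<Sum>a\<in>orbs. K_pull (top_on M N\<kappa>) (\<lambda>x. x (r a))
    (S_virt G X \<rho> (\<psi> a) + q_scale ((of_nat (card a) - 1) / 2) (virt_of (TM_restricted X (X.Fix {\<psi> a})))))"
proof -
 \<comment> \<open>The factor \<open>card a\<close> accompanies the order of the cycle product
   because the eigenvalues over \<open>X\<close> are the \<open>card a\<close>-th powers of those
   over the power of \<open>X\<close>.\<close>
 define R where "R = W.ord \<kappa> * (\<Prod>a\<in>orbs. card a * X.ord (\<psi> a))"
 let ?Y = "top_on M N\<kappa>"
 let ?\<mu> = "\<lambda>k. exp (- (2 * of_real pi * \<i> * of_nat k / of_nat R))"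
 have card: "0 < card a" if "a \<in> orbs" for a using orb_cycle(4)[of "r a"] orb_r[OF that] by simp
 have ordW: "0 < W.ord \<kappa>" using W.ord_ge_1[OF W.finite_carrier \<kappa>_in] by simp
 have ordX: "0 < X.ord (\<psi> a)" if "a \<in> orbs" for a using X.ord_ge_1[OF X.finite_carrier \<psi>_in[OF that]] by simp
 have R0: "0 < R" unfolding R_def using card ordX ordW by (simp add: prod_pos)
 have dvd: "card a * X.ord (\<psi> a) dvd R" if "a \<in> orbs" for a
  unfolding R_def using dvd_prodI[OF finite_orbs(1) that, of "\<lambda>a. card a * X.ord (\<psi> a)"] by (rule dvd_mult)
 \<comment> \<open>A zero multiple of the tangent bundle brings \<open>S_virt\<close> into the form
   of \<open>weighted_eig_sum\<close> with \<open>n = 1\<close>, which replaces the order by the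
   common multiple \<open>R\<close>.\<close>
 have "K_equiv ?Y (S_virt W M \<rho>W \<kappa>) (S_virt W M \<rho>W \<kappa> + q_scale ((of_nat 1 - 1) / 2) (virt_of (TM_restricted M N\<kappa>)))"
  by (simp add: q_scale_simps)
 also have "K_equiv ?Y \<dots> (\<Sum>k<R. q_scale (of_nat k / of_nat R) (virt_of (W.eig \<kappa> (?\<mu> k ^ 1))))"
  by (rule K_equiv_sym[OF W.weighted_eig_sum[OF \<kappa>_in _ R0]]) (simp_all add: R_def)
 also have "K_equiv ?Y \<dots> (\<Sum>k<R. q_scale (of_nat k / of_nat R)
   (\<Sum>a\<in>orbs. K_pull ?Y (\<lambda>x. x (r a)) (virt_of (X.eig (\<psi> a) (?\<mu> k ^ card a)))))"
  unfolding power_one_right by (intro K_equiv_sum K_equiv_scale eig_wreath exp_not_eq_zero)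
 also have "\<dots> = (\<Sum>a\<in>orbs. K_pull ?Y (\<lambda>x. x (r a))
   (\<Sum>k<R. q_scale (of_nat k / of_nat R) (virt_of (X.eig (\<psi> a) (?\<mu> k ^ card a)))))"
  unfolding q_scale_sum K_pull_linear by (rule sum.swap)
 also have "K_equiv ?Y \<dots> (\<Sum>a\<in>orbs. K_pull ?Y (\<lambda>x. x (r a))
    (S_virt G X \<rho> (\<psi> a) + q_scale ((of_nat (card a) - 1) / 2) (virt_of (TM_restricted X (X.Fix {\<psi> a})))))"
  by (intro K_equiv_sum K_equiv_pull[OF continuous_rep] X.weighted_eig_sum \<psi>_in card R0 dvd)
 finally show ?thesis .
qed

end

section \<open>Decomposition of the fixed locus\<close>

text \<open>Tangent vectors of \<open>Z\<close> are velocities of curves in \<open>Z\<close>, and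
  along such curves \<open>F\<close> and \<open>H\<close> are the same map.\<close>

lemma tangent_map_eq_on:
 assumes F: "c1_map M N F" and H: "c1_map M N H"
  and v: "v \<in> tangent_subspace M Z p" and p: "p \<in> points M" "p \<in> Z" and eq: "\<And>z. z \<in> Z \<Longrightarrow> F z = H z"
 shows "tangent_map M N F p v = tangent_map M N H p v"
proof -
 interpret F: c1_map M N F by fact
 obtain \<gamma> where \<gamma>: "cmap euclidean (mtop M) \<gamma>" "range \<gamma> \<subseteq> Z" "\<gamma> 0 = p" "velocity M \<gamma> v"
  and vT: "v \<in> \<T> M p" using v unfolding tangent_subspace_iff by blast
 have vel: "velocity N (\<lambda>t. K (\<gamma> t)) (tangent_map M N K p v)" if "c1_map M N K" for K
  using c1_map.velocity_image[OF that \<gamma>(1)] vT \<gamma>(3,4) by blast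
 have "(\<lambda>t. F (\<gamma> t)) = (\<lambda>t. H (\<gamma> t))" using eq \<gamma>(2) by (auto simp: image_subset_iff)
 with vel[OF F] have vF: "velocity N (\<lambda>t. H (\<gamma> t)) (tangent_map M N F p v)" by simp
 show ?thesis using F.N.velocity_unique[OF vF vel[OF H]] F.tangent_in[OF p(1) vT] c1_map.tangent_in[OF H p(1) vT]
   F.maps_points[OF p(1)] \<gamma>(3) eq[OF p(2)] by simp
qed

lemma half_cycle_sum:
 assumes I: "finite I" and Q: "\<forall>\<pi>\<in>Q. \<pi> permutes I" and \<pi>: "\<pi> permutes I" "\<pi> \<in> generate (perm_group I) Q"
  and d: "d \<in> orbits_on I Q"
 shows "(\<Sum>a\<in>orbits_in I \<pi> d. (of_nat (card a) - 1) / 2) = ((of_nat (card d) - of_nat (card (orbits_in I \<pi> d))) / 2 :: rat)"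
 using sum_orbits_in[OF I Q \<pi> d, of "\<lambda>_. 1 :: rat"] by (simp add: sum_divide_distrib[symmetric] sum_subtractf)

text \<open>\<open>N\<close> has two descriptions here. As a set of translated diagonals it splits
  into factors \<open>Fix (A d)\<close>; as a fixed locus its tangent spaces are complex
  subspaces.\<close>

locale sector_decomposition = wreath_action G X \<rho> I + G: comm_group G
 for G :: "('g, 'm) monoid_scheme" (structure) and X :: "('x, 'e::euclidean_space) acm" and \<rho>
  and I :: "'i::finite set" +
 fixes Q :: "('i \<Rightarrow> 'i) set" and A :: "'i set \<Rightarrow> 'g set" and fbar :: "'i \<Rightarrow> 'g" and N :: "('i \<Rightarrow> 'x) set"
  and B :: "(('i \<Rightarrow> 'g) \<times> ('i \<Rightarrow> 'i)) set"
 assumes Q: "\<forall>\<pi>\<in>Q. \<pi> permutes I"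
  and A: "\<And>d. d \<in> orbits_on I Q \<Longrightarrow> A d \<subseteq> carrier G"
  and fbar: "\<And>i. i \<in> I \<Longrightarrow> fbar i \<in> carrier G"
  and N_iff: "\<And>x. x \<in> N \<longleftrightarrow> x \<in> points M \<and>
   (\<forall>d\<in>orbits_on I Q. \<exists>z\<in>X.Fix (A d). \<forall>i\<in>d. \<rho> (fbar i) (x i) = z)"
  and B: "B \<subseteq> carrier W" and N_fixed: "N = W.Fix B"
begin

abbreviation "D \<equiv> orbits_on I Q"
abbreviation "blk i \<equiv> orbit_on I Q i"
abbreviation "Z d \<equiv> X.Fix (A d)"
abbreviation "NY \<equiv> top_on M N"

definition rep :: "'i set \<Rightarrow> 'i" where "rep d = (SOME i. i \<in> d)"
text \<open>The projection of \<open>N\<close> to the factor \<open>Z d\<close>. By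
  \<open>q_eq\<close> every element of the block \<open>d\<close> gives the same value as the chosen
  one.\<close>

definition q :: "'i set \<Rightarrow> ('i \<Rightarrow> 'x) \<Rightarrow> 'x" where "q d x = \<rho> (fbar (rep d)) (x (rep d))"
abbreviation "pull d \<equiv> K_pull NY (q d)"

lemma rep: "d \<in> D \<Longrightarrow> rep d \<in> d" "d \<in> D \<Longrightarrow> rep d \<in> I"
proof -
 show r: "rep d \<in> d" if "d \<in> D" for d unfolding rep_def using orbits_on_nonempty[OF Q that] by (simp add: some_in_eq)
 show "rep d \<in> I" if "d \<in> D" using orbits_onD(1)[OF Q that r[OF that]] .
qed

lemma blk: "i \<in> I \<Longrightarrow> blk i \<in> D" "i \<in> blk i" using orbits_on_mem[OF Q] orbit_on_self[OF Q] by auto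

lemma N_points: "N \<subseteq> points M" using N_iff by blast

lemma N_comp: "\<lbrakk>x \<in> N; i \<in> I\<rbrakk> \<Longrightarrow> x i \<in> points X"
 using P.component_point N_points by blast

lemma q_eq:
 assumes "x \<in> N" "d \<in> D"
 shows "i \<in> d \<Longrightarrow> \<rho> (fbar i) (x i) = q d x" and "q d x \<in> Z d"
proof -
 have "\<exists>z\<in>Z d. \<forall>i\<in>d. \<rho> (fbar i) (x i) = z" using assms(1)[unfolded N_iff] assms(2) by simp
 then obtain z where "z \<in> Z d" "\<forall>i\<in>d. \<rho> (fbar i) (x i) = z" ..
 then show "i \<in> d \<Longrightarrow> \<rho> (fbar i) (x i) = q d x" "q d x \<in> Z d" using rep(1)[OF assms(2)] by (simp_all add: q_def)
qed

lemma q_back: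
 assumes x: "x \<in> N" and i: "i \<in> I"
 shows "\<rho> (inv fbar i) (q (blk i) x) = x i"
 unfolding q_eq(1)[OF x blk(1)[OF i] blk(2), symmetric] by (rule X.act_inv(1)[OF fbar[OF i] N_comp[OF x i]])

lemma continuous_NY:
 assumes "i \<in> I" "a \<in> carrier G" "\<And>x. x \<in> N \<Longrightarrow> \<rho> a (x i) \<in> S"
 shows "cmap NY (top_on X S) (\<lambda>x. \<rho> a (x i))"
 using continuous_component[OF assms(2,1)] assms(3) by (auto simp: into_sub from_sub)

lemma continuous_q: "d \<in> D \<Longrightarrow> cmap NY (top_on X (Z d)) (q d)"
 unfolding q_def using continuous_NY[OF rep(2) fbar[OF rep(2)]] q_eq(2) by (simp add: q_def)

lemma continuous_pr: "\<lbrakk>i \<in> I; \<And>x. x \<in> N \<Longrightarrow> x i \<in> S\<rbrakk> \<Longrightarrow> cmap NY (top_on X S) (\<lambda>x. x i)"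
 by (rule continuous_map_eq[OF continuous_NY[OF _ X.one_closed]])
  (use N_comp X.act_one in auto)

text \<open>Here the sum runs over single components and not over blocks: the full tangent space at
  a point of \<open>N\<close> has independent components, in contrast to that of
  \<open>N\<close>.\<close>

lemma TM_decomposition:
 "K_equiv NY (virt_of (TM_restricted M N)) (\<Sum>i\<in>I. K_pull NY (\<lambda>x. x i) (virt_of (TM_restricted X (points X))))"
 unfolding TM_restricted_def
proof (rule decomposition(2)[where \<iota> = "\<lambda>i. i" and e = "\<lambda>_. \<one>" and \<kappa> = "\<lambda>i. i" and k = "\<lambda>_. \<one>" and z = "\<lambda>_. 1"])
 have one: "X.push \<one> (x i) (P.pr i x v) = P.pr i x v" "P.pr i x v \<in> \<T> X (x i)"
  if "x \<in> N" "v \<in> \<T> M x" "i \<in> I" for x v i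
  using X.push_one[OF N_comp[OF that(1,3)]] P.pr_in[OF that(3) _ that(2)] N_points that(1) by auto
 show "c_subspace M x (\<T> M x)" if "x \<in> N" for x by (rule W.c_subspace_tangent) (use that N_points in blast)
 fix i assume i: "i \<in> I"
 show "vector_bundle (tangent_subbundle X (points X) (\<T> X))"
  by (rule X.vector_bundle_TM[unfolded TM_restricted_def, OF order_refl])
 show "X.push \<one> (x i) (P.pr i x v) \<in> \<T> X (x i)"
  "P.pr i x v = c_scale X (x i) 1 (X.push \<one> (x i) (X.push \<one> (x i) (P.pr i x v)))"
  if "x \<in> N" "v \<in> \<T> M x" for x v using one[OF that i] by simp_all
next
 fix x u w assume x: "x \<in> N" and u: "\<And>j. j \<in> I \<Longrightarrow> u j \<in> \<T> X (x j)" and w: "w \<in> \<T> M x"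
  and wu: "\<And>i. i \<in> I \<Longrightarrow> P.pr i x w = c_scale X (x i) 1 (X.push \<one> (x i) (u i))"
 show "w \<in> \<T> M x \<and> (\<forall>i\<in>I. X.push \<one> (x i) (P.pr i x w) = u i)"
  using w wu u X.push_one[OF N_comp[OF x]] by simp
qed (use N_points N_comp X.act_one X.c_subspace_tangent in auto)

lemma TN_decomposition:
 "K_equiv NY (virt_of (T_submanifold M N)) (\<Sum>d\<in>D. pull d (virt_of (T_submanifold X (Z d))))" unfolding T_submanifold_def
proof (rule decomposition(2)[where \<iota> = rep and e = "\<lambda>d. fbar (rep d)" and \<kappa> = blk and k = "\<lambda>i. inv fbar i" and z = "\<lambda>_. 1"])
 have TN: "v \<in> \<T> M x" if "v \<in> tangent_subspace M N x" for x v using that by (simp add: tangent_subspace_def)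
 show "N \<subseteq> points M" by (rule N_points)
 show "c_subspace M x (tangent_subspace M N x)" if "x \<in> N" for x using W.c_subspace_fixed[OF B] that unfolding N_fixed by blast
 show "finite D" by (simp add: orbits_on_def)
 fix d assume d: "d \<in> D"
 note r = rep[OF d]
 show "Z d \<subseteq> points X" by (rule X.fixed_locus_subset)
 show "c_subspace X y (tangent_subspace X (Z d) y)" if "y \<in> Z d" for y by (rule X.c_subspace_fixed[OF A[OF d] that])
 show "vector_bundle (tangent_subbundle X (Z d) (tangent_subspace X (Z d)))"
  using X.vector_bundle_T_submanifold[OF A[OF d]] by (simp add: T_submanifold_def)
 show "rep d \<in> I" "fbar (rep d) \<in> carrier G" using r fbar by auto
 fix x assume x: "x \<in> N"
 show "q d x = \<rho> (fbar (rep d)) (x (rep d))" by (simp add: q_def)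
 show "q d x \<in> Z d" by (rule q_eq(2)[OF x d])
 fix v assume v: "v \<in> tangent_subspace M N x"
 have "tangent_map M X (\<lambda>y. \<rho> (fbar (rep d)) (y (rep d))) x v \<in> tangent_subspace X (Z d) (\<rho> (fbar (rep d)) (x (rep d)))"
  by (rule c1_map.tangent_subspace_image[OF c1_component[OF fbar[OF r(2)] r(2)] v])
   (use q_eq(2)[OF _ d] x N_points in \<open>auto simp: q_def\<close>)
 then show "X.push (fbar (rep d)) (x (rep d)) (P.pr (rep d) x v) \<in> tangent_subspace X (Z d) (q d x)"
  using tangent_map_component[OF fbar[OF r(2)] r(2) subsetD[OF N_points x] TN[OF v]] by (simp add: q_def)
next
 fix i assume i: "i \<in> I"
 show "blk i \<in> D" "inv fbar i \<in> carrier G" using blk(1)[OF i] fbar[OF i] by auto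
 note r = rep[OF blk(1)[OF i]]
 fix x assume x: "x \<in> N"
 show "\<rho> (inv fbar i) (q (blk i) x) = x i" by (rule q_back[OF x i])
 have xM: "x \<in> points M" using x N_points by blast
 fix v assume v: "v \<in> tangent_subspace M N x"
 have vT: "v \<in> \<T> M x" using v by (simp add: tangent_subspace_def)
 note tm = tangent_map_component[OF fbar _ xM vT]
 \<comment> \<open>On \<open>N\<close> the translated components of one block are the same map, so
   their tangent maps agree on vectors tangent to \<open>N\<close>; this recovers all components
   from one.\<close>
 have eq: "X.push (fbar (rep (blk i))) (x (rep (blk i))) (P.pr (rep (blk i)) x v) = X.push (fbar i) (x i) (P.pr i x v)"
  unfolding tm[OF i i, symmetric] tm[OF r(2) r(2), symmetric]
  by (rule tangent_map_eq_on[OF c1_component[OF fbar[OF r(2)] r(2)] c1_component[OF fbar[OF i] i] v xM x])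
   (use q_eq(1)[OF _ blk(1)[OF i]] blk(2) r(1) in simp)
 have "q (blk i) x = \<rho> (fbar i) (x i)" using q_eq(1)[OF x blk(1)[OF i] blk(2)] by simp
 then show "P.pr i x v = c_scale X (x i) 1 (X.push (inv fbar i) (q (blk i) x)
   (X.push (fbar (rep (blk i))) (x (rep (blk i))) (P.pr (rep (blk i)) x v)))"
  unfolding eq using X.push_inv(1)[OF fbar[OF i] N_comp[OF x i] P.pr_in[OF i xM vT]] by simp
next
 fix x u w
 assume x: "x \<in> N" and u: "\<And>d. d \<in> D \<Longrightarrow> u d \<in> tangent_subspace X (Z d) (q d x)" and w: "w \<in> \<T> M x"
  and wu: "\<And>i. i \<in> I \<Longrightarrow> P.pr i x w = c_scale X (x i) 1 (X.push (inv fbar i) (q (blk i) x) (u (blk i)))"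
 have xM: "x \<in> points M" using x N_points by blast
 have "\<forall>d\<in>D. \<exists>\<gamma>. cmap euclidean (mtop X) \<gamma> \<and> range \<gamma> \<subseteq> Z d \<and> \<gamma> 0 = q d x \<and> velocity X \<gamma> (u d)"
  using u unfolding tangent_subspace_iff by blast
 from bchoice[OF this] obtain \<gamma> where "\<forall>d\<in>D. cmap euclidean (mtop X) (\<gamma> d) \<and> range (\<gamma> d) \<subseteq> Z d \<and> \<gamma> d 0 = q d x \<and> velocity X (\<gamma> d) (u d)" ..
 then have \<gamma>: "cmap euclidean (mtop X) (\<gamma> d)" "\<gamma> d t \<in> Z d" "\<gamma> d 0 = q d x" "velocity X (\<gamma> d) (u d)"
  if "d \<in> D" for d t using that by auto
 have uT: "u d \<in> \<T> X (q d x)" if "d \<in> D" for d using u[OF that] by (simp add: tangent_subspace_def)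
 have ZX: "z \<in> points X" if "z \<in> Z d" for z d using that X.fixed_locus_subset by blast
 \<comment> \<open>Curves in the factors, spread over the blocks by the inverse translations, form a
   curve in \<open>N\<close> through \<open>x\<close>; its velocity will be
   \<open>w\<close>.\<close>
 define \<Gamma> where "\<Gamma> = (\<lambda>t. \<lambda>i\<in>I. \<rho> (inv fbar i) (\<gamma> (blk i) t))"
 have ci: "cmap euclidean (mtop X) (\<lambda>t. \<rho> (inv fbar i) (\<gamma> (blk i) t))" if "i \<in> I" for i
  using continuous_map_compose[OF \<gamma>(1)[OF blk(1)[OF that]] X.continuous_act[OF X.inv_closed[OF fbar[OF that]]]]
  by (simp add: o_def)
 have c\<Gamma>: "cmap euclidean (mtop M) \<Gamma>"
  unfolding P.acm_power_fields continuous_map_componentwise using ci by (auto simp: \<Gamma>_def cong: restrict_cong)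
 have \<Gamma>N: "\<Gamma> t \<in> N" for t unfolding N_iff
 proof (intro conjI ballI)
  show "\<Gamma> t \<in> points M" using continuous_map_mem[OF c\<Gamma>, of t] by simp
  fix d assume d: "d \<in> D"
  have "\<rho> (fbar i) (\<Gamma> t i) = \<gamma> d t" if i: "i \<in> d" for i
  proof -
   have "i \<in> I" "blk i = d" using orbits_onD[OF Q d i] by auto
   then show ?thesis using X.act_inv(2)[OF fbar ZX[OF \<gamma>(2)[OF d]]] by (simp add: \<Gamma>_def)
  qed
  then show "\<exists>z\<in>Z d. \<forall>i\<in>d. \<rho> (fbar i) (\<Gamma> t i) = z" using \<gamma>(2)[OF d] by blast
 qed
 have \<Gamma>0: "\<Gamma> 0 = x" using P.points_M xM \<gamma>(3)[OF blk(1)] q_back[OF x]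
  by (intro extensionalityI[of _ I]) (auto simp: \<Gamma>_def PiE_iff)
 have "velocity M \<Gamma> w"
 proof (rule P.velocity_power[OF c\<Gamma>])
  show "w \<in> \<T> M (\<Gamma> 0)" using w \<Gamma>0 by simp
  fix i assume i: "i \<in> I"
  note b = blk(1)[OF i]
  have "velocity X (\<lambda>t. \<rho> (inv fbar i) (\<gamma> (blk i) t)) (X.push (inv fbar i) (\<gamma> (blk i) 0) (u (blk i)))"
   by (rule c1_map.velocity_image[OF X.act_c1[OF X.inv_closed[OF fbar[OF i]]] \<gamma>(1)[OF b]])
    (use uT[OF b] \<gamma>(3,4)[OF b] in auto)
  then show "velocity X (\<lambda>t. \<Gamma> t i) (P.pr i (\<Gamma> 0) w)"
   using wu[OF i] \<gamma>(3)[OF b] i by (simp add: \<Gamma>0) (simp add: \<Gamma>_def)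
 qed
 then have wN: "w \<in> tangent_subspace M N x" unfolding tangent_subspace_iff using w c\<Gamma> \<Gamma>N \<Gamma>0 by blast
 have "X.push (fbar (rep d)) (x (rep d)) (P.pr (rep d) x w) = u d" if d: "d \<in> D" for d
 proof -
  have b: "blk (rep d) = d" by (rule orbits_onD(2)[OF Q d rep(1)[OF d]])
  show ?thesis using wu[OF rep(2)[OF d]] X.push_inv(3)[OF fbar[OF rep(2)[OF d]] N_comp[OF x rep(2)[OF d]]] uT[OF d]
   by (simp add: b q_def)
 qed
 with wN show "w \<in> tangent_subspace M N x \<and> (\<forall>d\<in>D. X.push (fbar (rep d)) (x (rep d)) (P.pr (rep d) x w) = u d)" by blast
qed

end

section \<open>Comparing classes taken at different components\<close>

context sector_decomposition
begin

text \<open>A single reference class on all of \<open>X\<close>; the tangent bundles over the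
  various fixed loci are compared with it after pull-back to \<open>N\<close>.\<close>

definition TX :: "'x virt" where "TX = virt_of (TM_restricted X (points X))"

lemma bundle_virt_TM: "S \<subseteq> points X \<Longrightarrow> bundle_virt (top_on X S) (virt_of (TM_restricted X S))"
 by (intro bundle_virt_virt_of X.vector_bundle_TM) (simp_all add: TM_restricted_def)

text \<open>The tangent bundle is equivariant, so its pull-back along a map does not change when the
  map is followed by a group element.\<close>

lemma TX_natural:
 assumes a: "a \<in> carrier G" and S: "S \<subseteq> points X" and h: "cmap NY (top_on X S) h"
  and k: "\<And>x. x \<in> N \<Longrightarrow> \<rho> a (h x) = k x"
 shows "K_equiv NY (K_pull NY h (virt_of (TM_restricted X S))) (K_pull NY k TX)"
proof -
 let ?S = "top_on X S" and ?X = "top_on X (points X)"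
 have \<rho>: "cmap ?S ?X (\<rho> a)" using X.continuous_act[OF a] by (simp add: from_sub)
 have "K_equiv ?S (virt_of (TM_restricted X S)) (K_pull ?S (\<rho> a) TX)" unfolding TX_def TM_restricted_def
 proof (rule X.virt_of_natural[OF a S subset_refl])
  show "\<rho> a p \<in> points X" if "p \<in> S" for p using X.act_in[OF a] S that by blast
  show "v \<in> \<T> X p \<longleftrightarrow> X.push a p v \<in> \<T> X (\<rho> a p)" if "p \<in> S" "v \<in> \<T> X p" for p v
   using X.push_in[OF a _ that(2)] S that by blast
  show "vector_bundle (tangent_subbundle X (points X) (\<T> X))"
   by (rule X.vector_bundle_TM[unfolded TM_restricted_def, OF order_refl])
 qed (use S X.c_subspace_tangent in auto)
 from K_equiv_pull[OF h this]
 have "K_equiv NY (K_pull NY h (virt_of (TM_restricted X S))) (K_pull NY h (K_pull ?S (\<rho> a) TX))" .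
 also have "K_equiv NY \<dots> (K_pull NY k TX)" unfolding TX_def by (rule K_pull_via[OF bundle_virt_TM \<rho> h k]) simp_all
 finally show ?thesis .
qed

lemma TX_q: "d \<in> D \<Longrightarrow> K_equiv NY (pull d (virt_of (TM_restricted X (Z d)))) (pull d TX)"
 by (rule TX_natural[OF X.one_closed X.fixed_locus_subset continuous_q])
  (use q_eq(2) X.act_one X.fixed_locus_subset in blast)+

lemma TX_component:
 assumes d: "d \<in> D" and i: "i \<in> d" and S: "S \<subseteq> points X" "\<And>x. x \<in> N \<Longrightarrow> x i \<in> S"
 shows "K_equiv NY (K_pull NY (\<lambda>x. x i) (virt_of (TM_restricted X S))) (pull d TX)"
proof -
 have iI: "i \<in> I" by (rule orbits_onD(1)[OF Q d i])
 have "cmap NY (top_on X S) (\<lambda>x. x i)" by (rule continuous_pr[OF iI]) (rule S(2))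
 then show ?thesis by (rule TX_natural[OF fbar[OF iI] S(1)]) (rule q_eq(1)[OF _ d i])
qed

text \<open>Translation by \<open>fbar i\<close> relates the class of \<open>c\<close> to that of a
  conjugate of \<open>c\<close>, which is \<open>c\<close> again by commutativity.\<close>

lemma S_component:
 assumes d: "d \<in> D" and i: "i \<in> d" and c: "c \<in> carrier G"
  and xi: "\<And>x. x \<in> N \<Longrightarrow> x i \<in> X.Fix {c}"
 shows "K_equiv NY (K_pull NY (\<lambda>x. x i) (S_virt G X \<rho> c)) (pull d (S_virt G X \<rho> c))"
proof -
 let ?S = "top_on X (X.Fix {c})"
 have iI: "i \<in> I" by (rule orbits_onD(1)[OF Q d i])
 note f = fbar[OF iI]
 have c': "c = fbar i \<otimes> c \<otimes> inv fbar i" using f c by (simp add: G.m_comm[of "fbar i" c] X.m_assoc)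
 have h: "cmap NY ?S (\<lambda>x. x i)" by (rule continuous_pr[OF iI]) (rule xi)
 have \<rho>: "cmap ?S ?S (\<rho> (fbar i))" using from_sub[OF X.continuous_act[OF f]] X.conj_fixed[OF f c c'] X.act_in[OF f]
  by (auto simp: into_sub X.fixed_locus_single[OF c])
 have "K_equiv NY (K_pull NY (\<lambda>x. x i) (S_virt G X \<rho> c)) (K_pull NY (\<lambda>x. x i) (K_pull ?S (\<rho> (fbar i)) (S_virt G X \<rho> c)))"
  by (rule K_equiv_pull[OF h X.S_virt_conj[OF f c c']])
 also have "K_equiv NY \<dots> (pull d (S_virt G X \<rho> c))"
  by (rule K_pull_via[OF X.bundle_virt_S[OF c] \<rho> h]) (use q_eq(1)[OF _ d i] in auto)
 finally show ?thesis .
qed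

definition S_loc :: "'i set \<Rightarrow> 'i set set \<Rightarrow> ('i set \<Rightarrow> 'g) \<Rightarrow> 'x virt" where
 "S_loc d J \<xi> = K_restrict (mtop X) (Z d) (S_tuple_virt G X \<rho> J \<xi>)"

lemma S_loc:
 assumes d: "d \<in> D" and J: "\<And>j. j \<in> J \<Longrightarrow> \<xi> j \<in> carrier G" and Zd: "\<And>j. j \<in> J \<Longrightarrow> Z d \<subseteq> X.Fix {\<xi> j}"
 shows "bundle_virt (top_on X (Z d)) (S_loc d J \<xi>)"
  and "K_equiv NY (pull d (S_loc d J \<xi>)) (\<Sum>j\<in>J. pull d (S_virt G X \<rho> (\<xi> j)))"
proof -
 let ?F = "X.Fix (\<xi> ` J)" let ?S = "\<lambda>j. S_virt G X \<rho> (\<xi> j)"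
 have F: "?F = {p \<in> points X. \<forall>j\<in>J. \<rho> (\<xi> j) p = p}" by (subst X.fixed_locus_eq) (use J in auto)
 have id: "cmap (top_on X S) (top_on X S') id" if "S \<subseteq> S'" for S S' using that by (auto simp: into_sub)
 have cj: "cmap (top_on X ?F) (top_on X (X.Fix {\<xi> j})) id" if "j \<in> J" for j
  by (rule id) (use that in \<open>auto simp: F X.fixed_locus_single[OF J[OF that]]\<close>)
 have "Z d \<subseteq> {p \<in> points X. \<rho> (\<xi> j) p = p}" if "j \<in> J" for j
  using Zd[OF that] unfolding X.fixed_locus_single[OF J[OF that]] .
 then have cz: "cmap (top_on X (Z d)) (top_on X ?F) id"
  by (intro id) (use X.fixed_locus_subset[of "A d"] in \<open>auto simp: F\<close>)
 note bv = X.bundle_virt_S[OF J]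
 show "bundle_virt (top_on X (Z d)) (S_loc d J \<xi>)"
  unfolding S_loc_def S_tuple_virt_def by (intro bundle_virt_pull[OF _ cz] bundle_virt_sum bundle_virt_pull[OF bv cj])
 have "K_equiv NY (pull d (K_restrict (mtop X) (Z d) (K_restrict (mtop X) ?F (?S j)))) (pull d (?S j))" if j: "j \<in> J" for j
 proof -
  have "K_equiv NY (pull d (K_restrict (mtop X) (Z d) (K_restrict (mtop X) ?F (?S j))))
    (K_pull NY (\<lambda>x. id (q d x)) (K_restrict (mtop X) ?F (?S j)))"
   by (rule K_pull_compose[OF bundle_virt_pull[OF bv[OF j] cj[OF j]] cz continuous_q[OF d]])
  also have "K_equiv NY \<dots> (K_pull NY (\<lambda>x. id (id (q d x))) (?S j))" by (rule K_pull_compose[OF bv[OF j] cj[OF j]])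
    (use continuous_map_compose[OF continuous_q[OF d] cz] in \<open>simp add: o_def\<close>)
  finally show ?thesis by simp
 qed
 then show "K_equiv NY (pull d (S_loc d J \<xi>)) (\<Sum>j\<in>J. pull d (?S j))"
  unfolding S_loc_def S_tuple_virt_def K_pull_linear by (rule K_equiv_sum)
qed

text \<open>Regroups \<open>S_virt_wreath\<close> by blocks after moving each class from the
  representative of its cycle to \<open>q d\<close>. The tuple \<open>\<xi>\<close> is kept
  abstract, as the cycle products will be those of \<gg> and \<hh> and the inverses of those of
  \<ww>.\<close>

lemma S_sector:
 assumes E: "wreath_element G I \<pi> r g" and N\<kappa>: "N \<subseteq> W.Fix {(g, \<pi>)}"
  and \<pi>Q: "\<pi> \<in> generate (perm_group I) Q" and \<xi>: "\<And>a. a \<in> orbits_on I {\<pi>} \<Longrightarrow> finprod G g a = \<xi> a"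
  and Zd: "\<And>d a. \<lbrakk>d \<in> D; a \<in> orbits_in I \<pi> d\<rbrakk> \<Longrightarrow> Z d \<subseteq> X.Fix {\<xi> a}"
 shows "K_equiv NY (K_restrict (mtop M) N (S_virt W M \<rho>W (g, \<pi>)))
  (\<Sum>d\<in>D. pull d (S_loc d (orbits_in I \<pi> d) \<xi>)
    + q_scale ((of_nat (card d) - of_nat (card (orbits_in I \<pi> d))) / 2) (pull d TX))"
proof -
 interpret E: wreath_action_element G X \<rho> I \<pi> r g by (intro wreath_action_element.intro wreath_action_axioms E)
 let ?F = "\<lambda>a. X.Fix {\<xi> a}"
 let ?y = "\<lambda>a. S_virt G X \<rho> (\<xi> a) + q_scale ((of_nat (card a) - 1) / 2) (virt_of (TM_restricted X (?F a)))"
 let ?z = "\<lambda>d a. pull d (S_virt G X \<rho> (\<xi> a)) + q_scale ((of_nat (card a) - 1) / 2) (pull d TX)"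
 have \<xi>_in: "\<xi> a \<in> carrier G" if "a \<in> orbits_on I {\<pi>}" for a using E.\<psi>_in[OF that] \<xi>[OF that] by simp
 have xr: "x (r a) \<in> ?F a" if "x \<in> N" "a \<in> orbits_on I {\<pi>}" for x a using E.N\<kappa>_r[of x a] N\<kappa> \<xi> that by auto
 have id: "cmap NY (top_on M E.N\<kappa>) id" using N\<kappa> by (auto simp: into_sub)
 have cr: "cmap (top_on M E.N\<kappa>) (top_on X (?F a)) (\<lambda>x. x (r a))" if a: "a \<in> orbits_on I {\<pi>}" for a
  using E.continuous_rep[OF a] \<xi>[OF a] by simp
 have each: "K_equiv NY (K_pull NY id (K_pull (top_on M E.N\<kappa>) (\<lambda>x. x (r a)) (?y a))) (?z d a)"
  if d: "d \<in> D" and ad: "a \<in> orbits_in I \<pi> d" for d a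
 proof -
  have a: "a \<in> orbits_on I {\<pi>}" and ra: "r a \<in> d" using ad E.r_in by (auto simp: orbits_in_def)
  have bv: "bundle_virt (top_on X (?F a)) (?y a)"
   by (intro bundle_virt_add bundle_virt_scale bundle_virt_TM X.bundle_virt_S \<xi>_in a X.fixed_locus_subset)
  have "K_equiv NY (K_pull NY id (K_pull (top_on M E.N\<kappa>) (\<lambda>x. x (r a)) (?y a)))
    (K_pull NY (\<lambda>x. id x (r a)) (?y a))" by (rule K_pull_compose[OF bv cr[OF a] id])
  also have "K_equiv NY \<dots> (?z d a)" unfolding K_pull_linear id_apply
   by (intro K_equiv_add K_equiv_scale S_component[OF d ra \<xi>_in[OF a]] TX_component[OF d ra X.fixed_locus_subset])
    (use xr a in auto)
  finally show ?thesis .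
 qed
 have "K_equiv NY (K_restrict (mtop M) N (S_virt W M \<rho>W (g, \<pi>)))
   (K_pull NY id (\<Sum>a\<in>E.orbs. K_pull (top_on M E.N\<kappa>) (\<lambda>x. x (r a)) (?y a)))"
  using K_equiv_pull[OF id E.S_virt_wreath] \<xi> by (simp cong: sum.cong)
 also have "K_pull NY id (\<Sum>a\<in>E.orbs. K_pull (top_on M E.N\<kappa>) (\<lambda>x. x (r a)) (?y a)) =
   (\<Sum>d\<in>D. \<Sum>a\<in>orbits_in I \<pi> d. K_pull NY id (K_pull (top_on M E.N\<kappa>) (\<lambda>x. x (r a)) (?y a)))"
  unfolding K_pull_sum by (rule sum_orbits_on_blocks[OF E.finite_I Q E.\<pi> \<pi>Q])
 also have "K_equiv NY \<dots> (\<Sum>d\<in>D. \<Sum>a\<in>orbits_in I \<pi> d. ?z d a)" by (intro K_equiv_sum each)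
 also have "\<dots> = (\<Sum>d\<in>D. (\<Sum>a\<in>orbits_in I \<pi> d. pull d (S_virt G X \<rho> (\<xi> a)))
    + q_scale ((of_nat (card d) - of_nat (card (orbits_in I \<pi> d))) / 2) (pull d TX))" by (rule sum.cong[OF refl])
   (simp add: sum.distrib half_cycle_sum[OF E.finite_I Q E.\<pi> \<pi>Q, symmetric] q_scale_sum_left)
 also have "K_equiv NY \<dots> (\<Sum>d\<in>D. pull d (S_loc d (orbits_in I \<pi> d) \<xi>)
    + q_scale ((of_nat (card d) - of_nat (card (orbits_in I \<pi> d))) / 2) (pull d TX))"
  by (intro K_equiv_sum K_equiv_add K_equiv_refl K_equiv_sym[OF S_loc(2)] Zd) (auto simp: orbits_in_def \<xi>_in)
 finally show ?thesis .
qed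

end

section \<open>The obstruction class\<close>

lemma (in comm_group) finprod_inv:
 assumes "f \<in> A \<rightarrow> carrier G"
 shows "finprod G (\<lambda>i. inv f i) A = inv (finprod G f A)"
proof -
 have "finprod G (\<lambda>i. inv f i) A \<otimes> finprod G f A = finprod G (\<lambda>i. inv f i \<otimes> f i) A"
  by (rule finprod_multf[symmetric]) (use assms in auto)
 also have "\<dots> = \<one>" using assms by (intro finprod_one_eqI) (auto simp: Pi_iff)
 finally show ?thesis by (rule inv_equality[symmetric]) (use assms in \<open>auto intro!: finprod_closed\<close>)
qed

text \<open>Supplies the translate by \<open>f\<close> that stands on the left of the assumed
  decomposition of the fixed locus.\<close>

lemma (in c1_action) fixed_locus_conj:
 assumes e: "e \<in> carrier \<Gamma>" and f: "f \<in> carrier \<Gamma>"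
 shows "Fix {inv f \<otimes> e \<otimes> f} = \<rho> f ` Fix {e}"
proof -
 let ?e = "inv f \<otimes> e \<otimes> f"
 have fi: "inv f \<in> carrier \<Gamma>" and e': "?e \<in> carrier \<Gamma>" using e f by auto
 have "?e = inv f \<otimes> e \<otimes> inv (inv f)" using f by simp
 note fixd = conj_fixed[OF fi e this]
 show ?thesis unfolding fixed_locus_single[OF e] fixed_locus_single[OF e']
 proof (intro equalityI subsetI)
  fix p assume "p \<in> {p \<in> points M. \<rho> ?e p = p}"
  then have p: "p \<in> points M" "\<rho> ?e p = p" by auto
  then have "\<rho> (inv f) p \<in> {p \<in> points M. \<rho> e p = p}" using fixd[OF p(1)] act_in[OF fi p(1)] by simp
  moreover have "\<rho> f (\<rho> (inv f) p) = p" by (rule act_inv(2)[OF f p(1)])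
  ultimately show "p \<in> \<rho> f ` {p \<in> points M. \<rho> e p = p}" by force
 next
  fix p assume "p \<in> \<rho> f ` {p \<in> points M. \<rho> e p = p}"
  then obtain y where y: "y \<in> points M" "\<rho> e y = y" "p = \<rho> f y" by auto
  show "p \<in> {p \<in> points M. \<rho> ?e p = p}"
   using fixd[OF act_in[OF f y(1)]] act_inv(1)[OF f y(1)] act_in[OF f y(1)] y by simp
 qed
qed

lemma conj_by_eq:
 assumes "group G" and f: "f \<in> I \<rightarrow>\<^sub>E carrier G" and h: "h \<in> I \<rightarrow>\<^sub>E carrier G" and \<tau>: "\<tau> permutes I"
 shows "conj_by G I f (h, \<tau>) = (\<lambda>i\<in>I. inv\<^bsub>G\<^esub> f i \<otimes>\<^bsub>G\<^esub> h i \<otimes>\<^bsub>G\<^esub> f (inv_into UNIV \<tau> i), \<tau>)"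
 unfolding conj_by_def wreath_inv[OF assms(1) f permutes_id] wreath_simps by (auto simp: inv_id fun_eq_iff)

lemma twisted_diag_iff:
 "x \<in> twisted_diag X \<rho> f d S \<longleftrightarrow> x \<in> d \<rightarrow>\<^sub>E points X \<and> (\<exists>z\<in>S. \<forall>i\<in>d. \<rho> (f i) (x i) = z)"
proof -
 have "(\<lambda>i\<in>d. \<rho> (restrict f d i) (x i)) = (\<lambda>i\<in>d. z) \<longleftrightarrow> (\<forall>i\<in>d. \<rho> (f i) (x i) = z)" for z
  by (auto simp: fun_eq_iff restrict_def)
 then show ?thesis by (auto simp: twisted_diag_def diag_def diag_map_def image_iff)
qed

lemma block_product_diag_iff:
 assumes \<pi>: "\<forall>\<pi>\<in>Q. \<pi> permutes I" and x: "x \<in> block_product I (orbits_on I Q) (\<lambda>a. diag a (S a))"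
  and a: "a \<in> orbits_on I Q"
 shows "\<exists>z\<in>S a. \<forall>i\<in>a. x i = z"
proof -
 have "restrict x a \<in> diag a (S a)" using x a by (simp add: block_product_def)
 then obtain z where "z \<in> S a" "restrict x a = (\<lambda>i\<in>a. z)" by (auto simp: diag_def diag_map_def)
 then have "\<forall>i\<in>a. x i = z" by (metis restrict_apply')
 with \<open>z \<in> S a\<close> show ?thesis by blast
qed

lemma block_product_diagI:
 assumes "x \<in> extensional I" "\<And>a. a \<in> D \<Longrightarrow> \<exists>z\<in>S a. \<forall>i\<in>a. x i = z"
 shows "x \<in> block_product I D (\<lambda>a. diag a (S a))"
 using assms by (force simp: block_product_def diag_def diag_map_def restrict_def fun_eq_iff)

context wreath_action_element
begin

text \<open>This is \<open>nu_step\<close> at the preimage of each index. In the second formula it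
  is applied to g\<sigma> and to h\<tau>.\<close>

lemma nu_conj:
 "(g, \<pi>) = (nu G I \<pi> r g, id) \<otimes>\<^bsub>W\<^esub> (eps_tuple G I \<pi> r (cycle_product G I \<pi> r g), \<pi>) \<otimes>\<^bsub>W\<^esub> inv\<^bsub>W\<^esub> (nu G I \<pi> r g, id)"
proof -
 let ?n = "nu G I \<pi> r g" and ?e = "eps_tuple G I \<pi> r (cycle_product G I \<pi> r g)"
 have cp: "cycle_product G I \<pi> r g \<in> orbs \<rightarrow>\<^sub>E carrier G"
  using \<psi>_in cycle_product_eq by (auto simp: cycle_product_def)
 have e: "?e \<in> I \<rightarrow>\<^sub>E carrier G" by (rule eps_tuple_in[OF G.comm_group_axioms cp])
 have "g i = ?n i \<otimes> ?e i \<otimes> inv ?n (inv_into UNIV \<pi> i)" if i: "i \<in> I" for i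
 proof -
  let ?j = "inv_into UNIV \<pi> i"
  have j: "?j \<in> I" "\<pi> ?j = i" using permutes_inv_in[OF \<pi> i] permutes_inverses(1)[OF \<pi>] by auto
  have n: "?n i \<in> carrier G" "?n ?j \<in> carrier G" "?e i \<in> carrier G" "g i \<in> carrier G" using nu_in e i j g_in by auto
  have "?n i \<otimes> ?e i = g i \<otimes> ?n ?j" using nu_step[OF j(1)] j(2) by simp
  then show ?thesis using n by (simp add: X.m_assoc)
 qed
 then have eq: "g = (\<lambda>i\<in>I. ?n i \<otimes> ?e i \<otimes> inv ?n (inv_into UNIV \<pi> i))"
  using g by (intro extensionalityI[of g I]) (auto simp: PiE_iff)
 show ?thesis unfolding wreath_inv[OF X.is_group nu_in permutes_id] wreath_simps
  by (subst eq) (use permutes_inv_in[OF \<pi>] in \<open>auto simp: inv_id fun_eq_iff\<close>)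
qed

end

context wreath_action
begin

lemma wreath_elementI:
 assumes "comm_group G" "\<pi> permutes I" "representatives I \<pi> r" "g \<in> I \<rightarrow>\<^sub>E carrier G"
 shows "wreath_element G I \<pi> r g" using assms by (intro wreath_element.intro orbit_representatives.intro cyclic_orbits.intro
   orbit_representatives_axioms.intro wreath_element_axioms.intro) auto

lemma wreath_actionI: "wreath_element G I \<pi> r g \<Longrightarrow> wreath_action_element G X \<rho> I \<pi> r g"
 by (intro wreath_action_element.intro wreath_action_axioms)

text \<open>Each factor of \<open>eps_tuple\<close> on a cycle is 1 or \<gg> at that cycle, and the
  latter fixes the component at the representative. So no step along the cycle changes the
  component.\<close>

lemma fixed_locus_eps:
 assumes G: "comm_group G" and \<pi>: "\<pi> permutes I" and r: "representatives I \<pi> r"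
  and \<gg>: "\<gg> \<in> orbits_on I {\<pi>} \<rightarrow>\<^sub>E carrier G"
 shows "W.Fix {(eps_tuple G I \<pi> r \<gg>, \<pi>)} =
  block_product I (orbits_on I {\<pi>}) (\<lambda>a. diag a (X.Fix {\<gg> a}))"
proof -
 interpret R: orbit_representatives I \<pi> r
  using \<pi> r by (intro orbit_representatives.intro cyclic_orbits.intro orbit_representatives_axioms.intro) auto
 let ?e = "eps_tuple G I \<pi> r \<gg>"
 have e: "?e \<in> I \<rightarrow>\<^sub>E carrier G" by (rule R.eps_tuple_in[OF G \<gg>])
 interpret E: wreath_action_element G X \<rho> I \<pi> r ?e by (rule wreath_actionI[OF wreath_elementI[OF G \<pi> r e]])
 have \<psi>: "finprod G ?e a = \<gg> a" if "a \<in> R.orbs" for a by (rule R.finprod_eps_tuple[OF G \<gg> that])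
 have e_cases: "?e i = \<one> \<or> ?e i = \<gg> (R.orb i)" if "i \<in> I" for i using that by (simp add: eps_tuple_def)
 have fixz: "\<rho> (?e i) z = z" if "i \<in> I" "z \<in> X.Fix {\<gg> (R.orb i)}" for i z
 proof -
  have c: "\<gg> (R.orb i) \<in> carrier G" using \<gg> R.orb_in[OF that(1)] by (auto simp: PiE_iff)
  have "z \<in> points X" "\<rho> (\<gg> (R.orb i)) z = z" using that(2) unfolding X.fixed_locus_single[OF c] by auto
  then show ?thesis using e_cases[OF that(1)] X.act_one by auto
 qed
 show ?thesis
 proof (intro equalityI subsetI)
  fix x assume x: "x \<in> E.N\<kappa>"
  have const: "x i = x (r (R.orb i))" if "i \<in> I" for i using that
  proof (induction rule: E.ahead_induct)
   case (rep a)
   then show ?case by (simp add: R.orb_r)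
  next
   case (step i)
   note \<pi>i = E.\<pi>_in[OF step(1)]
   have "x (r (R.orb i)) \<in> X.Fix {\<gg> (R.orb (\<pi> i))}"
    using E.N\<kappa>_r[OF x R.orb_in[OF step(1)]] \<psi>[OF R.orb_in[OF step(1)]] by (simp add: E.orb_\<pi>)
   from fixz[OF \<pi>i this] show ?case using E.N\<kappa>_step[OF x step(1)] step(3) by (simp add: E.orb_\<pi>)
  qed
  show "x \<in> block_product I R.orbs (\<lambda>a. diag a (X.Fix {\<gg> a}))"
  proof (rule block_product_diagI)
   show "x \<in> extensional I" using E.N\<kappa>_points[OF x] P.points_M by (auto simp: PiE_iff)
   fix a assume a: "a \<in> R.orbs"
   have "x i = x (r a)" if "i \<in> a" for i using const orbits_onD[OF R.\<pi>_permutes a that] by metis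
   then show "\<exists>z\<in>X.Fix {\<gg> a}. \<forall>i\<in>a. x i = z" using E.N\<kappa>_r[OF x a] \<psi>[OF a] by auto
  qed
 next
  fix x assume x: "x \<in> block_product I R.orbs (\<lambda>a. diag a (X.Fix {\<gg> a}))"
  have ext: "x \<in> extensional I" using x by (simp add: block_product_def)
  have xi: "x i \<in> X.Fix {\<gg> (R.orb i)}" "x (\<pi> i) = x i" if i: "i \<in> I" for i
  proof -
   obtain z where "z \<in> X.Fix {\<gg> (R.orb i)}" "\<forall>j\<in>R.orb i. x j = z"
    using block_product_diag_iff[OF R.\<pi>_permutes x R.orb_in[OF i]] by blast
   then show "x i \<in> X.Fix {\<gg> (R.orb i)}" "x (\<pi> i) = x i"
    using R.in_orb[of i] R.\<pi>_in_orb[OF R.orb_in[OF i] R.in_orb] by auto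
  qed
  have xM: "x \<in> points M" using xi(1) X.fixed_locus_subset ext unfolding P.points_M by (auto simp: PiE_iff)
  have "\<rho>W E.\<kappa> x = x"
  proof (rule extensionalityI[of _ I])
   show "\<rho>W E.\<kappa> x i = x i" if i: "i \<in> I" for i using fixz[OF E.\<pi>_in[OF i]] xi[OF i] i by (simp add: E.orb_\<pi>)
  qed (use ext in \<open>auto simp: wreath_act_def\<close>)
  then show "x \<in> E.N\<kappa>" using xM W.fixed_locus_single[OF E.\<kappa>_in] by blast
 qed
qed

end

context sector_decomposition
begin

text \<open>Restriction to the block, translation by \<open>fbar\<close> and the inverse of the
  diagonal compose to \<open>q d\<close>.\<close>

lemma transfer_q:
 assumes d: "d \<in> D" and y: "bundle_virt (top_on X (Z d)) y"
 shows "K_equiv NY (K_pull NY (\<lambda>x. restrict x d) (transfer X \<rho> fbar d (Z d) y)) (K_pull NY (q d) y)"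
proof -
 define Xd where "Xd = product_topology (\<lambda>_. mtop X) d"
 let ?T = "twisted_diag X \<rho> fbar d (Z d)" and ?a = "wreath_act \<rho> d (restrict fbar d, id)"
  and ?p = "inv_into (topspace (top_on X (Z d))) (diag_map d)"
 let ?TY = "subtopology Xd ?T" and ?DY = "subtopology Xd (diag d (Z d))"
 have dI: "i \<in> I" if "i \<in> d" for i by (rule orbits_onD(1)[OF Q d that])
 note rd = rep(1)[OF d]
 have tZ: "topspace (top_on X (Z d)) = Z d" using X.fixed_locus_subset by auto
 have pd: "?p (diag_map d z) = z" if "z \<in> Z d" for z
  unfolding tZ by (rule inv_into_f_f[OF _ that]) (use rd in \<open>auto simp: inj_on_def diag_map_def fun_eq_iff restrict_def split: if_splits\<close>)
 have cp: "cmap ?DY (top_on X (Z d)) ?p"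
 proof (rule continuous_map_eq)
  show "cmap ?DY (top_on X (Z d)) (\<lambda>x. x (rep d))"
   using continuous_map_product_projection[OF rd, of "\<lambda>_. mtop X"] rd
   by (auto simp: into_sub from_sub Xd_def diag_def diag_map_def)
  show "x (rep d) = ?p x" if "x \<in> topspace ?DY" for x using that pd rd by (auto simp: diag_def) (simp add: diag_map_def)
 qed
 have a_eq: "?a x = (\<lambda>i\<in>d. \<rho> (fbar i) (x i))" for x by (auto simp: wreath_act_def fun_eq_iff)
 have aT: "?a x \<in> diag d (Z d)" if "x \<in> ?T" for x using that by (simp add: twisted_diag_def)
 have ca: "cmap ?TY ?DY ?a"
 proof -
  have "cmap Xd (mtop X) (\<lambda>x. \<rho> (fbar i) (x i))" if "i \<in> d" for i
   using continuous_map_compose[OF continuous_map_product_projection[OF that, of "\<lambda>_. mtop X"] X.continuous_act[OF fbar[OF dI[OF that]]]]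
   by (simp add: Xd_def o_def)
  then have "cmap Xd Xd ?a" unfolding a_eq Xd_def continuous_map_componentwise by (auto cong: restrict_cong)
  then show ?thesis using aT by (auto simp: into_sub from_sub)
 qed
 have cr: "cmap NY ?TY (\<lambda>x. restrict x d)"
 proof -
  have "cmap (mtop M) Xd (\<lambda>x. restrict x d)" unfolding Xd_def P.acm_power_fields continuous_map_componentwise
   using dI continuous_map_product_projection[of _ I "\<lambda>_. mtop X"] by auto
  moreover have "restrict x d \<in> ?T" if "x \<in> N" for x
   unfolding twisted_diag_iff using N_comp[OF that dI] q_eq[OF that d] by auto
  ultimately show ?thesis by (auto simp: into_sub from_sub)
 qed
 have "K_equiv NY (K_pull NY (\<lambda>x. restrict x d) (transfer X \<rho> fbar d (Z d) y))
   (K_pull NY (\<lambda>x. ?a (restrict x d)) (K_pull ?DY ?p y))" unfolding transfer_def Let_def K_push_def Xd_def[symmetric]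
  by (rule K_pull_compose[OF bundle_virt_pull[OF y cp] ca cr])
 also have "K_equiv NY \<dots> (K_pull NY (q d) y)"
 proof (rule K_pull_via[OF y cp])
  show "cmap NY ?DY (\<lambda>x. ?a (restrict x d))" using continuous_map_compose[OF cr ca] by (simp add: o_def)
  fix x assume "x \<in> topspace NY"
  then have x: "x \<in> N" by simp
  have "?a (restrict x d) = diag_map d (q d x)" unfolding a_eq diag_map_def using q_eq(1)[OF x d] by (intro restrict_ext) simp
  then show "?p (?a (restrict x d)) = q d x" using pd[OF q_eq(2)[OF x d]] by simp
 qed
 finally show ?thesis .
qed

end

context wreath_action
begin

text \<open>Collects the five terms of the obstruction class over the blocks. The base is identified
  first, since all pull-backs are taken from it.\<close>

lemma obstruction_sector:
 fixes \<sigma> \<tau> r\<^sub>\<sigma> r\<^sub>\<tau> r\<^sub>\<sigma>\<^sub>\<tau>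
 assumes G: "comm_group G" and \<sigma>: "\<sigma> permutes I" and \<tau>: "\<tau> permutes I"
  and r: "representatives I \<sigma> r\<^sub>\<sigma>" "representatives I \<tau> r\<^sub>\<tau>" "representatives I (\<sigma> \<circ> \<tau>) r\<^sub>\<sigma>\<^sub>\<tau>"
  and \<gg>: "\<gg> \<in> orbits_on I {\<sigma>} \<rightarrow>\<^sub>E carrier G" and \<hh>: "\<hh> \<in> orbits_on I {\<tau>} \<rightarrow>\<^sub>E carrier G"
  and \<ww>: "\<ww> \<in> orbits_on I {\<sigma> \<circ> \<tau>} \<rightarrow>\<^sub>E carrier G" and f: "f \<in> I \<rightarrow>\<^sub>E carrier G"
  and \<alpha>_def: "\<alpha> = (eps_tuple G I \<sigma> r\<^sub>\<sigma> \<gg>, \<sigma>)" and \<beta>_def: "\<beta> = conj_by G I f (eps_tuple G I \<tau> r\<^sub>\<tau> \<hh>, \<tau>)"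
  and O: "\<alpha> \<otimes>\<^bsub>W\<^esub> \<beta> \<in> O_class G I (\<sigma> \<circ> \<tau>) r\<^sub>\<sigma>\<^sub>\<tau> \<ww>"
  and D_def: "D = orbits_on I {\<sigma>, \<tau>}"
  and fs: "\<forall>d\<in>D. set (fs d) \<subseteq> carrier G"
  and fbar: "fbar \<in> block_product I (orbits_on I {\<sigma>}) (\<lambda>a. diag a (carrier G))"
  and Z_def: "Z = (\<lambda>d. Z_sector G X \<rho> I \<sigma> \<tau> \<gg> \<hh> \<ww> (fs d) d)"
  and N_def: "N = block_product I D (\<lambda>d. twisted_diag X \<rho> fbar d (Z d))"
  and N_eq: "block_product I (orbits_on I {\<sigma>}) (\<lambda>a. diag a (X.Fix {\<gg> a})) \<inter>
     \<rho>W (f, id) ` block_product I (orbits_on I {\<tau>}) (\<lambda>b. diag b (X.Fix {\<hh> b})) = N"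
 shows "W.Fix {\<alpha>, \<beta>} = N"
  and "K_equiv (top_on M N) (obstruction_virt W M \<rho>W \<alpha> \<beta>)
   (K_external_sum (top_on M N) D (\<lambda>d x. restrict x d)
    (\<lambda>d. transfer X \<rho> fbar d (Z d) (local_virt G X \<rho> I \<sigma> \<tau> \<gg> \<hh> \<ww> (fs d) d)))"
proof -
 interpret G: comm_group G by fact
 let ?Q = "{\<sigma>, \<tau>}"
 have Q: "\<forall>\<pi>\<in>?Q. \<pi> permutes I" using \<sigma> \<tau> by simp
 have \<sigma>\<tau>: "\<sigma> \<circ> \<tau> permutes I" by (rule permutes_compose[OF \<tau> \<sigma>])
 have gen: "\<sigma> \<in> generate (perm_group I) ?Q" "\<tau> \<in> generate (perm_group I) ?Q" by (auto intro: generate.incl)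
 then have gen\<sigma>\<tau>: "\<sigma> \<circ> \<tau> \<in> generate (perm_group I) ?Q"
  using generate.eng[OF gen] by (simp add: perm_group_def)
 have gen_inv: "inv_into UNIV (\<sigma> \<circ> \<tau>) \<in> generate (perm_group I) ?Q"
  using group.generate_m_inv_closed[OF group_perm_group perm_carrier[OF Q] gen\<sigma>\<tau>] by (simp add: perm_group_inv[OF \<sigma>\<tau>])
 interpret R\<sigma>: orbit_representatives I \<sigma> r\<^sub>\<sigma>
  using \<sigma> r by (intro orbit_representatives.intro cyclic_orbits.intro orbit_representatives_axioms.intro) auto
 interpret R\<tau>: orbit_representatives I \<tau> r\<^sub>\<tau>
  using \<tau> r by (intro orbit_representatives.intro cyclic_orbits.intro orbit_representatives_axioms.intro) auto
 let ?a = "eps_tuple G I \<sigma> r\<^sub>\<sigma> \<gg>" and ?e = "eps_tuple G I \<tau> r\<^sub>\<tau> \<hh>"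
 define b where "b = (\<lambda>i\<in>I. inv f i \<otimes> ?e i \<otimes> f (inv_into UNIV \<tau> i))"
 have a: "?a \<in> I \<rightarrow>\<^sub>E carrier G" by (rule R\<sigma>.eps_tuple_in[OF G \<gg>])
 have e: "?e \<in> I \<rightarrow>\<^sub>E carrier G" by (rule R\<tau>.eps_tuple_in[OF G \<hh>])
 have \<beta>: "\<beta> = (b, \<tau>)" unfolding \<beta>_def b_def by (rule conj_by_eq[OF X.is_group f e \<tau>])
 have b: "b \<in> I \<rightarrow>\<^sub>E carrier G" using f e permutes_inv_in[OF \<tau>] by (auto simp: b_def PiE_iff)
 have \<alpha>W: "\<alpha> \<in> carrier W" using a \<sigma> by (simp add: \<alpha>_def)
 have \<beta>W: "\<beta> \<in> carrier W" using b \<tau> by (simp add: \<beta>)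
 have B: "{\<alpha>, \<beta>} \<subseteq> carrier W" using \<alpha>W \<beta>W by simp
 obtain p where p: "\<alpha> \<otimes>\<^bsub>W\<^esub> \<beta> = (p, \<sigma> \<circ> \<tau>)" "p \<in> I \<rightarrow>\<^sub>E carrier G" "cycle_product G I (\<sigma> \<circ> \<tau>) r\<^sub>\<sigma>\<^sub>\<tau> p = \<ww>"
  using O by (auto simp: O_class_def)
 define c where "c = (\<lambda>i\<in>I. inv p ((\<sigma> \<circ> \<tau>) i))"
 have inv_eq: "inv\<^bsub>W\<^esub> (\<alpha> \<otimes>\<^bsub>W\<^esub> \<beta>) = (c, inv_into UNIV (\<sigma> \<circ> \<tau>))"
  unfolding p(1) c_def by (rule wreath_inv[OF X.is_group p(2) \<sigma>\<tau>])
 have c: "c \<in> I \<rightarrow>\<^sub>E carrier G" using p(2) permutes_in_image[OF \<sigma>\<tau>] by (auto simp: c_def PiE_iff)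
 have r_inv: "representatives I (inv_into UNIV (\<sigma> \<circ> \<tau>)) r\<^sub>\<sigma>\<^sub>\<tau>"
  using r(3) by (simp add: representatives_def orbits_on_inv[OF \<sigma>\<tau>])
 note E\<alpha> = wreath_elementI[OF G \<sigma> r(1) a] and E\<beta> = wreath_elementI[OF G \<tau> r(2) b]
  and E\<epsilon> = wreath_elementI[OF G \<tau> r(2) e] and Ep = wreath_elementI[OF G \<sigma>\<tau> r(3) p(2)]
  and E\<gamma> = wreath_elementI[OF G permutes_inv[OF \<sigma>\<tau>] r_inv c]
 interpret E\<tau>: wreath_element G I \<tau> r\<^sub>\<tau> ?e by (rule E\<epsilon>)
 interpret E\<sigma>\<tau>: wreath_element G I "\<sigma> \<circ> \<tau>" r\<^sub>\<sigma>\<^sub>\<tau> p by (rule Ep)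
 \<comment> \<open>Conjugation by \<open>f\<close> leaves cycle products alone: its factor and the
   inverse factor, shifted by \<open>\<tau>\<close>, have inverse products over a cycle.\<close>
 have prod_b: "finprod G b o\<^sub>\<tau> = \<hh> o\<^sub>\<tau>" if o: "o\<^sub>\<tau> \<in> orbits_on I {\<tau>}" for o\<^sub>\<tau>
 proof -
  note sub = E\<tau>.orbs_subset[OF o]
  have fo: "f \<in> o\<^sub>\<tau> \<rightarrow> carrier G" "?e \<in> o\<^sub>\<tau> \<rightarrow> carrier G" "(\<lambda>i. inv f i) \<in> o\<^sub>\<tau> \<rightarrow> carrier G"
   "(\<lambda>i. f (inv_into UNIV \<tau> i)) \<in> o\<^sub>\<tau> \<rightarrow> carrier G"
   using f e sub permutes_inv_in[OF \<tau>] by (auto simp: PiE_iff Pi_iff)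
  have "finprod G b o\<^sub>\<tau> = finprod G (\<lambda>i. inv f i \<otimes> ?e i \<otimes> f (inv_into UNIV \<tau> i)) o\<^sub>\<tau>"
   using fo sub by (intro G.finprod_cong') (auto simp: b_def Pi_iff)
  also have "\<dots> = inv finprod G f o\<^sub>\<tau> \<otimes> finprod G ?e o\<^sub>\<tau> \<otimes> finprod G (\<lambda>i. f (inv_into UNIV \<tau> i)) o\<^sub>\<tau>"
   unfolding G.finprod_inv[OF fo(1), symmetric] using fo by (subst G.finprod_multf; simp add: Pi_iff)+
  also have "finprod G (\<lambda>i. f (inv_into UNIV \<tau> i)) o\<^sub>\<tau> = finprod G f o\<^sub>\<tau>"
   using E\<tau>.finprod_shift[OF o, of "\<lambda>i. f (inv_into UNIV \<tau> i)"] f permutes_inv_in[OF \<tau>] permutes_inverses(2)[OF \<tau>]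
   by (auto simp: Pi_iff PiE_iff)
  also have "inv finprod G f o\<^sub>\<tau> \<otimes> finprod G ?e o\<^sub>\<tau> \<otimes> finprod G f o\<^sub>\<tau> = finprod G ?e o\<^sub>\<tau>"
   using fo by (subst G.m_comm) (simp_all add: X.inv_mult_cancel)
  finally show ?thesis using R\<tau>.finprod_eps_tuple[OF G \<hh> o] \<hh> o by (auto simp: PiE_iff)
 qed
 have prod_p: "finprod G p o\<^sub>\<tau> = \<ww> o\<^sub>\<tau>" if "o\<^sub>\<tau> \<in> orbits_on I {\<sigma> \<circ> \<tau>}" for o\<^sub>\<tau>
  using E\<sigma>\<tau>.cycle_product_eq[OF that] p(3) by simp
 \<comment> \<open>The inverse element runs through the same cycles in the opposite direction with
   inverted entries, so its cycle products are the inverses of \<ww>.\<close>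
 have prod_c: "finprod G c o\<^sub>\<tau> = inv \<ww> o\<^sub>\<tau>" if "o\<^sub>\<tau> \<in> orbits_on I {inv_into UNIV (\<sigma> \<circ> \<tau>)}" for o\<^sub>\<tau>
 proof -
  have o: "o\<^sub>\<tau> \<in> orbits_on I {\<sigma> \<circ> \<tau>}" using that by (simp add: orbits_on_inv[OF \<sigma>\<tau>])
  note sub = E\<sigma>\<tau>.orbs_subset[OF o]
  have po: "p i \<in> carrier G" if "i \<in> o\<^sub>\<tau>" for i using p(2) sub that by auto
  have "finprod G c o\<^sub>\<tau> = finprod G (\<lambda>i. inv p ((\<sigma> \<circ> \<tau>) i)) o\<^sub>\<tau>"
   using sub po E\<sigma>\<tau>.\<pi>_in_orb[OF o] by (intro G.finprod_cong') (auto simp: c_def)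
  also have "\<dots> = finprod G (\<lambda>i. inv p i) o\<^sub>\<tau>" by (rule E\<sigma>\<tau>.finprod_shift[OF o]) (use p(2) in auto)
  also have "\<dots> = inv (finprod G p o\<^sub>\<tau>)" by (rule G.finprod_inv) (use po in auto)
  finally show ?thesis using prod_p[OF o] by simp
 qed
 have \<ww>_in: "\<ww> a \<in> carrier G" if "a \<in> orbits_on I {\<sigma> \<circ> \<tau>}" for a using \<ww> that by auto
 define A where "A = (\<lambda>d. \<gg> ` orbits_in I \<sigma> d \<union> \<hh> ` orbits_in I \<tau> d \<union> \<ww> ` orbits_in I (\<sigma> \<circ> \<tau>) d \<union> set (fs d))"
 have ZA: "Z = (\<lambda>d. X.Fix (A d))" by (simp add: Z_def Z_sector_def A_def)
 have A: "A d \<subseteq> carrier G" if "d \<in> D" for d using that fs \<gg> \<hh> \<ww> by (auto simp: A_def orbits_in_def)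
 have fbar_in: "fbar i \<in> carrier G" if "i \<in> I" for i
  using block_product_diag_iff[OF R\<sigma>.\<pi>_permutes fbar R\<sigma>.orb_in[OF that]]
   R\<sigma>.in_orb[of i] by auto
 have N_iff: "x \<in> N \<longleftrightarrow> x \<in> points M \<and> (\<forall>d\<in>D. \<exists>z\<in>X.Fix (A d). \<forall>i\<in>d. \<rho> (fbar i) (x i) = z)" for x
 proof -
  have "x \<in> points M" if "x \<in> extensional I" "\<forall>d\<in>D. restrict x d \<in> d \<rightarrow>\<^sub>E points X"
  proof -
   have "x i \<in> points X" if "i \<in> I" for i
    using PiE_mem[OF bspec[OF \<open>\<forall>d\<in>D. restrict x d \<in> d \<rightarrow>\<^sub>E points X\<close>[unfolded D_def] orbits_on_mem[OF Q that]] orbit_on_self[OF Q]]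
     orbit_on_self[OF Q, of i] by simp
   then show ?thesis using that(1) unfolding P.points_M by (simp add: PiE_iff)
  qed
  moreover have "restrict x d \<in> d \<rightarrow>\<^sub>E points X" if "x \<in> points M" "d \<in> D" for d
   using that(1) orbits_onD(1)[OF Q that(2)[unfolded D_def]] unfolding P.points_M by (auto simp: PiE_iff)
  moreover have "x \<in> extensional I" if "x \<in> points M" using that unfolding P.points_M by (auto simp: PiE_iff)
  ultimately show ?thesis unfolding N_def ZA block_product_def by (auto simp: twisted_diag_iff)
 qed
 \<comment> \<open>The fixed locus of \<beta> is the translate by \<open>f\<close> of that of the
   unconjugated element; with \<open>fixed_locus_eps\<close> the intersection becomes the left side
   of the assumed decomposition.\<close>
 show fixN: "W.Fix {\<alpha>, \<beta>} = N"
 proof -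
  have "W.Fix {\<alpha>, \<beta>} = W.Fix {\<alpha>} \<inter> W.Fix {\<beta>}"
   unfolding W.fixed_locus_eq[OF B] W.fixed_locus_single[OF \<alpha>W] W.fixed_locus_single[OF \<beta>W] by auto
  also have "W.Fix {\<beta>} = \<rho>W (f, id) ` W.Fix {(?e, \<tau>)}"
   unfolding \<beta>_def conj_by_def by (rule W.fixed_locus_conj) (use e f \<tau> permutes_id in auto)
  finally show ?thesis
   unfolding \<alpha>_def fixed_locus_eps[OF G \<sigma> r(1) \<gg>] fixed_locus_eps[OF G \<tau> r(2) \<hh>] N_eq .
 qed
 interpret S: sector_decomposition G X \<rho> I ?Q A fbar N "{\<alpha>, \<beta>}"
  by (intro sector_decomposition.intro sector_decomposition_axioms.intro wreath_action_axioms G Q A[unfolded D_def] fbar_in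
    N_iff[unfolded D_def] B fixN[symmetric])
 note pair = W.fixed_locus_pair_subset[OF \<alpha>W \<beta>W, unfolded fixN]
 have Zsub: "S.Z d \<subseteq> X.Fix {x}" if "d \<in> S.D" "x \<in> A d" for d x
  unfolding X.fixed_locus_eq[OF A[unfolded D_def, OF that(1)]] using that A[unfolded D_def, OF that(1)]
  by (subst X.fixed_locus_single) auto
 have Zs: "S.Z d \<subseteq> X.Fix {\<gg> j}" if "d \<in> S.D" "j \<in> orbits_in I \<sigma> d" for d j
  by (rule Zsub[OF that(1)]) (use that(2) in \<open>simp add: A_def\<close>)
 have Zt: "S.Z d \<subseteq> X.Fix {\<hh> j}" if "d \<in> S.D" "j \<in> orbits_in I \<tau> d" for d j
  by (rule Zsub[OF that(1)]) (use that(2) in \<open>simp add: A_def\<close>)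
 note S\<alpha> = S.S_sector[OF E\<alpha> pair(1)[unfolded \<alpha>_def] gen(1) R\<sigma>.finprod_eps_tuple[OF G \<gg>] Zs, folded \<alpha>_def]
  and S\<beta> = S.S_sector[OF E\<beta> pair(2)[unfolded \<beta>] gen(2) prod_b Zt, folded \<beta>]
 have in_inv: "orbits_in I (inv_into UNIV (\<sigma> \<circ> \<tau>)) d = orbits_in I (\<sigma> \<circ> \<tau>) d" for d
  by (simp add: orbits_in_def orbits_on_inv[OF \<sigma>\<tau>])
 have Zinv: "S.Z d \<subseteq> X.Fix {inv \<ww> a}" if d: "d \<in> S.D" and ad: "a \<in> orbits_in I (\<sigma> \<circ> \<tau>) d" for d a
 proof -
  have w: "\<ww> a \<in> carrier G" using \<ww>_in ad by (simp add: orbits_in_def)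
  have "S.Z d \<subseteq> X.Fix {\<ww> a}" by (rule Zsub[OF d]) (use ad in \<open>simp add: A_def\<close>)
  also have "\<dots> \<subseteq> X.Fix {inv \<ww> a}"
   using X.act_inv(1)[OF w] unfolding X.fixed_locus_single[OF w] X.fixed_locus_single[OF X.inv_closed[OF w]] by auto metis
  finally show ?thesis .
 qed
 note S\<gamma> = S.S_sector[OF E\<gamma> pair(3)[unfolded inv_eq] gen_inv prod_c, unfolded in_inv, OF _ Zinv, folded inv_eq]
 have TM: "K_equiv S.NY (virt_of (TM_restricted M N)) (\<Sum>d\<in>S.D. q_scale (of_nat (card d)) (S.pull d S.TX))"
 proof -
  note S.TM_decomposition
  also have "(\<Sum>i\<in>I. K_pull S.NY (\<lambda>x. x i) (virt_of (TM_restricted X (points X)))) =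
    (\<Sum>d\<in>S.D. \<Sum>i\<in>d. K_pull S.NY (\<lambda>x. x i) (virt_of (TM_restricted X (points X))))"
   by (rule sum_orbits_on[OF _ Q]) simp
  also have "K_equiv S.NY \<dots> (\<Sum>d\<in>S.D. \<Sum>i\<in>d. S.pull d S.TX)"
   by (intro K_equiv_sum S.TX_component) (auto intro: S.N_comp orbits_onD(1)[OF Q])
  also have "\<dots> = (\<Sum>d\<in>S.D. q_scale (of_nat (card d)) (S.pull d S.TX))"
   by (simp add: q_scale_sum_left[of "\<lambda>_. 1", simplified] q_scale_simps)
  finally show ?thesis .
 qed
 let ?L = "\<lambda>d. local_virt G X \<rho> I \<sigma> \<tau> \<gg> \<hh> \<ww> (fs d) d"
 have L: "?L d = virt_of (T_submanifold X (S.Z d)) + q_scale (gd I \<sigma> \<tau> d - 1) (virt_of (TM_restricted X (S.Z d)))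
   + S.S_loc d (orbits_in I \<sigma> d) \<gg> + S.S_loc d (orbits_in I \<tau> d) \<hh> + S.S_loc d (orbits_in I (\<sigma> \<circ> \<tau>) d) (\<lambda>c. inv (\<ww> c))" for d
  using fun_cong[OF Z_def, of d] by (simp add: local_virt_def Let_def S.S_loc_def ZA)
 have bL: "bundle_virt (top_on X (S.Z d)) (?L d)" if d: "d \<in> S.D" for d
 proof -
  have "bundle_virt (top_on X (S.Z d)) (virt_of (T_submanifold X (S.Z d)))"
   using X.vector_bundle_T_submanifold[OF S.A[OF d]] by (intro bundle_virt_virt_of) (simp_all add: T_submanifold_def)
  then show ?thesis unfolding L
   by (intro bundle_virt_add bundle_virt_scale S.bundle_virt_TM X.fixed_locus_subset S.S_loc(1)[OF d] Zs[OF d] Zt[OF d] Zinv[OF d])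
    (use \<gg> \<hh> \<ww>_in in \<open>auto simp: orbits_in_def\<close>)
 qed
 let ?h = "\<lambda>\<pi> d. (of_nat (card d) - of_nat (card (orbits_in I \<pi> d))) / 2" and ?T = "\<lambda>d. S.pull d S.TX"
  and ?V = "\<lambda>d. S.pull d (virt_of (T_submanifold X (S.Z d)))" and ?S = "\<lambda>\<pi> \<xi> d. S.pull d (S.S_loc d (orbits_in I \<pi> d) \<xi>)"
 \<comment> \<open>The balance of the copies of \<open>TX\<close> over \<open>d\<close>: one
   negative copy for each index in \<open>d\<close>, and from each of the three classes S half of
   \<open>card d\<close> minus the number of cycles.\<close>
 have genus: "gd I \<sigma> \<tau> d - 1 = - of_nat (card d) + ?h \<sigma> d + ?h \<tau> d + ?h (\<sigma> \<circ> \<tau>) d" for d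
  unfolding gd_def by (simp add: field_simps)
 note K_equiv_add[OF K_equiv_add[OF K_equiv_add[OF K_equiv_diff[OF S.TN_decomposition TM] S\<alpha>] S\<beta>] S\<gamma>]
 also have "(\<Sum>d\<in>S.D. ?V d) - (\<Sum>d\<in>S.D. q_scale (of_nat (card d)) (?T d))
   + (\<Sum>d\<in>S.D. ?S \<sigma> \<gg> d + q_scale (?h \<sigma> d) (?T d)) + (\<Sum>d\<in>S.D. ?S \<tau> \<hh> d + q_scale (?h \<tau> d) (?T d))
   + (\<Sum>d\<in>S.D. ?S (\<sigma> \<circ> \<tau>) (\<lambda>c. inv \<ww> c) d + q_scale (?h (\<sigma> \<circ> \<tau>) d) (?T d)) =
   (\<Sum>d\<in>S.D. ?V d + q_scale (gd I \<sigma> \<tau> d - 1) (?T d) + ?S \<sigma> \<gg> d + ?S \<tau> \<hh> d + ?S (\<sigma> \<circ> \<tau>) (\<lambda>c. inv \<ww> c) d)"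
  unfolding sum.distrib[symmetric] sum_subtractf[symmetric] genus q_scale_simps(3,8)
  by (intro sum.cong refl) (simp add: algebra_simps)
 also have "K_equiv S.NY \<dots> (\<Sum>d\<in>S.D. S.pull d (?L d))"
  unfolding L K_pull_add K_pull_scale by (intro K_equiv_sum K_equiv_add K_equiv_refl K_equiv_scale K_equiv_sym[OF S.TX_q])
 also have "K_equiv S.NY \<dots> (\<Sum>d\<in>S.D. K_pull S.NY (\<lambda>x. restrict x d) (transfer X \<rho> fbar d (S.Z d) (?L d)))"
  by (intro K_equiv_sum K_equiv_sym[OF S.transfer_q] bL)
 finally show "K_equiv (top_on M N) (obstruction_virt W M \<rho>W \<alpha> \<beta>)
   (K_external_sum (top_on M N) D (\<lambda>d x. restrict x d) (\<lambda>d. transfer X \<rho> fbar d (Z d) (?L d)))"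
  unfolding obstruction_virt_def Let_def fixN K_external_sum_def ZA D_def .
qed

end

theorem proposition7p6:
  fixes G :: "('g, 'm) monoid_scheme"
    and X :: "('x, 'e::euclidean_space) acm"
    and \<rho> :: "'g \<Rightarrow> 'x \<Rightarrow> 'x"
    and I :: "'i::finite set"
    and \<sigma> \<tau> :: "'i \<Rightarrow> 'i"
    and r\<^sub>\<sigma> r\<^sub>\<tau> r\<^sub>\<sigma>\<^sub>\<tau> :: "'i set \<Rightarrow> 'i"
  assumes "comm_group G" and "finite (carrier G)"
    and "compact_acm X" and "acm_action G X \<rho>"
    and "\<sigma> permutes I" and "\<tau> permutes I"
    and "representatives I \<sigma> r\<^sub>\<sigma>" and "representatives I \<tau> r\<^sub>\<tau>" and "representatives I (\<sigma> \<circ> \<tau>) r\<^sub>\<sigma>\<^sub>\<tau>"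
  defines "D \<equiv> orbits_on I {\<sigma>, \<tau>}"
    and "\<W> \<equiv> wreath G I"
    and "M \<equiv> acm_power I X"
    and "\<rho>' \<equiv> wreath_act \<rho> I"
    and "\<epsilon>\<sigma> \<equiv> (\<lambda>\<gg>. (eps_tuple G I \<sigma> r\<^sub>\<sigma> \<gg>, \<sigma>))"
    and "\<epsilon>\<tau> \<equiv> (\<lambda>\<hh>. (eps_tuple G I \<tau> r\<^sub>\<tau> \<hh>, \<tau>))"
  shows
    "(\<forall>\<gg> \<hh> \<ww> f fs fbar.
        \<gg> \<in> orbits_on I {\<sigma>} \<rightarrow>\<^sub>E carrier G \<longrightarrow>
        \<hh> \<in> orbits_on I {\<tau>} \<rightarrow>\<^sub>E carrier G \<longrightarrow>
        \<ww> \<in> orbits_on I {\<sigma> \<circ> \<tau>} \<rightarrow>\<^sub>E carrier G \<longrightarrow>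
        f \<in> I \<rightarrow>\<^sub>E carrier G \<longrightarrow>
        \<epsilon>\<sigma> \<gg> \<otimes>\<^bsub>\<W>\<^esub> conj_by G I f (\<epsilon>\<tau> \<hh>) \<in> O_class G I (\<sigma> \<circ> \<tau>) r\<^sub>\<sigma>\<^sub>\<tau> \<ww> \<longrightarrow>
        (\<forall>d\<in>D. set (fs d) \<subseteq> carrier G \<and> of_nat (length (fs d)) = 2 * gd I \<sigma> \<tau> d) \<longrightarrow>
        fbar \<in> block_product I (orbits_on I {\<sigma>}) (\<lambda>a. diag a (carrier G)) \<longrightarrow>
        block_product I (orbits_on I {\<sigma>}) (\<lambda>a. diag a (fixed_locus G X \<rho> {\<gg> a})) \<inter>
          \<rho>' (f, id) ` block_product I (orbits_on I {\<tau>}) (\<lambda>b. diag b (fixed_locus G X \<rho> {\<hh> b}))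
        = block_product I D (\<lambda>d. twisted_diag X \<rho> fbar d (Z_sector G X \<rho> I \<sigma> \<tau> \<gg> \<hh> \<ww> (fs d) d)) \<longrightarrow>
        (let \<alpha> = \<epsilon>\<sigma> \<gg>;
             \<beta> = conj_by G I f (\<epsilon>\<tau> \<hh>);
             Z = (\<lambda>d. Z_sector G X \<rho> I \<sigma> \<tau> \<gg> \<hh> \<ww> (fs d) d);
             N = subtopology (mtop M) (block_product I D (\<lambda>d. twisted_diag X \<rho> fbar d (Z d)))
         in K_class (subtopology (mtop M) (fixed_locus \<W> M \<rho>' {\<alpha>, \<beta>}))
              (obstruction_virt \<W> M \<rho>' \<alpha> \<beta>)
            = K_class N (K_external_sum N D (\<lambda>d x. restrict x d)
                (\<lambda>d. transfer X \<rho> fbar d (Z d) (local_virt G X \<rho> I \<sigma> \<tau> \<gg> \<hh> \<ww> (fs d) d)))))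
     \<and>
     (\<forall>g h. g \<in> I \<rightarrow>\<^sub>E carrier G \<longrightarrow> h \<in> I \<rightarrow>\<^sub>E carrier G \<longrightarrow>
        (let \<nu> = nu G I \<sigma> r\<^sub>\<sigma> g;
             \<gg> = cycle_product G I \<sigma> r\<^sub>\<sigma> g;
             \<hh> = cycle_product G I \<tau> r\<^sub>\<tau> h;
             f = (\<lambda>i\<in>I. inv\<^bsub>G\<^esub> (nu G I \<tau> r\<^sub>\<tau> h i) \<otimes>\<^bsub>G\<^esub> \<nu> i);
             Y = subtopology (mtop M) (fixed_locus \<W> M \<rho>' {(g, \<sigma>), (h, \<tau>)})
         in K_class Y (obstruction_virt \<W> M \<rho>' (g, \<sigma>) (h, \<tau>))
            = K_class Y (K_pull Y (\<rho>' (\<nu>, id))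
                (obstruction_virt \<W> M \<rho>' (\<epsilon>\<sigma> \<gg>) (conj_by G I f (\<epsilon>\<tau> \<hh>))))))"
proof -
 interpret X: c1_action G X \<rho>
  by (rule c1_action_of_acm_action) (use assms(1-4) in \<open>auto intro: comm_group.axioms\<close>)
 interpret WA: wreath_action G X \<rho> I by (intro wreath_action.intro acm_c1_power.intro X.c1_action_axioms X.acm_c1_axioms)
 show ?thesis unfolding D_def \<W>_def M_def \<rho>'_def \<epsilon>\<sigma>_def \<epsilon>\<tau>_def Let_def
 proof (intro conjI allI impI, goal_cases)
  case (1 \<gg> \<hh> \<ww> f fs fbar)
  have fs: "\<forall>d\<in>orbits_on I {\<sigma>, \<tau>}. set (fs d) \<subseteq> carrier G" using 1(6) by blast
  note S = WA.obstruction_sector[OF assms(1,5-9) 1(1-4) refl refl 1(5) refl fs 1(7) refl refl 1(8)]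
  \<comment> \<open>The two K-classes are taken over bases that are written differently;
    \<open>S(1)\<close> identifies these bases.\<close>
  show ?case unfolding S(1) K_class_eq_iff by (rule S(2))
 next
  case (2 g h)
  interpret E\<sigma>: wreath_action_element G X \<rho> I \<sigma> r\<^sub>\<sigma> g
   by (rule WA.wreath_actionI[OF WA.wreath_elementI[OF assms(1,5,7) 2(1)]])
  interpret E\<tau>: wreath_action_element G X \<rho> I \<tau> r\<^sub>\<tau> h
   by (rule WA.wreath_actionI[OF WA.wreath_elementI[OF assms(1,6,8) 2(2)]])
  let ?W = "wreath G I"
  let ?n = "(nu G I \<sigma> r\<^sub>\<sigma> g, id)" and ?m = "(nu G I \<tau> r\<^sub>\<tau> h, id)"
   and ?f = "(\<lambda>i\<in>I. inv\<^bsub>G\<^esub> nu G I \<tau> r\<^sub>\<tau> h i \<otimes>\<^bsub>G\<^esub> nu G I \<sigma> r\<^sub>\<sigma> g i, id)"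
   and ?a = "(eps_tuple G I \<sigma> r\<^sub>\<sigma> (cycle_product G I \<sigma> r\<^sub>\<sigma> g), \<sigma>)"
   and ?e = "(eps_tuple G I \<tau> r\<^sub>\<tau> (cycle_product G I \<tau> r\<^sub>\<tau> h), \<tau>)"
  have nm: "?n \<in> carrier ?W" "?m \<in> carrier ?W" using E\<sigma>.nu_in E\<tau>.nu_in permutes_id by auto
  have ae: "?a \<in> carrier ?W" "?e \<in> carrier ?W"
   using E\<sigma>.eps_tuple_in[OF assms(1)] E\<tau>.eps_tuple_in[OF assms(1)] E\<sigma>.\<psi>_in E\<tau>.\<psi>_in
    E\<sigma>.cycle_product_eq E\<tau>.cycle_product_eq assms(5,6) by (auto simp: cycle_product_def)
  have f: "?f = inv\<^bsub>?W\<^esub> ?m \<otimes>\<^bsub>?W\<^esub> ?n"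
   unfolding wreath_inv[OF X.is_group E\<tau>.nu_in permutes_id] by (auto simp: fun_eq_iff inv_id)
  \<comment> \<open>With f = m^-1 n, conjugating f^-1 e f by \<open>n\<close> amounts to conjugating
    \<open>e\<close> by \<open>m\<close>, which gives (h, \<tau>). So the one element
    \<open>n\<close> conjugates both members of the pair to their normal forms.\<close>
  have h: "(h, \<tau>) = ?n \<otimes>\<^bsub>?W\<^esub> (inv\<^bsub>?W\<^esub> ?f \<otimes>\<^bsub>?W\<^esub> ?e \<otimes>\<^bsub>?W\<^esub> ?f) \<otimes>\<^bsub>?W\<^esub> inv\<^bsub>?W\<^esub> ?n"
   unfolding f using nm ae E\<tau>.nu_conj by (simp add: WA.W.inv_mult_group WA.W.m_assoc WA.W.inv_mult_cancel del: wreath_simps)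
  have "?f \<in> carrier ?W" unfolding f using nm by (simp del: wreath_simps)
  then show ?case unfolding K_class_eq_iff conj_by_def using ae(2)
   by (intro WA.W.obstruction_virt_conj[OF nm(1) ae(1) _ E\<sigma>.nu_conj h]) (simp del: wreath_simps)
 qed
qed

end
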